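(* Let $0\le t<1$, let $\{a_i\}_{i\ge1}$, $\{b_j\}_{j\ge1}$ be positive reals with $a_ib_j<1$ for all $i,j$, and let $\{\Lambda(i,j)\}_{i,j\ge0}$ be the Hall-Littlewood RSK field (defined in the context). Let $m_1\ge m_2\ge\dots\ge m_k$ and $n_1\le n_2\le\dots\le n_k$ be positive integers, and put $n_0=0$, $m_{k+1}=0$. Then the collection of signatures $$\varnothing=\Lambda(m_1,0),\ \Lambda(m_1,n_1),\ \Lambda(m_2,n_1),\ \Lambda(m_2,n_2),\ \dots,\ \Lambda(m_k,n_{k-1}),\ \Lambda(m_k,n_k),\ \Lambda(0,n_k)=(\underbrace{0,\dots,0}_{n_k})$$ is distributed as the Hall-Littlewood process with specializations $$\rho_i^-=\rho(a_{m_{i+1}+1},\dots,a_{m_i}),\qquad \rho_i^+=\rho(b_{n_{i-1}+1},\dots,b_{n_i}),\qquad i=1,\dots,k,$$ that is, for all signatures with nonnegative parts $\kappa^{i}\in\mathrm{Sig}_{n_i}$ ($1\le i\le k$) and $\eta^{i}\in\mathrm{Sig}_{n_i}$ ($0\le i\le k$) with $\eta^0=\varnothing$, $\eta^k=(0,\dots,0)$, $$\mathrm{Prob}\big(\Lambda(m_i,n_i)=\kappa^i\ (1\le i\le k),\ \Lambda(m_{i+1},n_i)=\eta^i\ (1\le i\le k-1)\big)=\frac1Z\prod_{i=1}^kP_{\kappa^i/\eta^{i-1}}(b_{n_{i-1}+1},\dots,b_{n_i})\,Q_{\kappa^i/\eta^i}(a_{m_{i+1}+1},\dots,a_{m_i}),$$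 where $P,Q$ are the skew Hall-Littlewood functions with parameter $t$ and $$Z=\prod_{1\le i\le j\le k}\ \prod_{l=n_{i-1}+1}^{n_i}\ \prod_{p=m_{j+1}+1}^{m_j}\frac{1-t\,a_pb_l}{1-a_pb_l}.$$
   Context: $P_{\lambda/\mu},Q_{\lambda/\mu}$ are the skew Macdonald functions with Macdonald parameters $q=0$ and $t$ (skew Hall-Littlewood functions); signatures with nonnegative parts are identified with Young diagrams by dropping zeros, and a skew function with an empty set of variables is $\mathbf 1_{\lambda=\mu}$. $\rho(c_1,\dots,c_p)$ denotes specialization of the variables to $c_1,\dots,c_p$. A signature of length $N$ is a sequence of integers $\lambda_1\ge\dots\ge\lambda_N$; $\mathrm{Sig}_N$ is the set of these ($\mathrm{Sig}_0=\{\varnothing\}$), $|\lambda|=\sum\lambda_i$. For $\lambda,\mu\in\mathrm{Sig}_N$ write $\lambda\prec\mu$ if $\mu_1\ge\lambda_1\ge\mu_2\ge\dots\ge\mu_N\ge\lambda_N$; for $\lambda\in\mathrm{Sig}_{N-1}$, $\mu\in\mathrm{Sig}_N$ write $\lambda\prec\mu$ if $\mu_1\ge\lambda_1\ge\dots\ge\lambda_{N-1}\ge\mu_N$. A signature is viewed as particles on $\mathbb Z$ at the positions of its coordinates; moving a particle at position $k$ by $+1$ means replacing one coordinate equal to $k$ by $k+1$ (and reordering). Definition of $U(\mu\to\rho\mid\lambda\to\nu)$ for $\lambda,\mu,\nu,\rho\in\mathrm{Sig}_N$. It is $0$ unless $\lambda\prec\mu\prec\rho$, $\lambda\prec\nu\prec\rho$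 and $|\nu|-|\lambda|=|\rho|-|\mu|$. Otherwise put $m=|\nu|-|\lambda|$, $n=|\mu|-|\lambda|$, and consider functions $L:\{0,\dots,m\}\times\{0,\dots,n\}\to\mathrm{Sig}_N$ with $L(0,0)=\lambda$, $L(m,0)=\nu$, $L(0,n)=\mu$, $L(m,n)=\rho$ such that: $L(i+1,j)$ is obtained from $L(i,j)$ by moving one particle, at position denoted $h_{i,j}$, by $+1$; $L(i,j+1)$ is obtained from $L(i,j)$ by moving one particle, at position denoted $v_{i,j}$, by $+1$; $h_{i,j}<h_{i+1,j}$ and $v_{i,j}<v_{i,j+1}$ whenever defined; and whenever $h_{i,j}=v_{i,j}=k$ (with $0\le i<m$, $0\le j<n$), one has $h_{i,j+1}=v_{i+1,j}\in\{k,k+1\}$. At most one such $L$ exists. If none exists, $U:=0$. If it exists, let $\mathsf b_{i,j}$ ($0\le i<m$, $0\le j<n$) be the unit box with south-west corner $(i,j)$. It is a zero-box if $h_{i,j}=v_{i,j}=h_{i,j+1}=v_{i+1,j}$; a one-box if $h_{i,j}=v_{i,j}=h_{i,j+1}-1=v_{i+1,j}-1$; and otherwise trivial. Boxes outside the rectangle are trivial, and $h_{-1,j}=v_{i,-1}=-\infty$. For a zero-box or one-box $B=\mathsf b_{i,j}$ put $r(B)=h_{i,j}=v_{i,j}$, $\bar r(B)=h_{i,j+1}=v_{i+1,j}$, $c(B)=t^{\#}$, where $\#$ is the number of coordinates of $L(i,j)$ equal to $r(B)$. The weight $w(B)$ of $B=\mathsf b_{i,j}$ is: (1) $1$ if $B$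 is trivial; or $B$ is a one-box and at least one of $\mathsf b_{i-1,j},\mathsf b_{i,j-1}$ is a one-box; or $B$ is a one-box and $\mathsf b_{i-1,j-1}$ is a one-box with $\bar r(\mathsf b_{i-1,j-1})=r(B)-1$; or $B$ is a zero-box and $\mathsf b_{i-1,j-1}$ is a zero-box with $\bar r(\mathsf b_{i-1,j-1})=r(B)-1$; (2) $t$ if $B$ is a zero-box and exactly one of $h_{i-1,j},v_{i,j-1}$ equals $r(B)-1$; (3) $1-t$ if $B$ is a one-box, $\mathsf b_{i-1,j},\mathsf b_{i,j-1}$ are trivial, and exactly one of $h_{i-1,j},v_{i,j-1}$ equals $r(B)-1$; (4) $\frac{t-c(B)}{1-c(B)}$ if $B$ is a zero-box and $h_{i-1,j},v_{i,j-1}<r(B)-1$; (5) $\frac{1-t}{1-c(B)}$ if $B$ is a one-box and $h_{i-1,j},v_{i,j-1}<r(B)-1$; (6) $0$ if $B$ is a one-box and $\mathsf b_{i-1,j-1}$ is a zero-box with $\bar r(\mathsf b_{i-1,j-1})=r(B)-1$, or $B$ is a zero-box and $\mathsf b_{i-1,j-1}$ is a one-box with $\bar r(\mathsf b_{i-1,j-1})=r(B)-1$. Then $U(\mu\to\rho\mid\lambda\to\nu):=\prod_{i=0}^{m-1}\prod_{j=0}^{n-1}w(\mathsf b_{i,j})$. HL-RSK with input: for $\lambda,\nu\in\mathrm{Sig}_{N-1}$, $\mu,\rho\in\mathrm{Sig}_N$, $\lambda\prec\mu$, $\lambda\prec\nu$ and an integer $r\ge0$, choose an integer $-V$ strictly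 smaller than all coordinates of $\mu$ and $\nu$, let $\tilde\nu=(\nu_1,\dots,\nu_{N-1},-V)$, $\tilde\lambda=(\lambda_1,\dots,\lambda_{N-1},-V-r)$, and set $U^r(\mu\to\rho\mid\lambda\to\nu):=U(\mu\to\rho\mid\tilde\lambda\to\tilde\nu)$ (independent of $V$). For fixed $\lambda,\mu,\nu,r$ this is a probability distribution in $\rho$. Hall-Littlewood RSK field: the random array $\Lambda(i,j)\in\mathrm{Sig}_j$, $i,j\ge0$, with $\Lambda(i,0)=\varnothing$, $\Lambda(0,j)=(0,\dots,0)\in\mathrm{Sig}_j$, built as follows. Let $r_{i,j}$, $i,j\ge1$, be independent with $\mathrm{Prob}(r_{i,j}=d)=(1-t\mathbf 1_{d\ge1})(a_ib_j)^d\frac{1-a_ib_j}{1-ta_ib_j}$, $d=0,1,2,\dots$. Successively for $i+j=2,3,\dots$ ($i,j\ge1$), given $\lambda=\Lambda(i-1,j-1)$, $\nu=\Lambda(i,j-1)$, $\mu=\Lambda(i-1,j)$ and $r=r_{i,j}$, set $\Lambda(i,j)=\rho$ with probability $U^r(\mu\to\rho\mid\lambda\to\nu)$, independently for distinct $(i,j)$. *)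

theory Defs
  imports "HOL-Probability.Probability" "HOL-Combinatorics.Multiset_Permutations"
begin

section \<open>Hall-Littlewood functions\<close>

definition is_partition :: "nat list \<Rightarrow> bool" where
  "is_partition p \<longleftrightarrow> sorted_wrt (\<ge>) p \<and> 0 \<notin> set p"

text \<open>Macdonald's sum over the cosets \<open>S\<^sub>n / S\<^sub>n\<^sup>\<lambda>\<close>, that is, over the distinct rearrangements
  \<open>\<alpha>\<close> of the \<open>n\<close>-tuple \<open>p\<close>. Meaningful when the \<open>n\<close> variables \<open>x\<close> are pairwise distinct.\<close>

definition hl_sym :: "real \<Rightarrow> nat list \<Rightarrow> real list \<Rightarrow> real" where
  "hl_sym t p x = (\<Sum>\<alpha>\<in>permutations_of_multiset (mset p).
     (\<Prod>i<length x. x ! i ^ (\<alpha> ! i)) *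
     (\<Prod>(i, j) | i < length x \<and> j < length x \<and> \<alpha> ! i > \<alpha> ! j.
        (x ! i - t * x ! j) / (x ! i - x ! j)))"

text \<open>The symmetrization above is a polynomial in the variables. Its value at points with coinciding
  coordinates is obtained by continuity: for small nonzero \<open>\<epsilon>\<close> the perturbed variables
  \<open>x\<^sub>i + i\<epsilon>\<close> are pairwise distinct. As usual \<open>P\<^sub>\<lambda>\<close> vanishes if there are fewer variables than parts.\<close>

definition hl_P :: "real \<Rightarrow> nat list \<Rightarrow> real list \<Rightarrow> real" where
  "hl_P t p x = (if length p \<le> length x
     then Lim (at 0) (\<lambda>\<epsilon>. hl_sym t (p @ replicate (length x - length p) 0)
                             (map (\<lambda>i. x ! i + real i * \<epsilon>) [0..<length x]))
     else 0)"

definition hl_b :: "real \<Rightarrow> nat list \<Rightarrow> real" where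
  "hl_b t p = (\<Prod>i\<in>set p. \<Prod>j = 1..count_list p i. 1 - t ^ j)"

definition hl_Q :: "real \<Rightarrow> nat list \<Rightarrow> real list \<Rightarrow> real" where
  "hl_Q t p x = hl_b t p * hl_P t p x"

text \<open>Skew functions of a family \<open>F\<close> indexed by partitions:
  \<open>F\<^sub>\<lambda>(x, y) = \<Sum>\<^sub>\<mu> F\<^bsub>\<lambda>/\<mu>\<^esub>(x) F\<^sub>\<mu>(y)\<close>, where \<open>x\<close> is fixed and \<open>y\<close> ranges over all finite sets of
  variables. The coefficients are unique for the (linearly independent) Hall-Littlewood functions.\<close>

definition skew :: "(nat list \<Rightarrow> real list \<Rightarrow> real) \<Rightarrow> nat list \<Rightarrow> nat list \<Rightarrow> real list \<Rightarrow> real" where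
  "skew F p q x = (THE c. finite {s. c s \<noteq> 0} \<and> (\<forall>s. c s \<noteq> 0 \<longrightarrow> is_partition s) \<and>
     (\<forall>y. F p (x @ y) = (\<Sum>s | c s \<noteq> 0. c s * F s y))) q"


section \<open>Signatures\<close>

definition Sig :: "nat \<Rightarrow> int list set" where
  "Sig N = {l. length l = N \<and> sorted_wrt (\<ge>) l}"

definition young :: "int list \<Rightarrow> nat list" where
  "young l = map nat (filter (\<lambda>a. a \<noteq> 0) l)"

definition skew_P :: "real \<Rightarrow> int list \<Rightarrow> int list \<Rightarrow> real list \<Rightarrow> real" where
  "skew_P t k l = skew (hl_P t) (young k) (young l)"

definition skew_Q :: "real \<Rightarrow> int list \<Rightarrow> int list \<Rightarrow> real list \<Rightarrow> real" where
  "skew_Q t k l = skew (hl_Q t) (young k) (young l)"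

text \<open>Covers both the case of equal lengths and that of lengths differing by one.\<close>

definition interlace :: "int list \<Rightarrow> int list \<Rightarrow> bool" (infix \<open>\<prec>\<close> 50) where
  "l \<prec> k \<longleftrightarrow> (length k = length l \<or> length k = Suc (length l)) \<and>
     (\<forall>i<length l. k ! i \<ge> l ! i) \<and>
     (\<forall>i. i < length l \<and> Suc i < length k \<longrightarrow> l ! i \<ge> k ! Suc i)"

definition moves :: "int \<Rightarrow> int list \<Rightarrow> int list \<Rightarrow> bool" where
  "moves a l l' \<longleftrightarrow> a \<in> set l \<and> mset l' = add_mset (a + 1) (mset l - {#a#})"


section \<open>The transition weights\<close>

definition hpos :: "(nat \<Rightarrow> nat \<Rightarrow> int list) \<Rightarrow> nat \<Rightarrow> nat \<Rightarrow> int" where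
  "hpos L i j = (THE a. moves a (L i j) (L (Suc i) j))"

definition vpos :: "(nat \<Rightarrow> nat \<Rightarrow> int list) \<Rightarrow> nat \<Rightarrow> nat \<Rightarrow> int" where
  "vpos L i j = (THE a. moves a (L i j) (L i (Suc j)))"

text \<open>Corners: \<open>\<lambda>\<close> (written \<open>la\<close>) south-west, \<open>\<nu>\<close> south-east, \<open>\<mu>\<close> north-west, \<open>\<rho>\<close> north-east.\<close>

definition filling :: "nat \<Rightarrow> nat \<Rightarrow> nat \<Rightarrow> int list \<Rightarrow> int list \<Rightarrow> int list \<Rightarrow> int list \<Rightarrow>
    (nat \<Rightarrow> nat \<Rightarrow> int list) \<Rightarrow> bool" where
  "filling N m n la \<nu> \<mu> \<rho> L \<longleftrightarrow>
     (\<forall>i\<le>m. \<forall>j\<le>n. L i j \<in> Sig N) \<and>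
     L 0 0 = la \<and> L m 0 = \<nu> \<and> L 0 n = \<mu> \<and> L m n = \<rho> \<and>
     (\<forall>i<m. \<forall>j\<le>n. \<exists>a. moves a (L i j) (L (Suc i) j)) \<and>
     (\<forall>i\<le>m. \<forall>j<n. \<exists>a. moves a (L i j) (L i (Suc j))) \<and>
     (\<forall>i j. Suc i < m \<and> j \<le> n \<longrightarrow> hpos L i j < hpos L (Suc i) j) \<and>
     (\<forall>i j. i \<le> m \<and> Suc j < n \<longrightarrow> vpos L i j < vpos L i (Suc j)) \<and>
     (\<forall>i<m. \<forall>j<n. hpos L i j = vpos L i j \<longrightarrow>
        hpos L i (Suc j) = vpos L (Suc i) j \<and> hpos L i (Suc j) \<in> {hpos L i j, hpos L i j + 1})"

definition zero_box :: "nat \<Rightarrow> nat \<Rightarrow> (nat \<Rightarrow> nat \<Rightarrow> int list) \<Rightarrow> nat \<Rightarrow> nat \<Rightarrow> bool" where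
  "zero_box m n L i j \<longleftrightarrow> i < m \<and> j < n \<and> hpos L i j = vpos L i j \<and>
     hpos L i (Suc j) = hpos L i j \<and> vpos L (Suc i) j = hpos L i j"

definition one_box :: "nat \<Rightarrow> nat \<Rightarrow> (nat \<Rightarrow> nat \<Rightarrow> int list) \<Rightarrow> nat \<Rightarrow> nat \<Rightarrow> bool" where
  "one_box m n L i j \<longleftrightarrow> i < m \<and> j < n \<and> hpos L i j = vpos L i j \<and>
     hpos L i (Suc j) - 1 = hpos L i j \<and> vpos L (Suc i) j - 1 = hpos L i j"

abbreviation box_r :: "(nat \<Rightarrow> nat \<Rightarrow> int list) \<Rightarrow> nat \<Rightarrow> nat \<Rightarrow> int" where
  "box_r L i j \<equiv> hpos L i j"

abbreviation box_rbar :: "(nat \<Rightarrow> nat \<Rightarrow> int list) \<Rightarrow> nat \<Rightarrow> nat \<Rightarrow> int" where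
  "box_rbar L i j \<equiv> hpos L i (Suc j)"

text \<open>A neighbour with an index \<open>-1\<close> lies outside the rectangle: such a box is trivial, and the
  positions \<open>h\<^bsub>-1,j\<^esub> = v\<^bsub>i,-1\<^esub> = -\<infinity>\<close> never equal \<open>r - 1\<close> and are always smaller. The clauses are
  mutually exclusive up to overlaps with equal values, and for a filling they are exhaustive.\<close>

definition box_weight :: "real \<Rightarrow> nat \<Rightarrow> nat \<Rightarrow> (nat \<Rightarrow> nat \<Rightarrow> int list) \<Rightarrow> nat \<Rightarrow> nat \<Rightarrow> real" where
  "box_weight t m n L i j =
    (let zero = zero_box m n L i j;
         one = one_box m n L i j;
         r = box_r L i j;
         c = t ^ count_list (L i j) r;
         W_zero = (i > 0 \<and> zero_box m n L (i - 1) j);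
         W_one = (i > 0 \<and> one_box m n L (i - 1) j);
         S_zero = (j > 0 \<and> zero_box m n L i (j - 1));
         S_one = (j > 0 \<and> one_box m n L i (j - 1));
         SW_zero = (i > 0 \<and> j > 0 \<and> zero_box m n L (i - 1) (j - 1) \<and> box_rbar L (i - 1) (j - 1) = r - 1);
         SW_one = (i > 0 \<and> j > 0 \<and> one_box m n L (i - 1) (j - 1) \<and> box_rbar L (i - 1) (j - 1) = r - 1);
         h_eq = (i > 0 \<and> hpos L (i - 1) j = r - 1);
         v_eq = (j > 0 \<and> vpos L i (j - 1) = r - 1);
         h_less = (i = 0 \<or> hpos L (i - 1) j < r - 1);
         v_less = (j = 0 \<or> vpos L i (j - 1) < r - 1)
     in if (\<not> zero \<and> \<not> one) \<or> (one \<and> (W_one \<or> S_one)) \<or> (one \<and> SW_one) \<or> (zero \<and> SW_zero) then 1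
        else if zero \<and> (h_eq \<noteq> v_eq) then t
        else if one \<and> \<not> W_zero \<and> \<not> W_one \<and> \<not> S_zero \<and> \<not> S_one \<and> (h_eq \<noteq> v_eq) then 1 - t
        else if zero \<and> h_less \<and> v_less then (t - c) / (1 - c)
        else if one \<and> h_less \<and> v_less then (1 - t) / (1 - c)
        else 0)"

text \<open>\<open>hl_U t \<mu> \<rho> \<lambda> \<nu>\<close> is \<open>U(\<mu> \<rightarrow> \<rho> | \<lambda> \<rightarrow> \<nu>)\<close>. A filling is unique on the rectangle, and only its
  values there matter.\<close>

definition hl_U :: "real \<Rightarrow> int list \<Rightarrow> int list \<Rightarrow> int list \<Rightarrow> int list \<Rightarrow> real" where
  "hl_U t \<mu> \<rho> la \<nu> =
    (let N = length la;
         m = nat (sum_list \<nu> - sum_list la);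
         n = nat (sum_list \<mu> - sum_list la)
     in if {la, \<mu>, \<nu>, \<rho>} \<subseteq> Sig N \<and> la \<prec> \<mu> \<and> \<mu> \<prec> \<rho> \<and> la \<prec> \<nu> \<and> \<nu> \<prec> \<rho> \<and>
           sum_list \<nu> - sum_list la = sum_list \<rho> - sum_list \<mu> \<and>
           (\<exists>L. filling N m n la \<nu> \<mu> \<rho> L)
        then (let L = (SOME L. filling N m n la \<nu> \<mu> \<rho> L)
              in \<Prod>i<m. \<Prod>j<n. box_weight t m n L i j)
        else 0)"

text \<open>The version with input \<open>r\<close>; here \<open>w\<close> plays the role of \<open>-V\<close>.\<close>

definition hl_U_input :: "real \<Rightarrow> nat \<Rightarrow> int list \<Rightarrow> int list \<Rightarrow> int list \<Rightarrow> int list \<Rightarrow> real" where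
  "hl_U_input t r \<mu> \<rho> la \<nu> =
    (let w = (SOME w. \<forall>a\<in>set \<mu> \<union> set \<nu>. w < a)
     in hl_U t \<mu> \<rho> (la @ [w - int r]) (\<nu> @ [w]))"


section \<open>The random field\<close>

text \<open>In \<open>field_step\<close>, \<open>n\<close> is the antidiagonal being sampled: conditionally on all inputs
  (equivalently, on any finite family of them containing those used so far) and on all earlier
  antidiagonals, the signatures on antidiagonal \<open>n\<close> are independent with the laws given by
  \<open>hl_U_input\<close>. The conditional law is written in product form, so that conditions of probability
  zero need no special treatment.\<close>

locale hl_rsk_field = prob_space M for M :: "'w measure" +
  fixes t :: real and a b :: "nat \<Rightarrow> real"
    and R :: "nat \<Rightarrow> nat \<Rightarrow> 'w \<Rightarrow> nat"
    and \<Lambda> :: "nat \<Rightarrow> nat \<Rightarrow> 'w \<Rightarrow> int list"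
  assumes R_indep: "indep_vars (\<lambda>_. count_space UNIV) (\<lambda>(i, j). R i j) ({1..} \<times> {1..})"
    and R_law: "\<And>i j d. 1 \<le> i \<Longrightarrow> 1 \<le> j \<Longrightarrow>
      prob {\<omega> \<in> space M. R i j \<omega> = d} =
        (1 - (if d \<ge> 1 then t else 0)) * (a i * b j) ^ d * ((1 - a i * b j) / (1 - t * (a i * b j)))"
    and field_measurable: "\<And>i j. \<Lambda> i j \<in> measurable M (count_space UNIV)"
    and field_Sig: "\<And>i j \<omega>. \<omega> \<in> space M \<Longrightarrow> \<Lambda> i j \<omega> \<in> Sig j"
    and field_bottom: "\<And>i \<omega>. \<omega> \<in> space M \<Longrightarrow> \<Lambda> i 0 \<omega> = []"
    and field_left: "\<And>j \<omega>. \<omega> \<in> space M \<Longrightarrow> \<Lambda> 0 j \<omega> = replicate j 0"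
    and field_step: "\<And>n K (d :: nat \<Rightarrow> nat \<Rightarrow> nat) (s :: nat \<Rightarrow> nat \<Rightarrow> int list). 2 \<le> n \<Longrightarrow> n \<le> K \<Longrightarrow>
      prob {\<omega> \<in> space M. (\<forall>i\<ge>1. \<forall>j\<ge>1. i + j \<le> K \<longrightarrow> R i j \<omega> = d i j) \<and>
                         (\<forall>i j. i + j < n \<longrightarrow> \<Lambda> i j \<omega> = s i j) \<and>
                         (\<forall>i\<ge>1. \<forall>j\<ge>1. i + j = n \<longrightarrow> \<Lambda> i j \<omega> = s i j)} =
      prob {\<omega> \<in> space M. (\<forall>i\<ge>1. \<forall>j\<ge>1. i + j \<le> K \<longrightarrow> R i j \<omega> = d i j) \<and>
                         (\<forall>i j. i + j < n \<longrightarrow> \<Lambda> i j \<omega> = s i j)} *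
      (\<Prod>(i, j) | 1 \<le> i \<and> 1 \<le> j \<and> i + j = n.
        hl_U_input t (d i j) (s (i - 1) j) (s i j) (s (i - 1) (j - 1)) (s i (j - 1)))"

end

theory Submission
  imports Defs "HOL-Computational_Algebra.Polynomial"
begin

text \<open>In terms of column heights (conjugate partitions), the weight \<open>U(\<mu> \<rightarrow> \<rho> | \<lambda> \<rightarrow> \<nu>)\<close> is a product over
  columns: the unit moves form crossing lines of labels, each column contains at most one box of
  non-trivial weight, and neighbouring columns interact only through the number of one-boxes carried to
  the next column. Summing column by column gives both stochasticity in \<open>\<rho>\<close> and a local identity: the
  sum over \<open>\<lambda>\<close> of \<open>\<psi>\<^bsub>\<mu>/\<lambda>\<^esub> \<phi>\<^bsub>\<nu>/\<lambda>\<^esub> (1 - t \<one>\<^bsub>r \<ge> 1\<^esub>) U\<^sup>r(\<mu> \<rightarrow> \<rho> | \<lambda> \<rightarrow> \<nu>)\<close> is \<open>\<psi>\<^bsub>\<rho>/\<nu>\<^esub> \<phi>\<^bsub>\<rho>/\<mu>\<^esub>\<close>, a refinement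
  of the skew Cauchy identity with one variable on each side. The field is deterministic along the path
  through \<open>(0, 0)\<close>; since it is Markov, the local identity moves the product formula for the law along a
  path across one box at a time, and steps in the same direction are merged by the branching rule of the
  skew Hall-Littlewood functions. The branching rule is obtained from the symmetrization formula by an
  induction over columns based on partial fractions.\<close>

section \<open>Signatures and their heights\<close>

text \<open>The weight of a box depends on its western, southern and south-western neighbours, so
  neither rows nor columns of the rectangle can be summed separately. Sorting the boxes by label
  removes this obstacle: what one label passes to the next is an integer carry, as in written
  addition. The input \<open>r\<close> is the initial carry, because the auxiliary particle crosses
  \<open>r\<close> full columns on its way. The condition that heights decrease would couple the
  columns again. It is dropped in the sums, since the weights vanish by themselves on other
  functions, through factors \<open>1 - t^0\<close> or \<open>t - t^1\<close>. In the law of the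
  input, the factor \<open>1 - t\<close> for \<open>r \<ge> 1\<close> is the boundary value of the
  transfer relation; the constant \<open>(1 - ab) / (1 - tab)\<close> supplies one factor of
  \<open>1 / Z\<close> for each box that the path is moved across. On the algebraic side, skew
  functions are defined as the coefficients of an expansion, which requires linear independence, and
  P at coinciding variables is a limit, so branching is proved at distinct variables and extended by
  continuity.\<close>

text \<open>The conjugate of a signature, indexed by all of \<open>\<int>\<close>.\<close>

definition ht :: "int list \<Rightarrow> int \<Rightarrow> int" where
  "ht l k = int (length (filter (\<lambda>a. k < a) l))"

lemma ht_Nil [simp]: "ht [] k = 0"
  by (simp add: ht_def)

lemma ht_Cons: "ht (a # l) k = ht l k + (if k < a then 1 else 0)"
  by (simp add: ht_def)

lemma ht_append: "ht (l @ l') k = ht l k + ht l' k"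
  by (simp add: ht_def)

lemma ht_nonneg: "0 \<le> ht l k"
  by (simp add: ht_def)

lemma ht_le_length: "ht l k \<le> int (length l)"
  by (simp add: ht_def)

lemma ht_antimono: "k \<le> k' \<Longrightarrow> ht l k' \<le> ht l k"
  by (induction l) (auto simp: ht_Cons)

lemma ht_eq_length: "(\<And>a. a \<in> set l \<Longrightarrow> k < a) \<Longrightarrow> ht l k = int (length l)"
  by (auto simp: ht_def)

lemma ht_eq_0: "(\<And>a. a \<in> set l \<Longrightarrow> a \<le> k) \<Longrightarrow> ht l k = 0"
  by (auto simp: ht_def filter_empty_conv not_less)

lemma ht_eq_0_iff: "ht l k = 0 \<longleftrightarrow> (\<forall>a\<in>set l. a \<le> k)"
  by (auto simp: ht_def filter_empty_conv not_less)

lemma ht_eq_length_iff: "ht l k = int (length l) \<longleftrightarrow> (\<forall>a\<in>set l. k < a)"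
proof
  assume "ht l k = int (length l)"
  thus "\<forall>a\<in>set l. k < a"
    by (metis ht_def int_int_eq length_filter_less less_irrefl_nat)
qed (simp add: ht_eq_length)

lemma count_list_ht: "int (count_list l k) = ht l (k - 1) - ht l k"
  by (induction l) (auto simp: ht_Cons)

lemma SigD: "l \<in> Sig N \<Longrightarrow> length l = N" "l \<in> Sig N \<Longrightarrow> sorted_wrt (\<ge>) l"
  by (auto simp: Sig_def)

lemma mset_eq_ht: "(\<And>k. ht l k = ht l' k) \<Longrightarrow> mset l = mset l'"
  by (rule multiset_eqI) (metis count_list_ht count_mset int_int_eq)

lemma less_nth_iff_ht:
  assumes "sorted_wrt (\<ge>) l" "i < length l"
  shows "k < l ! i \<longleftrightarrow> int i < ht l k"
  using assms
proof (induction l arbitrary: i)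
  case (Cons a l)
  have z: "ht l k = 0" if "\<not> k < a"
    using that Cons.prems(1) by (intro ht_eq_0) force
  show ?case
  proof (cases i)
    case 0
    then show ?thesis using z ht_nonneg[of l k] by (auto simp: ht_Cons)
  next
    case (Suc j)
    with Cons have "k < l ! j \<longleftrightarrow> int j < ht l k" by simp
    moreover have "l ! j \<le> a" using Cons.prems Suc by simp
    ultimately show ?thesis using z Suc by (auto simp: ht_Cons)
  qed
qed simp

lemma Sig_eqI:
  assumes "l \<in> Sig N" "l' \<in> Sig N" "\<And>k. ht l k = ht l' k"
  shows "l = l'"
proof (rule nth_equalityI)
  show len: "length l = length l'" using assms by (simp add: Sig_def)
  fix i assume i: "i < length l"
  have "k < l ! i \<longleftrightarrow> k < l' ! i" for k
    using less_nth_iff_ht[of l i k] less_nth_iff_ht[of l' i k] assms i len by (simp add: Sig_def)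
  thus "l ! i = l' ! i" by (metis linorder_neq_iff less_irrefl)
qed

text \<open>Interlacing is the horizontal strip condition. Both conventions for the lengths fit one
  formula because the height far to the left is the length. A violated inequality becomes visible in
  the column given by the smaller of the two coordinates, and a violated height bound at the index
  given by the smaller of the two heights.\<close>

lemma interlace_iff_ht:
  assumes l: "l \<in> Sig N" and \<kappa>: "\<kappa> \<in> Sig M" and NM: "M = N \<or> M = Suc N"
  shows "interlace l \<kappa> \<longleftrightarrow> (\<forall>k. ht l k \<le> ht \<kappa> k \<and> ht \<kappa> k \<le> ht l k + 1)"
proof
  assume il: "interlace l \<kappa>"
  show "\<forall>k. ht l k \<le> ht \<kappa> k \<and> ht \<kappa> k \<le> ht l k + 1"
  proof (intro allI conjI)
    fix k
    show "ht l k \<le> ht \<kappa> k"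
    proof (rule ccontr)
      assume "\<not> ?thesis"
      hence lt: "ht \<kappa> k < ht l k" by simp
      define i where "i = nat (ht \<kappa> k)"
      have i: "int i = ht \<kappa> k" using ht_nonneg by (simp add: i_def)
      have "i < length l" using lt i ht_le_length[of l k] by linarith
      moreover have "k < l ! i" using calculation lt i l by (subst less_nth_iff_ht) (auto simp: Sig_def)
      moreover have i': "i < length \<kappa>" using calculation l \<kappa> NM by (auto simp: Sig_def)
      moreover have "l ! i \<le> \<kappa> ! i" using il calculation by (simp add: interlace_def)
      ultimately have "k < \<kappa> ! i" by linarith
      thus False using \<kappa> i i' less_nth_iff_ht[of \<kappa> i k] by (simp add: Sig_def)
    qed
    show "ht \<kappa> k \<le> ht l k + 1"
    proof (rule ccontr)
      assume "\<not> ?thesis"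
      hence lt: "ht l k + 1 < ht \<kappa> k" by simp
      define i where "i = nat (ht l k)"
      have i: "int i = ht l k" using ht_nonneg by (simp add: i_def)
      have S: "Suc i < length \<kappa>" using lt i ht_le_length[of \<kappa> k] by linarith
      moreover have "k < \<kappa> ! Suc i" using S lt i \<kappa> by (subst less_nth_iff_ht) (auto simp: Sig_def)
      moreover have i': "i < length l" using S l \<kappa> NM by (auto simp: Sig_def)
      moreover have "\<kappa> ! Suc i \<le> l ! i" using il S i' by (simp add: interlace_def)
      ultimately have "k < l ! i" by linarith
      thus False using l i i' less_nth_iff_ht[of l i k] by (simp add: Sig_def)
    qed
  qed
next
  assume H: "\<forall>k. ht l k \<le> ht \<kappa> k \<and> ht \<kappa> k \<le> ht l k + 1"
  have len: "length l = N" "length \<kappa> = M" using l \<kappa> by (auto simp: Sig_def)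
  have "l ! i \<le> \<kappa> ! i" if "i < length l" for i
  proof (rule ccontr)
    assume "\<not> ?thesis"
    hence "\<kappa> ! i < l ! i" by simp
    hence "int i < ht l (\<kappa> ! i)" using less_nth_iff_ht[of l i] l that by (simp add: Sig_def)
    moreover have "\<not> int i < ht \<kappa> (\<kappa> ! i)"
      using less_nth_iff_ht[of \<kappa> i "\<kappa> ! i"] \<kappa> that len NM by (auto simp: Sig_def)
    ultimately show False using H[rule_format, of "\<kappa> ! i"] by linarith
  qed
  moreover have "\<kappa> ! Suc i \<le> l ! i" if "i < length l" "Suc i < length \<kappa>" for i
  proof (rule ccontr)
    assume "\<not> ?thesis"
    hence "l ! i < \<kappa> ! Suc i" by simp
    hence "int (Suc i) < ht \<kappa> (l ! i)" using less_nth_iff_ht[of \<kappa> "Suc i"] \<kappa> that by (simp add: Sig_def)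
    moreover have "\<not> int i < ht l (l ! i)"
      using less_nth_iff_ht[of l i "l ! i"] l that by (auto simp: Sig_def)
    ultimately show False using H[rule_format, of "l ! i"] by linarith
  qed
  ultimately show "interlace l \<kappa>" using len NM by (auto simp: interlace_def)
qed

lemma Sig_exists:
  fixes f :: "int \<Rightarrow> int"
  assumes anti: "\<And>k. f (k + 1) \<le> f k"
    and lo: "\<And>k. k < A \<Longrightarrow> f k = int N" and hi: "\<And>k. B \<le> k \<Longrightarrow> f k = 0"
  obtains l where "l \<in> Sig N" "\<And>k. ht l k = f k"
proof -
  have anti': "f k' \<le> f k" if "k \<le> k'" for k k'
    using that by (induction k' rule: int_ge_induct) (auto intro: order_trans[OF anti])
  have f0: "0 \<le> f k" and fN: "f k \<le> int N" for k
    using anti'[of k "max k B"] hi[of "max k B"] anti'[of "min k (A - 1)" k] lo[of "min k (A - 1)"] by auto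
  \<comment> \<open>Row \<open>i\<close> ends where the heights stop exceeding \<open>i\<close>. All
    columns left of \<open>A\<close> are full, so only those from \<open>A\<close> on need
    counting.\<close>
  define g where "g i = A + int (card {k \<in> {A..<B}. int i < f k})" for i :: nat
  have fin: "finite {k \<in> {A..<B}. int i < f k}" for i
    by (rule finite_subset[of _ "{A..<B}"]) auto
  have g: "k < g i \<longleftrightarrow> int i < f k" if "i < N" for i k
  proof (cases "k < A")
    case True
    then show ?thesis using lo that by (auto simp: g_def)
  next
    case kA: False
    show ?thesis
    proof (cases "int i < f k")
      case True
      have "k < B" using hi[of k] True by (cases "k < B") auto
      have "{A..k} \<subseteq> {k \<in> {A..<B}. int i < f k}"
      proof
        fix k' assume "k' \<in> {A..k}"
        thus "k' \<in> {k \<in> {A..<B}. int i < f k}" using True anti'[of k' k] \<open>k < B\<close> by simp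
      qed
      from card_mono[OF fin this] show ?thesis using kA True by (simp add: g_def)
    next
      case False
      have "{k \<in> {A..<B}. int i < f k} \<subseteq> {A..<k}"
      proof
        fix k' assume "k' \<in> {k \<in> {A..<B}. int i < f k}"
        thus "k' \<in> {A..<k}" using False anti'[of k k'] by (cases "k \<le> k'") auto
      qed
      from card_mono[OF _ this] have "card {k \<in> {A..<B}. int i < f k} \<le> nat (k - A)" by simp
      thus ?thesis using False kA by (auto simp: g_def)
    qed
  qed
  define l where "l = map g [0..<N]"
  have "g j \<le> g i" if "i \<le> j" for i j
    using that card_mono[OF fin, of "{k \<in> {A..<B}. int j < f k}" i] by (auto simp: g_def subset_iff)
  hence "l \<in> Sig N" by (auto simp: Sig_def l_def sorted_wrt_iff_nth_less)
  moreover have "ht l k = f k" for k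
  proof -
    have "ht l k = int (card {i. i < N \<and> k < l ! i})"
      unfolding ht_def length_filter_conv_card by (simp add: l_def)
    also have "{i. i < N \<and> k < l ! i} = {..<nat (f k)}"
      using g fN[of k] by (auto simp: l_def)
    finally show ?thesis using f0 by simp
  qed
  ultimately show thesis by (rule that)
qed

text \<open>Only the threshold \<open>a\<close> separates \<open>a\<close> from
  \<open>a + 1\<close>, so a move adds one box in column \<open>a\<close>. Conversely, the
  multiplicity of a value is the difference of two consecutive heights, so the heights recover the
  multiset.\<close>

lemma moves_iff_ht:
  assumes "l \<in> Sig N" "l' \<in> Sig N"
  shows "moves a l l' \<longleftrightarrow> (\<forall>k. ht l' k = ht l k + (if k = a then 1 else 0))"
proof
  assume mv: "moves a l l'"
  have ht_mset: "ht x k = int (size (filter_mset (\<lambda>b. k < b) (mset x)))" for x k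
    by (simp add: ht_def flip: size_mset)
  obtain X where X: "mset l = add_mset a X"
    using mv by (metis moves_def multi_member_split set_mset_mset)
  hence "mset l' = add_mset (a + 1) X" using mv by (simp add: moves_def)
  with X show "\<forall>k. ht l' k = ht l k + (if k = a then 1 else 0)" by (auto simp: ht_mset)
next
  assume H: "\<forall>k. ht l' k = ht l k + (if k = a then 1 else 0)"
  have c: "int (count_list l' b) = int (count_list l b) + (if b = a + 1 then 1 else 0) - (if b = a then 1 else 0)" for b
    using H by (auto simp: count_list_ht)
  have "count_list l a > 0" using c[of a] by simp
  hence a: "a \<in> set l" using count_notin by fastforce
  have "mset l' = add_mset (a + 1) (mset l - {#a#})"
  proof (rule multiset_eqI)
    fix b show "count (mset l') b = count (add_mset (a + 1) (mset l - {#a#})) b"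
      using c[of b] \<open>count_list l a > 0\<close> by (auto simp: count_mset)
  qed
  with a show "moves a l l'" by (simp add: moves_def)
qed

lemma moves_unique:
  assumes "l \<in> Sig N" "l' \<in> Sig N" "moves a l l'" "moves b l l'"
  shows "a = b"
  using assms(3,4) unfolding moves_iff_ht[OF assms(1,2)] by (metis add_cancel_left_right zero_neq_one)

lemma sum_list_ht:
  assumes "\<And>a. a \<in> set l \<Longrightarrow> A \<le> a \<and> a \<le> B"
  shows "sum_list l = int (length l) * A + (\<Sum>k\<in>{A..<B}. ht l k)"
  using assms
proof (induction l)
  case (Cons a l)
  have "(\<Sum>k\<in>{A..<B}. if k < a then 1 else 0 :: int) = (\<Sum>k\<in>{A..<a}. 1)"
    using Cons.prems[of a] by (intro sum.mono_neutral_cong_right) auto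
  also have "\<dots> = a - A" using Cons.prems[of a] by simp
  finally show ?case using Cons by (simp add: ht_Cons sum.distrib algebra_simps)
qed simp

section \<open>Crossing lines\<close>

text \<open>The labels of a filling: line \<open>i\<close> runs upwards through the boxes \<open>(i, 0), (i, 1), \<dots>\<close> with
  labels \<open>h i j\<close>, line \<open>j\<close> runs to the right with labels \<open>v i j\<close>. Labels change only at one-boxes,
  where the two equal labels both increase by one.\<close>

locale labels =
  fixes m n :: nat and h v :: "nat \<Rightarrow> nat \<Rightarrow> int"
  assumes pass: "\<And>i j. i < m \<Longrightarrow> j < n \<Longrightarrow> h i j \<noteq> v i j \<Longrightarrow> h i (Suc j) = h i j \<and> v (Suc i) j = v i j"
    and meet: "\<And>i j. i < m \<Longrightarrow> j < n \<Longrightarrow> h i j = v i j \<Longrightarrow>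
      v (Suc i) j = h i (Suc j) \<and> (h i (Suc j) = h i j \<or> h i (Suc j) = h i j + 1)"
    and h_step: "\<And>i j. Suc i < m \<Longrightarrow> j \<le> n \<Longrightarrow> h i j < h (Suc i) j"
    and v_step: "\<And>i j. i \<le> m \<Longrightarrow> Suc j < n \<Longrightarrow> v i j < v i (Suc j)"
begin

definition one :: "nat \<Rightarrow> nat \<Rightarrow> bool" where
  "one i j \<longleftrightarrow> i < m \<and> j < n \<and> h i j = v i j \<and> h i (Suc j) = h i j + 1"

text \<open>As in addition by columns: a one-box with label \<open>k - 1\<close> hands its two lines
  over to column \<open>k\<close>.\<close>

definition carry :: "int \<Rightarrow> bool" where
  "carry k \<longleftrightarrow> (\<exists>i j. one i j \<and> h i j = k - 1)"

definition cc :: "int \<Rightarrow> int" where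
  "cc k = (\<Sum>i<m. \<Sum>j<n. of_bool (one i j \<and> h i j = k - 1))"

text \<open>For the labels of a filling, \<open>X\<close>, \<open>X'\<close>, \<open>Y\<close>,
  \<open>Y'\<close> turn out to mark the columns in which \<nu>/\<lambda>, \<rho>/\<mu>,
  \<mu>/\<lambda> and \<rho>/\<nu> have a box.\<close>

definition X :: "int \<Rightarrow> bool" where "X k \<longleftrightarrow> (\<exists>i<m. h i 0 = k)"
definition X' :: "int \<Rightarrow> bool" where "X' k \<longleftrightarrow> (\<exists>i<m. h i n = k)"
definition Y :: "int \<Rightarrow> bool" where "Y k \<longleftrightarrow> (\<exists>j<n. v 0 j = k)"
definition Y' :: "int \<Rightarrow> bool" where "Y' k \<longleftrightarrow> (\<exists>j<n. v m j = k)"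

text \<open>The axioms are symmetric under exchanging the two families of lines. Each fact about
  upward lines thus yields one about rightward lines, once the derived notions are rewritten by the
  transposition rules below.\<close>

lemma transpose_labels: "labels n m (\<lambda>i j. v j i) (\<lambda>i j. h j i)"
proof
  fix i j assume "i < n" "j < m" "v j i = h j i"
  thus "h j (Suc i) = v (Suc j) i \<and> (v (Suc j) i = v j i \<or> v (Suc j) i = v j i + 1)"
    using meet[of j i] by auto
next
  fix i j assume "i < n" "j < m" "v j i \<noteq> h j i"
  thus "v (Suc j) i = v j i \<and> h j (Suc i) = h j i"
    using pass[of j i] by auto
qed (auto intro: h_step v_step)

lemma one_transpose: "labels.one n m (\<lambda>i j. v j i) (\<lambda>i j. h j i) i j \<longleftrightarrow> one j i"
  unfolding labels.one_def[OF transpose_labels] one_def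
  using meet[of j i] by auto

lemma carry_transpose: "labels.carry n m (\<lambda>i j. v j i) (\<lambda>i j. h j i) k \<longleftrightarrow> carry k"
  unfolding labels.carry_def[OF transpose_labels] carry_def one_transpose
  by (metis one_def)

lemma cc_transpose: "labels.cc n m (\<lambda>i j. v j i) (\<lambda>i j. h j i) k = cc k"
  unfolding labels.cc_def[OF transpose_labels] cc_def one_transpose
  by (subst sum.swap) (intro sum.cong refl, auto simp: one_def)

lemma X_transpose: "labels.X n (\<lambda>i j. v j i) k \<longleftrightarrow> Y k"
  unfolding labels.X_def[OF transpose_labels] Y_def ..

lemma X'_transpose: "labels.X' n m (\<lambda>i j. v j i) k \<longleftrightarrow> Y' k"
  unfolding labels.X'_def[OF transpose_labels] Y'_def ..

section \<open>Monotonicity of labels and places where they jump\<close>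

lemma h_less: "i < i' \<Longrightarrow> i' < m \<Longrightarrow> j \<le> n \<Longrightarrow> h i j < h i' j"
proof (induction i')
  case (Suc i')
  then show ?case using h_step[of i' j] by (cases "i = i'") auto
qed simp

lemma h_inj: "i < m \<Longrightarrow> i' < m \<Longrightarrow> j \<le> n \<Longrightarrow> h i j = h i' j \<Longrightarrow> i = i'"
  by (metis h_less less_irrefl linorder_neqE_nat)

lemma h_less_D: "i < m \<Longrightarrow> i' < m \<Longrightarrow> j \<le> n \<Longrightarrow> h i j < h i' j \<Longrightarrow> i < i'"
  by (metis h_less less_asym less_irrefl linorder_neqE_nat)

lemma h_Suc_mono: "i < m \<Longrightarrow> j < n \<Longrightarrow> h i j \<le> h i (Suc j)"
  using pass[of i j] meet[of i j] by fastforce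

lemma h_mono: "i < m \<Longrightarrow> j \<le> j' \<Longrightarrow> j' \<le> n \<Longrightarrow> h i j \<le> h i j'"
proof (induction j')
  case (Suc j')
  then show ?case using h_Suc_mono[of i j'] by (cases "j = Suc j'") auto
qed simp

text \<open>A discrete intermediate value property: labels grow by at most one at a time, and only
  at one-boxes.\<close>

lemma h_cross:
  "i < m \<Longrightarrow> j \<le> j' \<Longrightarrow> j' \<le> n \<Longrightarrow> h i j < k \<Longrightarrow> k \<le> h i j' \<Longrightarrow>
    \<exists>j''. j \<le> j'' \<and> j'' < j' \<and> one i j'' \<and> h i j'' = k - 1"
proof (induction j')
  case (Suc j')
  show ?case
  proof (cases "k \<le> h i j'")
    case True
    moreover have "j \<le> j'" using Suc.prems by (cases "j = Suc j'") auto
    ultimately show ?thesis using Suc by (metis Suc_leD less_SucI)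
  next
    case False
    have "j \<le> j'" using Suc.prems by (cases "j = Suc j'") auto
    moreover have "one i j' \<and> h i j' = k - 1"
    proof -
      have ij: "i < m" "j' < n" using Suc.prems by auto
      have lt: "h i j' < k" "k \<le> h i (Suc j')" using False Suc.prems by auto
      hence "h i j' = v i j'" using pass[OF ij] by force
      thus ?thesis using meet[OF ij] lt ij by (auto simp: one_def)
    qed
    ultimately show ?thesis by blast
  qed
qed simp

lemma one_h_Suc: "one i j \<Longrightarrow> h i (Suc j) = h i j + 1"
  and one_v_Suc: "one i j \<Longrightarrow> v (Suc i) j = h i j + 1"
  and one_v: "one i j \<Longrightarrow> v i j = h i j"
  and one_bound: "one i j \<Longrightarrow> i < m \<and> j < n"
  using meet[of i j] by (auto simp: one_def)

lemma v_less: "j < j' \<Longrightarrow> j' < n \<Longrightarrow> i \<le> m \<Longrightarrow> v i j < v i j'"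
  by (rule labels.h_less[OF transpose_labels])

lemma v_less_D: "j < n \<Longrightarrow> j' < n \<Longrightarrow> i \<le> m \<Longrightarrow> v i j < v i j' \<Longrightarrow> j < j'"
  by (rule labels.h_less_D[OF transpose_labels])

lemma v_inj: "j < n \<Longrightarrow> j' < n \<Longrightarrow> i \<le> m \<Longrightarrow> v i j = v i j' \<Longrightarrow> j = j'"
  by (rule labels.h_inj[OF transpose_labels])

lemma v_mono: "j < n \<Longrightarrow> i \<le> i' \<Longrightarrow> i' \<le> m \<Longrightarrow> v i j \<le> v i' j"
  by (rule labels.h_mono[OF transpose_labels])

lemma v_cross:
  "j < n \<Longrightarrow> i \<le> i' \<Longrightarrow> i' \<le> m \<Longrightarrow> v i j < k \<Longrightarrow> k \<le> v i' j \<Longrightarrow>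
    \<exists>i''. i \<le> i'' \<and> i'' < i' \<and> one i'' j \<and> h i'' j = k - 1"
  using labels.h_cross[OF transpose_labels, of j i i' k] one_v unfolding one_transpose by metis

lemma cc_nonneg: "0 \<le> cc k"
  unfolding cc_def by (intro sum_nonneg) auto

lemma cc_eq_0_iff: "cc k = 0 \<longleftrightarrow> \<not> carry k"
proof
  assume z: "cc k = 0"
  show "\<not> carry k"
  proof
    assume "carry k"
    then obtain i j where ij: "one i j" "h i j = k - 1" by (auto simp: carry_def)
    have "(\<Sum>j<n. of_bool (one i j \<and> h i j = k - 1) :: int) = 0"
      using z one_bound[OF ij(1)] unfolding cc_def by (subst (asm) sum_nonneg_eq_0_iff) (auto intro: sum_nonneg)
    hence "of_bool (one i j \<and> h i j = k - 1) = (0::int)"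
      using one_bound[OF ij(1)] by (subst (asm) sum_nonneg_eq_0_iff) auto
    thus False using ij by simp
  qed
next
  assume "\<not> carry k"
  thus "cc k = 0" by (auto simp: cc_def carry_def intro!: sum.neutral)
qed

lemma of_bool_label: 
  assumes j: "j \<le> n"
  shows "of_bool (\<exists>i<m. h i j = k) = (\<Sum>i<m. of_bool (h i j = k) :: int)"
proof (cases "\<exists>i<m. h i j = k")
    case True
    then obtain i0 where i0: "i0 < m" "h i0 j = k" by blast
    have "(\<Sum>i<m. of_bool (h i j = k) :: int) = (\<Sum>i\<in>{i0}. of_bool (h i j = k))"
    proof (intro sum.mono_neutral_right ballI)
      fix i assume "i \<in> {..<m} - {i0}"
      hence "h i j \<noteq> k" using h_inj[of i i0 j] i0 j by auto
      thus "of_bool (h i j = k) = (0 :: int)" by simp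
    qed (use i0 in auto)
    thus ?thesis using True i0 by auto
qed auto

text \<open>Follow the indicator of label \<open>k\<close> along each upward line. It changes only
  at one-boxes: label \<open>k - 1\<close> switches it on, label \<open>k\<close> switches it off.
  Summing the telescoped changes over all lines gives the balance.\<close>

lemma conservation: "of_bool (X' k) - of_bool (X k) = cc k - cc (k + 1)"
proof -
  have "of_bool (X' k) - of_bool (X k) = (\<Sum>i<m. of_bool (h i n = k) - of_bool (h i 0 = k) :: int)"
    unfolding X'_def X_def using of_bool_label[of n] of_bool_label[of 0] by (simp add: sum_subtractf)
  also have "\<dots> = (\<Sum>i<m. \<Sum>j<n. of_bool (h i (Suc j) = k) - of_bool (h i j = k))"
    by (simp only: sum_lessThan_telescope[of "\<lambda>j. of_bool (h _ j = k)"])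
  also have "\<dots> = (\<Sum>i<m. \<Sum>j<n. of_bool (one i j \<and> h i j = k - 1) - of_bool (one i j \<and> h i j = (k + 1) - 1))"
  proof (intro sum.cong refl)
    fix i j assume "i \<in> {..<m}" "j \<in> {..<n}"
    thus "of_bool (h i (Suc j) = k) - of_bool (h i j = k) =
      (of_bool (one i j \<and> h i j = k - 1) - of_bool (one i j \<and> h i j = (k + 1) - 1) :: int)"
      using pass[of i j] meet[of i j] by (cases "h i j = v i j") (auto simp: one_def)
  qed
  also have "\<dots> = cc k - cc (k + 1)"
    by (simp add: cc_def sum_subtractf)
  finally show ?thesis .
qed

text \<open>Take the leftmost line with a one-box of label \<open>k - 1\<close>. To leave column
  \<open>k\<close> it would have to meet a rightward line of label \<open>k\<close>. Such a line did
  not start in column \<open>k\<close>, so it entered there at a one-box further left, against the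
  choice.\<close>

lemma carry_imp_X':
  assumes "carry k" "\<not> Y k"
  shows "X' k"
proof -
  define P where "P i \<longleftrightarrow> (\<exists>j. one i j \<and> h i j = k - 1)" for i
  define i where "i = (LEAST i. P i)"
  have "\<exists>i. P i" using assms(1) by (auto simp: carry_def P_def)
  hence "P i" and least: "\<And>i'. i' < i \<Longrightarrow> \<not> P i'"
    unfolding i_def by (auto intro: LeastI dest: not_less_Least)
  then obtain j where j: "one i j" "h i j = k - 1" by (auto simp: P_def)
  hence ij: "i < m" "j < n" by (auto simp: one_def)
  have nv: "v i j' \<noteq> k" if "j' < n" for j'
  proof
    assume vk: "v i j' = k"
    have "v 0 j' \<le> k" using v_mono[of j' 0 i] that ij vk by simp
    hence "v 0 j' < k" using assms(2) that by (auto simp: Y_def order_less_le)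
    hence "\<exists>i'<i. one i' j' \<and> h i' j' = k - 1"
      using v_cross[of j' 0 i k] that ij vk by auto
    then obtain i' where "i' < i" "one i' j'" "h i' j' = k - 1" by blast
    thus False using least[of i'] unfolding P_def by metis
  qed
  have "h i n = k"
  proof (rule ccontr)
    assume "h i n \<noteq> k"
    moreover have "h i (Suc j) = k" using j by (simp add: one_h_Suc)
    ultimately have "k + 1 \<le> h i n" using h_mono[of i "Suc j" n] ij by simp
    then obtain j' where "one i j'" "h i j' = k"
      using h_cross[of i "Suc j" n "k + 1"] ij \<open>h i (Suc j) = k\<close> by auto
    thus False using nv[of j'] by (auto simp: one_def)
  qed
  thus ?thesis using ij by (auto simp: X'_def)
qed

text \<open>Suppose that line \<open>i\<close> ends in column \<open>k\<close>. Comparison with the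
  line starting at \<open>k\<close> and with a line lifted into \<open>k\<close> shows that line
  \<open>i\<close> starts below \<open>k\<close> and is lifted at some height \<open>j0\<close>,
  lower than the rightward line \<open>j1\<close> that starts at \<open>k\<close>. Line
  \<open>i\<close> still has label \<open>k\<close> at height \<open>j1\<close>. If line
  \<open>j1\<close> has label \<open>k\<close> there too, the strict order of labels pushes the pair
  on; if not, it left column \<open>k\<close> at an upward line further left with the same label
  \<open>k\<close>. Both are impossible.\<close>

lemma carry_imp_not_X':
  assumes "carry k" "X k" "Y k"
  shows "\<not> X' k"
proof
  assume "X' k"
  then obtain i where i: "i < m" "h i n = k" by (auto simp: X'_def)
  obtain i1 where i1: "i1 < m" "h i1 0 = k" using assms(2) by (auto simp: X_def)
  obtain j1 where j1: "j1 < n" "v 0 j1 = k" using assms(3) by (auto simp: Y_def)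
  obtain i0 j0' where i0: "one i0 j0'" "h i0 j0' = k - 1" using assms(1) by (auto simp: carry_def)
  have b0: "i0 < m" "j0' < n" using i0 by (auto simp: one_def)
  have "h i0 0 < h i1 0" using h_mono[of i0 0 j0'] b0 i0 i1 by simp
  hence "i0 < i1" using h_less_D b0 i1 by blast
  have "k \<le> h i0 n" using h_mono[of i0 "Suc j0'" n] i0 b0 by (simp add: one_h_Suc)
  hence "i \<le> i0" using h_less[of i0 i n] i b0 by fastforce
  hence "h i 0 < k" using h_less[of i i1 0] \<open>i0 < i1\<close> i1 by simp
  then obtain j0 where j0: "j0 < n" "one i j0" "h i j0 = k - 1"
    using h_cross[of i 0 n k] i by auto
  have "v i j0 < v i j1 \<or> j1 \<le> j0"
    using v_less[of j0 j1 i] j1 i by fastforce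
  have vj1: "k \<le> v i j1" using v_mono[of j1 0 i] j1 i by simp
  have "j0 < j1"
    using v_less_D[of j0 j1 i] j0 j1 i vj1 by (auto simp: one_v)
  have hk: "h i j1 = k"
    using h_mono[of i "Suc j0" j1] h_mono[of i j1 n] i j1 j0 \<open>j0 < j1\<close> by (simp add: one_h_Suc)
  show False
  proof (cases "v i j1 = k")
    case True
    have "v (Suc i) j0 < v (Suc i) j1"
      using v_less[of j0 j1 "Suc i"] \<open>j0 < j1\<close> j1 i by simp
    hence "k < v (Suc i) j1" using j0 by (simp add: one_v_Suc)
    hence "k < h i (Suc j1)" using meet[of i j1] i j1 hk True by simp
    thus False using h_mono[of i "Suc j1" n] i j1 by simp
  next
    case False
    hence "k + 1 \<le> v i j1" using vj1 by simp
    then obtain i' where i': "i' < i" "one i' j1" "h i' j1 = k"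
      using v_cross[of j1 0 i "k + 1"] j1 i by auto
    thus False using h_less[of i' i j1] i j1 hk by simp
  qed
qed

text \<open>Two lines meeting at \<open>k\<close> cannot both have started there, since a line
  lifted into column \<open>k\<close> would break the strict order. So one of them was lifted at a
  one-box, and strictness leaves no line in between: this box is the western or southern neighbour.
  Its other outgoing line already has label \<open>k\<close>, hence the meeting pair must move
  on.\<close>

lemma carry_box:
  assumes "carry k" "i < m" "j < n" "h i j = k" "v i j = k"
  shows "one i j" "(0 < i \<and> one (i - 1) j) \<or> (0 < j \<and> one i (j - 1))"
proof -
  have W: "0 < i \<and> one (i - 1) j" if "v 0 j < k"
  proof -
    have "\<exists>i'<i. one i' j \<and> h i' j = k - 1"
      using v_cross[of j 0 i k] that assms by auto
    then obtain i' where i': "i' < i" "one i' j" "h i' j = k - 1" by blast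
    have "i' = i - 1"
    proof (rule ccontr)
      assume "i' \<noteq> i - 1"
      hence "h i' j < h (Suc i') j" "h (Suc i') j < h i j"
        using i' assms h_less[of i' "Suc i'" j] h_less[of "Suc i'" i j] Suc_lessI[of i' i] by auto
      thus False using i' assms by simp
    qed
    thus ?thesis using i' by auto
  qed
  have S: "0 < j \<and> one i (j - 1)" if "h i 0 < k"
  proof -
    have "\<exists>j'<j. one i j' \<and> h i j' = k - 1"
      using h_cross[of i 0 j k] that assms by auto
    then obtain j' where j': "j' < j" "one i j'" "h i j' = k - 1" by blast
    have "j' = j - 1"
    proof (rule ccontr)
      assume "j' \<noteq> j - 1"
      hence "v i j' < v i (Suc j')" "v i (Suc j') < v i j"
        using j' assms v_less[of j' "Suc j'" i] v_less[of "Suc j'" j i] Suc_lessI[of j' j] by auto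
      thus False using j' assms by (simp add: one_v)
    qed
    thus ?thesis using j' by auto
  qed
  have le: "h i 0 \<le> k" "v 0 j \<le> k"
    using h_mono[of i 0 j] v_mono[of j 0 i] assms by auto
  have "\<not> (h i 0 = k \<and> v 0 j = k)"
  proof
    assume eq: "h i 0 = k \<and> v 0 j = k"
    obtain i0 j0 where 0: "one i0 j0" "h i0 j0 = k - 1" using assms(1) by (auto simp: carry_def)
    hence b: "i0 < m" "j0 < n" by (auto simp: one_def)
    have "h i0 0 < h i 0" using h_mono[of i0 0 j0] b 0 eq by simp
    hence "i0 < i" using h_less_D b assms by blast
    have "v 0 j0 < v 0 j"
      using v_mono[of j0 0 i0] b 0 eq by (simp add: one_v)
    hence "j0 < j" using v_less_D[of j0 j 0] b assms by simp
    have "k \<le> h i0 j" using h_mono[of i0 "Suc j0" j] 0 b assms \<open>j0 < j\<close> by (simp add: one_h_Suc)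
    thus False using h_less[of i0 i j] \<open>i0 < i\<close> assms by simp
  qed
  thus *: "(0 < i \<and> one (i - 1) j) \<or> (0 < j \<and> one i (j - 1))"
    using le W S by fastforce
  show "one i j"
  proof (cases "0 < i \<and> one (i - 1) j")
    case True
    hence "v i j = h (i - 1) (Suc j)" "h (i - 1) (Suc j) = h (i - 1) j + 1"
      using one_v_Suc[of "i - 1" j] one_h_Suc[of "i - 1" j] by auto
    moreover have "h (i - 1) (Suc j) < h i (Suc j)" using True assms by (intro h_less) auto
    ultimately show ?thesis using assms meet[of i j] by (auto simp: one_def)
  next
    case False
    hence j: "0 < j" "one i (j - 1)" using * by auto
    hence "h i j = v (Suc i) (j - 1)"
      using one_v_Suc[of i "j - 1"] one_h_Suc[of i "j - 1"] by auto
    moreover have "v (Suc i) (j - 1) < v (Suc i) j"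
      using j assms by (intro v_less) auto
    ultimately show ?thesis using assms meet[of i j] by (auto simp: one_def)
  qed
qed

text \<open>Without a carry the border between columns \<open>k - 1\<close> and \<open>k\<close> is
  closed. Labels \<open>k - 1\<close> are frozen and labels \<open>k\<close> date from the start, so
  the conditions on neighbouring boxes can be read off the boundary of the rectangle; this is the
  purpose of the lemmas that follow.\<close>

lemma no_carry_final:
  assumes "\<not> carry k" "i < m" "j \<le> n" "h i j = k - 1"
  shows "h i n = k - 1"
proof (rule ccontr)
  assume "h i n \<noteq> k - 1"
  hence "k \<le> h i n" using h_mono[of i j n] assms by simp
  then obtain j' where "one i j'" "h i j' = k - 1"
    using h_cross[of i j n k] assms by auto
  thus False using assms(1) by (auto simp: carry_def)
qed

lemma no_carry_source:
  assumes "\<not> carry k" "i < m" "j \<le> n" "h i j = k"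
  shows "h i 0 = k"
proof (rule ccontr)
  assume "h i 0 \<noteq> k"
  hence "h i 0 < k" using h_mono[of i 0 j] assms by simp
  then obtain j' where "one i j'" "h i j' = k - 1" using h_cross[of i 0 j k] assms by auto
  thus False using assms(1) by (auto simp: carry_def)
qed

lemma no_carry_box:
  assumes "\<not> carry k" "i < m" "j < n" "h i 0 = k" "v 0 j = k"
  shows "h i j = k"
proof (rule ccontr)
  assume "h i j \<noteq> k"
  hence "k + 1 \<le> h i j" using h_mono[of i 0 j] assms by simp
  then obtain j' where j': "j' < j" "one i j'" "h i j' = k"
    using h_cross[of i 0 j "k + 1"] assms by auto
  hence "v 0 j' = k"
    using labels.no_carry_source[OF transpose_labels, of k j' i] assms
    by (simp add: carry_transpose one_v)
  thus False using v_inj[of j j' 0] j' assms by simp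
qed

text \<open>Between a line ending at \<open>k - 1\<close> and the line starting at \<open>k\<close>
  there is no room: a line in between would have to cross the closed border. Nor can the former
  reach \<open>k - 1\<close> only above height \<open>j\<close>, because that one-box would release
  a rightward line of label \<open>k - 1\<close> above one whose label is already at least
  \<open>k\<close>.\<close>

lemma no_carry_neighbour:
  assumes "\<not> carry k" "i < m" "j < n" "h i 0 = k" "v 0 j = k"
  shows "(0 < i \<and> h (i - 1) j = k - 1) \<longleftrightarrow> X' (k - 1)"
proof
  assume L: "0 < i \<and> h (i - 1) j = k - 1"
  have "h (i - 1) n = k - 1" using no_carry_final[of k "i - 1" j] L assms by simp
  moreover have "i - 1 < m" using assms by simp
  ultimately show "X' (k - 1)" by (auto simp: X'_def)
next
  assume "X' (k - 1)"
  then obtain i' where i': "i' < m" "h i' n = k - 1" by (auto simp: X'_def)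
  have "k \<le> h i n" using h_mono[of i 0 n] assms by simp
  hence "i' < i" using h_less_D[of i' i n] i' assms by simp
  have "i' = i - 1"
  proof (rule ccontr)
    assume ne: "i' \<noteq> i - 1"
    hence "i' < i - 1" "i - 1 < i" "i - 1 < m" using \<open>i' < i\<close> assms by auto
    hence "h i' n < h (i - 1) n" "h (i - 1) 0 < h i 0" using assms by (auto intro!: h_less)
    hence "k \<le> h (i - 1) n" "h (i - 1) 0 < k" using i' assms by auto
    then obtain j' where "one (i - 1) j'" "h (i - 1) j' = k - 1"
      using h_cross[of "i - 1" 0 n k] \<open>i - 1 < m\<close> by auto
    thus False using assms(1) by (auto simp: carry_def)
  qed
  have "h (i - 1) j = k - 1"
  proof (rule ccontr)
    assume "h (i - 1) j \<noteq> k - 1"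
    hence "h i' j < k - 1" using h_mono[of i' j n] i' assms \<open>i' = i - 1\<close> by simp
    then obtain j' where j': "j \<le> j'" "j' < n" "one i' j'" "h i' j' = k - 2"
      using h_cross[of i' j n "k - 1"] i' assms by auto
    have "v i j' = k - 1"
      using one_v_Suc[OF j'(3)] j' \<open>i' < i\<close> \<open>i' = i - 1\<close> by simp
    moreover have "v i j \<ge> k"
      using v_mono[of j 0 i] assms by simp
    moreover have "v i j \<le> v i j'"
      using v_less[of j j' i] j' assms by (cases "j = j'") auto
    ultimately show False by simp
  qed
  thus "0 < i \<and> h (i - 1) j = k - 1" using \<open>i' < i\<close> by auto
qed

text \<open>The balances of the two families together leave a free choice only where no carry
  arrives and lines of both families start: the crossing of these two lines may or may not lift its
  pair.\<close>

lemma cc_step: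
  "(if cc k = 0 \<and> X k \<and> Y k then cc (k + 1) \<in> {0, 1}
    else if cc k = 0 then cc (k + 1) = 0
    else cc (k + 1) = cc k + of_bool (X k) + of_bool (Y k) - 1)"
proof -
  have x: "of_bool (X' k) - of_bool (X k) = cc k - cc (k + 1)" by (rule conservation)
  have y: "of_bool (Y' k) - of_bool (Y k) = cc k - cc (k + 1)"
    using labels.conservation[OF transpose_labels, of k]
    by (simp add: X_transpose X'_transpose cc_transpose)
  show ?thesis
    using x y cc_nonneg[of k] cc_nonneg[of "k + 1"] carry_imp_X'[of k] carry_imp_not_X'[of k] cc_eq_0_iff[of k]
    by (cases "X k"; cases "Y k"; cases "X' k"; cases "Y' k") auto
qed

end

section \<open>The transition weight as a product over columns\<close>

text \<open>The weight of column \<open>k\<close>, where \<open>l, p, q, s\<close> are the heights of \<open>\<lambda>, \<nu>, \<mu>, \<rho>\<close> there,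
  \<open>l', p', q', s'\<close> those in column \<open>k - 1\<close>, and \<open>c\<close> is the number of one-boxes with \<open>r(B) = k - 1\<close>.\<close>

definition zero_weight :: "real \<Rightarrow> int \<Rightarrow> int \<Rightarrow> int \<Rightarrow> int \<Rightarrow> int \<Rightarrow> real" where
  "zero_weight t l' p' q' s' l =
    (if s' = q' + 1 \<and> s' = p' + 1 then of_bool (s' = l' + 2)
     else if s' = q' + 1 \<or> s' = p' + 1 then t
     else (t - t ^ nat (l' - l)) / (1 - t ^ nat (l' - l)))"

definition col_weight :: "real \<Rightarrow> int \<Rightarrow> int \<Rightarrow> int \<Rightarrow> int \<Rightarrow> int \<Rightarrow> int \<Rightarrow> int \<Rightarrow> int \<Rightarrow> int \<Rightarrow> real" where
  "col_weight t l' p' q' s' l p q s c =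
    (if c = 0 \<and> p = l + 1 \<and> q = l + 1 then
       if s = l + 2 then zero_weight t l' p' q' s' l
       else if s = l + 1 then 1 - zero_weight t l' p' q' s' l else 0
     else if c = 0 then of_bool (s + l = p + q) else of_bool (s = l + 1))"

section \<open>Labels, carry and box weights of a given filling\<close>

locale filled =
  fixes t :: real and N m n :: nat and la \<nu> \<mu> \<rho> :: "int list" and L :: "nat \<Rightarrow> nat \<Rightarrow> int list"
  assumes t: "0 \<le> t" "t < 1" and filling: "filling N m n la \<nu> \<mu> \<rho> L"
begin

lemma L_Sig: "i \<le> m \<Longrightarrow> j \<le> n \<Longrightarrow> L i j \<in> Sig N"
  using filling by (auto simp: filling_def)

lemma filling_moves:
  "\<forall>i<m. \<forall>j\<le>n. \<exists>a. moves a (L i j) (L (Suc i) j)"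
  by (insert filling, unfold filling_def, elim conjE, assumption)

lemma filling_moves':
  "\<forall>i\<le>m. \<forall>j<n. \<exists>a. moves a (L i j) (L i (Suc j))"
  by (insert filling, unfold filling_def, elim conjE, assumption)

lemma filling_meet:
  "\<forall>i<m. \<forall>j<n. hpos L i j = vpos L i j \<longrightarrow>
    hpos L i (Suc j) = vpos L (Suc i) j \<and> hpos L i (Suc j) \<in> {hpos L i j, hpos L i j + 1}"
  by (insert filling, unfold filling_def, elim conjE, assumption)

lemma hpos_moves: "i < m \<Longrightarrow> j \<le> n \<Longrightarrow> moves (hpos L i j) (L i j) (L (Suc i) j)"
proof -
  assume ij: "i < m" "j \<le> n"
  then obtain a where a: "moves a (L i j) (L (Suc i) j)"
    using filling_moves by blast
  show ?thesis unfolding hpos_def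
    by (rule theI[of _ a]) (use a moves_unique L_Sig[of i j] L_Sig[of "Suc i" j] ij in auto)
qed

lemma vpos_moves: "i \<le> m \<Longrightarrow> j < n \<Longrightarrow> moves (vpos L i j) (L i j) (L i (Suc j))"
proof -
  assume ij: "i \<le> m" "j < n"
  then obtain a where a: "moves a (L i j) (L i (Suc j))"
    using filling_moves' by blast
  show ?thesis unfolding vpos_def
    by (rule theI[of _ a]) (use a moves_unique L_Sig[of i j] L_Sig[of i "Suc j"] ij in auto)
qed

lemma ht_h: "i < m \<Longrightarrow> j \<le> n \<Longrightarrow> ht (L (Suc i) j) k = ht (L i j) k + of_bool (hpos L i j = k)"
  using moves_iff_ht[OF L_Sig[of i j] L_Sig[of "Suc i" j]] hpos_moves[of i j] by auto

lemma ht_v: "i \<le> m \<Longrightarrow> j < n \<Longrightarrow> ht (L i (Suc j)) k = ht (L i j) k + of_bool (vpos L i j = k)"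
  using moves_iff_ht[OF L_Sig[of i j] L_Sig[of i "Suc j"]] vpos_moves[of i j] by auto

lemma box_labels:
  assumes "i < m" "j < n"
  shows "of_bool (hpos L i j = k) + of_bool (vpos L (Suc i) j = k) =
    (of_bool (vpos L i j = k) + of_bool (hpos L i (Suc j) = k) :: int)"
  using ht_h[of i j k] ht_h[of i "Suc j" k] ht_v[of i j k] ht_v[of "Suc i" j k] assms by simp

sublocale labels m n "hpos L" "vpos L"
proof
  fix i j assume ij: "i < m" "j < n"
  show "hpos L i (Suc j) = hpos L i j \<and> vpos L (Suc i) j = vpos L i j" if "hpos L i j \<noteq> vpos L i j"
    using that box_labels[OF ij, of "hpos L i j"] box_labels[OF ij, of "vpos L i j"]
    by (auto simp: of_bool_def split: if_splits)
  show "vpos L (Suc i) j = hpos L i (Suc j) \<and> (hpos L i (Suc j) = hpos L i j \<or> hpos L i (Suc j) = hpos L i j + 1)"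
    if "hpos L i j = vpos L i j"
  proof -
    have "hpos L i (Suc j) = vpos L (Suc i) j \<and> hpos L i (Suc j) \<in> {hpos L i j, hpos L i j + 1}"
      using that ij filling_meet by blast
    thus ?thesis by auto
  qed
qed (use filling in \<open>auto simp: filling_def\<close>)

lemma ht_bottom: "i \<le> m \<Longrightarrow> ht (L i 0) k = ht la k + (\<Sum>i'<i. of_bool (hpos L i' 0 = k))"
proof (induction i)
  case 0 thus ?case using filling by (simp add: filling_def)
qed (use ht_h[of _ 0 k] in simp)

lemma ht_top: "i \<le> m \<Longrightarrow> ht (L i n) k = ht \<mu> k + (\<Sum>i'<i. of_bool (hpos L i' n = k))"
proof (induction i)
  case 0 thus ?case using filling by (simp add: filling_def)
qed (use ht_h[of _ n k] in simp)

lemma ht_vert: "i \<le> m \<Longrightarrow> j \<le> n \<Longrightarrow> ht (L i j) k = ht (L i 0) k + (\<Sum>j'<j. of_bool (vpos L i j' = k))"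
proof (induction j)
  case (Suc j) thus ?case using ht_v[of i j k] by simp
qed simp

lemma corners: "L 0 0 = la" "L m 0 = \<nu>" "L 0 n = \<mu>" "L m n = \<rho>"
  using filling by (auto simp: filling_def)

lemma ht_nu: "ht \<nu> k = ht la k + of_bool (X k)"
  using ht_bottom[of m k] of_bool_label[of 0 k] by (simp add: corners X_def)

lemma ht_rho: "ht \<rho> k = ht \<mu> k + of_bool (X' k)"
  using ht_top[of m k] of_bool_label[of n k] by (simp add: corners X'_def)

lemma ht_mu: "ht \<mu> k = ht la k + of_bool (Y k)"
  using ht_vert[of 0 n k] labels.of_bool_label[OF transpose_labels, of 0 k] by (simp add: corners Y_def)

lemma ht_rho': "ht \<rho> k = ht \<nu> k + of_bool (Y' k)"
  using ht_vert[of m n k] labels.of_bool_label[OF transpose_labels, of m k] by (simp add: corners Y'_def)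

lemma cc_diff: "cc (k + 1) = cc k + ht \<nu> k + ht \<mu> k - ht la k - ht \<rho> k"
  using conservation[of k] ht_nu[of k] ht_rho[of k] by simp

lemma one_box_iff: "one_box m n L i j \<longleftrightarrow> one i j"
  unfolding one_box_def one_def using meet[of i j] by auto

lemma zero_box_iff: "zero_box m n L i j \<longleftrightarrow> i < m \<and> j < n \<and> hpos L i j = vpos L i j \<and> \<not> one i j"
  unfolding zero_box_def one_def using meet[of i j] by auto

lemma box_weight_trivial:
  assumes "hpos L i j \<noteq> vpos L i j"
  shows "box_weight t m n L i j = 1"
  using assms by (simp add: box_weight_def one_box_def zero_box_def)

lemma box_weight_carry:
  assumes "carry (hpos L i j)" "i < m" "j < n" "hpos L i j = vpos L i j"
  shows "box_weight t m n L i j = 1"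
proof -
  have o: "one i j" and ws: "(0 < i \<and> one (i - 1) j) \<or> (0 < j \<and> one i (j - 1))"
    by (fact carry_box[OF assms(1-3) refl assms(4)[symmetric]])+
  show ?thesis unfolding box_weight_def Let_def one_box_iff
    by (rule if_P) (use o ws in blast)
qed

text \<open>No line enters column \<open>k\<close>, so the crossing sees its surroundings through
  the boundary: the adjacent labels tell whether \<rho>/\<mu> and \<rho>/\<nu> have a box in column
  \<open>k - 1\<close>, and if both do, the south-west box is a one-box exactly if a carry reaches
  column \<open>k - 1\<close>. In each situation the weights of a zero-box and of a one-box add up
  to 1, which is why \<open>col_weight\<close> is expressed through \<open>zero_weight\<close>
  alone.\<close>

lemma box_weight_start:
  assumes nc: "\<not> carry k" and ij: "i < m" "j < n" and lab: "hpos L i 0 = k" "vpos L 0 j = k"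
  shows "box_weight t m n L i j =
    col_weight t (ht la (k - 1)) (ht \<nu> (k - 1)) (ht \<mu> (k - 1)) (ht \<rho> (k - 1))
      (ht la k) (ht \<nu> k) (ht \<mu> k) (ht \<rho> k) (cc k)"
proof -
  have h: "hpos L i j = k" using no_carry_box nc ij lab by blast
  have v: "vpos L i j = k"
    using labels.no_carry_box[OF transpose_labels, of k j i] nc ij lab by (simp add: carry_transpose)
  have he: "(0 < i \<and> hpos L (i - 1) j = k - 1) \<longleftrightarrow> X' (k - 1)"
    using no_carry_neighbour nc ij lab by blast
  have ve: "(0 < j \<and> vpos L i (j - 1) = k - 1) \<longleftrightarrow> Y' (k - 1)"
    using labels.no_carry_neighbour[OF transpose_labels, of k j i] nc ij lab
    by (simp add: carry_transpose X'_transpose)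
  have hlt: "hpos L (i - 1) j < k" if "0 < i" using h_less[of "i - 1" i j] that ij h by simp
  have vlt: "vpos L i (j - 1) < k" if "0 < j" using v_less[of "j - 1" j i] that ij v by simp
  have W1: "\<not> one (i - 1) j" if "0 < i"
  proof
    assume o: "one (i - 1) j"
    hence "hpos L (i - 1) j = k - 1" using one_v_Suc[OF o] that v by simp
    thus False using nc o by (auto simp: carry_def)
  qed
  have S1: "\<not> one i (j - 1)" if "0 < j"
  proof
    assume o: "one i (j - 1)"
    hence "hpos L i (j - 1) = k - 1" using one_h_Suc[OF o] that h by simp
    thus False using nc o by (auto simp: carry_def)
  qed
  have W0: "\<not> zero_box m n L (i - 1) j" if "0 < i"
    using that hlt v by (auto simp: zero_box_def)
  have S0: "\<not> zero_box m n L i (j - 1)" if "0 < j"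
    using that vlt h by (auto simp: zero_box_def)
  have cc0: "cc k = 0" using nc cc_eq_0_iff by blast
  have XY: "X k" "Y k" using ij lab by (auto simp: X_def Y_def)
  have cons1: "of_bool (X' (k - 1)) - of_bool (X (k - 1)) = cc (k - 1)"
    using conservation[of "k - 1"] cc0 by simp
  have cons1': "of_bool (Y' (k - 1)) - of_bool (Y (k - 1)) = cc (k - 1)"
    using labels.conservation[OF transpose_labels, of "k - 1"] cc0
    by (simp add: X_transpose X'_transpose cc_transpose)
  have s'q': "(ht \<rho> (k - 1) = ht \<mu> (k - 1) + 1) \<longleftrightarrow> X' (k - 1)" using ht_rho[of "k - 1"] by auto
  have s'p': "(ht \<rho> (k - 1) = ht \<nu> (k - 1) + 1) \<longleftrightarrow> Y' (k - 1)" using ht_rho'[of "k - 1"] by auto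
  have s'l': "ht \<rho> (k - 1) = ht la (k - 1) + 2 \<longleftrightarrow> cc (k - 1) = 0" if "X' (k - 1)" "Y' (k - 1)"
    using that cons1 cons1' ht_rho[of "k - 1"] ht_mu[of "k - 1"] by (auto split: if_splits)
  have SW: "0 < i" "0 < j" "zero_box m n L (i - 1) (j - 1) \<longleftrightarrow> cc (k - 1) = 0"
       "one (i - 1) (j - 1) \<longleftrightarrow> cc (k - 1) \<noteq> 0" "hpos L (i - 1) (Suc (j - 1)) = k - 1"
    if X'Y': "X' (k - 1)" "Y' (k - 1)"
  proof -
    show i: "0 < i" and j: "0 < j" using he ve that by auto
    have hv: "hpos L (i - 1) (Suc (j - 1)) = k - 1" "vpos L (Suc (i - 1)) (j - 1) = k - 1"
      using he ve that i j by auto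
    thus "hpos L (i - 1) (Suc (j - 1)) = k - 1" by simp
    have b: "i - 1 < m" "j - 1 < n" using ij by auto
    have eq: "hpos L (i - 1) (j - 1) = vpos L (i - 1) (j - 1)"
      using pass[OF b] hv by force
    have "one (i - 1) (j - 1) \<longleftrightarrow> cc (k - 1) \<noteq> 0"
    proof
      assume o: "one (i - 1) (j - 1)"
      hence "hpos L (i - 1) (j - 1) = k - 1 - 1" using one_h_Suc[OF o] hv by simp
      hence "carry (k - 1)" using o by (auto simp: carry_def)
      thus "cc (k - 1) \<noteq> 0" by (simp add: cc_eq_0_iff)
    next
      assume "cc (k - 1) \<noteq> 0"
      hence c: "carry (k - 1)" by (simp add: cc_eq_0_iff)
      show "one (i - 1) (j - 1)"
      proof (rule ccontr)
        assume no: "\<not> one (i - 1) (j - 1)"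
        hence "hpos L (i - 1) (j - 1) = k - 1" using meet[OF b eq] hv b eq by (auto simp: one_def)
        thus False using carry_box(1)[OF c b] eq no by simp
      qed
    qed
    thus "one (i - 1) (j - 1) \<longleftrightarrow> cc (k - 1) \<noteq> 0"
      "zero_box m n L (i - 1) (j - 1) \<longleftrightarrow> cc (k - 1) = 0"
      using b eq by (auto simp: zero_box_iff)
  qed
  have SWn: "\<not> (0 < i \<and> 0 < j \<and> (zero_box m n L (i - 1) (j - 1) \<or> one (i - 1) (j - 1)) \<and>
      hpos L (i - 1) (Suc (j - 1)) = k - 1)" if "\<not> (X' (k - 1) \<and> Y' (k - 1))"
  proof
    assume a: "0 < i \<and> 0 < j \<and> (zero_box m n L (i - 1) (j - 1) \<or> one (i - 1) (j - 1)) \<and>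
      hpos L (i - 1) (Suc (j - 1)) = k - 1"
    hence "vpos L (Suc (i - 1)) (j - 1) = k - 1"
      using meet[of "i - 1" "j - 1"] ij by (auto simp: zero_box_iff one_def)
    thus False using a he ve that by auto
  qed
  \<comment> \<open>The crossing is the only possible one-box of label \<open>k\<close>, so it alone
    decides the next carry and with it the height of \<rho>.\<close>
  have zo: "ht \<rho> k = ht la k + (if one i j then 1 else 2)"
  proof (cases "one i j")
    case True
    hence "cc (k + 1) \<noteq> 0" unfolding cc_eq_0_iff carry_def using h by auto
    hence "cc (k + 1) \<ge> 1" using cc_nonneg[of "k + 1"] by simp
    hence "\<not> X' k" using conservation[of k] cc0 XY by (cases "X' k") auto
    thus ?thesis using True ht_rho[of k] ht_mu[of k] XY by simp
  next
    case False
    have "cc (k + 1) = 0" unfolding cc_eq_0_iff carry_def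
    proof
      assume "\<exists>i' j'. one i' j' \<and> hpos L i' j' = k + 1 - 1"
      then obtain i' j' where o: "one i' j'" "hpos L i' j' = k" by auto
      have b: "i' < m" "j' < n" using o by (auto simp: one_def)
      have "hpos L i' 0 = k" using no_carry_source[of k i' j'] nc b o by simp
      moreover have "vpos L 0 j' = k"
        using labels.no_carry_source[OF transpose_labels, of k j' i'] nc b o
        by (simp add: carry_transpose one_v)
      ultimately have "i' = i" "j' = j" using h_inj[of i i' 0] v_inj[of j j' 0] b ij lab by auto
      thus False using o False by simp
    qed
    hence "X' k" using conservation[of k] cc0 XY by (cases "X' k") auto
    thus ?thesis using False ht_rho[of k] ht_mu[of k] XY by simp
  qed
  \<comment> \<open>The exponent in \<open>c(B)\<close> counts particles of \<open>L i j\<close>,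
    not of \<lambda>. It matters only if no line ends in column \<open>k - 1\<close>, and then
    columns \<open>k - 1\<close> and \<open>k\<close> of \<open>L i j\<close> are still those of
    \<lambda>.\<close>
  have cnt: "int (count_list (L i j) k) = ht la (k - 1) - ht la k"
    if n: "\<not> X' (k - 1)" "\<not> Y' (k - 1)"
  proof -
    have nX: "hpos L i' 0 \<noteq> k - 1" if "i' < m" for i'
      using no_carry_final[of k i' 0] nc that n by (auto simp: X'_def)
    have nY: "vpos L i j' \<noteq> k - 1" if "j' < n" for j'
      using labels.no_carry_final[OF transpose_labels, of k j' i] nc that n ij
      by (auto simp: carry_transpose Y'_def)
    have a: "hpos L i' 0 \<noteq> k" if "i' < i" for i' using h_less[of i' i 0] that ij lab by simp
    have b: "vpos L i j' \<noteq> k" if "j' < j" for j' using v_less[of j' j i] that ij v by simp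
    have "ht (L i j) k = ht la k"
      using ij a b by (simp add: ht_vert[of i j] ht_bottom[of i])
    moreover have "ht (L i j) (k - 1) = ht la (k - 1)"
      using ij nX nY by (simp add: ht_vert[of i j] ht_bottom[of i])
    ultimately show ?thesis by (simp add: count_list_ht)
  qed
  have cntpos: "0 < count_list (L i j) k"
  proof -
    have "k \<in> set (L i j)" using hpos_moves[of i j] ij h by (simp add: moves_def)
    thus ?thesis by (metis count_list_0_iff gr0I)
  qed
  have t1: "1 - t ^ count_list (L i j) k \<noteq> 0"
    using power_Suc_less_one[of t "count_list (L i j) k - 1"] t cntpos
    by (cases "t = 0") (auto simp: power_0_left)
  have zb: "zero_box m n L i j \<longleftrightarrow> \<not> one i j" using ij h v by (simp add: zero_box_iff)
  have p: "ht \<nu> k = ht la k + 1" and q: "ht \<mu> k = ht la k + 1"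
    using XY ht_nu[of k] ht_mu[of k] by auto
  define h_eq v_eq where "h_eq = (0 < i \<and> hpos L (i - 1) j = k - 1)"
    and "v_eq = (0 < j \<and> vpos L i (j - 1) = k - 1)"
  have hle: "(i = 0 \<or> hpos L (i - 1) j < k - 1) \<longleftrightarrow> \<not> X' (k - 1)"
    using he hlt by force
  have vle: "(j = 0 \<or> vpos L i (j - 1) < k - 1) \<longleftrightarrow> \<not> Y' (k - 1)"
    using ve vlt by force
  have col: "col_weight t (ht la (k - 1)) (ht \<nu> (k - 1)) (ht \<mu> (k - 1)) (ht \<rho> (k - 1))
      (ht la k) (ht \<nu> k) (ht \<mu> k) (ht \<rho> k) (cc k) =
    (let z = zero_weight t (ht la (k - 1)) (ht \<nu> (k - 1)) (ht \<mu> (k - 1)) (ht \<rho> (k - 1)) (ht la k)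
     in if one i j then 1 - z else z)"
    using zo by (simp add: col_weight_def cc0 p q Let_def)
  have zw: "zero_weight t (ht la (k - 1)) (ht \<nu> (k - 1)) (ht \<mu> (k - 1)) (ht \<rho> (k - 1)) (ht la k) =
    (if X' (k - 1) \<and> Y' (k - 1) then of_bool (cc (k - 1) = 0)
     else if X' (k - 1) \<or> Y' (k - 1) then t
     else (t - t ^ count_list (L i j) k) / (1 - t ^ count_list (L i j) k))"
  proof -
    have "nat (ht la (k - 1) - ht la k) = count_list (L i j) k" if "\<not> X' (k - 1)" "\<not> Y' (k - 1)"
      using cnt[OF that] by (metis nat_int)
    thus ?thesis unfolding zero_weight_def s'q' s'p' using s'l' by auto
  qed
  have bw: "box_weight t m n L i j =
    (if (one i j \<and> X' (k - 1) \<and> Y' (k - 1) \<and> cc (k - 1) \<noteq> 0) \<or>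
        (\<not> one i j \<and> X' (k - 1) \<and> Y' (k - 1) \<and> cc (k - 1) = 0) then 1
     else if \<not> one i j \<and> X' (k - 1) \<noteq> Y' (k - 1) then t
     else if one i j \<and> X' (k - 1) \<noteq> Y' (k - 1) then 1 - t
     else if \<not> one i j \<and> \<not> X' (k - 1) \<and> \<not> Y' (k - 1)
       then (t - t ^ count_list (L i j) k) / (1 - t ^ count_list (L i j) k)
     else if one i j \<and> \<not> X' (k - 1) \<and> \<not> Y' (k - 1) then (1 - t) / (1 - t ^ count_list (L i j) k)
     else 0)"
    unfolding box_weight_def Let_def one_box_iff zb h hle vle he ve
    using W1 S1 W0 S0 SW SWn by (cases "X' (k - 1) \<and> Y' (k - 1)"; cases "one i j"; auto)
  show ?thesis unfolding bw col zw Let_def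
    using t1 by (cases "X' (k - 1)"; cases "Y' (k - 1)"; cases "one i j"; cases "cc (k - 1) = 0")
      (auto simp: field_simps)
qed

text \<open>Columns with a carry contribute only boxes of weight one; a column without a carry contains
  at most one non-trivial box.\<close>

lemma column_weight:
  "(\<Prod>(i, j)\<in>{(i, j). i < m \<and> j < n \<and> hpos L i j = k}. box_weight t m n L i j) =
    col_weight t (ht la (k - 1)) (ht \<nu> (k - 1)) (ht \<mu> (k - 1)) (ht \<rho> (k - 1))
      (ht la k) (ht \<nu> k) (ht \<mu> k) (ht \<rho> k) (cc k)" (is "prod _ ?B = ?C")
proof -
  have fin: "finite ?B" by (rule finite_subset[of _ "{..<m} \<times> {..<n}"]) auto
  have step: "cc (k + 1) = cc k + of_bool (X k) + of_bool (Y k) - (ht \<rho> k - ht la k)"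
    using cc_diff[of k] ht_nu[of k] ht_mu[of k] by simp
  show ?thesis
  proof (cases "\<not> carry k \<and> X k \<and> Y k")
    case True
    then obtain i j where ij: "i < m" "j < n" "hpos L i 0 = k" "vpos L 0 j = k"
      by (auto simp: X_def Y_def)
    have "(i, j) \<in> ?B" using no_carry_box True ij by auto
    moreover have "box_weight t m n L i' j' = 1" if "(i', j') \<in> ?B - {(i, j)}" for i' j'
    proof (rule box_weight_trivial, rule notI)
      assume eq: "hpos L i' j' = vpos L i' j'"
      have "hpos L i' 0 = k" using no_carry_source[of k i' j'] True that by auto
      moreover have "vpos L 0 j' = k"
        using labels.no_carry_source[OF transpose_labels, of k j' i'] True that eq
        by (auto simp: carry_transpose)
      ultimately have "i' = i" "j' = j" using h_inj[of i i' 0] v_inj[of j j' 0] that ij by auto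
      thus False using that by simp
    qed
    ultimately have "(\<Prod>(i, j)\<in>?B. box_weight t m n L i j) = box_weight t m n L i j"
      using fin by (subst prod.remove[of _ "(i, j)"]) (auto intro!: prod.neutral)
    thus ?thesis using box_weight_start[of k i j] True ij by simp
  next
    case False
    have "(\<Prod>(i, j)\<in>?B. box_weight t m n L i j) = 1"
    proof (rule prod.neutral, clarify)
      fix i j assume ij: "i < m" "j < n" "k = hpos L i j"
      show "box_weight t m n L i j = 1"
      proof (cases "hpos L i j = vpos L i j \<and> \<not> carry k")
        case True
        have nc: "\<not> carry k" "hpos L i j = k" "vpos L i j = k" using ij(3) True by metis+
        have "hpos L i 0 = k" using no_carry_source[OF nc(1) ij(1) less_imp_le[OF ij(2)]] nc(2) by blast
        moreover have "vpos L 0 j = k"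
          using labels.no_carry_source[OF transpose_labels, of k j i] nc ij(1,2)
          by (simp add: carry_transpose)
        ultimately have "X k" "Y k" using ij by (auto simp: X_def Y_def)
        thus ?thesis using nc(1) False by simp
      next
        case no: False
        show ?thesis
        proof (cases "hpos L i j = vpos L i j")
          case True
          hence "carry (hpos L i j)" using no ij(3) by simp
          thus ?thesis using box_weight_carry ij(1,2) True by blast
        qed (rule box_weight_trivial)
      qed
    qed
    also have "1 = ?C"
    proof (cases "cc k = 0")
      case True
      hence n: "\<not> (X k \<and> Y k)" using False cc_eq_0_iff[of k] by auto
      have "cc (k + 1) = 0" using cc_step[of k] n True by (auto split: if_splits)
      thus ?thesis using step n True ht_nu[of k] ht_mu[of k]
        by (auto simp: col_weight_def split: if_splits)
    next
      case c: False
      hence "cc (k + 1) = cc k + of_bool (X k) + of_bool (Y k) - 1" using cc_step[of k] by simp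
      thus ?thesis using step c by (simp add: col_weight_def)
    qed
    finally show ?thesis .
  qed
qed

text \<open>A label is a column that receives a box. A column in which \<lambda> has height
  \<open>N\<close> has no room for one, and a column that is empty in \<rho> never received
  one.\<close>

lemma label_bounds:
  assumes A: "\<And>k. k < A \<Longrightarrow> ht la k = int N" and B: "\<And>k. B \<le> k \<Longrightarrow> ht \<rho> k = 0"
    and ij: "i < m" "j \<le> n"
  shows "A \<le> hpos L i j" "hpos L i j < B"
proof -
  define a where "a = hpos L i j"
  have up: "ht (L (Suc i) j) a = ht (L i j) a + 1" using ht_h[of i j a] ij by (simp add: a_def)
  have "ht la a \<le> ht (L i j) a"
    using ht_vert[of i j a] ht_bottom[of i a] ij by (simp add: sum_nonneg)
  moreover have "ht (L (Suc i) j) a \<le> int N"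
    using ht_le_length[of "L (Suc i) j" a] SigD(1)[OF L_Sig[of "Suc i" j]] ij by simp
  ultimately have "ht la a \<noteq> int N" using up by simp
  thus "A \<le> hpos L i j" using A[of a] by (cases "a < A") (auto simp: a_def)
  have "ht (L (Suc i) j) a \<le> ht (L (Suc i) n) a"
    using ij ht_vert[of "Suc i" j a] ht_vert[of "Suc i" n a]
      sum_mono2[of "{..<n}" "{..<j}" "\<lambda>j'. of_bool (vpos L (Suc i) j' = a) :: int"] by auto
  also have "\<dots> \<le> ht \<rho> a"
    using ij ht_top[of "Suc i" a] ht_top[of m a] corners
      sum_mono2[of "{..<m}" "{..<Suc i}" "\<lambda>i'. of_bool (hpos L i' n = a) :: int"]
    by (auto simp del: sum.lessThan_Suc)
  finally have "ht (L (Suc i) j) a \<le> ht \<rho> a" .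
  hence "ht \<rho> a \<ge> 1" using up ht_nonneg[of "L i j" a] by simp
  thus "hpos L i j < B" using B[of a] by (cases "B \<le> a") (auto simp: a_def)
qed

text \<open>No one-box has label \<open>A - 1\<close>, so the carry vanishes at \<open>A\<close>,
  and the balance accumulates from there.\<close>

lemma cc_eq_sum:
  assumes A: "\<And>k. k < A \<Longrightarrow> ht la k = int N" and B: "\<And>k. B \<le> k \<Longrightarrow> ht \<rho> k = 0" and "A \<le> k"
  shows "cc k = (\<Sum>k'\<in>{A..<k}. ht \<nu> k' + ht \<mu> k' - ht la k' - ht \<rho> k')"
  using \<open>A \<le> k\<close>
proof (induction k rule: int_ge_induct)
  case base
  have "\<not> carry A"
  proof
    assume "carry A"
    then obtain i j where "one i j" "hpos L i j = A - 1" by (auto simp: carry_def)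
    thus False using label_bounds(1)[of A B i j] A B one_bound[of i j] by simp
  qed
  thus ?case using cc_eq_0_iff by simp
next
  case (step k)
  have "{A..<k + 1} = insert k {A..<k}" using step.hyps by auto
  thus ?case using cc_diff[of k] step.IH by simp
qed

lemma prod_box_weight:
  assumes A: "\<And>k. k < A \<Longrightarrow> ht la k = int N" and B: "\<And>k. B \<le> k \<Longrightarrow> ht \<rho> k = 0"
  shows "(\<Prod>i<m. \<Prod>j<n. box_weight t m n L i j) =
    (\<Prod>k\<in>{A..<B}. col_weight t (ht la (k - 1)) (ht \<nu> (k - 1)) (ht \<mu> (k - 1)) (ht \<rho> (k - 1))
      (ht la k) (ht \<nu> k) (ht \<mu> k) (ht \<rho> k) (\<Sum>k'\<in>{A..<k}. ht \<nu> k' + ht \<mu> k' - ht la k' - ht \<rho> k'))"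
proof -
  have "(\<Prod>i<m. \<Prod>j<n. box_weight t m n L i j) = (\<Prod>(i, j)\<in>{..<m} \<times> {..<n}. box_weight t m n L i j)"
    by (simp add: prod.cartesian_product)
  also have "\<dots> = (\<Prod>k\<in>{A..<B}. prod (\<lambda>(i, j). box_weight t m n L i j)
      {x \<in> {..<m} \<times> {..<n}. (case x of (i, j) \<Rightarrow> hpos L i j) = k})"
    using label_bounds[of A B] A B by (subst prod.group) (auto simp: less_imp_le)
  also have "\<dots> = (\<Prod>k\<in>{A..<B}. \<Prod>(i, j)\<in>{(i, j). i < m \<and> j < n \<and> hpos L i j = k}. box_weight t m n L i j)"
    by (intro prod.cong refl) auto
  finally show ?thesis
    unfolding column_weight using cc_eq_sum[of A B] A B by (auto intro!: prod.cong)
qed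

end

subsection \<open>Existence of fillings\<close>

text \<open>\<open>crossing hs vs D i j\<close> gives the labels leaving box \<open>(i, j)\<close> upwards and to the right. Two lines
  meeting at \<open>k\<close> move on to \<open>k + 1\<close> if one of them would otherwise collide with its predecessor,
  and else unless \<open>D k\<close>.\<close>

fun crossing :: "(nat \<Rightarrow> int) \<Rightarrow> (nat \<Rightarrow> int) \<Rightarrow> (int \<Rightarrow> bool) \<Rightarrow> nat \<Rightarrow> nat \<Rightarrow> int \<times> int" where
  "crossing hs vs D i j =
    (let x = (case j of 0 \<Rightarrow> hs i | Suc j' \<Rightarrow> fst (crossing hs vs D i j'));
         y = (case i of 0 \<Rightarrow> vs j | Suc i' \<Rightarrow> snd (crossing hs vs D i' j))
     in if x = y \<and> (\<not> D x \<or> (case i of 0 \<Rightarrow> False | Suc i' \<Rightarrow> fst (crossing hs vs D i' j) = x)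
                           \<or> (case j of 0 \<Rightarrow> False | Suc j' \<Rightarrow> snd (crossing hs vs D i j') = x))
        then (x + 1, y + 1) else (x, y))"

declare crossing.simps [simp del]

text \<open>The forcing clauses keep the labels strictly increasing: the only danger is a line
  moving onto the label of its neighbour, and then the crossing line meets that neighbour next and
  pushes it on. If no carry arrives, a crossing of two lines starting in the column is never forced,
  so there the choice \<open>D\<close> takes effect.\<close>

lemma labels_exist:
  fixes hs vs :: "nat \<Rightarrow> int"
  assumes hs: "\<And>i. Suc i < m \<Longrightarrow> hs i < hs (Suc i)" and vs: "\<And>j. Suc j < n \<Longrightarrow> vs j < vs (Suc j)"
  obtains h v where "labels m n h v" "\<And>i. h i 0 = hs i" "\<And>j. v 0 j = vs j"
    "\<And>i j. i < m \<Longrightarrow> j < n \<Longrightarrow> h i 0 = v 0 j \<Longrightarrow> \<not> labels.carry m n h v (h i 0) \<Longrightarrow>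
      labels.one m n h v i j \<longleftrightarrow> \<not> D (h i 0)"
proof -
  define h where "h i j = (case j of 0 \<Rightarrow> hs i | Suc j' \<Rightarrow> fst (crossing hs vs D i j'))" for i j
  define v where "v i j = (case i of 0 \<Rightarrow> vs j | Suc i' \<Rightarrow> snd (crossing hs vs D i' j))" for i j
  define forced where "forced i j \<longleftrightarrow> (case i of 0 \<Rightarrow> False | Suc i' \<Rightarrow> h i' (Suc j) = h i j)
      \<or> (case j of 0 \<Rightarrow> False | Suc j' \<Rightarrow> v (Suc i) j' = h i j)" for i j
  have out: "crossing hs vs D i j = (h i (Suc j), v (Suc i) j)" for i j
    by (simp add: h_def v_def)
  have step: "(h i (Suc j), v (Suc i) j) =
     (if h i j = v i j \<and> (\<not> D (h i j) \<or> forced i j) then (h i j + 1, v i j + 1) else (h i j, v i j))" for i j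
  proof -
    have "crossing hs vs D i j =
      (if h i j = v i j \<and> (\<not> D (h i j) \<or> forced i j) then (h i j + 1, v i j + 1) else (h i j, v i j))"
      unfolding crossing.simps[of hs vs D i j] Let_def forced_def h_def v_def
      by (cases i; cases j; simp)
    thus ?thesis by (simp add: out)
  qed
  have mono: "h i j \<le> h i (Suc j)" "v i j \<le> v (Suc i) j" for i j
    using step[of i j] by (auto split: if_splits)
  have hstep: "h i j < h (Suc i) j" if "Suc i < m" for i j
  proof (induction j)
    case 0 thus ?case using hs that by (simp add: h_def)
  next
    case (Suc j)
    have le: "h i (Suc j) \<le> h i j + 1" using step[of i j] by (auto split: if_splits)
    show ?case
    proof (rule ccontr)
      assume "\<not> ?case"
      hence eq: "h i (Suc j) = h i j + 1" "h (Suc i) j = h i j + 1" "h (Suc i) (Suc j) = h i j + 1"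
        using le Suc mono(1)[of "Suc i" j] by auto
      hence "v (Suc i) j = h i j + 1" using step[of i j] by (auto split: if_splits)
      moreover have "forced (Suc i) j" using eq by (simp add: forced_def)
      ultimately show False using step[of "Suc i" j] eq by simp
    qed
  qed
  have vstep: "v i j < v i (Suc j)" if "Suc j < n" for i j
  proof (induction i)
    case 0 thus ?case using vs that by (simp add: v_def)
  next
    case (Suc i)
    have le: "v (Suc i) j \<le> v i j + 1" using step[of i j] by (auto split: if_splits)
    show ?case
    proof (rule ccontr)
      assume "\<not> ?case"
      hence eq: "v (Suc i) j = v i j + 1" "v i (Suc j) = v i j + 1" "v (Suc i) (Suc j) = v i j + 1"
        using le Suc mono(2)[of i "Suc j"] by auto
      hence "h i (Suc j) = v i j + 1" using step[of i j] by (auto split: if_splits)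
      moreover have "forced i (Suc j)" using eq calculation by (simp add: forced_def)
      ultimately show False using step[of i "Suc j"] eq by simp
    qed
  qed
  have lab: "labels m n h v"
  proof
    fix i j
    show "h i (Suc j) = h i j \<and> v (Suc i) j = v i j" if "h i j \<noteq> v i j"
      using step[of i j] that by (auto split: if_splits)
    show "v (Suc i) j = h i (Suc j) \<and> (h i (Suc j) = h i j \<or> h i (Suc j) = h i j + 1)" if "h i j = v i j"
      using step[of i j] that by (auto split: if_splits)
  qed (use hstep vstep in auto)
  interpret labels m n h v by (rule lab)
  show thesis
  proof (rule that[OF lab])
    fix i j assume ij: "i < m" "j < n" and eq: "h i 0 = v 0 j" and nc: "\<not> carry (h i 0)"
    define k where "k = h i 0"
    have k: "\<not> carry k" "h i 0 = k" "v 0 j = k" using nc eq unfolding k_def by simp_all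
    have hv: "h i j = k" "v i j = k"
      using no_carry_box[OF k(1) ij k(2,3)] labels.no_carry_box[OF transpose_labels, of k j i] ij k
      unfolding carry_transpose by blast+
    have "\<not> forced i j"
    proof
      assume "forced i j"
      then consider i' where "i = Suc i'" "h i' (Suc j) = k" | j' where "j = Suc j'" "v (Suc i) j' = k"
        unfolding forced_def hv by (cases i; cases j) auto
      thus False
      proof cases
        case 1
        hence "h i' 0 = h i 0" using no_carry_source[of k i' "Suc j"] k ij by simp
        thus False using h_less[of i' i 0] 1 ij by simp
      next
        case 2
        hence "v 0 j' = v 0 j" 
          using labels.no_carry_source[OF transpose_labels, of k j' "Suc i"] k ij
          by (simp add: carry_transpose)
        thus False using v_less[of j' j 0] 2 ij by simp
      qed
    qed
    thus "one i j \<longleftrightarrow> \<not> D (h i 0)"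
      using step[of i j] ij hv k by (auto simp: one_def split: if_splits)
  qed (simp_all add: h_def v_def)
qed

text \<open>The boxes come in increasing columns. If column \<open>k + 1\<close> has received its
  box, both columns have reached their final heights; otherwise the left side is unchanged and the
  right side can only have grown.\<close>

lemma partial_heights_antimono:
  fixes e :: "nat \<Rightarrow> int" and f :: "int \<Rightarrow> int"
  assumes e: "\<And>i i'. i < i' \<Longrightarrow> i' < m \<Longrightarrow> e i < e i'"
    and f: "f (k + 1) \<le> f k"
    and fm: "f (k + 1) + (\<Sum>i<m. of_bool (e i = k + 1)) \<le> f k + (\<Sum>i<m. of_bool (e i = k))"
    and r: "r \<le> m"
  shows "f (k + 1) + (\<Sum>i<r. of_bool (e i = k + 1)) \<le> f k + (\<Sum>i<r. of_bool (e i = k))"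
proof (cases "\<exists>i<r. e i = k + 1")
  case True
  then obtain i0 where i0: "i0 < r" "e i0 = k + 1" by blast
  have "e i \<noteq> k + 1" "e i \<noteq> k" if "i < m" "r \<le> i" for i using e[of i0 i] i0 that by auto
  hence ne: "e i \<noteq> k'" if "i < m" "r \<le> i" "k' \<in> {k, k + 1}" for i k' using that by blast
  have "(\<Sum>i<m. of_bool (e i = k')) = (\<Sum>i<r. of_bool (e i = k') :: int)" if "k' \<in> {k, k + 1}" for k'
    using r ne[OF _ _ that] by (intro sum.mono_neutral_right) force+
  thus ?thesis using fm by simp
next
  case False
  hence "(\<Sum>i<r. of_bool (e i = k + 1)) = (0::int)" by (intro sum.neutral) auto
  moreover have "0 \<le> (\<Sum>i<r. of_bool (e i = k) :: int)" by (simp add: sum_nonneg)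
  ultimately show ?thesis using f by linarith
qed

text \<open>The column rule is sufficient as well as necessary. The starting labels are the columns
  of \<nu>/\<lambda> and \<mu>/\<lambda> in increasing order, and a free crossing becomes a zero-box
  if \<rho> exceeds \<lambda> by two there; the carry of these lines then agrees with
  \<open>c\<close> column by column. The remaining conclusions are the side conditions in the
  definition of \<open>hl_U\<close>.\<close>

lemma filling_exists:
  assumes S: "la \<in> Sig N" "\<nu> \<in> Sig N" "\<mu> \<in> Sig N" "\<rho> \<in> Sig N"
    and il: "interlace la \<mu>" "interlace la \<nu>"
    and A: "\<And>a. a \<in> set la \<Longrightarrow> A \<le> a" "\<And>a. a \<in> set \<rho> \<Longrightarrow> A \<le> a"
    and B: "\<And>a. a \<in> set \<nu> \<union> set \<mu> \<union> set \<rho> \<Longrightarrow> a < B" and AB: "A < B"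
    and c: "\<And>k. c k = (\<Sum>k'\<in>{A..<k}. ht \<nu> k' + ht \<mu> k' - ht la k' - ht \<rho> k')"
    and rule: "\<And>k. k \<in> {A..<B} \<Longrightarrow> 0 \<le> c k \<Longrightarrow>
      (if c k = 0 \<and> ht \<nu> k = ht la k + 1 \<and> ht \<mu> k = ht la k + 1
       then ht \<rho> k \<in> {ht la k + 1, ht la k + 2}
       else if c k = 0 then ht \<rho> k + ht la k = ht \<nu> k + ht \<mu> k else ht \<rho> k = ht la k + 1)"
    and mn: "m = nat (sum_list \<nu> - sum_list la)" "n = nat (sum_list \<mu> - sum_list la)"
  shows "\<exists>L. filling N m n la \<nu> \<mu> \<rho> L" "interlace \<mu> \<rho>" "interlace \<nu> \<rho>"
    "sum_list \<nu> - sum_list la = sum_list \<rho> - sum_list \<mu>"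
proof -
  define l p q s where "l = ht la" and "p = ht \<nu>" and "q = ht \<mu>" and "s = ht \<rho>"
  note defs = l_def p_def q_def s_def
  have p01: "p k = l k \<or> p k = l k + 1" for k
    using interlace_iff_ht[OF S(1,2)] il(2) unfolding defs
    by (metis add.commute le_less not_le zless_add1_eq)
  have q01: "q k = l k \<or> q k = l k + 1" for k
    using interlace_iff_ht[OF S(1,3)] il(1) unfolding defs
    by (metis add.commute le_less not_le zless_add1_eq)
  have loN: "l k = int N" "s k = int N" if "k < A" for k
    using ht_eq_length[of la k] ht_eq_length[of \<rho> k] A S that unfolding defs by (fastforce simp: Sig_def)+
  have pqN: "p k \<le> int N" "q k \<le> int N" for k
    using ht_le_length[of \<nu> k] ht_le_length[of \<mu> k] S by (auto simp: defs Sig_def)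
  have lopq: "p k = int N" "q k = int N" if "k < A" for k
    using loN[OF that] p01[of k] q01[of k] pqN[of k] by auto
  have hi: "p k = 0" "q k = 0" "s k = 0" if "B - 1 \<le> k" for k
    using B that unfolding defs ht_eq_0_iff by force+
  have hil: "l k = 0" if "B - 1 \<le> k" for k
    using hi[OF that] p01[of k] ht_nonneg[of la k] by (auto simp: defs)
  define H V where "H = {k. p k = l k + 1}" and "V = {k. q k = l k + 1}"
  have HA: "H \<subseteq> {A..<B}" "V \<subseteq> {A..<B}"
  proof -
    have "k \<in> {A..<B}" if "p k = l k + 1 \<or> q k = l k + 1" for k
    proof (rule ccontr)
      assume "k \<notin> {A..<B}"
      hence "k < A \<or> B - 1 \<le> k" by auto
      thus False using loN[of k] lopq[of k] hi[of k] hil[of k] that by auto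
    qed
    thus "H \<subseteq> {A..<B}" "V \<subseteq> {A..<B}" unfolding H_def V_def by blast+
  qed
  have finHV: "finite H" "finite V" using HA finite_subset by blast+
  have sums: "sum_list \<nu> = int N * A + (\<Sum>k\<in>{A..<B}. p k)" "sum_list \<mu> = int N * A + (\<Sum>k\<in>{A..<B}. q k)"
    "sum_list la = int N * A + (\<Sum>k\<in>{A..<B}. l k)" "sum_list \<rho> = int N * A + (\<Sum>k\<in>{A..<B}. s k)"
  proof -
    have in_AB: "A \<le> a \<and> a \<le> B" if "x \<in> Sig N" "a \<in> set x" "\<And>k. k < A \<Longrightarrow> ht x k = int N" "\<And>k. B - 1 \<le> k \<Longrightarrow> ht x k = 0"
      for x a
    proof -
      have "\<forall>a\<in>set x. A - 1 < a" using that by (subst ht_eq_length_iff[symmetric]) (simp add: Sig_def)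
      moreover have "\<forall>a\<in>set x. a \<le> B - 1" using that by (subst ht_eq_0_iff[symmetric]) simp
      ultimately show ?thesis using that(2) by force
    qed
    show "sum_list \<nu> = int N * A + (\<Sum>k\<in>{A..<B}. p k)"
      unfolding p_def using S SigD(1)[OF S(2)] in_AB[of \<nu>] lopq hi by (subst sum_list_ht[of _ A B]) (auto simp: defs)
    show "sum_list \<mu> = int N * A + (\<Sum>k\<in>{A..<B}. q k)"
      unfolding q_def using S SigD(1)[OF S(3)] in_AB[of \<mu>] lopq hi by (subst sum_list_ht[of _ A B]) (auto simp: defs)
    show "sum_list la = int N * A + (\<Sum>k\<in>{A..<B}. l k)"
      unfolding l_def using S SigD(1)[OF S(1)] in_AB[of la] loN hil by (subst sum_list_ht[of _ A B]) (auto simp: defs)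
    show "sum_list \<rho> = int N * A + (\<Sum>k\<in>{A..<B}. s k)"
      unfolding s_def using S SigD(1)[OF S(4)] in_AB[of \<rho>] loN hi by (subst sum_list_ht[of _ A B]) (auto simp: defs)
  qed
  have card_sum: "(\<Sum>k\<in>{A..<B}. f k) - (\<Sum>k\<in>{A..<B}. l k) = int (card {k. f k = l k + 1})"
    if f: "\<And>k. f k = l k \<or> f k = l k + 1" and sub: "{k. f k = l k + 1} \<subseteq> {A..<B}" for f :: "int \<Rightarrow> int"
  proof -
    have fl: "f k - l k = of_bool (f k = l k + 1)" for k using f[of k] by auto
    have "(\<Sum>k\<in>{A..<B}. f k - l k) = (\<Sum>k\<in>{k. f k = l k + 1}. 1)"
      using sub unfolding fl by (intro sum.mono_neutral_cong_right) auto
    thus ?thesis by (simp add: sum_subtractf)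
  qed
  have mH: "m = card H" and nV: "n = card V"
    using card_sum[of p] card_sum[of q] p01 q01 HA unfolding mn sums H_def V_def by auto
  define hs where "hs i = sorted_list_of_set H ! i" for i
  define vs where "vs j = sorted_list_of_set V ! j" for j
  have lenHV: "length (sorted_list_of_set H) = m" "length (sorted_list_of_set V) = n"
    using mH nV by simp_all
  have "hs i < hs (Suc i)" if "Suc i < m" for i
    unfolding hs_def using that lenHV strict_sorted_list_of_set[of H]
    by (auto simp: sorted_wrt_iff_nth_less)
  moreover have "vs j < vs (Suc j)" if "Suc j < n" for j
    unfolding vs_def using that lenHV strict_sorted_list_of_set[of V]
    by (auto simp: sorted_wrt_iff_nth_less)
  ultimately obtain h v where lab: "labels m n h v" and h0: "\<And>i. h i 0 = hs i" and v0: "\<And>j. v 0 j = vs j"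
    and D: "\<And>i j. i < m \<Longrightarrow> j < n \<Longrightarrow> h i 0 = v 0 j \<Longrightarrow> \<not> labels.carry m n h v (h i 0) \<Longrightarrow>
      labels.one m n h v i j \<longleftrightarrow> \<not> (\<lambda>k. s k = l k + 2) (h i 0)"
    using labels_exist[of m hs n vs "\<lambda>k. s k = l k + 2"] by metis
  interpret labels m n h v by (rule lab)
  have X: "X k \<longleftrightarrow> p k = l k + 1" for k
  proof -
    have "X k \<longleftrightarrow> k \<in> set (sorted_list_of_set H)"
      unfolding X_def h0 hs_def in_set_conv_nth lenHV ..
    thus ?thesis using finHV by (simp add: H_def)
  qed
  have Y: "Y k \<longleftrightarrow> q k = l k + 1" for k
  proof -
    have "Y k \<longleftrightarrow> k \<in> set (sorted_list_of_set V)"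
      unfolding Y_def v0 vs_def in_set_conv_nth lenHV ..
    thus ?thesis using finHV by (simp add: V_def)
  qed
  have pX: "p k = l k + of_bool (X k)" and qY: "q k = l k + of_bool (Y k)" for k
    using p01[of k] q01[of k] X[of k] Y[of k] by auto
  have c_Suc: "c (k + 1) = c k + p k + q k - l k - s k" if "A \<le> k" for k
  proof -
    have "{A..<k + 1} = insert k {A..<k}" using that by auto
    thus ?thesis by (simp add: c defs)
  qed
  have cc_step': "cc (k + 1) = cc k + p k + q k - l k - s k" if "A \<le> k" "k < B" "cc k = c k" for k
  proof -
    have r: "if cc k = 0 \<and> X k \<and> Y k then s k \<in> {l k + 1, l k + 2}
       else if cc k = 0 then s k + l k = p k + q k else s k = l k + 1"
      using rule[of k] that cc_nonneg[of k] X[of k] Y[of k] by (auto simp: defs)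
    show ?thesis
    proof (cases "cc k = 0 \<and> X k \<and> Y k")
      case True
      then obtain i j where ij: "i < m" "j < n" "h i 0 = k" "v 0 j = k" by (auto simp: X_def Y_def)
      have nc: "\<not> carry k" using True cc_eq_0_iff by blast
      have one: "one i j \<longleftrightarrow> s k \<noteq> l k + 2" using D[of i j] ij nc by simp
      have uniq: "i' = i \<and> j' = j" if "one i' j'" "h i' j' = k" for i' j'
      proof -
        have b: "i' < m" "j' < n" using one_bound[OF that(1)] by auto
        have "h i' 0 = k" using no_carry_source[of k i' j'] nc b that by simp
        moreover have "v 0 j' = k"
          using labels.no_carry_source[OF transpose_labels, of k j' i'] nc b that
          by (simp add: carry_transpose one_v)
        ultimately show ?thesis using h_inj[of i i' 0] v_inj[of j j' 0] b ij by auto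
      qed
      have hk: "h i j = k" using no_carry_box[of k i j] nc ij by simp
      have "carry (k + 1) \<longleftrightarrow> one i j" unfolding carry_def using uniq hk by auto
      moreover have "cc (k + 1) \<in> {0, 1}" using cc_step[of k] True by simp
      ultimately have "cc (k + 1) = of_bool (s k \<noteq> l k + 2)" using one cc_eq_0_iff[of "k + 1"] by auto
      thus ?thesis using r True pX[of k] qY[of k] by auto
    next
      case False
      thus ?thesis using r cc_step[of k] pX[of k] qY[of k] by (auto split: if_splits)
    qed
  qed
  have lab_ge: "A \<le> h i j" if "i < m" "j \<le> n" for i j
  proof -
    have "hs i \<in> H" using that finHV lenHV by (metis hs_def nth_mem set_sorted_list_of_set)
    thus ?thesis using h_mono[of i 0 j] h0 HA that by fastforce
  qed
  have ncA: "\<not> carry k" if "k \<le> A" for k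
  proof
    assume "carry k"
    then obtain i j where "one i j" "h i j = k - 1" by (auto simp: carry_def)
    thus False using lab_ge[of i j] one_bound[of i j] that by simp
  qed
  have cc_c: "cc k = c k" if "A \<le> k" "k \<le> B" for k
    using that
  proof (induction k rule: int_ge_induct)
    case base
    show ?case using cc_eq_0_iff[of A] ncA by (simp add: c)
  next
    case (step k)
    thus ?case using cc_step'[of k] c_Suc[of k] by simp
  qed
  \<comment> \<open>A carry reaching column \<open>B - 1\<close> would force a box of \<rho> there,
    but no coordinate of \<rho> exceeds \<open>B - 1\<close>.\<close>
  have ccB1: "cc (B - 1) = 0"
  proof (rule ccontr)
    assume ne: "cc (B - 1) \<noteq> 0"
    hence "s (B - 1) = l (B - 1) + 1"
      using rule[of "B - 1"] cc_c[of "B - 1"] AB cc_nonneg[of "B - 1"] by (simp add: defs)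
    thus False using hi[of "B - 1"] hil[of "B - 1"] by simp
  qed
  have cc_hi: "cc k = 0" if "B - 1 \<le> k" for k
    using that
  proof (induction k rule: int_ge_induct)
    case (step k)
    hence "\<not> X k" "\<not> Y k" using X[of k] hi[of k] hil[of k] Y[of k] by auto
    thus ?case using cc_step[of k] step by simp
  qed (rule ccB1)
  have cc_all: "cc (k + 1) = cc k + p k + q k - l k - s k" for k
  proof -
    consider "k < A" | "A \<le> k" "k < B" | "B \<le> k" by linarith
    thus ?thesis
    proof cases
      case 1
      hence "cc k = 0" "cc (k + 1) = 0" using ncA cc_eq_0_iff by auto
      thus ?thesis using loN[OF 1] lopq[OF 1] by simp
    next
      case 2 thus ?thesis using cc_step' cc_c by simp
    next
      case 3
      hence "cc k = 0" "cc (k + 1) = 0" using cc_hi by auto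
      thus ?thesis using hi[of k] hil[of k] 3 by simp
    qed
  qed
  have sX: "s k = q k + of_bool (X' k)" for k
    using conservation[of k] cc_all[of k] pX[of k] by simp
  have sY: "s k = p k + of_bool (Y' k)" for k
    using labels.conservation[OF transpose_labels, of k] cc_all[of k] qY[of k]
    by (simp add: X_transpose X'_transpose cc_transpose)
  show "interlace \<mu> \<rho>" "interlace \<nu> \<rho>"
    unfolding interlace_iff_ht[OF S(3,4) disjI1[OF refl]] interlace_iff_ht[OF S(2,4) disjI1[OF refl]]
      defs[symmetric] by (simp add: sX, simp add: sY)
  have "(\<Sum>k\<in>{A..<B}. p k + q k - l k - s k) = 0" using cc_c[of B] cc_hi[of B] AB by (simp add: c defs)
  thus "sum_list \<nu> - sum_list la = sum_list \<rho> - sum_list \<mu>"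
    unfolding sums by (simp add: sum.distrib sum_subtractf)
  \<comment> \<open>Heights along the route that goes right first and then up. By
    \<open>hh_h\<close> a step to the right at any level changes them in the required way
    too.\<close>
  define hh where "hh i j k = l k + (\<Sum>i'<i. of_bool (h i' 0 = k)) + (\<Sum>j'<j. of_bool (v i j' = k))" for i j k
  have hh_v: "hh i (Suc j) k = hh i j k + of_bool (v i j = k)" for i j k by (simp add: hh_def)
  have hh_h: "hh (Suc i) j k = hh i j k + of_bool (h i j = k)" if "i < m" "j \<le> n" for i j k
    using that(2)
  proof (induction j)
    case 0 show ?case by (simp add: hh_def)
  next
    case (Suc j)
    have "of_bool (h i j = k) + of_bool (v (Suc i) j = k) = (of_bool (v i j = k) + of_bool (h i (Suc j) = k) :: int)"
      using pass[of i j] meet[of i j] \<open>i < m\<close> Suc.prems by (cases "h i j = v i j") auto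
    thus ?case using Suc by (simp add: hh_v)
  qed
  have hh00: "hh 0 0 k = l k" for k by (simp add: hh_def)
  have hh0: "hh i 0 k = l k + (\<Sum>i'<i. of_bool (h i' 0 = k))" for i k by (simp add: hh_def)
  have hhn: "hh i n k = q k + (\<Sum>i'<i. of_bool (h i' n = k))" if "i \<le> m" for i k
    using that
  proof (induction i)
    case 0
    have "hh 0 n k = l k + of_bool (Y k)"
      using labels.of_bool_label[OF transpose_labels, of 0 k] by (simp add: hh_def Y_def)
    thus ?case using qY[of k] by simp
  next
    case (Suc i) thus ?case using hh_h[of i n k] by simp
  qed
  have hhm0: "hh m 0 k = p k" for k
    using of_bool_label[of 0 k] pX[of k] by (simp add: hh0 X_def)
  have hhmn: "hh m n k = s k" for k
    using of_bool_label[of n k] sX[of k] by (simp add: hhn X'_def)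
  have anti: "f (k + 1) \<le> f k" if "f \<in> {l, p, q, s}" for f k
    using that ht_antimono[of k "k + 1"] by (auto simp: defs)
  have anti0: "hh i 0 (k + 1) \<le> hh i 0 k" if "i \<le> m" for i k
    using partial_heights_antimono[of m "\<lambda>i. h i 0" l k i] h_less[of _ _ 0] anti[of l k] anti[of p k]
      that hhm0[unfolded hh0] by (auto simp: hh0)
  have antin: "hh i n (k + 1) \<le> hh i n k" if "i \<le> m" for i k
    using partial_heights_antimono[of m "\<lambda>i. h i n" q k i] h_less[of _ _ n] anti[of q k] anti[of s k]
      that hhmn hhn[of m] by (auto simp: hhn)
  have antih: "hh i j (k + 1) \<le> hh i j k" if "i \<le> m" "j \<le> n" for i j k
    using partial_heights_antimono[of n "v i" "hh i 0" k j] v_less[of _ _ i] anti0[of i k] antin[of i k] that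
    by (auto simp: hh_def)
  have hh_le: "hh i j k \<le> s k" if "i \<le> m" "j \<le> n" for i j k
  proof -
    have "hh i j k \<le> hh i n k" using that sum_mono2[of "{..<n}" "{..<j}" "\<lambda>j'. of_bool (v i j' = k) :: int"]
      by (auto simp: hh_def)
    also have "\<dots> \<le> hh m n k"
      using that sum_mono2[of "{..<m}" "{..<i}" "\<lambda>i'. of_bool (h i' n = k) :: int"] by (auto simp: hhn)
    finally show ?thesis by (simp add: hhmn)
  qed
  have hh_ge: "l k \<le> hh i j k" for i j k by (simp add: hh_def sum_nonneg)
  have "\<exists>x. x \<in> Sig N \<and> (\<forall>k. ht x k = hh i j k)" if "i \<le> m" "j \<le> n" for i j
  proof (rule Sig_exists[of "hh i j" A N B])
    show "hh i j (k + 1) \<le> hh i j k" for k using antih that by blast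
    show "hh i j k = int N" if "k < A" for k
      using hh_le[of i j k] hh_ge[of k i j] loN[OF that] \<open>i \<le> m\<close> \<open>j \<le> n\<close> by simp
    show "hh i j k = 0" if "B \<le> k" for k
      using hh_le[of i j k] hh_ge[of k i j] hi[of k] hil[of k] that \<open>i \<le> m\<close> \<open>j \<le> n\<close> by simp
  qed blast
  then obtain L where L: "\<And>i j. i \<le> m \<Longrightarrow> j \<le> n \<Longrightarrow> L i j \<in> Sig N"
      "\<And>i j k. i \<le> m \<Longrightarrow> j \<le> n \<Longrightarrow> ht (L i j) k = hh i j k"
    by metis
  have mh: "moves (h i j) (L i j) (L (Suc i) j)" if "i < m" "j \<le> n" for i j
    using moves_iff_ht[OF L(1)[of i j] L(1)[of "Suc i" j]] hh_h[of i j] L(2)[of i j] L(2)[of "Suc i" j] that by auto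
  have mv: "moves (v i j) (L i j) (L i (Suc j))" if "i \<le> m" "j < n" for i j
    using moves_iff_ht[OF L(1)[of i j] L(1)[of i "Suc j"]] hh_v[of i j] L(2)[of i j] L(2)[of i "Suc j"] that by auto
  have hp: "hpos L i j = h i j" if "i < m" "j \<le> n" for i j
    unfolding hpos_def using mh[OF that] moves_unique[OF L(1)[of i j] L(1)[of "Suc i" j]] that
    by (intro the_equality) auto
  have vp: "vpos L i j = v i j" if "i \<le> m" "j < n" for i j
    unfolding vpos_def using mv[OF that] moves_unique[OF L(1)[of i j] L(1)[of i "Suc j"]] that
    by (intro the_equality) auto
  have "filling N m n la \<nu> \<mu> \<rho> L"
    unfolding filling_def
  proof (intro conjI allI impI)
    show "L 0 0 = la" "L m 0 = \<nu>" "L 0 n = \<mu>" "L m n = \<rho>"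
      using L S hh00 hhm0 hhmn hhn[of 0] by (auto intro!: Sig_eqI simp: defs)
    show "L i j \<in> Sig N" if "i \<le> m" "j \<le> n" for i j using L that by blast
    show "\<exists>a. moves a (L i j) (L (Suc i) j)" if "i < m" "j \<le> n" for i j using mh that by blast
    show "\<exists>a. moves a (L i j) (L i (Suc j))" if "i \<le> m" "j < n" for i j using mv that by blast
    show "hpos L i j < hpos L (Suc i) j" if "Suc i < m \<and> j \<le> n" for i j
      using that hp[of i j] hp[of "Suc i" j] h_step by simp
    show "vpos L i j < vpos L i (Suc j)" if "i \<le> m \<and> Suc j < n" for i j
      using that vp[of i j] vp[of i "Suc j"] v_step by simp
    show "hpos L i (Suc j) = vpos L (Suc i) j" "hpos L i (Suc j) \<in> {hpos L i j, hpos L i j + 1}"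
      if "i < m" "j < n" "hpos L i j = vpos L i j" for i j
      using that hp[of i j] hp[of i "Suc j"] vp[of i j] vp[of "Suc i" j] meet[of i j] by auto
  qed
  thus "\<exists>L. filling N m n la \<nu> \<mu> \<rho> L" by blast
qed

lemma col_weight_nonzero:
  assumes "col_weight t l' p' q' s' l p q s c \<noteq> 0"
  shows "if c = 0 \<and> p = l + 1 \<and> q = l + 1 then s \<in> {l + 1, l + 2}
    else if c = 0 then s + l = p + q else s = l + 1"
  using assms by (auto simp: col_weight_def split: if_splits)

text \<open>The product also has to be 0 whenever the definition gives 0. This holds because a
  non-zero product means that every column obeys the rule, and then \<open>filling_exists\<close>
  supplies a filling together with all side conditions.\<close>

lemma hl_U_eq_prod:
  assumes t: "0 \<le> t" "t < 1"
    and S: "la \<in> Sig N" "\<nu> \<in> Sig N" "\<mu> \<in> Sig N" "\<rho> \<in> Sig N"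
    and il: "interlace la \<mu>" "interlace la \<nu>"
    and A: "\<And>a. a \<in> set la \<Longrightarrow> A \<le> a" "\<And>a. a \<in> set \<rho> \<Longrightarrow> A \<le> a"
    and B: "\<And>a. a \<in> set \<nu> \<union> set \<mu> \<union> set \<rho> \<Longrightarrow> a < B" and AB: "A < B"
  shows "hl_U t \<mu> \<rho> la \<nu> =
    (\<Prod>k\<in>{A..<B}. col_weight t (ht la (k - 1)) (ht \<nu> (k - 1)) (ht \<mu> (k - 1)) (ht \<rho> (k - 1))
      (ht la k) (ht \<nu> k) (ht \<mu> k) (ht \<rho> k) (\<Sum>k'\<in>{A..<k}. ht \<nu> k' + ht \<mu> k' - ht la k' - ht \<rho> k'))"
    (is "_ = ?P")
proof -
  define m n where "m = nat (sum_list \<nu> - sum_list la)" and "n = nat (sum_list \<mu> - sum_list la)"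
  have len: "length la = N" using S by (simp add: Sig_def)
  have hA: "ht la k = int N" if "k < A" for k
    using A(1) that ht_eq_length[of la k] len by force
  have hB: "ht \<rho> k = 0" if "B \<le> k" for k
    using B that by (force simp: ht_eq_0_iff)
  have prodL: "(\<Prod>i<m. \<Prod>j<n. box_weight t m n L i j) = ?P" if "filling N m n la \<nu> \<mu> \<rho> L" for L
  proof -
    interpret filled t N m n la \<nu> \<mu> \<rho> L using t that by unfold_locales
    show ?thesis using prod_box_weight[of A B] hA hB by blast
  qed
  have rule: "if c = 0 \<and> ht \<nu> k = ht la k + 1 \<and> ht \<mu> k = ht la k + 1
       then ht \<rho> k \<in> {ht la k + 1, ht la k + 2}
       else if c = 0 then ht \<rho> k + ht la k = ht \<nu> k + ht \<mu> k else ht \<rho> k = ht la k + 1"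
    if "?P \<noteq> 0" "k \<in> {A..<B}" "c = (\<Sum>k'\<in>{A..<k}. ht \<nu> k' + ht \<mu> k' - ht la k' - ht \<rho> k')" for k c
  proof -
    have "col_weight t (ht la (k - 1)) (ht \<nu> (k - 1)) (ht \<mu> (k - 1)) (ht \<rho> (k - 1))
      (ht la k) (ht \<nu> k) (ht \<mu> k) (ht \<rho> k) c \<noteq> 0"
      using that by (simp add: prod_zero_iff)
    thus ?thesis by (rule col_weight_nonzero)
  qed
  show ?thesis
  proof (cases "\<exists>L. filling N m n la \<nu> \<mu> \<rho> L")
    case True
    hence some: "filling N m n la \<nu> \<mu> \<rho> (SOME L. filling N m n la \<nu> \<mu> \<rho> L)" by (rule someI_ex)
    show ?thesis
    proof (cases "interlace \<mu> \<rho> \<and> interlace \<nu> \<rho> \<and> sum_list \<nu> - sum_list la = sum_list \<rho> - sum_list \<mu>")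
      case v: True
      show ?thesis
        unfolding hl_U_def Let_def len m_def[symmetric] n_def[symmetric]
        by (subst if_P) (use v S il True prodL[OF some] in auto)
    next
      case False
      interpret filled t N m n la \<nu> \<mu> \<rho> "SOME L. filling N m n la \<nu> \<mu> \<rho> L"
        using t some by unfold_locales
      have "interlace \<mu> \<rho>" "interlace \<nu> \<rho>"
        unfolding interlace_iff_ht[OF S(3,4) disjI1[OF refl]] interlace_iff_ht[OF S(2,4) disjI1[OF refl]]
        by (simp add: ht_rho, simp add: ht_rho')
      hence ne: "sum_list \<nu> - sum_list la \<noteq> sum_list \<rho> - sum_list \<mu>" using False by blast
      have U0: "hl_U t \<mu> \<rho> la \<nu> = 0" using ne by (simp add: hl_U_def)
      show ?thesis
      proof (rule ccontr)
        assume "hl_U t \<mu> \<rho> la \<nu> \<noteq> ?P"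
        hence nz: "?P \<noteq> 0" using U0 by simp
        show False
          using ne filling_exists(4)[OF S il A B AB refl rule[OF nz _ refl] m_def n_def] by simp
      qed
    qed
  next
    case False
    have U0: "hl_U t \<mu> \<rho> la \<nu> = 0"
      unfolding hl_U_def Let_def len m_def[symmetric] n_def[symmetric]
      by (rule if_not_P) (use False in blast)
    have "?P = 0"
    proof (rule ccontr)
      assume nz: "?P \<noteq> 0"
      show False
        using False filling_exists(1)[OF S il A B AB refl rule[OF nz _ refl] m_def n_def] by simp
    qed
    thus ?thesis using U0 by simp
  qed
qed

subsection \<open>Transitions with input\<close>

text \<open>The auxiliary last coordinates of \<open>\<lambda>\<close> and \<open>\<nu>\<close> only make the carry start with the value \<open>r\<close>.\<close>

lemma hl_U_input_eq_prod:
  assumes t: "0 \<le> t" "t < 1"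
    and S: "la \<in> Sig N" "\<nu> \<in> Sig N" "\<mu> \<in> Sig (Suc N)" "\<rho> \<in> Sig (Suc N)"
    and il: "interlace la \<mu>" "interlace la \<nu>"
    and nonneg: "\<And>a. a \<in> set la \<union> set \<nu> \<union> set \<mu> \<union> set \<rho> \<Longrightarrow> 0 \<le> a"
    and K: "\<And>a. a \<in> set \<nu> \<union> set \<mu> \<union> set \<rho> \<Longrightarrow> a < K"
  shows "hl_U_input t r \<mu> \<rho> la \<nu> =
    (\<Prod>k\<in>{0..<K}. col_weight t (ht la (k - 1)) (ht \<nu> (k - 1)) (ht \<mu> (k - 1)) (ht \<rho> (k - 1))
      (ht la k) (ht \<nu> k) (ht \<mu> k) (ht \<rho> k)
      (int r + (\<Sum>k'\<in>{0..<k}. ht \<nu> k' + ht \<mu> k' - ht la k' - ht \<rho> k')))"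
    (is "_ = (\<Prod>k\<in>_. ?W k)")
proof -
  define w where "w = (SOME w. \<forall>a\<in>set \<mu> \<union> set \<nu>. w < a)"
  have "\<forall>a\<in>set \<mu> \<union> set \<nu>. Min (insert 0 (set \<mu> \<union> set \<nu>)) - 1 < a"
  proof
    fix a assume "a \<in> set \<mu> \<union> set \<nu>"
    hence "Min (insert 0 (set \<mu> \<union> set \<nu>)) \<le> a" by (intro Min_le) auto
    thus "Min (insert 0 (set \<mu> \<union> set \<nu>)) - 1 < a" by linarith
  qed
  hence w: "w < a" if "a \<in> set \<mu> \<union> set \<nu>" for a
    using someI[of "\<lambda>w. \<forall>a\<in>set \<mu> \<union> set \<nu>. w < a"] that unfolding w_def by blast
  define lt nt where "lt = la @ [w - int r]" and "nt = \<nu> @ [w]"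
  have U: "hl_U_input t r \<mu> \<rho> la \<nu> = hl_U t \<mu> \<rho> lt nt"
    by (simp add: hl_U_input_def w_def[symmetric] Let_def lt_def nt_def)
  \<comment> \<open>Left of the smallest coordinate of \<mu> the columns of \<lambda>, \<nu> and
    \<mu> are all full, and the auxiliary coordinates lie in that region.\<close>
  define M where "M = last \<mu>"
  have \<mu>ne: "\<mu> \<noteq> []" using S by (auto simp: Sig_def)
  have M\<mu>: "M \<in> set \<mu>" using \<mu>ne by (simp add: M_def)
  have M: "0 \<le> M" "w < M" "M < K" using nonneg w K M\<mu> by auto
  have M_le: "M \<le> a" if "a \<in> set \<mu>" for a
  proof -
    have "\<exists>i<length \<mu>. a = \<mu> ! i" using that by (auto simp: in_set_conv_nth)
    then obtain i where "i < length \<mu>" "a = \<mu> ! i" by blast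
    thus ?thesis using SigD(2)[OF S(3)] \<mu>ne
      by (cases "i = length \<mu> - 1") (auto simp: M_def last_conv_nth sorted_wrt_iff_nth_less)
  qed
  have M_low: "ht \<mu> k = int N + 1" if "k < M" for k
    using ht_eq_length[of \<mu> k] SigD(1)[OF S(3)] less_le_trans[OF that M_le] by simp
  have l\<mu>: "ht la k \<le> ht \<mu> k" "ht \<mu> k \<le> ht la k + 1" for k
    using interlace_iff_ht[OF S(1,3)] il(1) by auto
  have l\<nu>: "ht la k \<le> ht \<nu> k" "ht \<nu> k \<le> ht la k + 1" for k
    using interlace_iff_ht[OF S(1,2)] il(2) by auto
  have leN: "ht la k \<le> int N" "ht \<nu> k \<le> int N" for k
    using ht_le_length[of la k] ht_le_length[of \<nu> k] S by (auto simp: Sig_def)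
  have low: "ht la k = int N" "ht \<nu> k = int N" if "k < M" for k
    using M_low[OF that] l\<mu>[of k] l\<nu>[of k] leN[of k] by auto
  have low': "M \<le> a" if "a \<in> set la \<union> set \<nu>" for a
  proof -
    have "\<forall>a\<in>set la. M - 1 < a" "\<forall>a\<in>set \<nu>. M - 1 < a"
      using low[of "M - 1"] SigD(1)[OF S(1)] SigD(1)[OF S(2)]
      by (simp_all flip: ht_eq_length_iff)
    thus ?thesis using that by force
  qed
  have Sl: "lt \<in> Sig (Suc N)"
  proof -
    have "w - int r \<le> a" if "a \<in> set la" for a using low'[of a] that M by simp
    thus ?thesis using S(1) by (simp add: lt_def Sig_def sorted_wrt_append)
  qed
  have Sn: "nt \<in> Sig (Suc N)"
  proof -
    have "w \<le> a" if "a \<in> set \<nu>" for a using low'[of a] that M by simp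
    thus ?thesis using S(2) by (simp add: nt_def Sig_def sorted_wrt_append)
  qed
  have htl: "ht lt k = ht la k + of_bool (k < w - int r)" and htn: "ht nt k = ht \<nu> k + of_bool (k < w)" for k
    by (simp_all add: lt_def nt_def ht_append ht_Cons)
  have il1: "interlace lt \<mu>"
    unfolding interlace_iff_ht[OF Sl S(3) disjI1[OF refl]] htl
  proof (intro allI)
    fix k show "ht la k + of_bool (k < w - int r) \<le> ht \<mu> k \<and> ht \<mu> k \<le> ht la k + of_bool (k < w - int r) + 1"
      using l\<mu>[of k] M M_low[of k] low[of k] by (cases "k < M") auto
  qed
  have il2: "interlace lt nt"
    unfolding interlace_iff_ht[OF Sl Sn disjI1[OF refl]] htl htn
  proof (intro allI)
    fix k show "ht la k + of_bool (k < w - int r) \<le> ht \<nu> k + of_bool (k < w) \<and>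
      ht \<nu> k + of_bool (k < w) \<le> ht la k + of_bool (k < w - int r) + 1"
      using l\<nu>[of k] M low[of k] by (cases "k < M") auto
  qed
  define A where "A = min (w - int r) 0"
  have \<rho>neg: "ht \<rho> k = int N + 1" if "k < 0" for k
  proof -
    have "k < a" if "a \<in> set \<rho>" for a using nonneg[of a] that \<open>k < 0\<close> by simp
    thus ?thesis using ht_eq_length[of \<rho> k] SigD(1)[OF S(4)] by simp
  qed
  show ?thesis
  proof (cases "\<forall>k<M. ht \<rho> k = int N + 1")
    case False
    \<comment> \<open>If \<rho> has a gap left of \<open>M\<close>, then \<mu> and \<rho> do not
      interlace, and the product has a zero factor at that column.\<close>
    then obtain k where k: "k < M" "ht \<rho> k \<noteq> int N + 1" by auto
    have "0 \<le> k" using k(2) \<rho>neg[of k] by linarith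
    have "\<not> interlace \<mu> \<rho>"
      using k M_low[of k] ht_le_length[of \<rho> k] SigD(1)[OF S(4)]
      unfolding interlace_iff_ht[OF S(3,4) disjI1[OF refl]] by (auto intro!: exI[of _ k])
    hence "hl_U t \<mu> \<rho> lt nt = 0" by (simp add: hl_U_def)
    moreover have "?W k = 0" using k low[of k] M_low[of k] by (simp add: col_weight_def)
    hence "(\<Prod>k\<in>{0..<K}. ?W k) = 0" using k \<open>0 \<le> k\<close> M by (auto simp: prod_zero_iff intro!: bexI[of _ k])
    ultimately show ?thesis using U by simp
  next
    case True
    define E where "E k = ht \<nu> k + ht \<mu> k - ht la k - ht \<rho> k" for k
    define Et where "Et k = ht nt k + ht \<mu> k - ht lt k - ht \<rho> k" for k
    define Wt where "Wt k = col_weight t (ht lt (k - 1)) (ht nt (k - 1)) (ht \<mu> (k - 1)) (ht \<rho> (k - 1))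
      (ht lt k) (ht nt k) (ht \<mu> k) (ht \<rho> k) (\<Sum>k'\<in>{A..<k}. Et k')" for k
    have "hl_U t \<mu> \<rho> lt nt = (\<Prod>k\<in>{A..<K}. Wt k)"
      unfolding Wt_def Et_def
    proof (rule hl_U_eq_prod[OF t Sl Sn S(3,4) il1 il2])
      show "A \<le> a" if "a \<in> set lt" for a
        using that low'[of a] M by (auto simp: lt_def A_def)
      show "A \<le> a" if "a \<in> set \<rho>" for a
        using that nonneg[of a] by (auto simp: A_def)
      show "a < K" if "a \<in> set nt \<union> set \<mu> \<union> set \<rho>" for a
        using that K[of a] M by (auto simp: nt_def)
      show "A < K" using M by (simp add: A_def)
    qed
    also have "{A..<K} = {A..<M} \<union> {M..<K}" using M by (auto simp: A_def)
    also have "(\<Prod>k\<in>\<dots>. Wt k) = (\<Prod>k\<in>{A..<M}. Wt k) * (\<Prod>k\<in>{M..<K}. Wt k)"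
      by (rule prod.union_disjoint) auto
    finally have U': "hl_U t \<mu> \<rho> lt nt = (\<Prod>k\<in>{A..<M}. Wt k) * (\<Prod>k\<in>{M..<K}. Wt k)" .
    have E0: "E k = 0" if "k < M" for k using that low[of k] M_low[of k] True by (simp add: E_def)
    have Et: "Et k = E k + of_bool (w - int r \<le> k \<and> k < w)" for k
      by (auto simp: Et_def E_def htl htn)
    \<comment> \<open>The auxiliary particle of \<nu> passes the columns from \<open>w - r\<close>
      to \<open>w - 1\<close>. Each of them adds one to the carry, which reaches \<open>r\<close>
      and stays there.\<close>
    have ctl: "(\<Sum>k'\<in>{A..<k}. Et k') = (if k < w - int r then 0 else if k < w then k - (w - int r) else int r)"
      if k: "A \<le> k" "k \<le> M" for k
    proof -
      have "(\<Sum>k'\<in>{A..<k}. Et k') = (\<Sum>k'\<in>{A..<k}. of_bool (w - int r \<le> k' \<and> k' < w))"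
        using k by (intro sum.cong refl) (simp add: Et E0)
      also have "\<dots> = (\<Sum>k'\<in>{w - int r..<min k w}. 1)"
        using k by (intro sum.mono_neutral_cong_right) (auto simp: A_def)
      finally show ?thesis by (auto simp: min_def)
    qed
    have "Wt k = 1" if k: "k \<in> {A..<M}" for k
    proof -
      \<comment> \<open>In the first of these columns only the auxiliary particle is present, so
        \<open>c(B) = t\<close> and a zero-box has weight 0: the one-box is certain.\<close>
      have "zero_weight t (int N + 1) (int N + 1) (int N + 1) (int N + 1) (int N) = 0"
        by (simp add: zero_weight_def)
      thus ?thesis using k M True M_low low ctl[of k]
        unfolding Wt_def htl htn by (auto simp: col_weight_def)
    qed
    hence 1: "(\<Prod>k\<in>{A..<M}. Wt k) = 1" by (intro prod.neutral) auto
    have c0: "int r + (\<Sum>k'\<in>{0..<k}. E k') = int r" if "k \<le> M" for k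
      using that E0 by (simp add: sum.neutral)
    have W1: "?W k = 1" if "k \<in> {0..<M}" for k
      using that low[of k] M_low[of k] True c0[of k] unfolding E_def by (simp add: col_weight_def)
    have ct: "(\<Sum>k'\<in>{A..<k}. Et k') = int r + (\<Sum>k'\<in>{0..<k}. E k')" if "M \<le> k" for k
    proof -
      have "{A..<k} = {A..<M} \<union> {M..<k}" "{0..<k} = {0..<M} \<union> {M..<k}" using that M by (auto simp: A_def)
      hence "(\<Sum>k'\<in>{A..<k}. Et k') = (\<Sum>k'\<in>{A..<M}. Et k') + (\<Sum>k'\<in>{M..<k}. Et k')"
        "(\<Sum>k'\<in>{0..<k}. E k') = (\<Sum>k'\<in>{0..<M}. E k') + (\<Sum>k'\<in>{M..<k}. E k')"
        by (simp_all add: sum.union_disjoint)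
      moreover have "(\<Sum>k'\<in>{M..<k}. Et k') = (\<Sum>k'\<in>{M..<k}. E k')"
        using M by (intro sum.cong refl) (simp add: Et)
      moreover have "(\<Sum>k'\<in>{A..<M}. Et k') = int r" using ctl[of M] M by (auto simp: A_def)
      moreover have "(\<Sum>k'\<in>{0..<M}. E k') = 0" using E0 by (simp add: sum.neutral)
      ultimately show ?thesis by simp
    qed
    have "Wt k = ?W k" if "k \<in> {M..<K}" for k
      using that M ct[of k] unfolding Wt_def htl htn E_def by simp
    hence "(\<Prod>k\<in>{M..<K}. Wt k) = (\<Prod>k\<in>{M..<K}. ?W k)" by (intro prod.cong refl) auto
    also have "\<dots> = (\<Prod>k\<in>{0..<K}. ?W k)"
      using M W1 by (intro prod.mono_neutral_left) auto
    finally show ?thesis using U U' 1 by simp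
  qed
qed

section \<open>Summing over signatures column by column\<close>

lemma sum_PiE_insert:
  assumes "x \<notin> S"
  shows "(\<Sum>f\<in>PiE (insert x S) (\<lambda>_. X). F f) = (\<Sum>f\<in>PiE S (\<lambda>_. X). \<Sum>y\<in>X. F (f(x := y)))"
proof -
  have "(\<Sum>f\<in>PiE (insert x S) (\<lambda>_. X). F f) = (\<Sum>(y, f)\<in>X \<times> PiE S (\<lambda>_. X). F (f(x := y)))"
    unfolding PiE_insert_eq using inj_combinator[OF assms, of "\<lambda>_. X"]
    by (subst sum.reindex) (auto simp: case_prod_unfold)
  also have "\<dots> = (\<Sum>y\<in>X. \<Sum>f\<in>PiE S (\<lambda>_. X). F (f(x := y)))"
    by (simp add: sum.cartesian_product)
  finally show ?thesis by (simp add: sum.swap[of _ X])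
qed

definition Sig_below :: "nat \<Rightarrow> int \<Rightarrow> int list set" where
  "Sig_below N K = {l \<in> Sig N. \<forall>a\<in>set l. 0 \<le> a \<and> a < K}"

lemma ht_Sig_below:
  assumes "l \<in> Sig_below N K"
  shows "k < 0 \<Longrightarrow> ht l k = int N" "K - 1 \<le> k \<Longrightarrow> ht l k = 0"
proof -
  have S: "length l = N" "\<And>a. a \<in> set l \<Longrightarrow> 0 \<le> a \<and> a < K"
    using assms by (auto simp: Sig_below_def Sig_def)
  show "ht l k = int N" if "k < 0"
    using ht_eq_length[of l k] S(1) less_le_trans[OF that] S(2) by auto
  show "ht l k = 0" if "K - 1 \<le> k"
  proof (rule ht_eq_0)
    fix a assume "a \<in> set l" thus "a \<le> k" using S(2)[of a] that by simp
  qed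
qed

lemma ht_Sig_below_inj:
  assumes "l \<in> Sig_below N K" "l' \<in> Sig_below N K" "\<And>k. k \<in> {-1..<K} \<Longrightarrow> ht l k = ht l' k"
  shows "l = l'"
proof (rule Sig_eqI)
  fix k
  consider "k < 0" | "K - 1 \<le> k" | "k \<in> {-1..<K}" by force
  thus "ht l k = ht l' k"
    using ht_Sig_below[OF assms(1), of k] ht_Sig_below[OF assms(2), of k] assms(3) by cases auto
qed (use assms in \<open>auto simp: Sig_below_def\<close>)

text \<open>Turns a sum over signatures into one over unrestricted functions, where each column can
  be summed on its own. The price is the last hypothesis: the summand has to vanish by itself on
  functions that are not the heights of a signature. Column \<open>-1\<close> is included because it
  records the length.\<close>

lemma sum_Sig_below:
  fixes F :: "(int \<Rightarrow> int) \<Rightarrow> real"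
  assumes K: "0 < K" and X: "{0..int N} \<subseteq> X" "finite X"
    and cong: "\<And>f g. (\<And>k. k \<in> {-1..<K} \<Longrightarrow> f k = g k) \<Longrightarrow> F f = F g"
    and nz: "\<And>f. F f \<noteq> 0 \<Longrightarrow> f (-1) = int N \<and> (\<forall>k\<in>{0..<K}. f k \<le> f (k - 1)) \<and> f (K - 1) = 0"
  shows "(\<Sum>l\<in>Sig_below N K. F (ht l)) = (\<Sum>f\<in>PiE {-1..<K} (\<lambda>_. X). F f)"
proof -
  let ?r = "\<lambda>l. restrict (ht l) {-1..<K}"
  have inj: "inj_on ?r (Sig_below N K)"
  proof (rule inj_onI)
    fix l l' assume l: "l \<in> Sig_below N K" "l' \<in> Sig_below N K" "?r l = ?r l'"
    show "l = l'"
      by (rule ht_Sig_below_inj[OF l(1,2)]) (use l(3) in \<open>metis restrict_apply'\<close>)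
  qed
  have "(\<Sum>l\<in>Sig_below N K. F (ht l)) = (\<Sum>f\<in>?r ` Sig_below N K. F f)"
    by (subst sum.reindex[OF inj]) (auto intro!: sum.cong cong)
  also have "\<dots> = (\<Sum>f\<in>PiE {-1..<K} (\<lambda>_. X). F f)"
  proof (rule sum.mono_neutral_left)
    show "finite (PiE {-1..<K} (\<lambda>_. X))" using X by (intro finite_PiE) auto
    have "ht l k \<in> X" if "l \<in> Sig_below N K" for l k
      using that ht_nonneg[of l k] ht_le_length[of l k] X by (force simp: Sig_below_def Sig_def)
    thus "?r ` Sig_below N K \<subseteq> PiE {-1..<K} (\<lambda>_. X)" by auto
    show "\<forall>f\<in>PiE {-1..<K} (\<lambda>_. X) - ?r ` Sig_below N K. F f = 0"
    proof (rule ballI, rule ccontr)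
      fix f assume f: "f \<in> PiE {-1..<K} (\<lambda>_. X) - ?r ` Sig_below N K" and "F f \<noteq> 0"
      hence f': "f (-1) = int N" "\<And>k. k \<in> {0..<K} \<Longrightarrow> f k \<le> f (k - 1)" "f (K - 1) = 0"
        using nz[of f] by auto
      define g where "g k = (if k < 0 then int N else if k < K then f k else 0)" for k
      have g1: "g (k + 1) \<le> g k" for k
        using f'(2)[of "k + 1"] f' K by (cases "k = -1"; cases "k + 1 = K") (auto simp: g_def)
      have g_hi: "g k = 0" if "K - 1 \<le> k" for k
        using that f'(3) K by (cases "k = K - 1") (auto simp: g_def)
      obtain l where l: "l \<in> Sig N" "\<And>k. ht l k = g k"
      proof (rule Sig_exists[of g 0 N "K - 1"])
        show "g (k + 1) \<le> g k" for k by (rule g1)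
        show "g k = int N" if "k < 0" for k using that by (simp add: g_def)
        show "g k = 0" if "K - 1 \<le> k" for k using that by (rule g_hi)
      qed blast
      have "\<forall>a\<in>set l. -1 < a"
        using l SigD(1)[OF l(1)] by (subst ht_eq_length_iff[symmetric]) (simp add: g_def)
      moreover have "\<forall>a\<in>set l. a \<le> K - 1"
        by (subst ht_eq_0_iff[symmetric]) (simp add: l g_hi)
      ultimately have "l \<in> Sig_below N K" using l(1) by (force simp: Sig_below_def)
      moreover have "?r l = f"
      proof
        fix k show "?r l k = f k"
          using f f'(1) by (cases "k = -1") (auto simp: l g_def restrict_def PiE_def extensional_def)
      qed
      ultimately show False using f by blast
    qed
  qed
  finally show ?thesis .
qed

subsection \<open>One-variable skew functions\<close>

text \<open>The factor of a single column. Primes denote the column to its left, so that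
  \<open>e' - e\<close> is the multiplicity of one value in \<eta>.\<close>

definition psi1 :: "real \<Rightarrow> int \<Rightarrow> int \<Rightarrow> int \<Rightarrow> int \<Rightarrow> real" where
  "psi1 t k' e' k e = (if k' = e' \<and> k = e + 1 then 1 - t ^ nat (e' - e) else 1)"

definition phi1 :: "real \<Rightarrow> int \<Rightarrow> int \<Rightarrow> int \<Rightarrow> int \<Rightarrow> real" where
  "phi1 t k' e' k e = (if k' = e' + 1 \<and> k = e then 1 - t ^ nat (k' - k) else 1)"

text \<open>Macdonald's coefficients \<open>\<psi>\<^bsub>\<kappa>/\<eta>\<^esub>(t)\<close> and \<open>\<phi>\<^bsub>\<kappa>/\<eta>\<^esub>(t)\<close>, as products over columns.\<close>

definition hl_psi :: "real \<Rightarrow> int list \<Rightarrow> int list \<Rightarrow> real" where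
  "hl_psi t \<kappa> \<eta> = (\<Prod>k | 0 < k \<and> ht \<kappa> (k - 1) = ht \<eta> (k - 1) \<and> ht \<kappa> k = ht \<eta> k + 1.
     1 - t ^ nat (ht \<eta> (k - 1) - ht \<eta> k))"

definition hl_phi :: "real \<Rightarrow> int list \<Rightarrow> int list \<Rightarrow> real" where
  "hl_phi t \<kappa> \<eta> = (\<Prod>k | 0 < k \<and> ht \<kappa> (k - 1) = ht \<eta> (k - 1) + 1 \<and> ht \<kappa> k = ht \<eta> k.
     1 - t ^ nat (ht \<kappa> (k - 1) - ht \<kappa> k))"

text \<open>The defining product leaves out column 0. Here the heights at \<open>-1\<close>, that is
  the lengths, differ, so the factor of column 0 is 1. For \<phi> the lengths agree, with the same
  effect.\<close>

lemma hl_psi_eq_prod: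
  assumes "\<And>k. K \<le> k \<Longrightarrow> ht \<kappa> k = 0" "ht \<kappa> (-1) \<noteq> ht \<eta> (-1)"
  shows "hl_psi t \<kappa> \<eta> = (\<Prod>k\<in>{0..<K}. psi1 t (ht \<kappa> (k - 1)) (ht \<eta> (k - 1)) (ht \<kappa> k) (ht \<eta> k))"
proof -
  have "k < K" if "ht \<kappa> k = ht \<eta> k + 1" for k
    using assms(1)[of k] ht_nonneg[of \<eta> k] that by (cases "k < K") auto
  note lt = this
  show ?thesis unfolding hl_psi_def
  proof (rule prod.mono_neutral_cong_left)
    show "{k. 0 < k \<and> ht \<kappa> (k - 1) = ht \<eta> (k - 1) \<and> ht \<kappa> k = ht \<eta> k + 1} \<subseteq> {0..<K}"
      using lt by (simp add: subset_iff)
    show "\<forall>k\<in>{0..<K} - {k. 0 < k \<and> ht \<kappa> (k - 1) = ht \<eta> (k - 1) \<and> ht \<kappa> k = ht \<eta> k + 1}.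
        psi1 t (ht \<kappa> (k - 1)) (ht \<eta> (k - 1)) (ht \<kappa> k) (ht \<eta> k) = 1"
    proof
      fix k assume "k \<in> {0..<K} - {k. 0 < k \<and> ht \<kappa> (k - 1) = ht \<eta> (k - 1) \<and> ht \<kappa> k = ht \<eta> k + 1}"
      thus "psi1 t (ht \<kappa> (k - 1)) (ht \<eta> (k - 1)) (ht \<kappa> k) (ht \<eta> k) = 1"
        using assms(2) by (cases "k = 0") (auto simp: psi1_def)
    qed
  qed (simp_all add: psi1_def)
qed

lemma hl_phi_eq_prod:
  assumes "\<And>k. K - 1 \<le> k \<Longrightarrow> ht \<kappa> k = 0" "ht \<kappa> (-1) = ht \<eta> (-1)"
  shows "hl_phi t \<kappa> \<eta> = (\<Prod>k\<in>{0..<K}. phi1 t (ht \<kappa> (k - 1)) (ht \<eta> (k - 1)) (ht \<kappa> k) (ht \<eta> k))"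
proof -
  have "k < K" if "ht \<kappa> (k - 1) = ht \<eta> (k - 1) + 1" for k
    using assms(1)[of "k - 1"] ht_nonneg[of \<eta> "k - 1"] that by (cases "k < K") auto
  note lt = this
  show ?thesis unfolding hl_phi_def
  proof (rule prod.mono_neutral_cong_left)
    show "{k. 0 < k \<and> ht \<kappa> (k - 1) = ht \<eta> (k - 1) + 1 \<and> ht \<kappa> k = ht \<eta> k} \<subseteq> {0..<K}"
      using lt by (simp add: subset_iff)
    show "\<forall>k\<in>{0..<K} - {k. 0 < k \<and> ht \<kappa> (k - 1) = ht \<eta> (k - 1) + 1 \<and> ht \<kappa> k = ht \<eta> k}.
        phi1 t (ht \<kappa> (k - 1)) (ht \<eta> (k - 1)) (ht \<kappa> k) (ht \<eta> k) = 1"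
    proof
      fix k assume "k \<in> {0..<K} - {k. 0 < k \<and> ht \<kappa> (k - 1) = ht \<eta> (k - 1) + 1 \<and> ht \<kappa> k = ht \<eta> k}"
      thus "phi1 t (ht \<kappa> (k - 1)) (ht \<eta> (k - 1)) (ht \<kappa> k) (ht \<eta> k) = 1"
        using assms(2) by (cases "k = 0") (auto simp: phi1_def)
    qed
  qed (simp_all add: phi1_def)
qed

subsection \<open>The sum over the south-west corner\<close>

text \<open>The total weight of all columns to the left of a column boundary, relative to the weight on
  the other side of the identity, depends only on the carry \<open>c\<close> and the last column.\<close>

definition left_weight :: "real \<Rightarrow> int \<Rightarrow> int \<Rightarrow> int \<Rightarrow> int \<Rightarrow> int \<Rightarrow> real" where
  "left_weight t l p q s c =
    (if c = 0 then (if s = q + 1 \<and> s = p + 1 then (if l = s - 2 then t else if l = s - 1 then 1 - t else 0)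
                    else of_bool (l = p + q - s))
     else if 0 < c then (1 - t) * of_bool (l = s - 1) else 0)"

lemma sum_two_points:
  fixes f :: "int \<Rightarrow> real"
  assumes "finite X" "a \<in> X" "b \<in> X" "a \<noteq> b" "\<And>x. x \<noteq> a \<Longrightarrow> x \<noteq> b \<Longrightarrow> f x = 0"
  shows "(\<Sum>x\<in>X. f x) = f a + f b"
proof -
  have "(\<Sum>x\<in>X. f x) = (\<Sum>x\<in>{a, b}. f x)"
    using assms by (intro sum.mono_neutral_right) auto
  thus ?thesis using assms(4) by simp
qed

lemma sum_one_point:
  fixes f :: "int \<Rightarrow> real"
  assumes "finite X" "a \<in> X" "\<And>x. x \<noteq> a \<Longrightarrow> f x = 0"
  shows "(\<Sum>x\<in>X. f x) = f a"
proof -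
  have "(\<Sum>x\<in>X. f x) = (\<Sum>x\<in>{a}. f x)"
    using assms by (intro sum.mono_neutral_right) auto
  thus ?thesis by simp
qed

text \<open>The transfer relation behind the local identity: summing out one column of \<lambda>
  reproduces \<open>left_weight\<close> one column further right. Given the other signatures,
  \<open>left_weight\<close> admits at most two values of \<open>l'\<close>, interlacing leaves six
  positions of \<open>p\<close>, \<open>q\<close>, \<open>l\<close> relative to \<open>s\<close>,
  and the difference \<open>s' - s\<close> is the only parameter left. The denominator of a zero- or
  one-box weight cancels against the \<psi> factor of the same column (\<open>z1\<close>,
  \<open>z2\<close>).\<close>

lemma left_weight_step:
  assumes t: "0 \<le> t" "t < 1"
    and X: "finite X" "s' - 2 \<in> X" "s' - 1 \<in> X" "p' + q' - s' \<in> X"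
    and d: "s = p \<or> s = p + 1" "s = q \<or> s = q + 1" "s' = p' \<or> s' = p' + 1" "s' = q' \<or> s' = q' + 1"
    and anti: "p \<le> p'" "q \<le> q'" "s \<le> s'"
  shows "(\<Sum>l'\<in>X. left_weight t l' p' q' s' c *
      (of_bool (p - l \<in> {0, 1} \<and> q - l \<in> {0, 1}) * psi1 t q' l' q l * phi1 t p' l' p l
        * col_weight t l' p' q' s' l p q s c)) =
    psi1 t s' p' s p * phi1 t s' q' s q * left_weight t l p q s (c + p + q - l - s)"
    (is "(\<Sum>l'\<in>X. left_weight t l' p' q' s' c * ?F l') = ?R")
proof -
  have pw: "1 - t ^ m \<noteq> 0" if "0 < m" for m
    using power_Suc_less_one[of t "m - 1"] t that by (cases "t = 0") (auto simp: power_0_left)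
  have z1: "(1 - t ^ m) * ((t - t ^ m) / (1 - t ^ m)) = t - t ^ m"
    and z2: "(1 - t ^ m) * (1 - (t - t ^ m) / (1 - t ^ m)) = 1 - t" if "0 < m" for m
    using pw[OF that] by (auto simp: field_simps)
  have six: "(p = s \<and> q = s \<and> l = s) \<or> (p = s \<and> q = s \<and> l = s - 1) \<or> (p = s - 1 \<and> q = s \<and> l = s - 1)
          \<or> (p = s \<and> q = s - 1 \<and> l = s - 1) \<or> (p = s - 1 \<and> q = s - 1 \<and> l = s - 1) \<or> (p = s - 1 \<and> q = s - 1 \<and> l = s - 2)"
    if "p - l \<in> {0, 1} \<and> q - l \<in> {0, 1}"
  proof -
    have "p = l \<or> p = l + 1" "q = l \<or> q = l + 1" using that by auto
    thus ?thesis using d(1,2) by presburger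
  qed
  show ?thesis
  proof (cases "c = 0 \<and> s' = q' + 1 \<and> s' = p' + 1")
    case True
    hence L: "(\<Sum>l'\<in>X. left_weight t l' p' q' s' c * ?F l') = t * ?F (s' - 2) + (1 - t) * ?F (s' - 1)"
      by (subst sum_two_points[OF X(1,2,3)]) (simp_all add: left_weight_def)
    have nat1: "nat (s' - s) = Suc (nat (s' - 1 - s))" if "s < s'" using that by simp
    have cases: "(p = s \<or> p = s - 1) \<and> (q = s \<or> q = s - 1) \<and> p' = s' - 1 \<and> q' = s' - 1" using True d by auto
    define D where "D = nat (s' - s)"
    have s': "s' = s + int D" using anti by (simp add: D_def)
    have nats: "nat (int D + 1) = Suc D" "nat (1 + int D) = Suc D" "nat (int D + 2) = Suc (Suc D)"
      "nat (2 + int D) = Suc (Suc D)" "nat (int D - 1) = D - 1" by auto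
    have zs: "(1 - t * t ^ m) * ((t - t * t ^ m) / (1 - t * t ^ m)) = t - t * t ^ m"
      "(1 - t * t ^ m) * (1 - (t - t * t ^ m) / (1 - t * t ^ m)) = 1 - t"  for m
      using z1[of "Suc m"] z2[of "Suc m"] by simp_all
    have c0: "c = 0" using True by simp
    have E: "p' = s + int D - 1" "q' = s + int D - 1" using cases s' by simp_all
    show ?thesis
    proof (cases "p - l \<in> {0, 1} \<and> q - l \<in> {0, 1}")
      case valid: True
      note six = six[OF valid]
      have D0: "D \<noteq> 0" if "p = s \<or> q = s" using that anti(1,2) E by auto
      show ?thesis
        unfolding L unfolding E s' c0 using six
      proof (elim disjE conjE, goal_cases)
        case 1
        then obtain D' where "D = Suc D'" using D0 not0_implies_Suc by blast
        moreover have "nat (1 + int D') = Suc D'" by simp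
        ultimately show ?case using 1
          by (simp add: psi1_def phi1_def col_weight_def zero_weight_def left_weight_def nats) (simp add: algebra_simps)
      qed (simp add: psi1_def phi1_def col_weight_def zero_weight_def left_weight_def nats zs; (simp add: algebra_simps)?)+
    next
      case False
      hence "left_weight t l p q s (c + p + q - l - s) = 0"
        using d(1,2) c0 by (auto simp: left_weight_def)
      moreover have "of_bool (p - l \<in> {0, 1} \<and> q - l \<in> {0, 1}) = (0 :: real)"
        using False by (simp only: of_bool_eq_0_iff not_False_eq_True)
      ultimately show ?thesis unfolding L by (simp only: mult_zero_left mult_zero_right add_0_left)
    qed
  next
    case not11: False
    define l0 where "l0 = (if c = 0 then p' + q' - s' else s' - 1)"
    have L: "(\<Sum>l'\<in>X. left_weight t l' p' q' s' c * ?F l') = left_weight t l0 p' q' s' c * ?F l0"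
      by (rule sum_one_point) (use X not11 in \<open>auto simp: left_weight_def l0_def\<close>)
    consider "c < 0" | "c > 0" | "c = 0" by linarith
    thus ?thesis
    proof cases
      case 1
      hence "left_weight t l0 p' q' s' c = 0" by (simp add: left_weight_def)
      moreover have "left_weight t l p q s (c + p + q - l - s) = 0"
        using 1 d by (auto simp: left_weight_def)
      ultimately show ?thesis unfolding L by simp
    next
      case 2
      show ?thesis
      proof (cases "l = s - 1")
        case True
        have "left_weight t l p q s (c + p + q - l - s) = 1 - t"
          using 2 d True by (auto simp: left_weight_def)
        moreover have "psi1 t q' l0 q l = phi1 t s' q' s q" "phi1 t p' l0 p l = psi1 t s' p' s p"
          using 2 d True by (auto simp: psi1_def phi1_def l0_def)
        moreover have "left_weight t l0 p' q' s' c = 1 - t" using 2 by (simp add: left_weight_def l0_def)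
        moreover have "p - l \<in> {0, 1} \<and> q - l \<in> {0, 1}" using d True by auto
        ultimately show ?thesis unfolding L using 2 True by (simp add: col_weight_def)
      next
        case False
        hence "left_weight t l p q s (c + p + q - l - s) = 0"
          using 2 d by (auto simp: left_weight_def)
        thus ?thesis unfolding L using 2 False by (simp add: col_weight_def)
      qed
    next
      case 3
      define D where "D = nat (s' - s)"
      have s': "s' = s + int D" using anti by (simp add: D_def)
      have nats: "nat (int D + 1) = Suc D" "nat (1 + int D) = Suc D" "nat (int D + 2) = Suc (Suc D)"
        "nat (2 + int D) = Suc (Suc D)" "nat (int D - 1) = D - 1" by auto
      have zs: "(1 - t * t ^ m) * ((t - t * t ^ m) / (1 - t * t ^ m)) = t - t * t ^ m"
        "(1 - t * t ^ m) * (1 - (t - t * t ^ m) / (1 - t * t ^ m)) = 1 - t"  for m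
        using z1[of "Suc m"] z2[of "Suc m"] by simp_all
      have l0: "l0 = p' + q' - s'" using 3 by (simp add: l0_def)
      have lw: "left_weight t l0 p' q' s' c = 1" using 3 not11 d by (auto simp: left_weight_def l0)
      have cs: "(p' = s + int D \<and> q' = s + int D) \<or> (p' = s + int D - 1 \<and> q' = s + int D) \<or> (p' = s + int D \<and> q' = s + int D - 1)"
      proof -
        have "p' = s + int D \<or> p' = s + int D - 1" "q' = s + int D \<or> q' = s + int D - 1"
          using d(3,4) unfolding s' by linarith+
        moreover have "\<not> (p' = s + int D - 1 \<and> q' = s + int D - 1)"
        proof
          assume "p' = s + int D - 1 \<and> q' = s + int D - 1"
          hence "s' = q' + 1" "s' = p' + 1" using s' by linarith+
          thus False using not11 3 by blast
        qed
        ultimately show ?thesis by blast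
      qed
      have "?F l0 = ?R"
      proof (cases "p - l \<in> {0, 1} \<and> q - l \<in> {0, 1}")
        case True
        show ?thesis
          unfolding l0 s' \<open>c = 0\<close> using six[OF True] cs anti(1,2)
        proof (elim disjE conjE, goal_cases)
          case 8
          have "(1 - t * (t * t ^ D)) * ((t - t * (t * t ^ D)) / (1 - t * (t * t ^ D))) = t - t * (t * t ^ D)"
            using z1[of "Suc (Suc D)"] by simp
          with 8 show ?case
            by (simp add: psi1_def phi1_def col_weight_def zero_weight_def left_weight_def nats del: times_divide_eq_right)
              (simp add: algebra_simps)
        qed (simp add: psi1_def phi1_def col_weight_def zero_weight_def left_weight_def nats zs)+
      next
        case False
        hence "left_weight t l p q s (c + p + q - l - s) = 0"
          using d(1,2) 3 by (auto simp: left_weight_def)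
        moreover have "of_bool (p - l \<in> {0, 1} \<and> q - l \<in> {0, 1}) = (0 :: real)"
          using False by (simp only: of_bool_eq_0_iff not_False_eq_True)
        ultimately show ?thesis by (simp only: mult_zero_left mult_zero_right)
      qed
      thus ?thesis unfolding L lw by simp
    qed
  qed
qed

text \<open>The heights of \<lambda> are summed out from the left. The carry is written as a sum
  over the columns to the right, so it does not involve heights already removed. At the last column
  everything is 0 and the remaining sum is 1.\<close>

lemma backward_sum:
  fixes p q s :: "int \<Rightarrow> int" and K :: int
  assumes t: "0 \<le> t" "t < 1" and X: "finite X" "\<And>k. k \<in> {-1..<K} \<Longrightarrow> {s k - 2, s k - 1, p k + q k - s k} \<subseteq> X"
    and K: "0 < K"
    and d: "\<And>k. s k = p k \<or> s k = p k + 1" "\<And>k. s k = q k \<or> s k = q k + 1"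
    and anti: "\<And>k. p k \<le> p (k - 1)" "\<And>k. q k \<le> q (k - 1)" "\<And>k. s k \<le> s (k - 1)"
    and fin: "p (K - 1) = 0" "q (K - 1) = 0" "s (K - 1) = 0" "0 \<in> X"
  defines "c \<equiv> \<lambda>l k. \<Sum>k'\<in>{k..<K}. l k' + s k' - p k' - q k'"
  defines "F \<equiv> \<lambda>l k. of_bool (p k - l k \<in> {0, 1} \<and> q k - l k \<in> {0, 1}) * psi1 t (q (k - 1)) (l (k - 1)) (q k) (l k)
      * phi1 t (p (k - 1)) (l (k - 1)) (p k) (l k)
      * col_weight t (l (k - 1)) (p (k - 1)) (q (k - 1)) (s (k - 1)) (l k) (p k) (q k) (s k) (c l k)"
  shows "(\<Sum>l\<in>PiE {-1..<K} (\<lambda>_. X). left_weight t (l (-1)) (p (-1)) (q (-1)) (s (-1)) (c l 0) * (\<Prod>k\<in>{0..<K}. F l k)) =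
    (\<Prod>k\<in>{0..<K}. psi1 t (s (k - 1)) (p (k - 1)) (s k) (p k) * phi1 t (s (k - 1)) (q (k - 1)) (s k) (q k))"
proof -
  define T where "T k = psi1 t (s (k - 1)) (p (k - 1)) (s k) (p k) * phi1 t (s (k - 1)) (q (k - 1)) (s k) (q k)" for k
  define G where "G l j = left_weight t (l j) (p j) (q j) (s j) (c l (j + 1))" for l :: "int \<Rightarrow> int" and j
  have c_cong: "c l k = c l' k" if "\<And>k'. k \<le> k' \<Longrightarrow> l k' = l' k'" for l l' k
    unfolding c_def using that by (intro sum.cong) auto
  have c_Suc: "c l j = l j + s j - p j - q j + c l (j + 1)" if "j < K" for l j
  proof -
    have "{j..<K} = insert j {j + 1..<K}" using that by auto
    thus ?thesis by (simp add: c_def)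
  qed
  have F_cong: "F l k = F l' k" if "\<And>k'. k - 1 \<le> k' \<Longrightarrow> l k' = l' k'" for l l' k
    unfolding F_def using that c_cong[of k l l'] by simp
  define S where "S j = (\<Sum>l\<in>PiE {j..<K} (\<lambda>_. X). G l j * (\<Prod>k\<in>{j + 1..<K}. F l k))" for j
  have step: "S j = T (j + 1) * S (j + 1)" if j: "-1 \<le> j" "j < K - 1" for j
  proof -
    have ins: "{j..<K} = insert j {j + 1..<K}" and ins': "{j + 1..<K} = insert (j + 1) {j + 2..<K}"
      using j by auto
    have "S j = (\<Sum>l\<in>PiE {j + 1..<K} (\<lambda>_. X). \<Sum>y\<in>X. G (l(j := y)) j * (\<Prod>k\<in>{j + 1..<K}. F (l(j := y)) k))"
      unfolding S_def ins by (rule sum_PiE_insert) simp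
    also have "\<dots> = (\<Sum>l\<in>PiE {j + 1..<K} (\<lambda>_. X). T (j + 1) * (G l (j + 1) * (\<Prod>k\<in>{j + 2..<K}. F l k)))"
    proof (intro sum.cong refl)
      fix l :: "int \<Rightarrow> int"
      have prod: "(\<Prod>k\<in>{j + 1..<K}. F (l(j := y)) k) = F (l(j := y)) (j + 1) * (\<Prod>k\<in>{j + 2..<K}. F l k)" for y
      proof -
        have "(\<Prod>k\<in>{j + 2..<K}. F (l(j := y)) k) = (\<Prod>k\<in>{j + 2..<K}. F l k)"
          by (intro prod.cong refl F_cong) auto
        thus ?thesis unfolding ins' by simp
      qed
      have cu: "c (l(j := y)) (j + 1) = c l (j + 1)" for y by (rule c_cong) simp
      have cn: "c l (j + 1) + p (j + 1) + q (j + 1) - l (j + 1) - s (j + 1) = c l (j + 1 + 1)"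
        using c_Suc[of "j + 1" l] j by simp
      have "(\<Sum>y\<in>X. G (l(j := y)) j * F (l(j := y)) (j + 1)) = T (j + 1) * G l (j + 1)"
        using left_weight_step[OF t X(1) _ _ _ d(1)[of "j + 1"] d(2)[of "j + 1"] d(1)[of j] d(2)[of j],
            of "c l (j + 1)" "l (j + 1)"] X(2)[of j] anti[of "j + 1"] j
        unfolding G_def F_def T_def cu cn[symmetric] by simp
      thus "(\<Sum>y\<in>X. G (l(j := y)) j * (\<Prod>k\<in>{j + 1..<K}. F (l(j := y)) k)) =
        T (j + 1) * (G l (j + 1) * (\<Prod>k\<in>{j + 2..<K}. F l k))"
        unfolding prod by (simp add: mult.assoc[symmetric] sum_distrib_right[symmetric])
    qed
    also have "\<dots> = T (j + 1) * S (j + 1)"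
    proof -
      have "{j + 2..<K} = {j + 1 + 1..<K}" by (simp add: add.commute)
      thus ?thesis unfolding S_def by (simp only: sum_distrib_left)
    qed
    finally show ?thesis .
  qed
  have all: "S (-1) = (\<Prod>k\<in>{0..<j + 1}. T k) * S j" if "-1 \<le> j" "j \<le> K - 1" for j
    using that
  proof (induction j rule: int_ge_induct)
    case (step j)
    have "{0..<j + 1 + 1} = insert (j + 1) {0..<j + 1}" using step.hyps by auto
    thus ?case using step \<open>\<And>j. -1 \<le> j \<Longrightarrow> j < K - 1 \<Longrightarrow> S j = T (j + 1) * S (j + 1)\<close>[of j] by simp
  qed simp
  have "S (K - 1) = (\<Sum>l\<in>PiE {K - 1} (\<lambda>_. X). of_bool (l (K - 1) = 0))"
  proof -
    have "{K - 1..<K} = {K - 1}" "{K..<K} = {}" by auto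
    thus ?thesis unfolding S_def G_def using fin by (simp add: c_def left_weight_def)
  qed
  also have "\<dots> = (\<Sum>f\<in>PiE {} (\<lambda>_. X). \<Sum>y\<in>X. of_bool ((f(K - 1 := y)) (K - 1) = 0))"
    by (rule sum_PiE_insert) simp
  also have "\<dots> = 1" using X fin by (simp add: sum_one_point)
  finally have "S (K - 1) = 1" .
  hence "S (-1) = (\<Prod>k\<in>{0..<K}. T k)" using all[of "K - 1"] K by simp
  thus ?thesis by (simp add: S_def G_def T_def)
qed

text \<open>Here the columns are removed from the right and the carry is counted from the left.
  Given the earlier columns, the weight of the last one sums to 1 over its height: it is a point
  mass, or the two complementary values of a free crossing.\<close>

lemma forward_sum:
  fixes l p q :: "int \<Rightarrow> int" and K r :: int
  assumes X: "finite X" "s0 \<in> X" "\<And>k. {l k + 1, l k + 2, p k + q k - l k} \<subseteq> X" and K: "0 \<le> K"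
  defines "c \<equiv> \<lambda>s k. r + (\<Sum>k'\<in>{0..<k}. p k' + q k' - l k' - s k')"
  shows "(\<Sum>s\<in>PiE {-1..<K} (\<lambda>_. X). of_bool (s (-1) = s0) * (\<Prod>k\<in>{0..<K}.
    col_weight t (l (k - 1)) (p (k - 1)) (q (k - 1)) (s (k - 1)) (l k) (p k) (q k) (s k) (c s k))) = 1"
  using K
proof (induction K rule: int_ge_induct)
  case base
  have e: "{-1..<0 :: int} = insert (-1) {}" by auto
  show ?case unfolding e by (subst sum_PiE_insert) (use X in \<open>simp_all add: sum_one_point\<close>)
next
  case (step K)
  define F where "F s k = col_weight t (l (k - 1)) (p (k - 1)) (q (k - 1)) (s (k - 1)) (l k) (p k) (q k) (s k) (c s k)" for s k
  have c_cong: "c s k = c s' k" if "\<And>k'. k' < k \<Longrightarrow> s k' = s' k'" for s s' k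
    unfolding c_def using that by (intro arg_cong2[where f = "(+)"] sum.cong) auto
  have F_cong: "F s k = F s' k" if "\<And>k'. k' \<le> k \<Longrightarrow> s k' = s' k'" for s s' k
    unfolding F_def using that c_cong[of k s s'] by simp
  have ins: "{-1..<K + 1} = insert K {-1..<K}" "{0..<K + 1} = insert K {0..<K}" using step.hyps by auto
  have "(\<Sum>s\<in>PiE {-1..<K + 1} (\<lambda>_. X). of_bool (s (-1) = s0) * (\<Prod>k\<in>{0..<K + 1}. F s k)) =
    (\<Sum>s\<in>PiE {-1..<K} (\<lambda>_. X). \<Sum>y\<in>X. of_bool ((s(K := y)) (-1) = s0) * (\<Prod>k\<in>{0..<K + 1}. F (s(K := y)) k))"
    unfolding ins(1) by (rule sum_PiE_insert) simp
  also have "\<dots> = (\<Sum>s\<in>PiE {-1..<K} (\<lambda>_. X). of_bool (s (-1) = s0) * (\<Prod>k\<in>{0..<K}. F s k))"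
  proof (intro sum.cong refl)
    fix s :: "int \<Rightarrow> int"
    have "(\<Prod>k\<in>{0..<K + 1}. F (s(K := y)) k) = F (s(K := y)) K * (\<Prod>k\<in>{0..<K}. F s k)" for y
    proof -
      have "(\<Prod>k\<in>{0..<K}. F (s(K := y)) k) = (\<Prod>k\<in>{0..<K}. F s k)"
        by (intro prod.cong refl F_cong) auto
      thus ?thesis unfolding ins(2) by simp
    qed
    moreover have "(\<Sum>y\<in>X. F (s(K := y)) K) = 1"
    proof -
      have c: "c (s(K := y)) K = c s K" for y by (rule c_cong) simp
      let ?z = "zero_weight t (l (K - 1)) (p (K - 1)) (q (K - 1)) (s (K - 1)) (l K)"
      show ?thesis
      proof (cases "c s K = 0 \<and> p K = l K + 1 \<and> q K = l K + 1")
        case True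
        hence "F (s(K := y)) K = (if y = l K + 2 then ?z else if y = l K + 1 then 1 - ?z else 0)" for y
          unfolding F_def c by (simp add: col_weight_def)
        moreover have "l K + 2 \<in> X" "l K + 1 \<in> X" using X(3)[of K] by auto
        ultimately show ?thesis by (simp add: sum_two_points[OF X(1), of "l K + 2" "l K + 1"])
      next
        case False
        hence "F (s(K := y)) K = of_bool (y = (if c s K = 0 then p K + q K - l K else l K + 1))" for y
          unfolding F_def c by (auto simp: col_weight_def)
        moreover have "(if c s K = 0 then p K + q K - l K else l K + 1) \<in> X" using X(3)[of K] by auto
        ultimately show ?thesis
          by (simp only:) (subst sum_one_point[OF X(1)]; simp)
      qed
    qed
    ultimately show "(\<Sum>y\<in>X. of_bool ((s(K := y)) (-1) = s0) * (\<Prod>k\<in>{0..<K + 1}. F (s(K := y)) k)) =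
      of_bool (s (-1) = s0) * (\<Prod>k\<in>{0..<K}. F s k)"
      using step.hyps by (simp add: mult.assoc[symmetric] flip: sum_distrib_left sum_distrib_right)
  qed
  also have "\<dots> = 1" using step.IH by (simp add: F_def)
  finally show ?case by (simp add: F_def)
qed

text \<open>Only a zero-box could raise \<rho> above the column to its left. That requires
  \<open>l' = l + 1\<close>, so a single particle of \<lambda> occupies the position, and the weight
  \<open>(t - t^1) / (1 - t^1)\<close> is 0. This is what makes functions that are not heights drop
  out of the sum over \<rho>.\<close>

lemma col_weight_antimono:
  assumes anti: "p \<le> p'" "q \<le> q'" "l \<le> l'"
    and d: "p = l \<or> p = l + 1" "q = l \<or> q = l + 1" "p' = l' \<or> p' = l' + 1" "q' = l' \<or> q' = l' + 1"
    and prev: "if c' = 0 \<and> p' = l' + 1 \<and> q' = l' + 1 then s' \<in> {l' + 1, l' + 2}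
      else if c' = 0 then s' + l' = p' + q' else s' = l' + 1" and c: "0 \<le> c'" "c = c' + p' + q' - l' - s'"
    and W: "col_weight t l' p' q' s' l p q s c \<noteq> 0"
  shows "s \<le> s'"
proof (rule ccontr)
  assume "\<not> s \<le> s'"
  hence lt: "s' < s" by simp
  have r: "if c = 0 \<and> p = l + 1 \<and> q = l + 1 then s \<in> {l + 1, l + 2}
    else if c = 0 then s + l = p + q else s = l + 1"
    by (rule col_weight_nonzero[OF W])
  have "c = 0 \<and> p = l + 1 \<and> q = l + 1 \<and> s = l + 2"
    using r lt anti d prev c by (auto split: if_splits)
  moreover have "zero_weight t l' p' q' s' l = 0"
  proof -
    have "l' = l + 1" if "s' \<noteq> q' + 1" "s' \<noteq> p' + 1"
      using calculation lt anti d prev c that by (auto split: if_splits)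
    thus ?thesis using calculation lt anti d prev c by (auto simp: zero_weight_def split: if_splits)
  qed
  ultimately show False using W by (simp add: col_weight_def)
qed

subsection \<open>Local identities for the transition weights\<close>

text \<open>The auxiliary coordinates come last, so dropping them preserves the inequalities for the
  others. The size balance shows that the four signatures determine the input.\<close>

lemma hl_U_input_nonzeroD:
  assumes "hl_U_input t r \<mu> \<rho> la \<nu> \<noteq> 0" "length la = N" "length \<nu> = N"
  shows "interlace la \<mu>" "interlace la \<nu>" "interlace \<mu> \<rho>" "interlace \<nu> \<rho>"
    "\<mu> \<in> Sig (Suc N)" "\<rho> \<in> Sig (Suc N)" "la \<in> Sig N" "\<nu> \<in> Sig N"
    "sum_list \<nu> - sum_list la + int r = sum_list \<rho> - sum_list \<mu>"
proof -
  define w where "w = (SOME w. \<forall>a\<in>set \<mu> \<union> set \<nu>. w < a)"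
  define lt nt where "lt = la @ [w - int r]" and "nt = \<nu> @ [w]"
  have "hl_U t \<mu> \<rho> lt nt \<noteq> 0"
    using assms by (simp add: hl_U_input_def w_def[symmetric] Let_def lt_def nt_def)
  hence *: "{lt, \<mu>, nt, \<rho>} \<subseteq> Sig (Suc N)" "interlace lt \<mu>" "interlace \<mu> \<rho>" "interlace lt nt" "interlace nt \<rho>"
    "sum_list nt - sum_list lt = sum_list \<rho> - sum_list \<mu>"
    using assms unfolding hl_U_def Let_def by (auto simp: lt_def split: if_splits)
  show "interlace \<mu> \<rho>" "\<mu> \<in> Sig (Suc N)" "\<rho> \<in> Sig (Suc N)" using * by auto
  show "la \<in> Sig N" "\<nu> \<in> Sig N"
    using *(1) assms by (auto simp: Sig_def lt_def nt_def sorted_wrt_append)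
  have len: "length \<mu> = Suc N" "length \<rho> = Suc N" using * by (auto simp: Sig_def)
  have nth: "lt ! i = la ! i" "nt ! i = \<nu> ! i" if "i < N" for i
    using that assms by (auto simp: lt_def nt_def nth_append)
  have lens: "length lt = Suc N" "length nt = Suc N" using assms by (auto simp: lt_def nt_def)
  have A: "\<forall>i<Suc N. lt ! i \<le> \<mu> ! i" "\<forall>i<N. \<mu> ! Suc i \<le> lt ! i"
    "\<forall>i<Suc N. lt ! i \<le> nt ! i" "\<forall>i<N. nt ! Suc i \<le> lt ! i"
    "\<forall>i<Suc N. nt ! i \<le> \<rho> ! i" "\<forall>i<N. \<rho> ! Suc i \<le> nt ! i"
    using *(2,4,5) lens len by (auto simp: interlace_def)
  have B: "la ! i \<le> \<mu> ! i" "\<mu> ! Suc i \<le> la ! i" "la ! i \<le> \<nu> ! i"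
    "\<nu> ! i \<le> \<rho> ! i" "\<rho> ! Suc i \<le> \<nu> ! i" if "i < N" for i
    using A[rule_format, of i] nth[OF that] that by simp_all
  have C: "\<nu> ! Suc i \<le> la ! i" if "Suc i < N" for i
    using A(4)[rule_format, of i] nth[of i] nth[of "Suc i"] that by simp
  show "interlace la \<mu>" "interlace la \<nu>" "interlace \<nu> \<rho>"
    using B C assms(2,3) len by (auto simp: interlace_def)
  show "sum_list \<nu> - sum_list la + int r = sum_list \<rho> - sum_list \<mu>"
    using *(6) by (simp add: lt_def nt_def)
qed

text \<open>A column lowers the carry by at most one, and only if the carry is positive.\<close>

lemma carry_nonneg:
  fixes l p q s c :: "int \<Rightarrow> int"
  assumes c0: "0 \<le> c 0" and c: "\<And>k. 0 \<le> k \<Longrightarrow> k < K \<Longrightarrow> c (k + 1) = c k + p k + q k - l k - s k"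
    and d: "\<And>k. 0 \<le> k \<Longrightarrow> k < K \<Longrightarrow> l k \<le> p k \<and> p k \<le> l k + 1 \<and> l k \<le> q k \<and> q k \<le> l k + 1"
    and rule: "\<And>k. 0 \<le> k \<Longrightarrow> k < K \<Longrightarrow> (if c k = 0 \<and> p k = l k + 1 \<and> q k = l k + 1
      then s k \<in> {l k + 1, l k + 2} else if c k = 0 then s k + l k = p k + q k else s k = l k + 1)"
    and k: "0 \<le> k" "k \<le> K"
  shows "0 \<le> c k"
  using k
proof (induction k rule: int_ge_induct)
  case (step k)
  have "0 \<le> c k" using step by simp
  thus ?case using c[of k] d[of k] rule[of k] step by (auto split: if_splits)
qed (rule c0)

lemma sum_list_Sig_below:
  assumes "l \<in> Sig_below N K" "0 \<le> K"
  shows "sum_list l = (\<Sum>k\<in>{0..<K}. ht l k)"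
  using assms sum_list_ht[of l 0 K] by (auto simp: Sig_below_def less_imp_le)

text \<open>The skew Cauchy identity for one variable on each side, refined by the transition weights.\<close>

lemma local_identity:
  assumes t: "0 \<le> t" "t < 1"
    and S: "\<nu> \<in> Sig_below N K" "\<mu> \<in> Sig_below (Suc N) K" "\<rho> \<in> Sig_below (Suc N) K" and K: "0 < K"
    and il: "interlace \<mu> \<rho>" "interlace \<nu> \<rho>"
  shows "(\<Sum>la\<in>Sig_below N K. of_bool (interlace la \<mu> \<and> interlace la \<nu>) * hl_psi t \<mu> la * hl_phi t \<nu> la *
      (let d = sum_list \<rho> + sum_list la - sum_list \<mu> - sum_list \<nu>
       in if d < 0 then 0 else (1 - (if 1 \<le> d then t else 0)) * hl_U_input t (nat d) \<mu> \<rho> la \<nu>)) =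
    hl_psi t \<rho> \<nu> * hl_phi t \<rho> \<mu>"
proof -
  define p q s where "p = ht \<nu>" and "q = ht \<mu>" and "s = ht \<rho>"
  note defs = p_def q_def s_def
  have Sig: "\<nu> \<in> Sig N" "\<mu> \<in> Sig (Suc N)" "\<rho> \<in> Sig (Suc N)" using S by (auto simp: Sig_below_def)
  have bd: "a < K" "0 \<le> a" if "a \<in> set \<nu> \<union> set \<mu> \<union> set \<rho>" for a using S that by (auto simp: Sig_below_def)
  have lo: "p k = int N" "q k = int N + 1" "s k = int N + 1" if "k < 0" for k
    using ht_Sig_below(1)[OF S(1) that] ht_Sig_below(1)[OF S(2) that] ht_Sig_below(1)[OF S(3) that]
    by (auto simp: defs)
  have hi: "p k = 0" "q k = 0" "s k = 0" if "K - 1 \<le> k" for k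
    using ht_Sig_below(2)[OF S(1) that] ht_Sig_below(2)[OF S(2) that] ht_Sig_below(2)[OF S(3) that]
    by (auto simp: defs)
  have d: "s k = p k \<or> s k = p k + 1" "s k = q k \<or> s k = q k + 1" for k
  proof -
    have "p k \<le> s k \<and> s k \<le> p k + 1" "q k \<le> s k \<and> s k \<le> q k + 1"
      using il unfolding interlace_iff_ht[OF Sig(2,3) disjI1[OF refl]]
        interlace_iff_ht[OF Sig(1,3) disjI2[OF refl]] defs by blast+
    thus "s k = p k \<or> s k = p k + 1" "s k = q k \<or> s k = q k + 1" by linarith+
  qed
  have anti: "p k \<le> p (k - 1)" "q k \<le> q (k - 1)" "s k \<le> s (k - 1)" for k
    by (auto simp: defs ht_antimono)
  define c where "c l k = (\<Sum>k'\<in>{k..<K}. l k' + s k' - p k' - q k')" for l :: "int \<Rightarrow> int" and k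
  define F where "F l k = of_bool (p k - l k \<in> {0, 1} \<and> q k - l k \<in> {0, 1}) * psi1 t (q (k - 1)) (l (k - 1)) (q k) (l k)
      * phi1 t (p (k - 1)) (l (k - 1)) (p k) (l k)
      * col_weight t (l (k - 1)) (p (k - 1)) (q (k - 1)) (s (k - 1)) (l k) (p k) (q k) (s k) (c l k)" for l k
  define FF where "FF l = left_weight t (l (-1)) (p (-1)) (q (-1)) (s (-1)) (c l 0) * (\<Prod>k\<in>{0..<K}. F l k)" for l
  define X where "X = {-2..int N + 2 + int N + 2}"
  have sN: "0 \<le> s k" "s k \<le> int N + 1" "0 \<le> p k" "p k \<le> int N" "0 \<le> q k" "q k \<le> int N + 1" for k
    using ht_nonneg ht_le_length[of _ k] Sig unfolding defs Sig_def by (auto simp: order.trans)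
      (metis (mono_tags, lifting) of_nat_Suc add.commute ht_le_length mem_Collect_eq)+
  have "(\<Sum>l\<in>PiE {-1..<K} (\<lambda>_. X). FF l) =
    (\<Prod>k\<in>{0..<K}. psi1 t (s (k - 1)) (p (k - 1)) (s k) (p k) * phi1 t (s (k - 1)) (q (k - 1)) (s k) (q k))"
    unfolding FF_def F_def c_def
  proof (rule backward_sum[OF t])
    show "{s k - 2, s k - 1, p k + q k - s k} \<subseteq> X" for k
      using sN[of k] d[of k] by (auto simp: X_def)
    show "p (K - 1) = 0" "q (K - 1) = 0" "s (K - 1) = 0" using hi by simp_all
  qed (use K d anti in \<open>auto simp: X_def\<close>)
  also have "\<dots> = hl_psi t \<rho> \<nu> * hl_phi t \<rho> \<mu>"
  proof -
    have "hl_psi t \<rho> \<nu> = (\<Prod>k\<in>{0..<K}. psi1 t (s (k - 1)) (p (k - 1)) (s k) (p k))"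
      unfolding defs by (rule hl_psi_eq_prod) (use hi lo in \<open>simp_all add: defs\<close>)
    moreover have "hl_phi t \<rho> \<mu> = (\<Prod>k\<in>{0..<K}. phi1 t (s (k - 1)) (q (k - 1)) (s k) (q k))"
      unfolding defs by (rule hl_phi_eq_prod) (use hi lo in \<open>simp_all add: defs\<close>)
    ultimately show ?thesis by (simp add: prod.distrib)
  qed
  finally have total: "(\<Sum>l\<in>PiE {-1..<K} (\<lambda>_. X). FF l) = hl_psi t \<rho> \<nu> * hl_phi t \<rho> \<mu>" .
  have c_Suc: "c l (k + 1) = c l k + p k + q k - l k - s k" if "k < K" for l k
  proof -
    have "{k..<K} = insert k {k + 1..<K}" using that by auto
    thus ?thesis by (simp add: c_def)
  qed
  have "(\<Sum>la\<in>Sig_below N K. FF (ht la)) = (\<Sum>l\<in>PiE {-1..<K} (\<lambda>_. X). FF l)"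
  proof (rule sum_Sig_below[OF K])
    show "{0..int N} \<subseteq> X" "finite X" by (auto simp: X_def)
    show "FF f = FF g" if "\<And>k. k \<in> {-1..<K} \<Longrightarrow> f k = g k" for f g
    proof -
      have cfg: "c f k = c g k" if "0 \<le> k" for k
        unfolding c_def using that \<open>\<And>k. k \<in> {-1..<K} \<Longrightarrow> f k = g k\<close> by (intro sum.cong) auto
      have "F f k = F g k" if "k \<in> {0..<K}" for k
        unfolding F_def using that cfg[of k] \<open>\<And>k. k \<in> {-1..<K} \<Longrightarrow> f k = g k\<close> by simp
      thus ?thesis unfolding FF_def using that K cfg[of 0] by simp
    qed
    fix f assume nz: "FF f \<noteq> 0"
    have Fnz: "F f k \<noteq> 0" if "k \<in> {0..<K}" for k
      using nz that unfolding FF_def by (auto simp: prod_zero_iff)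
    have lnz: "left_weight t (f (-1)) (p (-1)) (q (-1)) (s (-1)) (c f 0) \<noteq> 0"
      using nz unfolding FF_def by auto
    have f1: "f (-1) = int N" and cf0: "0 \<le> c f 0"
      using lnz lo[of "-1"] by (auto simp: left_weight_def split: if_splits)
    have val: "f k \<le> p k \<and> p k \<le> f k + 1 \<and> f k \<le> q k \<and> q k \<le> f k + 1" if "0 \<le> k" "k < K" for k
      using Fnz[of k] that unfolding F_def by auto
    have "0 \<le> c f (K - 1)"
    proof (rule carry_nonneg[where c = "c f" and p = p and q = q and l = f and s = s and K = "K - 1"])
      show "0 \<le> c f 0" by (rule cf0)
      show "f k \<le> p k \<and> p k \<le> f k + 1 \<and> f k \<le> q k \<and> q k \<le> f k + 1" if "0 \<le> k" "k < K - 1" for k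
        using val that by simp
      show "if c f k = 0 \<and> p k = f k + 1 \<and> q k = f k + 1 then s k \<in> {f k + 1, f k + 2}
        else if c f k = 0 then s k + f k = p k + q k else s k = f k + 1" if "0 \<le> k" "k < K - 1" for k
      proof -
        have "col_weight t (f (k - 1)) (p (k - 1)) (q (k - 1)) (s (k - 1)) (f k) (p k) (q k) (s k) (c f k) \<noteq> 0"
          using Fnz[of k] that unfolding F_def by simp
        thus ?thesis by (rule col_weight_nonzero)
      qed
      show "c f (k + 1) = c f k + p k + q k - f k - s k" if "0 \<le> k" "k < K - 1" for k
        using c_Suc that by simp
    qed (use K in auto)
    \<comment> \<open>\<nu>, \<mu> and \<rho> are empty in the last column, so the carry into it is
      the height of \<lambda> there. It is non-negative as a carry and at most 0 by
      interlacing.\<close>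
    moreover have "c f (K - 1) = f (K - 1)"
      using c_Suc[of "K - 1" f] hi[of "K - 1"] by (simp add: c_def)
    ultimately have "f (K - 1) = 0" using val[of "K - 1"] hi[of "K - 1"] K by simp
    \<comment> \<open>An increase of \<lambda> would give \<open>phi1\<close> the value
      \<open>1 - t^0 = 0\<close>.\<close>
    moreover have "f k \<le> f (k - 1)" if "k \<in> {0..<K}" for k
    proof (rule ccontr)
      assume gt: "\<not> f k \<le> f (k - 1)"
      have "p (k - 1) \<le> f (k - 1) + 1"
        using val[of "k - 1"] f1 lo[of "-1"] that by (cases "k = 0") auto
      hence "p (k - 1) = f (k - 1) + 1" "p k = f k" "p (k - 1) = p k"
        using gt val[of k] anti(1)[of k] that by auto
      hence "phi1 t (p (k - 1)) (f (k - 1)) (p k) (f k) = 0" by (simp add: phi1_def)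
      thus False using Fnz[OF that] by (simp add: F_def)
    qed
    ultimately show "f (-1) = int N \<and> (\<forall>k\<in>{0..<K}. f k \<le> f (k - 1)) \<and> f (K - 1) = 0"
      using f1 by simp
  qed
  moreover have "FF (ht la) = of_bool (interlace la \<mu> \<and> interlace la \<nu>) * hl_psi t \<mu> la * hl_phi t \<nu> la *
      (let d = sum_list \<rho> + sum_list la - sum_list \<mu> - sum_list \<nu>
       in if d < 0 then 0 else (1 - (if 1 \<le> d then t else 0)) * hl_U_input t (nat d) \<mu> \<rho> la \<nu>)"
    if la: "la \<in> Sig_below N K" for la
  proof -
    define dd where "dd = sum_list \<rho> + sum_list la - sum_list \<mu> - sum_list \<nu>"
    have laS: "la \<in> Sig N" using la by (simp add: Sig_below_def)
    have llo: "ht la k = int N" if "k < 0" for k using ht_Sig_below(1)[OF la that] .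
    have lhi: "ht la k = 0" if "K - 1 \<le> k" for k using ht_Sig_below(2)[OF la that] .
    have c0: "c (ht la) 0 = dd"
      unfolding c_def dd_def defs using K la S
      by (simp add: sum_list_Sig_below sum.distrib sum_subtractf)
    have valid: "interlace la \<mu> \<and> interlace la \<nu> \<longleftrightarrow>
      (\<forall>k\<in>{0..<K}. p k - ht la k \<in> {0, 1} \<and> q k - ht la k \<in> {0, 1})"
      unfolding interlace_iff_ht[OF laS Sig(2) disjI2[OF refl]] interlace_iff_ht[OF laS Sig(1) disjI1[OF refl]]
        defs[symmetric]
    proof safe
      fix k assume a: "\<forall>k\<in>{0..<K}. p k - ht la k \<in> {0, 1} \<and> q k - ht la k \<in> {0, 1}"
      consider "k < 0" | "K \<le> k" | "k \<in> {0..<K}" by force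
      hence "(ht la k \<le> q k \<and> q k \<le> ht la k + 1) \<and> ht la k \<le> p k \<and> p k \<le> ht la k + 1"
      proof cases
        case 3 thus ?thesis using a by fastforce
      qed (use lo[of k] hi[of k] llo[of k] lhi[of k] in auto)
      thus "ht la k \<le> q k" "q k \<le> ht la k + 1" "ht la k \<le> p k" "p k \<le> ht la k + 1" by auto
    qed (metis add.commute diff_add_cancel insertCI order_antisym_conv zle_add1_eq_le zless_add1_eq diff_self add_diff_cancel_left')+
    show ?thesis
    proof (cases "interlace la \<mu> \<and> interlace la \<nu>")
      case False
      then obtain k where k: "k \<in> {0..<K}" "\<not> (p k - ht la k \<in> {0, 1} \<and> q k - ht la k \<in> {0, 1})"
        using valid by blast
      have "F (ht la) k = 0"
        unfolding F_def using k(2) by (simp only: of_bool_eq mult_zero_left if_False)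
      hence "FF (ht la) = 0" unfolding FF_def using k(1) by (auto simp: prod_zero_iff)
      moreover have "of_bool (interlace la \<mu> \<and> interlace la \<nu>) = (0 :: real)" using False by auto
      ultimately show ?thesis by (simp only: mult_zero_left)
    next
      case True
      \<comment> \<open>Left of column 0 all heights are lengths, and \<open>left_weight\<close>
        reduces to the factor that distinguishes a positive input from a zero one.\<close>
      have lw: "left_weight t (ht la (-1)) (p (-1)) (q (-1)) (s (-1)) (c (ht la) 0) =
          (if dd < 0 then 0 else 1 - (if 1 \<le> dd then t else 0))"
        unfolding c0 using lo[of "-1"] llo[of "-1"] by (auto simp: left_weight_def)
      have psi: "hl_psi t \<mu> la = (\<Prod>k\<in>{0..<K}. psi1 t (q (k - 1)) (ht la (k - 1)) (q k) (ht la k))"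
        unfolding defs by (rule hl_psi_eq_prod) (use hi lo llo in \<open>simp_all add: defs\<close>)
      have phi: "hl_phi t \<nu> la = (\<Prod>k\<in>{0..<K}. phi1 t (p (k - 1)) (ht la (k - 1)) (p k) (ht la k))"
        unfolding defs by (rule hl_phi_eq_prod) (use hi lo llo in \<open>simp_all add: defs\<close>)
      have U: "hl_U_input t (nat dd) \<mu> \<rho> la \<nu> =
        (\<Prod>k\<in>{0..<K}. col_weight t (ht la (k - 1)) (p (k - 1)) (q (k - 1)) (s (k - 1))
           (ht la k) (p k) (q k) (s k) (c (ht la) k))" if "0 \<le> dd"
      proof -
        have "c (ht la) k = int (nat dd) + (\<Sum>k'\<in>{0..<k}. ht \<nu> k' + ht \<mu> k' - ht la k' - ht \<rho> k')"
          if k: "k \<in> {0..<K}" for k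
        proof -
          have "{0..<K} = {0..<k} \<union> {k..<K}" using k by auto
          hence "c (ht la) 0 = (\<Sum>k'\<in>{0..<k}. ht la k' + s k' - p k' - q k') + c (ht la) k"
            unfolding c_def by (simp add: sum.union_disjoint)
          thus ?thesis using \<open>0 \<le> dd\<close> unfolding c0 defs by (simp add: sum.distrib sum_subtractf)
        qed
        thus ?thesis
          unfolding defs using True la bd
          by (subst hl_U_input_eq_prod[OF t laS Sig, where K = K])
            (auto simp: Sig_below_def intro!: prod.cong)
      qed
      have "(\<Prod>k\<in>{0..<K}. F (ht la) k) = hl_psi t \<mu> la * hl_phi t \<nu> la *
        (\<Prod>k\<in>{0..<K}. col_weight t (ht la (k - 1)) (p (k - 1)) (q (k - 1)) (s (k - 1))
           (ht la k) (p k) (q k) (s k) (c (ht la) k))"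
        unfolding psi phi F_def prod.distrib[symmetric]
        by (intro prod.cong refl) (use True valid in simp)
      thus ?thesis unfolding FF_def lw using True U
        by (simp add: dd_def[symmetric] Let_def)
    qed
  qed
  ultimately show ?thesis using total by simp
qed

text \<open>The sum in \<open>forward_sum\<close> is finite, whereas \<rho> ranges over an infinite
  set. So it has to be shown that only \<rho> below a common bound have non-zero weight.\<close>

lemma hl_U_input_stochastic:
  assumes t: "0 \<le> t" "t < 1"
    and S: "la \<in> Sig N" "\<nu> \<in> Sig N" "\<mu> \<in> Sig (Suc N)"
    and nonneg: "\<And>a. a \<in> set la \<union> set \<nu> \<union> set \<mu> \<Longrightarrow> 0 \<le> a"
    and il: "interlace la \<mu>" "interlace la \<nu>"
  obtains T where "finite T" "T \<subseteq> {\<rho> \<in> Sig (Suc N). \<forall>a\<in>set \<rho>. 0 \<le> a}"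
    "\<And>\<rho>. hl_U_input t r \<mu> \<rho> la \<nu> \<noteq> 0 \<Longrightarrow> \<rho> \<in> T" "(\<Sum>\<rho>\<in>T. hl_U_input t r \<mu> \<rho> la \<nu>) = 1"
proof -
  define l p q where "l = ht la" and "p = ht \<nu>" and "q = ht \<mu>"
  note defs = l_def p_def q_def
  define k1 where "k1 = Max (insert 0 (set \<nu> \<union> set \<mu>)) + 1"
  have k1: "a < k1" if "a \<in> set \<nu> \<union> set \<mu>" for a
  proof -
    have "a \<le> Max (insert 0 (set \<nu> \<union> set \<mu>))" using that by (intro Max_ge) auto
    thus ?thesis by (simp add: k1_def)
  qed
  have k1_pos: "1 \<le> k1"
  proof -
    have "0 \<le> Max (insert 0 (set \<nu> \<union> set \<mu>))" by (intro Max_ge) auto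
    thus ?thesis by (simp add: k1_def)
  qed
  \<comment> \<open>Up to column \<open>k1\<close> the carry grows by at most one per column, so it
    is at most \<open>r + k1\<close> there. Beyond, no new lines start and each column absorbs one
    unit, so it is exhausted by column \<open>2 * k1 + r\<close>.\<close>
  define K where "K = 2 * k1 + int r + 2"
  have K: "0 < K" "k1 \<le> K - 1" using k1_pos by (auto simp: K_def)
  have d: "p k = l k \<or> p k = l k + 1" "q k = l k \<or> q k = l k + 1" for k
  proof -
    have "l k \<le> p k \<and> p k \<le> l k + 1" "l k \<le> q k \<and> q k \<le> l k + 1"
      using il unfolding interlace_iff_ht[OF S(1,3) disjI2[OF refl]]
        interlace_iff_ht[OF S(1,2) disjI1[OF refl]] defs by blast+
    thus "p k = l k \<or> p k = l k + 1" "q k = l k \<or> q k = l k + 1" by linarith+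
  qed
  have lo: "l k = int N" "p k = int N" "q k = int N + 1" if "k < 0" for k
    using ht_eq_length[of la k] ht_eq_length[of \<nu> k] ht_eq_length[of \<mu> k] less_le_trans[OF that nonneg]
      SigD(1)[OF S(1)] SigD(1)[OF S(2)] SigD(1)[OF S(3)] by (auto simp: defs)
  have hi: "p k = 0" "q k = 0" if "k1 - 1 \<le> k" for k
  proof -
    have "a \<le> k" if "a \<in> set \<nu> \<union> set \<mu>" for a using k1[OF that] \<open>k1 - 1 \<le> k\<close> by simp
    thus "p k = 0" "q k = 0" using ht_eq_0[of \<nu> k] ht_eq_0[of \<mu> k] by (auto simp: defs)
  qed
  have hil: "l k = 0" if "k1 - 1 \<le> k" for k
    using d(1)[of k] hi(1)[OF that] ht_nonneg[of la k] by (auto simp: defs)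
  have anti: "p k \<le> p (k - 1)" "q k \<le> q (k - 1)" "l k \<le> l (k - 1)" for k
    by (auto simp: defs ht_antimono)
  define c where "c s k = int r + (\<Sum>k'\<in>{0..<k}. p k' + q k' - l k' - s k')" for s :: "int \<Rightarrow> int" and k
  define F where "F s k = col_weight t (l (k - 1)) (p (k - 1)) (q (k - 1)) (s (k - 1)) (l k) (p k) (q k) (s k) (c s k)" for s k
  have c0: "c s 0 = int r" for s by (simp add: c_def)
  have c_Suc: "c s (k + 1) = c s k + p k + q k - l k - s k" if "0 \<le> k" for s k
  proof -
    have "{0..<k + 1} = insert k {0..<k}" using that by auto
    thus ?thesis by (simp add: c_def)
  qed
  have tail: "s k = 0" if nz: "\<And>k. k \<in> {0..<K'} \<Longrightarrow> F s k \<noteq> 0" and k: "K - 1 \<le> k" "k < K'" for s K' k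
  proof -
    have rule: "if c s k = 0 \<and> p k = l k + 1 \<and> q k = l k + 1 then s k \<in> {l k + 1, l k + 2}
      else if c s k = 0 then s k + l k = p k + q k else s k = l k + 1" if "0 \<le> k" "k < K'" for k
      by (rule col_weight_nonzero) (use nz[of k] that in \<open>simp add: F_def\<close>)
    have c_nonneg: "0 \<le> c s k" if "0 \<le> k" "k \<le> K'" for k
    proof (rule carry_nonneg[where c = "c s" and p = p and q = q and l = l and s = s and K = K', OF _ _ _ rule])
      show "l k \<le> p k \<and> p k \<le> l k + 1 \<and> l k \<le> q k \<and> q k \<le> l k + 1" for k using d[of k] by auto
    qed (use c_Suc c0 that in auto)
    have c_le: "c s (k + 1) \<le> c s k + 1" if "0 \<le> k" "k < K'" for k
      using rule[OF that] c_Suc[of k s] d[of k] that by (auto split: if_splits)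
    have up: "c s k \<le> int r + k" if "0 \<le> k" "k \<le> K'" for k
      using that
    proof (induction k rule: int_ge_induct)
      case (step k) thus ?case using c_le[of k] by simp
    qed (simp add: c0)
    have down: "c s k \<le> max 0 (int r + 2 * k1 - k)" if "k1 \<le> k" "k \<le> K'" for k
      using that
    proof (induction k rule: int_ge_induct)
      case base thus ?case using up[of k1] k1_pos by simp
    next
      case (step k)
      hence k: "0 \<le> k" "k < K'" using k1_pos by auto
      have z: "p k = 0" "q k = 0" "l k = 0" using hi[of k] hil[of k] step by auto
      show ?case using rule[OF k] c_Suc[OF k(1), of s] z step by (auto split: if_splits)
    qed
    have k': "0 \<le> k" "k1 \<le> k" using k K by auto
    have "c s k = 0" using down[of k] c_nonneg[of k] k k' by (simp add: K_def)
    thus ?thesis using rule[of k] hi[of k] hil[of k] k k' by (auto split: if_splits)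
  qed
  define X where "X = {0..2 * int N + 5}"
  have bnd: "0 \<le> l k" "l k \<le> int N" for k
    using ht_nonneg[of la k] ht_le_length[of la k] SigD(1)[OF S(1)] by (auto simp: defs)
  define FF where "FF s = of_bool (s (-1) = int (Suc N)) * (\<Prod>k\<in>{0..<K}. F s k)" for s
  have total: "(\<Sum>s\<in>PiE {-1..<K} (\<lambda>_. X). FF s) = 1"
    unfolding FF_def F_def c_def
  proof (rule forward_sum)
    show "{l k + 1, l k + 2, p k + q k - l k} \<subseteq> X" for k
      using bnd[of k] d[of k] by (auto simp: X_def)
  qed (use K in \<open>auto simp: X_def\<close>)
  have "(\<Sum>\<rho>\<in>Sig_below (Suc N) K. FF (ht \<rho>)) = (\<Sum>s\<in>PiE {-1..<K} (\<lambda>_. X). FF s)"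
  proof (rule sum_Sig_below[OF K(1)])
    show "{0..int (Suc N)} \<subseteq> X" "finite X" by (auto simp: X_def)
    show "FF f = FF g" if "\<And>k. k \<in> {-1..<K} \<Longrightarrow> f k = g k" for f g
    proof -
      have cfg: "c f k = c g k" if "k \<le> K" for k
        unfolding c_def using that \<open>\<And>k. k \<in> {-1..<K} \<Longrightarrow> f k = g k\<close>
        by (intro arg_cong2[where f = "(+)"] sum.cong) auto
      have "F f k = F g k" if "k \<in> {0..<K}" for k
        unfolding F_def using that cfg[of k] \<open>\<And>k. k \<in> {-1..<K} \<Longrightarrow> f k = g k\<close> by simp
      thus ?thesis unfolding FF_def using that K by simp
    qed
    fix s assume nz: "FF s \<noteq> 0"
    have s1: "s (-1) = int (Suc N)" using nz by (auto simp: FF_def split: if_splits)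
    have Fnz: "F s k \<noteq> 0" if "k \<in> {0..<K}" for k
      using nz that unfolding FF_def by (auto simp: prod_zero_iff)
    have rule: "if c s k = 0 \<and> p k = l k + 1 \<and> q k = l k + 1 then s k \<in> {l k + 1, l k + 2}
      else if c s k = 0 then s k + l k = p k + q k else s k = l k + 1" if "0 \<le> k" "k < K" for k
      by (rule col_weight_nonzero) (use Fnz[of k] that in \<open>simp add: F_def\<close>)
    have c_nonneg: "0 \<le> c s k" if "0 \<le> k" "k \<le> K" for k
    proof (rule carry_nonneg[where c = "c s" and p = p and q = q and l = l and s = s and K = K, OF _ _ _ rule])
      show "l k \<le> p k \<and> p k \<le> l k + 1 \<and> l k \<le> q k \<and> q k \<le> l k + 1" for k using d[of k] by auto
    qed (use c_Suc c0 that in auto)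
    have "s k \<le> s (k - 1)" if k: "k \<in> {0..<K}" for k
    proof (cases "k = 0")
      case True
      show ?thesis
        by (rule col_weight_antimono[OF anti(1)[of k] anti(2)[of k] anti(3)[of k] d(1)[of k] d(2)[of k]
              d(1)[of "k - 1"] d(2)[of "k - 1"], of "int r" _ "c s k"])
          (use True lo[of "-1"] s1 Fnz[OF k] c0[of s] in \<open>auto simp: F_def\<close>)
    next
      case False
      show ?thesis
        by (rule col_weight_antimono[OF anti(1)[of k] anti(2)[of k] anti(3)[of k] d(1)[of k] d(2)[of k]
              d(1)[of "k - 1"] d(2)[of "k - 1"], of "c s (k - 1)" _ "c s k"])
          (use False k rule[of "k - 1"] c_nonneg[of "k - 1"] c_Suc[of "k - 1" s] Fnz[OF k] in \<open>auto simp: F_def\<close>)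
    qed
    moreover have "s (K - 1) = 0" using tail[of K s "K - 1"] Fnz by simp
    ultimately show "s (-1) = int (Suc N) \<and> (\<forall>k\<in>{0..<K}. s k \<le> s (k - 1)) \<and> s (K - 1) = 0"
      using s1 by blast
  qed
  hence sum1: "(\<Sum>\<rho>\<in>Sig_below (Suc N) K. FF (ht \<rho>)) = 1" using total by simp
  have U: "hl_U_input t r \<mu> \<rho> la \<nu> = (\<Prod>k\<in>{0..<K'}. F (ht \<rho>) k)"
    if "\<rho> \<in> Sig_below (Suc N) K'" "K \<le> K'" for \<rho> K'
  proof -
    have a: "0 \<le> a" if "a \<in> set la \<union> set \<nu> \<union> set \<mu> \<union> set \<rho>" for a
      using that nonneg \<open>\<rho> \<in> _\<close> by (auto simp: Sig_below_def)
    have b: "a < K'" if "a \<in> set \<nu> \<union> set \<mu> \<union> set \<rho>" for a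
      using that k1[of a] K \<open>K \<le> K'\<close> \<open>\<rho> \<in> _\<close> by (auto simp: Sig_below_def)
    have "\<rho> \<in> Sig (Suc N)" using that by (simp add: Sig_below_def)
    from hl_U_input_eq_prod[OF t S this il a b, of r] show ?thesis
      by (simp add: F_def c_def defs)
  qed
  show thesis
  proof (rule that)
    show sub: "Sig_below (Suc N) K \<subseteq> {\<rho> \<in> Sig (Suc N). \<forall>a\<in>set \<rho>. 0 \<le> a}"
      by (auto simp: Sig_below_def)
    have "Sig_below (Suc N) K \<subseteq> {xs. set xs \<subseteq> {0..<K} \<and> length xs = Suc N}"
      by (auto simp: Sig_below_def Sig_def)
    thus "finite (Sig_below (Suc N) K)" by (rule finite_subset) (simp add: finite_lists_length_eq)
    have "FF (ht \<rho>) = hl_U_input t r \<mu> \<rho> la \<nu>" if "\<rho> \<in> Sig_below (Suc N) K" for \<rho>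
      using U[OF that order_refl] ht_Sig_below(1)[OF that, of "-1"] by (simp add: FF_def)
    thus "(\<Sum>\<rho>\<in>Sig_below (Suc N) K. hl_U_input t r \<mu> \<rho> la \<nu>) = 1" using sum1 by simp
    fix \<rho> assume nz: "hl_U_input t r \<mu> \<rho> la \<nu> \<noteq> 0"
    have \<rho>: "interlace \<mu> \<rho>" "\<rho> \<in> Sig (Suc N)"
      using hl_U_input_nonzeroD[OF nz] S by (auto simp: Sig_def)
    \<comment> \<open>An arbitrary \<rho> is first placed below a bound of its own; exhaustion of
      the carry then shows that it lies below \<open>K\<close>.\<close>
    define K' where "K' = max K (Max (insert 0 (set \<rho>)) + 1)"
    have "q (-1) \<le> ht \<rho> (-1)" unfolding defs
      using \<rho>(1) unfolding interlace_iff_ht[OF S(3) \<rho>(2) disjI1[OF refl]] by blast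
    hence "ht \<rho> (-1) = int (length \<rho>)"
      using lo(3)[of "-1"] ht_le_length[of \<rho> "-1"] SigD(1)[OF \<rho>(2)] by simp
    hence \<rho>0: "\<forall>a\<in>set \<rho>. -1 < a" by (simp only: ht_eq_length_iff)
    have "a < K'" if "a \<in> set \<rho>" for a
    proof -
      have "a \<le> Max (insert 0 (set \<rho>))" using that by (intro Max_ge) auto
      thus ?thesis by (simp add: K'_def)
    qed
    hence \<rho>K': "\<rho> \<in> Sig_below (Suc N) K'" using \<rho>(2) \<rho>0 by (force simp: Sig_below_def)
    have "(\<Prod>k\<in>{0..<K'}. F (ht \<rho>) k) \<noteq> 0" using nz U[OF \<rho>K'] by (simp add: K'_def)
    hence "F (ht \<rho>) k \<noteq> 0" if "k \<in> {0..<K'}" for k using that by (auto simp: prod_zero_iff)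
    hence "ht \<rho> (K - 1) = 0" using tail[of K' "ht \<rho>" "K - 1"] by (simp add: K'_def)
    hence "\<forall>a\<in>set \<rho>. a \<le> K - 1" by (simp only: ht_eq_0_iff)
    thus "\<rho> \<in> Sig_below (Suc N) K" using \<rho>(2) \<rho>0 by (force simp: Sig_below_def)
  qed
qed

section \<open>Branching of the Hall-Littlewood symmetrization\<close>

subsection \<open>Partial fractions\<close>

text \<open>As a function of \<open>u\<close> the left side tends to 1 at infinity and has simple
  poles at the \<open>x j\<close>. With denominators cleared, the two sides become polynomials of
  degree below \<open>card D\<close>, since the leading terms cancel, and they agree at the
  \<open>card D\<close> points \<open>x j\<close>.\<close>

lemma partial_fraction_h:
  fixes x :: "'a \<Rightarrow> real"
  assumes D: "finite D" "inj_on x D" and u: "u \<notin> x ` D"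
  shows "(\<Prod>j\<in>D. (u - t * x j) / (u - x j)) =
    1 + (\<Sum>j\<in>D. (1 - t) * x j / (u - x j) * (\<Prod>l\<in>D - {j}. (x j - t * x l) / (x j - x l)))"
proof (cases "D = {}")
  case ne: False
  define v where "v j = (1 - t) * x j * (\<Prod>l\<in>D - {j}. (x j - t * x l) / (x j - x l))" for j
  define p where "p = (\<Prod>j\<in>D. [:- (t * x j), 1:]) - (\<Prod>j\<in>D. [:- x j, 1:])"
  define q where "q = (\<Sum>j\<in>D. smult (v j) (\<Prod>l\<in>D - {j}. [:- x l, 1:]))"
  have card: "card (x ` D) = card D" using D by (simp add: card_image)
  have pos: "0 < card D" using D ne by (simp add: card_gt_0_iff)
  have mon: "degree (\<Prod>j\<in>A. [:- c j, 1:]) = card A \<and> lead_coeff (\<Prod>j\<in>A. [:- c j, 1:]) = 1"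
    if "finite A" for A and c :: "'a \<Rightarrow> real"
    using that
  proof (induction A rule: finite_induct)
    case (insert a A)
    hence "(\<Prod>j\<in>A. [:- c j, 1:]) \<noteq> 0" by auto
    hence "degree ([:- c a, 1:] * (\<Prod>j\<in>A. [:- c j, 1:])) = Suc (card A)"
      using insert by (simp add: degree_mult_eq del: mult_pCons_left)
    moreover have "lead_coeff ([:- c a, 1:] * (\<Prod>j\<in>A. [:- c j, 1:])) = 1"
    proof -
      have "lead_coeff (\<Prod>j\<in>A. [:- c j, 1:]) = 1" using insert by blast
      thus ?thesis by (simp only: lead_coeff_mult) simp
    qed
    ultimately show ?case using insert by (simp del: mult_pCons_left)
  qed simp
  have "degree p < card D"
  proof -
    have le: "degree p \<le> card D"
      unfolding p_def using mon[OF D(1), of "\<lambda>j. t * x j"] mon[OF D(1), of x]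
      by (intro degree_diff_le) auto
    have "coeff p (card D) = 0"
      unfolding p_def using mon[OF D(1), of "\<lambda>j. t * x j"] mon[OF D(1), of x] by auto
    thus ?thesis using le pos by (metis coeff_0_degree_minus_1 degree_0 diff_less le_neq_implies_less leading_coeff_0_iff zero_less_one)
  qed
  moreover have "degree q < card D"
  proof -
    have "degree q \<le> card D - 1" unfolding q_def
    proof (rule degree_sum_le[OF D(1)])
      fix j assume "j \<in> D"
      thus "degree (smult (v j) (\<Prod>l\<in>D - {j}. [:- x l, 1:])) \<le> card D - 1"
        using mon[of "D - {j}" x] D by (intro order.trans[OF degree_smult_le]) simp
    qed
    thus ?thesis using pos by simp
  qed
  moreover have "poly p y = poly q y" if "y \<in> x ` D" for y
  proof -
    obtain j where j: "j \<in> D" "y = x j" using \<open>y \<in> x ` D\<close> by blast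
    have ne0: "x j - x l \<noteq> 0" if "l \<in> D - {j}" for l using D j that by (auto simp: inj_on_def)
    have "poly p y = (1 - t) * x j * (\<Prod>l\<in>D - {j}. x j - t * x l)"
      using D j by (simp add: p_def poly_prod prod.remove[of D j] algebra_simps)
    also have "\<dots> = v j * (\<Prod>l\<in>D - {j}. x j - x l)"
      unfolding v_def using ne0 D by (simp add: prod_dividef prod_zero_iff)
    also have "\<dots> = poly q y"
    proof -
      have "(\<Sum>i\<in>D - {j}. v i * (\<Prod>l\<in>D - {i}. x j - x l)) = 0"
        using D j by (intro sum.neutral) (auto simp: prod_zero_iff)
      thus ?thesis using D j by (simp add: q_def poly_sum poly_prod sum.remove[of D j])
    qed
    finally show ?thesis .
  qed
  ultimately have "p = q" using poly_eqI_degree[of "x ` D" p q] card by metis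
  hence "poly p u = poly q u" by simp
  hence pq: "(\<Prod>j\<in>D. u - t * x j) = (\<Prod>j\<in>D. u - x j) + (\<Sum>j\<in>D. v j * (\<Prod>l\<in>D - {j}. u - x l))"
    by (simp add: p_def q_def poly_prod poly_sum algebra_simps)
  have nz: "u - x j \<noteq> 0" if "j \<in> D" for j using u that by auto
  have "(\<Prod>j\<in>D. (u - t * x j) / (u - x j)) = 1 + (\<Sum>j\<in>D. v j * (\<Prod>l\<in>D - {j}. u - x l) / (\<Prod>l\<in>D. u - x l))"
    using nz D by (simp add: prod_dividef pq add_divide_distrib sum_divide_distrib prod_zero_iff)
  also have "(\<Sum>j\<in>D. v j * (\<Prod>l\<in>D - {j}. u - x l) / (\<Prod>l\<in>D. u - x l)) = (\<Sum>j\<in>D. v j / (u - x j))"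
  proof (intro sum.cong refl)
    fix j assume "j \<in> D"
    thus "v j * (\<Prod>l\<in>D - {j}. u - x l) / (\<Prod>l\<in>D. u - x l) = v j / (u - x j)"
      using nz D by (simp add: prod.remove[of D j] prod_zero_iff)
  qed
  finally show ?thesis by (simp add: v_def)
qed simp

text \<open>Adding a point \<open>z\<close> multiplies the old summands by \<open>(x j - t * x z) /
  (x j - x z) = t - (1 - t) * x j / (x z - x j)\<close>. The second parts are collected by
  \<open>partial_fraction_h\<close> at \<open>u = x z\<close>. The value no longer depends on
  \<open>x\<close>.\<close>

lemma sum_prod_t_h:
  fixes x :: "'a \<Rightarrow> real"
  assumes "finite E" "inj_on x E"
  shows "(\<Sum>j\<in>E. \<Prod>l\<in>E - {j}. (x j - t * x l) / (x j - x l)) = (\<Sum>i<card E. t ^ i)"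
  using assms
proof (induction E rule: finite_induct)
  case (insert z D)
  have inj: "inj_on x D" and u: "x z \<notin> x ` D" using insert by (auto simp: inj_on_def)
  have "(\<Prod>l\<in>insert z D - {j}. (x j - t * x l) / (x j - x l)) =
     t * (\<Prod>l\<in>D - {j}. (x j - t * x l) / (x j - x l)) -
     (1 - t) * x j / (x z - x j) * (\<Prod>l\<in>D - {j}. (x j - t * x l) / (x j - x l))" if "j \<in> D" for j
  proof -
    have e: "insert z D - {j} = insert z (D - {j})" using that insert by auto
    have "x j \<noteq> x z" using u that by (metis imageI)
    hence "(x j - t * x z) / (x j - x z) = t - (1 - t) * x j / (x z - x j)" by (simp add: field_simps)
    moreover have "(\<Prod>l\<in>insert z (D - {j}). (x j - t * x l) / (x j - x l)) =
      (x j - t * x z) / (x j - x z) * (\<Prod>l\<in>D - {j}. (x j - t * x l) / (x j - x l))"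
      using insert by (subst prod.insert) auto
    ultimately show ?thesis unfolding e by (simp only: left_diff_distrib)
  qed
  hence "(\<Sum>j\<in>D. \<Prod>l\<in>insert z D - {j}. (x j - t * x l) / (x j - x l)) =
    t * (\<Sum>i<card D. t ^ i) -
      (\<Sum>j\<in>D. (1 - t) * x j / (x z - x j) * (\<Prod>l\<in>D - {j}. (x j - t * x l) / (x j - x l)))"
    using insert.IH[OF inj] by (simp add: sum_subtractf sum_distrib_left[symmetric])
  hence "(\<Sum>j\<in>insert z D. \<Prod>l\<in>insert z D - {j}. (x j - t * x l) / (x j - x l)) = 1 + t * (\<Sum>i<card D. t ^ i)"
    using insert partial_fraction_h[OF insert(1) inj u, of t] by simp
  thus ?case using insert by (simp add: sum.lessThan_Suc_shift sum_distrib_left del: sum.lessThan_Suc)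
qed simp

text \<open>For identities that are proved by passing to \<open>1 / t\<close> or dividing by
  \<open>t\<close>; the value at \<open>t = 0\<close> follows by continuity.\<close>

lemma continuous_eq_at_0:
  fixes f g :: "real \<Rightarrow> real"
  assumes "isCont f 0" "isCont g 0" "\<And>t. t \<noteq> 0 \<Longrightarrow> f t = g t"
  shows "f t = g t"
proof (cases "t = 0")
  case True
  have "f \<midarrow>0\<rightarrow> g 0"
    by (rule Lim_transform_eventually[of g]) (use assms in \<open>auto simp: isCont_def eventually_at_filter\<close>)
  thus ?thesis using assms(1) LIM_unique True unfolding isCont_def by blast
qed (use assms in auto)

text \<open>The mirror image of \<open>sum_prod_t_h\<close> under replacing \<open>t\<close> by
  \<open>1 / t\<close>, which reverses the geometric sum.\<close>

lemma sum_prod_t_v: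
  fixes x :: "'a \<Rightarrow> real"
  assumes E: "finite E" "inj_on x E"
  shows "(\<Sum>j\<in>E. \<Prod>l\<in>E - {j}. (x l - t * x j) / (x l - x j)) = (\<Sum>i<card E. t ^ i)"
proof (rule continuous_eq_at_0[of "\<lambda>t. \<Sum>j\<in>E. \<Prod>l\<in>E - {j}. (x l - t * x j) / (x l - x j)"])
  have ne: "x l - x j \<noteq> 0" if "j \<in> E" "l \<in> E - {j}" for j l using E that by (auto simp: inj_on_def)
  show "isCont (\<lambda>t. \<Sum>j\<in>E. \<Prod>l\<in>E - {j}. (x l - t * x j) / (x l - x j)) 0"
    by (intro continuous_intros) (use ne in auto)
  show "isCont (\<lambda>t::real. \<Sum>i<card E. t ^ i) 0" by (intro continuous_intros)
  fix t :: real assume t: "t \<noteq> 0"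
  have "(\<Sum>j\<in>E. \<Prod>l\<in>E - {j}. (x l - t * x j) / (x l - x j)) =
    (\<Sum>j\<in>E. t ^ (card E - 1) * (\<Prod>l\<in>E - {j}. (x j - (1 / t) * x l) / (x j - x l)))"
  proof (intro sum.cong refl)
    fix j assume j: "j \<in> E"
    have "(\<Prod>l\<in>E - {j}. (x l - t * x j) / (x l - x j)) = (\<Prod>l\<in>E - {j}. t * ((x j - (1 / t) * x l) / (x j - x l)))"
    proof (intro prod.cong refl)
      fix l assume "l \<in> E - {j}"
      hence "x l - x j \<noteq> 0" "x j - x l \<noteq> 0" using ne[OF j, of l] by auto
      thus "(x l - t * x j) / (x l - x j) = t * ((x j - (1 / t) * x l) / (x j - x l))"
        using t by (simp add: field_simps)
    qed
    also have "\<dots> = t ^ card (E - {j}) * (\<Prod>l\<in>E - {j}. (x j - (1 / t) * x l) / (x j - x l))"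
      by (simp only: prod.distrib prod_constant)
    also have "card (E - {j}) = card E - 1" using E j by simp
    finally show "(\<Prod>l\<in>E - {j}. (x l - t * x j) / (x l - x j)) =
      t ^ (card E - 1) * (\<Prod>l\<in>E - {j}. (x j - (1 / t) * x l) / (x j - x l))" .
  qed
  also have "\<dots> = t ^ (card E - 1) * (\<Sum>i<card E. (1 / t) ^ i)"
    using sum_prod_t_h[OF E, of "1 / t"] by (simp add: sum_distrib_left[symmetric])
  also have "\<dots> = (\<Sum>i<card E. t ^ (card E - Suc i))"
    unfolding sum_distrib_left using t by (intro sum.cong refl) (simp add: power_diff power_one_over field_simps)
  also have "\<dots> = (\<Sum>i<card E. t ^ i)" by (rule sum.nat_diff_reindex)
  finally show "(\<Sum>j\<in>E. \<Prod>l\<in>E - {j}. (x l - t * x j) / (x l - x j)) = (\<Sum>i<card E. t ^ i)" .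
qed

text \<open>This is \<open>sum_prod_t_v\<close> for the points \<open>x j\<close> together with
  \<open>u\<close>, minus \<open>t\<close> times the same for the \<open>x j\<close> alone: the
  geometric sums then differ by 1. The option type provides a fresh index for
  \<open>u\<close>.\<close>

lemma partial_fraction_v:
  fixes x :: "'a \<Rightarrow> real"
  assumes D: "finite D" "inj_on x D" and u: "u \<notin> x ` D"
  shows "(\<Prod>i\<in>D. (x i - t * u) / (x i - u)) +
    (\<Sum>j\<in>D. (1 - t) * u / (u - x j) * (\<Prod>i\<in>D - {j}. (x i - t * x j) / (x i - x j))) = 1"
proof -
  define y where "y k = (case k of None \<Rightarrow> u | Some i \<Rightarrow> x i)" for k
  have inj: "inj_on y (insert None (Some ` D))" using D u by (auto simp: inj_on_def y_def)
  have rem: "insert None (Some ` D) - {Some j} = insert None (Some ` (D - {j}))" for j by auto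
  have "(\<Sum>k\<in>insert None (Some ` D). \<Prod>l\<in>insert None (Some ` D) - {k}. (y l - t * y k) / (y l - y k)) =
    (\<Prod>i\<in>D. (x i - t * u) / (x i - u)) +
    (\<Sum>j\<in>D. (u - t * x j) / (u - x j) * (\<Prod>i\<in>D - {j}. (x i - t * x j) / (x i - x j)))"
    using D by (simp add: sum.reindex prod.reindex y_def rem)
  also have "\<dots> = (\<Prod>i\<in>D. (x i - t * u) / (x i - u)) +
    (\<Sum>j\<in>D. (1 - t) * u / (u - x j) * (\<Prod>i\<in>D - {j}. (x i - t * x j) / (x i - x j))) +
    t * (\<Sum>j\<in>D. \<Prod>i\<in>D - {j}. (x i - t * x j) / (x i - x j))"
  proof -
    have "(u - t * x j) / (u - x j) = (1 - t) * u / (u - x j) + t" if "j \<in> D" for j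
    proof -
      have "u - x j \<noteq> 0" using u that by auto
      thus ?thesis by (simp add: field_simps)
    qed
    hence "(\<Sum>j\<in>D. (u - t * x j) / (u - x j) * (\<Prod>i\<in>D - {j}. (x i - t * x j) / (x i - x j))) =
      (\<Sum>j\<in>D. ((1 - t) * u / (u - x j) + t) * (\<Prod>i\<in>D - {j}. (x i - t * x j) / (x i - x j)))" by simp
    thus ?thesis by (simp only: distrib_right sum.distrib sum_distrib_left add.assoc)
  qed
  also have "(\<Sum>k\<in>insert None (Some ` D). \<Prod>l\<in>insert None (Some ` D) - {k}. (y l - t * y k) / (y l - y k)) =
    1 + t * (\<Sum>i<card D. t ^ i)"
    using sum_prod_t_v[OF _ inj, of t] D
    by (simp add: card_image sum.lessThan_Suc_shift sum_distrib_left del: sum.lessThan_Suc)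
  finally show ?thesis using sum_prod_t_v[OF D, of t] by simp
qed

text \<open>With denominators cleared, \<open>partial_fraction_v\<close> is a polynomial identity in
  \<open>w\<close> (\<open>poly\<close>). At \<open>w = u / t\<close> it turns into this one after
  multiplication by a power of \<open>t\<close>. The term \<open>t ^ card D\<close> is the origin of
  the factors \<open>1 - t ^ ...\<close> in the branching rule.\<close>

lemma partial_fraction_scaled:
  fixes x :: "'a \<Rightarrow> real"
  assumes D: "finite D" "inj_on x D" and u: "u \<notin> x ` D"
  shows "(\<Prod>j\<in>D. (u - t * x j) / (u - x j)) = t ^ card D +
    (\<Sum>j\<in>D. (1 - t) * u / (u - x j) * (\<Prod>i\<in>D - {j}. (x i - t * x j) / (x i - x j) * ((u - t * x i) / (u - x i))))"
proof -
  have ne: "x i - x j \<noteq> 0" if "j \<in> D" "i \<in> D - {j}" for i j using D that by (auto simp: inj_on_def)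
  have nu: "u - x j \<noteq> 0" if "j \<in> D" for j using u that by auto
  define r where "r t j = (\<Prod>i\<in>D - {j}. (x i - t * x j) / (x i - x j))" for t j
  have poly: "(\<Prod>i\<in>D. x i - t * w) - (\<Sum>j\<in>D. (1 - t) * w * r t j * (\<Prod>i\<in>D - {j}. x i - w)) = (\<Prod>i\<in>D. x i - w)"
    for t w
  proof (cases "w \<in> x ` D")
    case False
    hence nw: "x j - w \<noteq> 0" if "j \<in> D" for j using that by auto
    have "(\<Prod>i\<in>D. x i - t * w) - (\<Sum>j\<in>D. (1 - t) * w * r t j * (\<Prod>i\<in>D - {j}. x i - w)) =
      (\<Prod>i\<in>D. x i - w) * ((\<Prod>i\<in>D. (x i - t * w) / (x i - w)) + (\<Sum>j\<in>D. (1 - t) * w / (w - x j) * r t j))"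
    proof -
      have "(\<Prod>i\<in>D. x i - w) * (\<Prod>i\<in>D. (x i - t * w) / (x i - w)) = (\<Prod>i\<in>D. x i - t * w)"
        using nw by (simp add: prod.distrib[symmetric])
      moreover have "(\<Prod>i\<in>D. x i - w) * ((1 - t) * w / (w - x j) * r t j) =
          - ((1 - t) * w * r t j * (\<Prod>i\<in>D - {j}. x i - w))" if "j \<in> D" for j
      proof -
        have 1: "(x j - w) * ((1 - t) * w / (w - x j)) = - ((1 - t) * w)"
          using nw[OF that] by (simp add: field_simps)
        have 2: "(\<Prod>i\<in>D. x i - w) = (x j - w) * (\<Prod>i\<in>D - {j}. x i - w)"
          using D that by (simp add: prod.remove[of D j])
        have "(\<Prod>i\<in>D. x i - w) * ((1 - t) * w / (w - x j) * r t j) =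
          ((x j - w) * ((1 - t) * w / (w - x j))) * (r t j * (\<Prod>i\<in>D - {j}. x i - w))"
          unfolding 2 by (simp only: mult_ac)
        thus ?thesis unfolding 1 by (simp only: mult_ac mult_minus_left mult_minus_right)
      qed
      ultimately show ?thesis by (simp add: distrib_left sum_distrib_left sum_negf)
    qed
    thus ?thesis using partial_fraction_v[OF D False, of t] by (simp add: r_def)
  next
    case True
    then obtain k where k: "k \<in> D" "w = x k" by blast
    have "(\<Sum>j\<in>D. (1 - t) * w * r t j * (\<Prod>i\<in>D - {j}. x i - w)) = (1 - t) * w * r t k * (\<Prod>i\<in>D - {k}. x i - w)"
    proof -
      have "(\<Sum>j\<in>D - {k}. (1 - t) * w * r t j * (\<Prod>i\<in>D - {j}. x i - w)) = 0"
        using D k by (intro sum.neutral) (auto simp: prod_zero_iff)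
      thus ?thesis using D k by (simp add: sum.remove[of D k])
    qed
    also have "r t k * (\<Prod>i\<in>D - {k}. x i - w) = (\<Prod>i\<in>D - {k}. x i - t * w)"
      unfolding r_def k(2) prod.distrib[symmetric] using ne[OF k(1)] by (intro prod.cong) auto
    hence "(1 - t) * w * r t k * (\<Prod>i\<in>D - {k}. x i - w) = (1 - t) * w * (\<Prod>i\<in>D - {k}. x i - t * w)"
      by (simp add: mult.assoc)
    finally show ?thesis using D k by (simp add: prod.remove[of D k] algebra_simps prod_zero_iff)
  qed
  let ?f = "\<lambda>t. \<Prod>j\<in>D. u - t * x j"
  let ?g = "\<lambda>t. t ^ card D * (\<Prod>j\<in>D. u - x j) + (\<Sum>j\<in>D. (1 - t) * u * r t j * (\<Prod>i\<in>D - {j}. u - t * x i))"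
  have fg: "?f t = ?g t"
  proof (rule continuous_eq_at_0[of ?f ?g])
    show "isCont ?f 0" by (intro continuous_intros)
    show "isCont ?g 0" unfolding r_def by (intro continuous_intros) (use ne in auto)
    fix t :: real assume t: "t \<noteq> 0"
    have a: "(\<Prod>j\<in>A. u - t * x j) = (- t) ^ card A * (\<Prod>j\<in>A. x j - u / t)" for A
    proof -
      have "u - t * x j = (- t) * (x j - u / t)" for j using t by (simp add: right_diff_distrib)
      thus ?thesis by (simp only: prod.distrib prod_constant)
    qed
    have b: "(\<Prod>j\<in>D. x j - t * (u / t)) = (-1) ^ card D * (\<Prod>j\<in>D. u - x j)"
    proof -
      have "(\<Prod>j\<in>D. x j - t * (u / t)) = (\<Prod>j\<in>D. (-1) * (u - x j))" using t by simp
      thus ?thesis by (simp only: prod.distrib prod_constant)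
    qed
    have "?f t = (- t) ^ card D * ((\<Prod>i\<in>D. x i - t * (u / t)) - (\<Sum>j\<in>D. (1 - t) * (u / t) * r t j * (\<Prod>i\<in>D - {j}. x i - u / t)))"
      unfolding a poly[of t "u / t"] ..
    also have "\<dots> = ?g t"
    proof -
      have "(- t) ^ card D * ((-1) ^ card D * (\<Prod>j\<in>D. u - x j)) = t ^ card D * (\<Prod>j\<in>D. u - x j)"
        by (simp add: mult.assoc[symmetric] power_mult_distrib[symmetric])
      moreover have "(- t) ^ card D * ((1 - t) * (u / t) * r t j * (\<Prod>i\<in>D - {j}. x i - u / t)) =
        - ((1 - t) * u * r t j * (\<Prod>i\<in>D - {j}. u - t * x i))" if "j \<in> D" for j
      proof -
        have "card D = Suc (card (D - {j}))" by (metis card_Suc_Diff1 D(1) that)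
        thus ?thesis unfolding a using t by (simp add: field_simps)
      qed
      ultimately show ?thesis unfolding b by (simp add: right_diff_distrib sum_distrib_left sum_negf)
    qed
    finally show "?f t = ?g t" .
  qed
  have P: "(\<Prod>j\<in>D. u - x j) \<noteq> 0" using D nu by (auto simp: prod_zero_iff)
  have "(\<Prod>j\<in>D. (u - t * x j) / (u - x j)) = ?g t / (\<Prod>j\<in>D. u - x j)"
    using fg by (simp add: prod_dividef)
  also have "\<dots> = t ^ card D + (\<Sum>j\<in>D. (1 - t) * u * r t j * (\<Prod>i\<in>D - {j}. u - t * x i) / (\<Prod>j\<in>D. u - x j))"
    using P by (simp add: add_divide_distrib sum_divide_distrib)
  also have "(\<Sum>j\<in>D. (1 - t) * u * r t j * (\<Prod>i\<in>D - {j}. u - t * x i) / (\<Prod>j\<in>D. u - x j)) =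
    (\<Sum>j\<in>D. (1 - t) * u / (u - x j) * (\<Prod>i\<in>D - {j}. (x i - t * x j) / (x i - x j) * ((u - t * x i) / (u - x i))))"
  proof (intro sum.cong refl)
    fix j assume "j \<in> D"
    thus "(1 - t) * u * r t j * (\<Prod>i\<in>D - {j}. u - t * x i) / (\<Prod>j\<in>D. u - x j) =
      (1 - t) * u / (u - x j) * (\<Prod>i\<in>D - {j}. (x i - t * x j) / (x i - x j) * ((u - t * x i) / (u - x i)))"
      using D by (simp add: r_def prod.remove[of D j] prod.distrib prod_dividef mult.assoc)
  qed
  finally show ?thesis .
qed

subsection \<open>Recursion over columns\<close>

text \<open>The part of a summand of the symmetrization that concerns the first column: one power of
  each variable with positive exponent (\<open>T\<close>), and the pairs between these variables and
  the others.\<close>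

definition hl_W :: "real \<Rightarrow> ('a \<Rightarrow> real) \<Rightarrow> 'a set \<Rightarrow> 'a set \<Rightarrow> real" where
  "hl_W t x S T = (\<Prod>i\<in>T. x i) * (\<Prod>i\<in>T. \<Prod>j\<in>S - T. (x i - t * x j) / (x i - x j))"

text \<open>The symmetrization for the partition with column heights \<open>f 0, f 1, \<dots>\<close>: the sum runs over the
  set \<open>T\<close> of variables whose exponent is positive.\<close>

fun hl_H :: "real \<Rightarrow> ('a \<Rightarrow> real) \<Rightarrow> nat \<Rightarrow> 'a set \<Rightarrow> (nat \<Rightarrow> nat) \<Rightarrow> real" where
  "hl_H t x 0 S f = 1"
| "hl_H t x (Suc K) S f =
    (\<Sum>T | T \<subseteq> S \<and> card T = f 0. hl_W t x S T * hl_H t x K T (\<lambda>k. f (Suc k)))"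

text \<open>The branching sum over heights \<open>g\<close> with \<open>g k \<in> {f k, f k - 1}\<close>; \<open>b\<close> records whether the
  previous column was shortened.\<close>

fun hl_branch :: "real \<Rightarrow> ('a \<Rightarrow> real) \<Rightarrow> real \<Rightarrow> nat \<Rightarrow> 'a set \<Rightarrow> (nat \<Rightarrow> nat) \<Rightarrow> bool \<Rightarrow> real" where
  "hl_branch t x u 0 S f b = 1"
| "hl_branch t x u (Suc K) S f b =
    (\<Sum>T | T \<subseteq> S \<and> card T = f 0. hl_W t x S T * hl_branch t x u K T (\<lambda>k. f (Suc k)) False) +
    (if f 0 = 0 then 0 else (if b then 1 else 1 - t ^ (card S + 1 - f 0)) * u *
      (\<Sum>T | T \<subseteq> S \<and> card T = f 0 - 1. hl_W t x S T * hl_branch t x u K T (\<lambda>k. f (Suc k)) True))"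

lemma hl_W_insert_out:
  assumes "finite S" "z \<notin> S" "T \<subseteq> S"
  shows "hl_W t x (insert z S) T = hl_W t x S T * (\<Prod>i\<in>T. (x i - t * x z) / (x i - x z))"
proof -
  have e: "insert z S - T = insert z (S - T)" "z \<notin> S - T" "finite (S - T)" using assms by auto
  have "(\<Prod>j\<in>insert z (S - T). (x i - t * x j) / (x i - x j)) =
    (x i - t * x z) / (x i - x z) * (\<Prod>j\<in>S - T. (x i - t * x j) / (x i - x j))" for i
    using e by (intro prod.insert)
  thus ?thesis unfolding hl_W_def e(1) by (simp only: prod.distrib mult_ac)
qed

lemma hl_W_insert_in:
  assumes "finite S" "z \<notin> S" "T \<subseteq> S"
  shows "hl_W t x (insert z S) (insert z T) =
    x z * hl_W t x S T * (\<Prod>j\<in>S - T. (x z - t * x j) / (x z - x j))"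
proof -
  have "insert z S - insert z T = S - T" "z \<notin> T" "finite T" using assms finite_subset by auto
  thus ?thesis by (simp add: hl_W_def mult_ac)
qed

lemma hl_W_remove:
  assumes "finite S" "j \<in> S - T" "T \<subseteq> S"
  shows "hl_W t x S T = hl_W t x (S - {j}) T * (\<Prod>i\<in>T. (x i - t * x j) / (x i - x j))"
  using hl_W_insert_out[of "S - {j}" j T t x] assms by (simp add: insert_absorb subset_Diff_insert)

lemma hl_H_insert:
  assumes S: "finite S" "z \<notin> S"
  shows "hl_H t x (Suc K) (insert z S) f =
    (\<Sum>T | T \<subseteq> S \<and> card T = f 0. hl_W t x S T * (\<Prod>i\<in>T. (x i - t * x z) / (x i - x z)) *
      hl_H t x K T (\<lambda>k. f (Suc k))) +
    (if f 0 = 0 then 0 else x z * (\<Sum>T | T \<subseteq> S \<and> card T = f 0 - 1. hl_W t x S T *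
      (\<Prod>j\<in>S - T. (x z - t * x j) / (x z - x j)) * hl_H t x K (insert z T) (\<lambda>k. f (Suc k))))"
proof -
  let ?A = "{T. T \<subseteq> S \<and> card T = f 0}" and ?B = "{T. T \<subseteq> S \<and> Suc (card T) = f 0}"
  let ?F = "\<lambda>T. hl_W t x (insert z S) T * hl_H t x K T (\<lambda>k. f (Suc k))"
  have fin: "finite ?A" "finite ?B" by (rule finite_subset[of _ "Pow S"]; use S in auto)+
  have card_ins: "card (insert z T) = Suc (card T)" if "T \<subseteq> S" for T
    using that S finite_subset[OF that S(1)] by (intro card_insert_disjoint) auto
  have "{T. T \<subseteq> insert z S \<and> card T = f 0} = ?A \<union> insert z ` ?B"
  proof (intro set_eqI iffI)
    fix T assume T: "T \<in> {T. T \<subseteq> insert z S \<and> card T = f 0}"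
    show "T \<in> ?A \<union> insert z ` ?B"
    proof (cases "z \<in> T")
      case True
      hence "T - {z} \<subseteq> S" "T = insert z (T - {z})" using T by auto
      thus ?thesis using T card_ins[of "T - {z}"] by (intro UnI2 image_eqI[of _ _ "T - {z}"]) auto
    qed (use T in auto)
  next
    fix T assume "T \<in> ?A \<union> insert z ` ?B"
    thus "T \<in> {T. T \<subseteq> insert z S \<and> card T = f 0}" using card_ins by auto
  qed
  hence "hl_H t x (Suc K) (insert z S) f = (\<Sum>T\<in>?A \<union> insert z ` ?B. ?F T)" by simp
  also have "\<dots> = (\<Sum>T\<in>?A. ?F T) + (\<Sum>T\<in>insert z ` ?B. ?F T)"
    using fin S by (intro sum.union_disjoint) auto
  also have "(\<Sum>T\<in>insert z ` ?B. ?F T) = (\<Sum>T\<in>?B. ?F (insert z T))"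
    by (intro sum.reindex_cong[of "insert z"]) (use S in \<open>auto simp: inj_on_def\<close>)
  also have "(\<Sum>T\<in>?A. ?F T) = (\<Sum>T\<in>?A. hl_W t x S T * (\<Prod>i\<in>T. (x i - t * x z) / (x i - x z)) *
      hl_H t x K T (\<lambda>k. f (Suc k)))"
    by (intro sum.cong refl) (simp add: hl_W_insert_out[OF S])
  also have "(\<Sum>T\<in>?B. ?F (insert z T)) = (\<Sum>T\<in>?B. x z * (hl_W t x S T *
      (\<Prod>j\<in>S - T. (x z - t * x j) / (x z - x j)) * hl_H t x K (insert z T) (\<lambda>k. f (Suc k))))"
    by (intro sum.cong refl) (simp add: hl_W_insert_in[OF S])
  also have "\<dots> = (if f 0 = 0 then 0 else x z * (\<Sum>T | T \<subseteq> S \<and> card T = f 0 - 1. hl_W t x S T *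
      (\<Prod>j\<in>S - T. (x z - t * x j) / (x z - x j)) * hl_H t x K (insert z T) (\<lambda>k. f (Suc k))))"
  proof (cases "f 0")
    case (Suc r)
    thus ?thesis by (simp add: sum_distrib_left)
  qed simp
  finally show ?thesis .
qed

lemma sum_subsets_swap:
  assumes "finite S"
  shows "(\<Sum>j\<in>S. \<Sum>T | T \<subseteq> S - {j} \<and> card T = r. F j T) =
    (\<Sum>T | T \<subseteq> S \<and> card T = r. \<Sum>j\<in>S - T. F j T)"
proof -
  have fin: "finite {T. T \<subseteq> S \<and> card T = r}" by (rule finite_subset[of _ "Pow S"]) (use assms in auto)
  have "(\<Sum>j\<in>S. \<Sum>T | T \<subseteq> S - {j} \<and> card T = r. F j T) =
    (\<Sum>j\<in>S. \<Sum>T\<in>{T \<in> {T. T \<subseteq> S \<and> card T = r}. j \<notin> T}. F j T)"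
    by (intro sum.cong refl) auto
  also have "\<dots> = (\<Sum>T | T \<subseteq> S \<and> card T = r. \<Sum>j\<in>{j \<in> S. j \<notin> T}. F j T)"
    by (rule sum.swap_restrict) (use assms fin in auto)
  finally show ?thesis by (simp add: set_diff_eq)
qed

lemma sum_subsets_insert:
  assumes "finite S"
  shows "(\<Sum>T | T \<subseteq> S \<and> card T = r. \<Sum>j\<in>S - T. F j T) =
    (\<Sum>T | T \<subseteq> S \<and> card T = Suc r. \<Sum>j\<in>T. F j (T - {j}))"
proof -
  have fin: "finite {T. T \<subseteq> S \<and> card T = k}" for k by (rule finite_subset[of _ "Pow S"]) (use assms in auto)
  have fs: "finite T" if "T \<subseteq> S" for T using that assms finite_subset by blast
  have "(\<Sum>(T, j)\<in>(SIGMA T:{T. T \<subseteq> S \<and> card T = r}. S - T). F j T) =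
    (\<Sum>(T, j)\<in>(SIGMA T:{T. T \<subseteq> S \<and> card T = Suc r}. T). F j (T - {j}))"
    by (rule sum.reindex_bij_witness[of _ "\<lambda>(T, j). (T - {j}, j)" "\<lambda>(T, j). (insert j T, j)"])
      (auto simp: fs insert_absorb card_insert_if)
  thus ?thesis using fin fs assms by (simp add: sum.Sigma)
qed

text \<open>Both directions of the induction over columns: the branching rule itself, and the value of the
  branching sum when the previous column was not shortened.\<close>

lemma hl_H_branch:
  assumes inj: "inj_on x (insert z S)" "finite S" "z \<notin> S" and f: "\<And>k. f (Suc k) \<le> f k"
  shows "f 0 \<le> card S + 1 \<Longrightarrow> hl_H t x K (insert z S) f = hl_branch t x (x z) K S f True"
    and "f 0 \<le> card S \<Longrightarrow>
      (\<Prod>i\<in>S. (x i - t * x z) / (x i - x z)) * hl_H t x K S f +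
      (\<Sum>j\<in>S. (1 - t) * x z / (x z - x j) * (\<Prod>i\<in>S - {j}. (x i - t * x j) / (x i - x j)) *
        hl_H t x K (insert z (S - {j})) f) = hl_branch t x (x z) K S f False"
  using inj f
proof (induction K arbitrary: S f)
  case 0
  {
    case (1 S f) show ?case by simp
  next
    case (2 S f)
    have "x z \<notin> x ` S" "inj_on x S" using 2 by (auto simp: inj_on_def)
    thus ?case using partial_fraction_v[of S x "x z" t] 2 by simp
  }
next
  case (Suc K)
  let ?u = "x z"
  have A: "hl_H t x (Suc K) (insert z S) f = hl_branch t x (x z) (Suc K) S f True"
    if c: "f 0 \<le> card S + 1" and inj: "inj_on x (insert z S)" "finite S" "z \<notin> S"
      and f: "\<And>k. f (Suc k) \<le> f k" for S :: "'a set" and f :: "nat \<Rightarrow> nat"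
  proof -
    let ?f' = "\<lambda>k. f (Suc k)"
    define B where "B T j = (1 - t) * ?u / (?u - x j) * (\<Prod>i\<in>T - {j}. (x i - t * x j) / (x i - x j)) *
        hl_H t x K (insert z (T - {j})) ?f'" for T j
    have u: "?u \<notin> x ` S" and injS: "inj_on x S" using inj by (auto simp: inj_on_def)
    have sub: "finite T" "z \<notin> T" "inj_on x (insert z T)" if "T \<subseteq> S" for T
      using that inj finite_subset by (auto intro: inj_on_subset)
    have IH1: "hl_H t x K (insert z T) ?f' = hl_branch t x ?u K T ?f' True"
      if "T \<subseteq> S" "Suc (card T) = f 0" for T
      using Suc.IH(1)[of ?f' T] sub[OF that(1)] that f[of 0] f by simp
    have IH2: "(\<Prod>i\<in>T. (x i - t * ?u) / (x i - ?u)) * hl_H t x K T ?f' + (\<Sum>j\<in>T. B T j) =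
        hl_branch t x ?u K T ?f' False"
      if "T \<subseteq> S" "card T = f 0" for T
      unfolding B_def using Suc.IH(2)[of ?f' T] sub[OF that(1)] that f[of 0] f by simp
    show ?thesis
    proof (cases "f 0")
      case 0
      have "{T. T \<subseteq> S \<and> card T = 0} = {{}}" using inj(2) finite_subset by fastforce
      thus ?thesis using IH2[of "{}"] 0 unfolding hl_H_insert[OF inj(2,3)] by simp
    next
      case (Suc r)
      \<comment> \<open>Expanding the product over \<open>S - T\<close> by
        \<open>partial_fraction_h\<close> yields the branching term itself, from the summand 1, and
        terms indexed by \<open>j\<close> outside \<open>T\<close>. The latter are regrouped by the
        set \<open>insert j T\<close>, where they complete the left side of the second statement one
        column further.\<close>
      have "?u * (\<Sum>T | T \<subseteq> S \<and> card T = r. hl_W t x S T *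
          (\<Prod>j\<in>S - T. (?u - t * x j) / (?u - x j)) * hl_H t x K (insert z T) ?f') =
        ?u * (\<Sum>T | T \<subseteq> S \<and> card T = r. hl_W t x S T * hl_branch t x ?u K T ?f' True) +
        (\<Sum>T | T \<subseteq> S \<and> card T = r. \<Sum>j\<in>S - T. hl_W t x S (insert j T) * B (insert j T) j)"
        unfolding sum_distrib_left sum.distrib[symmetric]
      proof (intro sum.cong refl)
        fix T assume "T \<in> {T. T \<subseteq> S \<and> card T = r}"
        hence T: "T \<subseteq> S" "card T = r" by auto
        have "?u \<notin> x ` (S - T)" "inj_on x (S - T)" "finite (S - T)"
          using u injS inj by (auto intro: inj_on_subset)
        note pf = partial_fraction_h[OF this(3,2,1), of t]
        have "hl_W t x S (insert j T) * B (insert j T) j =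
          ?u * (hl_W t x S T * ((1 - t) * x j / (?u - x j) * (\<Prod>l\<in>(S - T) - {j}. (x j - t * x l) / (x j - x l))) *
            hl_H t x K (insert z T) ?f')" if j: "j \<in> S - T" for j
        proof -
          have e: "insert j (S - {j}) = S" "(S - {j}) - T = (S - T) - {j}" "insert j T - {j} = T" using j by auto
          have "hl_W t x S (insert j T) = x j * hl_W t x (S - {j}) T *
              (\<Prod>l\<in>(S - T) - {j}. (x j - t * x l) / (x j - x l))"
            using hl_W_insert_in[of "S - {j}" j T t x] T inj j unfolding e by auto
          moreover have "hl_W t x S T = hl_W t x (S - {j}) T * (\<Prod>i\<in>T. (x i - t * x j) / (x i - x j))"
            using hl_W_remove[of S j T t x] T inj j by simp
          ultimately show ?thesis unfolding B_def e by (simp add: mult_ac)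
        qed
        hence "(\<Sum>j\<in>S - T. hl_W t x S (insert j T) * B (insert j T) j) =
          ?u * (hl_W t x S T * ((\<Prod>j\<in>S - T. (?u - t * x j) / (?u - x j)) - 1) *
            hl_H t x K (insert z T) ?f')"
          unfolding pf by (simp add: sum_distrib_left sum_distrib_right)
        thus "?u * (hl_W t x S T * (\<Prod>j\<in>S - T. (?u - t * x j) / (?u - x j)) * hl_H t x K (insert z T) ?f') =
          ?u * (hl_W t x S T * hl_branch t x ?u K T ?f' True) +
          (\<Sum>j\<in>S - T. hl_W t x S (insert j T) * B (insert j T) j)"
          using IH1[OF T(1)] T Suc by (simp add: algebra_simps)
      qed
      also have "(\<Sum>T | T \<subseteq> S \<and> card T = r. \<Sum>j\<in>S - T. hl_W t x S (insert j T) * B (insert j T) j) =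
        (\<Sum>T | T \<subseteq> S \<and> card T = f 0. hl_W t x S T * (\<Sum>j\<in>T. B T j))"
        unfolding sum_subsets_insert[OF inj(2)] Suc sum_distrib_left
        by (intro sum.cong refl) (simp add: insert_absorb)
      finally have "hl_H t x (Suc K) (insert z S) f =
        (\<Sum>T | T \<subseteq> S \<and> card T = f 0. hl_W t x S T * ((\<Prod>i\<in>T. (x i - t * ?u) / (x i - ?u)) * hl_H t x K T ?f' + (\<Sum>j\<in>T. B T j))) +
        ?u * (\<Sum>T | T \<subseteq> S \<and> card T = r. hl_W t x S T * hl_branch t x ?u K T ?f' True)"
        unfolding hl_H_insert[OF inj(2,3)] using Suc by (simp add: distrib_left sum.distrib mult.assoc)
      also have "(\<Sum>T | T \<subseteq> S \<and> card T = f 0. hl_W t x S T * ((\<Prod>i\<in>T. (x i - t * ?u) / (x i - ?u)) * hl_H t x K T ?f' + (\<Sum>j\<in>T. B T j))) =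
        (\<Sum>T | T \<subseteq> S \<and> card T = f 0. hl_W t x S T * hl_branch t x ?u K T ?f' False)"
        by (intro sum.cong refl) (use IH2 in auto)
      finally show ?thesis using Suc by simp
    qed
  qed
  {
    case (1 S f) thus ?case using A by blast
  next
    case (2 S f)
    let ?f' = "\<lambda>k. f (Suc k)"
    have u: "?u \<notin> x ` S" and injS: "inj_on x S" using 2 by (auto simp: inj_on_def)
    have finS: "finite S" and zS: "z \<notin> S" using 2 by auto
    have fin: "finite {T. T \<subseteq> S \<and> card T = k}" for k by (rule finite_subset[of _ "Pow S"]) (use finS in auto)
    define R where "R T j = (1 - t) * ?u / (?u - x j) * (\<Prod>i\<in>T - {j}. (x i - t * x j) / (x i - x j))" for T j
    have RW: "R S j * hl_W t x (S - {j}) T = R (S - T) j * hl_W t x S T" if "T \<subseteq> S" "j \<in> S - T" for T j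
    proof -
      have "S - {j} = (S - T - {j}) \<union> T" "(S - T - {j}) \<inter> T = {}" "finite T" using that finS finite_subset by auto
      hence "(\<Prod>i\<in>S - {j}. (x i - t * x j) / (x i - x j)) =
        (\<Prod>i\<in>S - T - {j}. (x i - t * x j) / (x i - x j)) * (\<Prod>i\<in>T. (x i - t * x j) / (x i - x j))"
        using finS by (simp add: prod.union_disjoint)
      thus ?thesis unfolding R_def using hl_W_remove[of S j T t x] that finS by (simp add: mult_ac)
    qed
    have split: "(\<Prod>i\<in>S. (x i - t * ?u) / (x i - ?u)) =
        (\<Prod>i\<in>T. (x i - t * ?u) / (x i - ?u)) * (\<Prod>i\<in>S - T. (x i - t * ?u) / (x i - ?u))" if "T \<subseteq> S" for T
      using that finS by (subst prod.subset_diff[of T S]) (auto simp: mult.commute)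
    define P where "P T = (\<Prod>i\<in>T. (x i - t * ?u) / (x i - ?u))" for T
    define Q where "Q T = (\<Prod>j\<in>T. (?u - t * x j) / (?u - x j))" for T
    define h1 where "h1 T = hl_H t x K T ?f'" for T
    define h2 where "h2 T = hl_H t x K (insert z T) ?f'" for T
    have h12: "h1 (insert z T) = h2 T" for T by (simp add: h1_def h2_def)
    have sumR: "(\<Sum>j\<in>S. R S j * hl_H t x (Suc K) (insert z (S - {j})) f) =
      (\<Sum>T | T \<subseteq> S \<and> card T = f 0. \<Sum>j\<in>S - T. R (S - T) j * hl_W t x S T * (P T * h1 T)) +
      (if f 0 = 0 then 0 else ?u * (\<Sum>T | T \<subseteq> S \<and> card T = f 0 - 1. \<Sum>j\<in>S - T.
         R (S - T) j * hl_W t x S T * (Q (S - T - {j}) * h2 T)))"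
    proof -
      have each: "R S j * hl_H t x (Suc K) (insert z (S - {j})) f =
        (\<Sum>T | T \<subseteq> S - {j} \<and> card T = f 0. R S j * hl_W t x (S - {j}) T * (P T * h1 T)) +
        (if f 0 = 0 then 0 else ?u * (\<Sum>T | T \<subseteq> S - {j} \<and> card T = f 0 - 1.
           R S j * hl_W t x (S - {j}) T * (Q (S - T - {j}) * h2 T)))" for j
      proof -
        have e: "S - {j} - T = S - T - {j}" for T by auto
        have fz: "finite (S - {j})" "z \<notin> S - {j}" using finS zS by auto
        have 1: "R S j * (\<Sum>T | T \<subseteq> S - {j} \<and> card T = f 0. hl_W t x (S - {j}) T * P T * h1 T) =
          (\<Sum>T | T \<subseteq> S - {j} \<and> card T = f 0. R S j * hl_W t x (S - {j}) T * (P T * h1 T))"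
          unfolding sum_distrib_left by (intro sum.cong refl) (simp only: mult_ac)
        have 2: "R S j * (\<Sum>T | T \<subseteq> S - {j} \<and> card T = f 0 - 1. hl_W t x (S - {j}) T * Q (S - {j} - T) * h2 T) =
          (\<Sum>T | T \<subseteq> S - {j} \<and> card T = f 0 - 1. R S j * hl_W t x (S - {j}) T * (Q (S - T - {j}) * h2 T))"
          unfolding sum_distrib_left e by (intro sum.cong refl) (simp only: mult_ac)
        show ?thesis
          unfolding hl_H_insert[OF fz] P_def[symmetric] Q_def[symmetric] h1_def[symmetric] h12
            1[symmetric] 2[symmetric]
          by (cases "f 0 = 0") (simp_all only: if_True if_False simp_thms distrib_left mult_zero_right mult.left_commute)
      qed
      have 1: "(\<Sum>j\<in>S. \<Sum>T | T \<subseteq> S - {j} \<and> card T = f 0. R S j * hl_W t x (S - {j}) T * (P T * h1 T)) =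
        (\<Sum>T | T \<subseteq> S \<and> card T = f 0. \<Sum>j\<in>S - T. R (S - T) j * hl_W t x S T * (P T * h1 T))"
        unfolding sum_subsets_swap[OF finS]
        by (intro sum.cong refl arg_cong2[where f = times] RW) auto
      have 2: "(\<Sum>j\<in>S. \<Sum>T | T \<subseteq> S - {j} \<and> card T = f 0 - 1. R S j * hl_W t x (S - {j}) T * (Q (S - T - {j}) * h2 T)) =
        (\<Sum>T | T \<subseteq> S \<and> card T = f 0 - 1. \<Sum>j\<in>S - T. R (S - T) j * hl_W t x S T * (Q (S - T - {j}) * h2 T))"
        unfolding sum_subsets_swap[OF finS]
        by (intro sum.cong refl arg_cong2[where f = times] RW) auto
      show ?thesis
      proof (cases "f 0 = 0")
        case True
        show ?thesis using 1 unfolding each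
          by (simp only: True sum.distrib if_True simp_thms sum.neutral_const)
      next
        case False
        thus ?thesis
          by (simp only: each 1 2 sum.distrib if_False simp_thms sum_distrib_left[symmetric])
      qed
    qed
    have first1: "P S * hl_H t x (Suc K) S f = (\<Sum>T | T \<subseteq> S \<and> card T = f 0. P S * hl_W t x S T * h1 T)"
      by (simp add: h1_def sum_distrib_left mult.assoc)
    \<comment> \<open>For fixed \<open>T\<close> the factors over \<open>S - T\<close> add up to 1
      by \<open>partial_fraction_v\<close>.\<close>
    have first2: "(\<Sum>T | T \<subseteq> S \<and> card T = f 0. P S * hl_W t x S T * h1 T) +
      (\<Sum>T | T \<subseteq> S \<and> card T = f 0. \<Sum>j\<in>S - T. R (S - T) j * hl_W t x S T * (P T * h1 T)) =
      (\<Sum>T | T \<subseteq> S \<and> card T = f 0. hl_W t x S T * P T * h1 T)"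
      unfolding sum.distrib[symmetric]
    proof (intro sum.cong refl)
      fix T assume "T \<in> {T. T \<subseteq> S \<and> card T = f 0}"
      hence T: "T \<subseteq> S" by auto
      have "?u \<notin> x ` (S - T)" "inj_on x (S - T)" "finite (S - T)"
        using u injS finS by (auto intro: inj_on_subset)
      note pf = partial_fraction_v[OF this(3,2,1), of t]
      have "P S * hl_W t x S T * h1 T + (\<Sum>j\<in>S - T. R (S - T) j * hl_W t x S T * (P T * h1 T)) =
        hl_W t x S T * P T * h1 T * (P (S - T) + (\<Sum>j\<in>S - T. R (S - T) j))"
        using split[OF T] by (simp add: P_def[symmetric] algebra_simps sum_distrib_left)
      also have "P (S - T) + (\<Sum>j\<in>S - T. R (S - T) j) = 1" using pf by (simp add: P_def R_def)
      finally show "P S * hl_W t x S T * h1 T + (\<Sum>j\<in>S - T. R (S - T) j * hl_W t x S T * (P T * h1 T)) =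
        hl_W t x S T * P T * h1 T" by simp
    qed
    have first: "P S * hl_H t x (Suc K) S f +
      (\<Sum>T | T \<subseteq> S \<and> card T = f 0. \<Sum>j\<in>S - T. R (S - T) j * hl_W t x S T * (P T * h1 T)) =
      (\<Sum>T | T \<subseteq> S \<and> card T = f 0. hl_W t x S T * P T * h1 T)"
      unfolding first1 by (rule first2)
    \<comment> \<open>\<open>partial_fraction_scaled\<close> reproduces the term of
      \<open>hl_H_insert\<close> up to a multiple of \<open>t ^ (card S + 1 - f 0)\<close>. This
      correction turns the coefficient 1 of the flag \<open>True\<close> into the coefficient of the
      flag \<open>False\<close>.\<close>
    have second: "(\<Sum>T | T \<subseteq> S \<and> card T = f 0 - 1. \<Sum>j\<in>S - T. R (S - T) j * hl_W t x S T * (Q (S - T - {j}) * h2 T)) =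
      (\<Sum>T | T \<subseteq> S \<and> card T = f 0 - 1. hl_W t x S T * Q (S - T) * h2 T) -
      t ^ (card S + 1 - f 0) * (\<Sum>T | T \<subseteq> S \<and> card T = f 0 - 1. hl_W t x S T * h2 T)" if "f 0 \<noteq> 0"
      unfolding sum_distrib_left sum_subtractf[symmetric]
    proof (intro sum.cong refl)
      fix T assume "T \<in> {T. T \<subseteq> S \<and> card T = f 0 - 1}"
      hence T: "T \<subseteq> S" "card T = f 0 - 1" by auto
      have "?u \<notin> x ` (S - T)" "inj_on x (S - T)" "finite (S - T)"
        using u injS finS by (auto intro: inj_on_subset)
      note pf = partial_fraction_scaled[OF this(3,2,1), of t]
      have c: "card (S - T) = card S + 1 - f 0"
        using T that finS finite_subset[OF T(1) finS] by (simp add: card_Diff_subset)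
      have "Q (S - T) = t ^ (card S + 1 - f 0) + (\<Sum>j\<in>S - T. R (S - T) j * Q (S - T - {j}))"
        unfolding Q_def R_def pf c by (simp only: prod.distrib mult.assoc)
      hence A1: "(\<Sum>j\<in>S - T. R (S - T) j * Q (S - T - {j})) = Q (S - T) - t ^ (card S + 1 - f 0)" by simp
      have A2: "(\<Sum>j\<in>S - T. R (S - T) j * hl_W t x S T * (Q (S - T - {j}) * h2 T)) =
        (\<Sum>j\<in>S - T. R (S - T) j * Q (S - T - {j})) * (hl_W t x S T * h2 T)"
        unfolding sum_distrib_right by (intro sum.cong refl) (simp only: mult_ac)
      show "(\<Sum>j\<in>S - T. R (S - T) j * hl_W t x S T * (Q (S - T - {j}) * h2 T)) =
        hl_W t x S T * Q (S - T) * h2 T - t ^ (card S + 1 - f 0) * (hl_W t x S T * h2 T)"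
        unfolding A2 A1 left_diff_distrib by (simp only: mult_ac)
    qed
    have h2: "(\<Sum>T | T \<subseteq> S \<and> card T = f 0 - 1. hl_W t x S T * h2 T) =
      (\<Sum>T | T \<subseteq> S \<and> card T = f 0 - 1. hl_W t x S T * hl_branch t x ?u K T ?f' True)" if "f 0 \<noteq> 0"
    proof (intro sum.cong refl)
      fix T assume "T \<in> {T. T \<subseteq> S \<and> card T = f 0 - 1}"
      hence T: "T \<subseteq> S" "card T = f 0 - 1" by auto
      have "h2 T = hl_branch t x ?u K T ?f' True"
        unfolding h2_def using T 2 finite_subset[OF T(1) finS] that
        by (intro Suc.IH(1)) (auto intro: inj_on_subset)
      thus "hl_W t x S T * h2 T = hl_W t x S T * hl_branch t x ?u K T ?f' True" by simp
    qed
    have "P S * hl_H t x (Suc K) S f + (\<Sum>j\<in>S. R S j * hl_H t x (Suc K) (insert z (S - {j})) f) =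
      hl_H t x (Suc K) (insert z S) f -
      (if f 0 = 0 then 0 else t ^ (card S + 1 - f 0) * ?u *
        (\<Sum>T | T \<subseteq> S \<and> card T = f 0 - 1. hl_W t x S T * hl_branch t x ?u K T ?f' True))"
    proof -
      have ins: "hl_H t x (Suc K) (insert z S) f = (\<Sum>T | T \<subseteq> S \<and> card T = f 0. hl_W t x S T * P T * h1 T) +
        (if f 0 = 0 then 0 else ?u * (\<Sum>T | T \<subseteq> S \<and> card T = f 0 - 1. hl_W t x S T * Q (S - T) * h2 T))"
        unfolding hl_H_insert[OF finS zS] P_def Q_def h1_def h2_def ..
      have arith: "a + (b + w * (q - r * h)) = (a + b) + w * q - r * w * h" for a b w q r h :: real
        by (simp add: algebra_simps)
      show ?thesis
      proof (cases "f 0 = 0")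
        case True
        thus ?thesis unfolding sumR ins first[symmetric] by simp
      next
        case False
        show ?thesis
          unfolding sumR ins first[symmetric] h2[OF False, symmetric] second[OF False] if_not_P[OF False]
          by (rule arith)
      qed
    qed
    also have "hl_H t x (Suc K) (insert z S) f = hl_branch t x ?u (Suc K) S f True"
      using A 2 by simp
    also have "\<dots> - (if f 0 = 0 then 0 else t ^ (card S + 1 - f 0) * ?u *
        (\<Sum>T | T \<subseteq> S \<and> card T = f 0 - 1. hl_W t x S T * hl_branch t x ?u K T ?f' True)) =
      hl_branch t x ?u (Suc K) S f False"
    proof -
      have "(a + 1 * w * b) - r * w * b = a + (1 - r) * w * b" for a b w r :: real
        by (simp add: algebra_simps)
      thus ?thesis unfolding hl_branch.simps if_True
        by (cases "f 0 = 0") (simp_all only: if_True if_False simp_thms diff_zero)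
    qed
    finally show ?case unfolding P_def R_def .
  }
qed

subsection \<open>The symmetrization over rearrangements\<close>

lemma hl_W_image:
  assumes "inj_on \<phi> S" "T \<subseteq> S"
  shows "hl_W t x (\<phi> ` S) (\<phi> ` T) = hl_W t (x \<circ> \<phi>) S T"
proof -
  have "\<phi> ` S - \<phi> ` T = \<phi> ` (S - T)" using assms by (simp add: inj_on_image_set_diff)
  moreover have "inj_on \<phi> T" "inj_on \<phi> (S - T)"
    using inj_on_subset[OF assms(1)] assms(2) by auto
  ultimately show ?thesis by (simp add: hl_W_def prod.reindex)
qed

lemma hl_H_image:
  assumes "inj_on \<phi> S"
  shows "hl_H t x K (\<phi> ` S) f = hl_H t (x \<circ> \<phi>) K S f"
  using assms
proof (induction K arbitrary: S f)
  case (Suc K)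
  have card: "card (\<phi> ` T) = card T" if "T \<subseteq> S" for T
    using that Suc.prems by (meson card_image inj_on_subset)
  have "{T. T \<subseteq> \<phi> ` S \<and> card T = f 0} = (`) \<phi> ` {T. T \<subseteq> S \<and> card T = f 0}"
    using card by (auto simp: subset_image_iff)
  moreover have "inj_on ((`) \<phi>) {T. T \<subseteq> S \<and> card T = f 0}"
    using inj_on_image_Pow[OF Suc.prems] by (rule inj_on_subset) auto
  ultimately have "hl_H t x (Suc K) (\<phi> ` S) f = (\<Sum>T | T \<subseteq> S \<and> card T = f 0.
      hl_W t x (\<phi> ` S) (\<phi> ` T) * hl_H t x K (\<phi> ` T) (\<lambda>k. f (Suc k)))"
    by (simp add: sum.reindex)
  also have "\<dots> = hl_H t (x \<circ> \<phi>) (Suc K) S f"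
    unfolding hl_H.simps
    by (intro sum.cong refl arg_cong2[where f = times] hl_W_image[OF Suc.prems] Suc.IH
        inj_on_subset[OF Suc.prems]) auto
  finally show ?case .
qed simp

lemma hl_H_cong:
  assumes "\<And>i. i \<in> S \<Longrightarrow> x i = y i"
  shows "hl_H t x K S f = hl_H t y K S f"
  using assms
proof (induction K arbitrary: S f)
  case (Suc K)
  have "hl_W t x S T = hl_W t y S T" if "T \<subseteq> S" for T
    unfolding hl_W_def using that Suc.prems
    by (intro arg_cong2[where f = times] prod.cong refl) (auto simp: subset_iff)
  moreover have "hl_H t x K T (\<lambda>k. f (Suc k)) = hl_H t y K T (\<lambda>k. f (Suc k))" if "T \<subseteq> S" for T
    using that Suc.prems by (intro Suc.IH) auto
  ultimately show ?case by (auto intro!: sum.cong)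
qed simp

definition hl_term :: "real \<Rightarrow> ('a \<Rightarrow> real) \<Rightarrow> 'a set \<Rightarrow> ('a \<Rightarrow> nat) \<Rightarrow> real" where
  "hl_term t x S \<alpha> = (\<Prod>i\<in>S. x i ^ \<alpha> i) *
    (\<Prod>(i, j) | i \<in> S \<and> j \<in> S \<and> \<alpha> j < \<alpha> i. (x i - t * x j) / (x i - x j))"

text \<open>Peeling off the first column: an exponent function corresponds to its support
  \<open>T\<close> and the function lowered by one on \<open>T\<close>. Pairs inside
  \<open>T\<close> keep their order, and pairs from \<open>T\<close> to its complement make up
  \<open>hl_W\<close>.\<close>

lemma hl_H_eq_sum:
  assumes "finite S" "\<And>k. K \<le> k \<Longrightarrow> f k = 0"
  shows "hl_H t x K S f =
    (\<Sum>\<alpha> | \<alpha> \<in> extensional S \<and> (\<forall>k. card {i \<in> S. k < \<alpha> i} = f k). hl_term t x S \<alpha>)"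
  using assms
proof (induction K arbitrary: S f)
  case 0
  have "{\<alpha>. \<alpha> \<in> extensional S \<and> (\<forall>k. card {i \<in> S. k < \<alpha> i} = f k)} = {\<lambda>i\<in>S. 0}"
  proof (intro set_eqI iffI)
    fix \<alpha> :: "'a \<Rightarrow> nat"
    assume a: "\<alpha> \<in> {\<alpha>. \<alpha> \<in> extensional S \<and> (\<forall>k. card {i \<in> S. k < \<alpha> i} = f k)}"
    hence "card {i \<in> S. 0 < \<alpha> i} = 0" using 0 by auto
    hence "\<alpha> i = 0" if "i \<in> S" for i using 0 that by auto
    thus "\<alpha> \<in> {\<lambda>i\<in>S. 0}" using a by (auto simp: extensional_def restrict_def)
  qed (use 0 in auto)
  thus ?case by (simp add: hl_term_def)
next
  case (Suc K)
  let ?f' = "\<lambda>k. f (Suc k)"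
  let ?A = "\<lambda>S f. {\<alpha> :: 'a \<Rightarrow> nat. \<alpha> \<in> extensional S \<and> (\<forall>k. card {i \<in> S. k < \<alpha> i} = f k)}"
  have finT: "finite T" if "T \<subseteq> S" for T using that Suc.prems finite_subset by blast
  define up :: "'a set \<Rightarrow> ('a \<Rightarrow> nat) \<Rightarrow> 'a \<Rightarrow> nat" where
    "up T \<beta> = (\<lambda>i\<in>S. if i \<in> T then Suc (\<beta> i) else 0)" for T \<beta>
  have trm: "hl_term t x S (up T \<beta>) = hl_W t x S T * hl_term t x T \<beta>" if T: "T \<subseteq> S" for T \<beta>
  proof -
    have "(\<Prod>i\<in>S. x i ^ up T \<beta> i) = (\<Prod>i\<in>T. x i * x i ^ \<beta> i)"
      using T Suc.prems by (intro prod.mono_neutral_cong_right) (auto simp: up_def)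
    moreover have "{(i, j). i \<in> S \<and> j \<in> S \<and> up T \<beta> j < up T \<beta> i} =
      (T \<times> (S - T)) \<union> {(i, j). i \<in> T \<and> j \<in> T \<and> \<beta> j < \<beta> i}"
      using T by (auto simp: up_def split: if_splits)
    moreover have "finite {(i, j). i \<in> T \<and> j \<in> T \<and> \<beta> j < \<beta> i}"
      by (rule finite_subset[of _ "T \<times> T"]) (use finT[OF T] in auto)
    moreover have "(T \<times> (S - T)) \<inter> {(i, j). i \<in> T \<and> j \<in> T \<and> \<beta> j < \<beta> i} = {}" by auto
    ultimately show ?thesis using finT[OF T] Suc.prems
      by (simp add: hl_term_def hl_W_def prod.union_disjoint prod.distrib prod.cartesian_product mult_ac)
  qed
  have heights: "card {i \<in> S. k < up T \<beta> i} = (if k = 0 then card T else card {i \<in> T. k - 1 < \<beta> i})"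
    if "T \<subseteq> S" for T \<beta> k
  proof -
    have "{i \<in> S. k < up T \<beta> i} = (if k = 0 then T else {i \<in> T. k - 1 < \<beta> i})"
      using that by (auto simp: up_def split: if_splits)
    thus ?thesis by simp
  qed
  have "(\<Sum>(T, \<beta>)\<in>(SIGMA T:{T. T \<subseteq> S \<and> card T = f 0}. ?A T ?f'). hl_W t x S T * hl_term t x T \<beta>) =
    (\<Sum>\<alpha>\<in>?A S f. hl_term t x S \<alpha>)"
  proof (rule sum.reindex_bij_witness[of _ "\<lambda>\<alpha>. ({i \<in> S. 0 < \<alpha> i}, \<lambda>i\<in>{i \<in> S. 0 < \<alpha> i}. \<alpha> i - 1)" "\<lambda>(T, \<beta>). up T \<beta>"])
    fix a assume a: "a \<in> (SIGMA T:{T. T \<subseteq> S \<and> card T = f 0}. ?A T ?f')"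
    obtain T \<beta> where T: "a = (T, \<beta>)" "T \<subseteq> S" "card T = f 0" "\<beta> \<in> ?A T ?f'" using a by auto
    have "{i \<in> S. 0 < up T \<beta> i} = T" using T(2) by (auto simp: up_def split: if_splits)
    moreover have "(\<lambda>i\<in>T. up T \<beta> i - 1) = \<beta>" using T by (auto simp: up_def extensional_def fun_eq_iff)
    ultimately show "({i \<in> S. 0 < (case a of (T, \<beta>) \<Rightarrow> up T \<beta>) i},
        \<lambda>i\<in>{i \<in> S. 0 < (case a of (T, \<beta>) \<Rightarrow> up T \<beta>) i}. (case a of (T, \<beta>) \<Rightarrow> up T \<beta>) i - 1) = a"
      using T(1) by simp
    show "(case a of (T, \<beta>) \<Rightarrow> up T \<beta>) \<in> ?A S f"
      using T heights[OF T(2)] by (auto simp: up_def gr0_conv_Suc)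
    show "hl_term t x S (case a of (T, \<beta>) \<Rightarrow> up T \<beta>) = (case a of (T, \<beta>) \<Rightarrow> hl_W t x S T * hl_term t x T \<beta>)"
      using T trm by simp
  next
    fix \<alpha> assume \<alpha>: "\<alpha> \<in> ?A S f"
    let ?T = "{i \<in> S. 0 < \<alpha> i}"
    show "(case (?T, \<lambda>i\<in>?T. \<alpha> i - 1) of (T, \<beta>) \<Rightarrow> up T \<beta>) = \<alpha>"
      using \<alpha> by (auto simp: up_def extensional_def fun_eq_iff)
    have "{i \<in> ?T. k < (\<lambda>i\<in>?T. \<alpha> i - 1) i} = {i \<in> S. Suc k < \<alpha> i}" for k by auto
    thus "(?T, \<lambda>i\<in>?T. \<alpha> i - 1) \<in> (SIGMA T:{T. T \<subseteq> S \<and> card T = f 0}. ?A T ?f')"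
      using \<alpha> by auto
  qed
  moreover have "finite (?A T ?f')" if "T \<subseteq> S" for T
  proof (rule finite_subset)
    show "?A T ?f' \<subseteq> PiE T (\<lambda>_. {..K})"
    proof
      fix \<beta> assume \<beta>: "\<beta> \<in> ?A T ?f'"
      have "\<beta> i \<le> K" if "i \<in> T" for i
      proof (rule ccontr)
        assume "\<not> \<beta> i \<le> K"
        hence "{i \<in> T. K < \<beta> i} \<noteq> {}" using that by auto
        moreover have "card {i \<in> T. K < \<beta> i} = 0" using \<beta> Suc.prems(2)[of "Suc K"] by auto
        ultimately show False using finT[OF \<open>T \<subseteq> S\<close>] by auto
      qed
      thus "\<beta> \<in> PiE T (\<lambda>_. {..K})" using \<beta> by (auto simp: PiE_def)
    qed
  qed (use finT[OF that] in \<open>auto intro!: finite_PiE\<close>)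
  moreover have "finite {T. T \<subseteq> S \<and> card T = f 0}"
    by (rule finite_subset[of _ "Pow S"]) (use Suc.prems in auto)
  ultimately have "(\<Sum>\<alpha>\<in>?A S f. hl_term t x S \<alpha>) =
    (\<Sum>T | T \<subseteq> S \<and> card T = f 0. \<Sum>\<beta>\<in>?A T ?f'. hl_W t x S T * hl_term t x T \<beta>)"
    by (simp add: sum.Sigma)
  also have "\<dots> = hl_H t x (Suc K) S f"
    using Suc.IH[of _ ?f'] Suc.prems finT by (auto intro!: sum.cong simp: sum_distrib_left[symmetric])
  finally show ?case by simp
qed

definition nht :: "nat list \<Rightarrow> nat \<Rightarrow> nat" where
  "nht p k = length (filter (\<lambda>a. k < a) p)"

lemma ht_map_int: "ht (map int p) k = (if k < 0 then int (length p) else int (nht p (nat k)))"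
  by (induction p) (auto simp: ht_Cons nht_def nat_less_iff)

lemma mset_eq_nht:
  assumes "length p = length q" "\<And>k. nht p k = nht q k"
  shows "mset p = mset q"
proof -
  have "mset (map int p) = mset (map int q)"
    by (rule mset_eq_ht) (simp add: ht_map_int assms)
  thus ?thesis using multiset.inj_map[of int] by (simp add: inj_def)
qed

lemma nht_mset: "mset p = mset q \<Longrightarrow> nht p k = nht q k"
  by (metis nht_def mset_filter size_mset)

text \<open>A rearrangement of \<open>p\<close> is an exponent function with the heights of
  \<open>p\<close>, because the heights determine a multiset of given size.\<close>

lemma hl_sym_eq_hl_H:
  assumes len: "length p = length xs" and K: "\<And>a. a \<in> set p \<Longrightarrow> a \<le> K"
  shows "hl_sym t p xs = hl_H t ((!) xs) K {..<length xs} (nht p)"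
proof -
  let ?n = "length xs"
  have "nht p k = 0" if "K \<le> k" for k using K that by (force simp: nht_def filter_empty_conv)
  hence "hl_H t ((!) xs) K {..<?n} (nht p) =
    (\<Sum>\<alpha> | \<alpha> \<in> extensional {..<?n} \<and> (\<forall>k. card {i \<in> {..<?n}. k < \<alpha> i} = nht p k). hl_term t ((!) xs) {..<?n} \<alpha>)"
    by (intro hl_H_eq_sum) auto
  also have "\<dots> = hl_sym t p xs"
    unfolding hl_sym_def
  proof (rule sum.reindex_bij_witness[of _ "\<lambda>\<alpha>. restrict ((!) \<alpha>) {..<?n}" "\<lambda>g. map g [0..<?n]"])
    fix g assume g: "g \<in> {\<alpha>. \<alpha> \<in> extensional {..<?n} \<and> (\<forall>k. card {i \<in> {..<?n}. k < \<alpha> i} = nht p k)}"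
    show "restrict ((!) (map g [0..<?n])) {..<?n} = g"
      using g by (auto simp: extensional_def fun_eq_iff)
    have "nht (map g [0..<?n]) k = nht p k" for k
    proof -
      have "nht (map g [0..<?n]) k = card {i. i < ?n \<and> k < map g [0..<?n] ! i}"
        unfolding nht_def length_filter_conv_card by simp
      also have "{i. i < ?n \<and> k < map g [0..<?n] ! i} = {i \<in> {..<?n}. k < g i}" by auto
      finally show ?thesis using g by simp
    qed
    hence "mset (map g [0..<?n]) = mset p" using len by (intro mset_eq_nht) auto
    thus "map g [0..<?n] \<in> permutations_of_multiset (mset p)" by (simp add: permutations_of_multiset_def)
    show "(\<Prod>i<?n. xs ! i ^ (map g [0..<?n] ! i)) *
      (\<Prod>(i, j) | i < ?n \<and> j < ?n \<and> map g [0..<?n] ! i > map g [0..<?n] ! j. (xs ! i - t * xs ! j) / (xs ! i - xs ! j)) =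
      hl_term t ((!) xs) {..<?n} g"
      unfolding hl_term_def by (intro arg_cong2[where f = times] prod.cong) auto
  next
    fix \<alpha> assume "\<alpha> \<in> permutations_of_multiset (mset p)"
    hence m: "mset \<alpha> = mset p" by (simp add: permutations_of_multiset_def)
    hence l: "length \<alpha> = ?n" using len by (metis size_mset)
    show "map (restrict ((!) \<alpha>) {..<?n}) [0..<?n] = \<alpha>" using l by (intro nth_equalityI) auto
    have "card {i \<in> {..<?n}. k < restrict ((!) \<alpha>) {..<?n} i} = nht p k" for k
    proof -
      have "{i \<in> {..<?n}. k < restrict ((!) \<alpha>) {..<?n} i} = {i. i < length \<alpha> \<and> k < \<alpha> ! i}" using l by auto
      hence "card {i \<in> {..<?n}. k < restrict ((!) \<alpha>) {..<?n} i} = nht \<alpha> k"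
        by (simp add: nht_def length_filter_conv_card)
      thus ?thesis using nht_mset[OF m] by simp
    qed
    thus "restrict ((!) \<alpha>) {..<?n} \<in> {\<alpha>. \<alpha> \<in> extensional {..<?n} \<and> (\<forall>k. card {i \<in> {..<?n}. k < \<alpha> i} = nht p k)}"
      by simp
  qed
  finally show ?thesis by simp
qed

subsection \<open>Horizontal strips and the branching rule\<close>

lemma partition_ht_0: "is_partition p \<Longrightarrow> nht p 0 = length p"
  unfolding nht_def is_partition_def by (metis filter_True gr0I)

lemma partition_map_int_Sig: "is_partition p \<Longrightarrow> map int p \<in> Sig (length p)"
  by (auto simp: is_partition_def Sig_def sorted_wrt_map)

lemma partition_eqI:
  assumes "is_partition p" "is_partition q" "\<And>k. nht p k = nht q k"
  shows "p = q"
proof -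
  have len: "length p = length q" using partition_ht_0 assms by metis
  have "map int p = map int q"
    using partition_map_int_Sig[OF assms(1)] partition_map_int_Sig[OF assms(2)] len assms(3)
    by (intro Sig_eqI[of _ "length p"]) (auto simp: ht_map_int)
  thus ?thesis by (metis inj_map_eq_map inj_of_nat)
qed

lemma nht_antimono: "k \<le> k' \<Longrightarrow> nht p k' \<le> nht p k"
  by (induction p) (auto simp: nht_def)

lemma nht_eq_0: "(\<And>a. a \<in> set p \<Longrightarrow> a \<le> k) \<Longrightarrow> nht p k = 0"
  by (auto simp: nht_def filter_empty_conv not_less)

lemma nht_pos: "a \<in> set p \<Longrightarrow> k < a \<Longrightarrow> 0 < nht p k"
  by (auto simp: nht_def filter_empty_conv)

lemma partition_exists:
  assumes g: "\<And>k. g (Suc k) \<le> g k" "\<And>k. K \<le> k \<Longrightarrow> g k = 0"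
  obtains q where "is_partition q" "\<And>k. nht q k = g k"
proof -
  obtain l where l: "l \<in> Sig (g 0)" "\<And>k. ht l k = (if k < 0 then int (g 0) else int (g (nat k)))"
  proof (rule Sig_exists[of "\<lambda>k. if k < 0 then int (g 0) else int (g (nat k))" 0 "g 0" "int K"])
    fix k :: int
    have "nat (k + 1) = Suc (nat k)" if "0 \<le> k" using that by simp
    thus "(if k + 1 < 0 then int (g 0) else int (g (nat (k + 1)))) \<le> (if k < 0 then int (g 0) else int (g (nat k)))"
      using g(1)[of "nat k"] by (cases "k = -1") auto
    show "k < 0 \<Longrightarrow> (if k < 0 then int (g 0) else int (g (nat k))) = int (g 0)" by simp
    show "int K \<le> k \<Longrightarrow> (if k < 0 then int (g 0) else int (g (nat k))) = 0" using g(2)[of "nat k"] by auto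
  qed blast
  have "\<forall>a\<in>set l. 0 < a" using l SigD(1)[OF l(1)] by (simp flip: ht_eq_length_iff)
  hence m: "map int (map nat l) = l" by (induction l) auto
  have "is_partition (map nat l)"
    using \<open>\<forall>a\<in>set l. 0 < a\<close> SigD(2)[OF l(1)]
    by (auto simp: is_partition_def sorted_wrt_map elim!: sorted_wrt_mono_rel[rotated])
  moreover have "nht (map nat l) k = g k" for k
    using ht_map_int[of "map nat l" "int k"] l(2)[of "int k"] unfolding m by simp
  ultimately show thesis by (rule that)
qed

text \<open>Column form of two relations between diagrams: \<open>p\<close>/\<open>q\<close> is a
  horizontal strip, and, for \<open>below'\<close>, plain containment of \<open>q\<close> in
  \<open>p\<close>.\<close>

definition below :: "nat list \<Rightarrow> nat list set" where
  "below p = {q. is_partition q \<and> (\<forall>k. nht q k \<le> nht p k \<and> nht p k \<le> Suc (nht q k))}"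

definition below' :: "nat list \<Rightarrow> nat list set" where
  "below' p = {q. is_partition q \<and> (\<forall>k. nht q k \<le> nht p k)}"

lemma below_subset: "below p \<subseteq> below' p"
  by (auto simp: below_def below'_def)

lemma finite_below': "finite (below' p)"
proof (rule finite_subset)
  show "below' p \<subseteq> {q. set q \<subseteq> {..sum_list p} \<and> length q \<le> length p}"
  proof
    fix q assume q: "q \<in> below' p"
    have "nht q 0 \<le> nht p 0" using q unfolding below'_def by blast
    moreover have "nht q 0 = length q" using q partition_ht_0[of q] by (simp add: below'_def)
    moreover have "nht p 0 \<le> length p" by (simp add: nht_def)
    moreover have "a \<le> sum_list p" if "a \<in> set q" for a
    proof (cases "a = 0")
      case False
      hence "0 < nht q (a - 1)" using that nht_pos[of a q "a - 1"] by simp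
      moreover have "nht q (a - 1) \<le> nht p (a - 1)" using q by (auto simp: below'_def)
      ultimately have "nht p (a - 1) \<noteq> 0" by simp
      then obtain b where b: "b \<in> set p" "a - 1 < b" using nht_eq_0[of p "a - 1"] by (meson not_le)
      thus ?thesis using member_le_sum_list[of b p] False by simp
    qed simp
    ultimately show "q \<in> {q. set q \<subseteq> {..sum_list p} \<and> length q \<le> length p}" by auto
  qed
qed (simp add: finite_lists_length_le)

lemma finite_below: "finite (below p)"
  using finite_below' below_subset finite_subset by blast

lemma sum_list_nht: "(\<And>a. a \<in> set p \<Longrightarrow> a \<le> K) \<Longrightarrow> sum_list p = (\<Sum>k<K. nht p k)"
proof (induction p)
  case (Cons a p)
  have "(\<Sum>k<K. if k < a then 1 else 0 :: nat) = (\<Sum>k<a. 1)"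
    using Cons.prems[of a] by (intro sum.mono_neutral_cong_right) auto
  moreover have "nht (a # p) k = nht p k + (if k < a then 1 else 0)" for k by (simp add: nht_def)
  ultimately show ?case using Cons by (simp add: sum.distrib)
qed (simp add: nht_def)

text \<open>The coefficient of one term in the expansion of \<open>hl_branch\<close>:
  \<open>f\<close> holds the heights of the large partition, \<open>g\<close> those of the small
  one, and \<open>n\<close> is the height of the small one in the preceding column, initially the
  number of variables left.\<close>

fun branch_coeff :: "real \<Rightarrow> real \<Rightarrow> nat \<Rightarrow> (nat \<Rightarrow> nat) \<Rightarrow> nat \<Rightarrow> bool \<Rightarrow> (nat \<Rightarrow> nat) \<Rightarrow> real" where
  "branch_coeff t u 0 f n b g = 1"
| "branch_coeff t u (Suc K) f n b g =
    (if f 0 = Suc (g 0) then (if b then 1 else 1 - t ^ (n - g 0)) * u else 1) *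
    branch_coeff t u K (\<lambda>k. f (Suc k)) (g 0) (f 0 = Suc (g 0)) (\<lambda>k. g (Suc k))"

definition strips :: "nat \<Rightarrow> (nat \<Rightarrow> nat) \<Rightarrow> nat \<Rightarrow> (nat \<Rightarrow> nat) set" where
  "strips K f n = {g. (\<forall>k. g (Suc k) \<le> g k) \<and> g 0 \<le> n \<and> (\<forall>k. g k \<le> f k \<and> f k \<le> Suc (g k)) \<and> (\<forall>k\<ge>K. g k = 0)}"

lemma finite_strips: "finite (strips K f n)"
proof (rule finite_subset)
  show "strips K f n \<subseteq> {g. \<forall>k. (k \<in> {..<K} \<longrightarrow> g k \<in> {..Max (f ` {..<K})}) \<and> (k \<notin> {..<K} \<longrightarrow> g k = 0)}"
    by (auto simp: strips_def intro: order.trans[OF _ Max_ge])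
qed (rule finite_set_of_finite_funs; simp)

text \<open>Choosing the size of \<open>T\<close> in every column amounts to choosing the heights of
  a strip. Sizes beyond \<open>card S\<close> belong to empty sums over subsets, which accounts for
  the bound in \<open>strips\<close>.\<close>

lemma hl_branch_eq_sum:
  assumes "finite S" "\<And>k. K \<le> k \<Longrightarrow> f k = 0"
  shows "hl_branch t x u K S f b =
    (\<Sum>g\<in>strips K f (card S). branch_coeff t u K f (card S) b g * hl_H t x K S g)"
  using assms
proof (induction K arbitrary: S f b)
  case 0
  hence "strips 0 f (card S) = {\<lambda>_. 0}" by (auto simp: strips_def)
  thus ?case by simp
next
  case (Suc K)
  let ?f' = "\<lambda>k. f (Suc k)" and ?n = "card S"
  define A where "A = {r. r \<le> ?n \<and> r \<le> f 0 \<and> f 0 \<le> Suc r}"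
  define C where "C r = (if f 0 = Suc r then (if b then 1 else 1 - t ^ (?n - r)) * u else 1)" for r
  define B where "B r = (\<Sum>T | T \<subseteq> S \<and> card T = r. hl_W t x S T * hl_branch t x u K T ?f' (f 0 = Suc r))" for r
  have finA: "finite A" by (rule finite_subset[of _ "{..?n}"]) (auto simp: A_def)
  have finT: "finite T" if "T \<subseteq> S" for T using that Suc.prems finite_subset by blast
  have "(\<Sum>g\<in>strips (Suc K) f ?n. branch_coeff t u (Suc K) f ?n b g * hl_H t x (Suc K) S g) =
    (\<Sum>(r, g)\<in>(SIGMA r:A. strips K ?f' r). branch_coeff t u (Suc K) f ?n b (case_nat r g) * hl_H t x (Suc K) S (case_nat r g))"
  proof (rule sum.reindex_bij_witness[of _ "\<lambda>(r, g). case_nat r g" "\<lambda>g. (g 0, \<lambda>k. g (Suc k))"])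
    fix g assume g: "g \<in> strips (Suc K) f ?n"
    show "(g 0, \<lambda>k. g (Suc k)) \<in> (SIGMA r:A. strips K ?f' r)"
      using g by (auto simp: strips_def A_def)
    show c: "(case (g 0, \<lambda>k. g (Suc k)) of (r, g) \<Rightarrow> case_nat r g) = g"
      by (auto simp: fun_eq_iff split: nat.splits)
    show "(case (g 0, \<lambda>k. g (Suc k)) of (r, g) \<Rightarrow> branch_coeff t u (Suc K) f ?n b (case_nat r g) *
      hl_H t x (Suc K) S (case_nat r g)) = branch_coeff t u (Suc K) f ?n b g * hl_H t x (Suc K) S g"
      using c by simp
  next
    fix a assume a: "a \<in> (SIGMA r:A. strips K ?f' r)"
    then obtain r g where rg: "a = (r, g)" "r \<in> A" "g \<in> strips K ?f' r" by auto
    show "((case a of (r, g) \<Rightarrow> case_nat r g) 0, \<lambda>k. (case a of (r, g) \<Rightarrow> case_nat r g) (Suc k)) = a"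
      using rg by simp
    have "case_nat r g \<in> strips (Suc K) f ?n" unfolding strips_def
    proof (safe)
      fix k show "case_nat r g (Suc k) \<le> case_nat r g k" using rg by (cases k) (auto simp: strips_def)
      show "case_nat r g k \<le> f k" "f k \<le> Suc (case_nat r g k)" 
        using rg by (cases k; auto simp: strips_def A_def)+
      show "Suc K \<le> k \<Longrightarrow> case_nat r g k = 0" using rg by (cases k) (auto simp: strips_def)
    qed (use rg in \<open>auto simp: A_def\<close>)
    thus "(case a of (r, g) \<Rightarrow> case_nat r g) \<in> strips (Suc K) f ?n" using rg by simp
  qed
  also have "\<dots> = (\<Sum>r\<in>A. \<Sum>g\<in>strips K ?f' r. branch_coeff t u (Suc K) f ?n b (case_nat r g) * hl_H t x (Suc K) S (case_nat r g))"
    using finA finite_strips by (simp add: sum.Sigma)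
  also have "\<dots> = (\<Sum>r\<in>A. C r * B r)"
  proof (intro sum.cong refl)
    fix r
    have "(\<Sum>g\<in>strips K ?f' r. branch_coeff t u (Suc K) f ?n b (case_nat r g) * hl_H t x (Suc K) S (case_nat r g)) =
      C r * (\<Sum>g\<in>strips K ?f' r. \<Sum>T | T \<subseteq> S \<and> card T = r. hl_W t x S T *
        (branch_coeff t u K ?f' r (f 0 = Suc r) g * hl_H t x K T g))"
      by (simp add: C_def sum_distrib_left mult_ac)
    also have "\<dots> = C r * (\<Sum>T | T \<subseteq> S \<and> card T = r. hl_W t x S T *
        (\<Sum>g\<in>strips K ?f' r. branch_coeff t u K ?f' r (f 0 = Suc r) g * hl_H t x K T g))"
      by (subst sum.swap) (simp add: sum_distrib_left)
    also have "\<dots> = C r * B r"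
      unfolding B_def using Suc.IH[of _ ?f'] Suc.prems finT
      by (intro arg_cong2[where f = times] refl sum.cong) auto
    finally show "(\<Sum>g\<in>strips K ?f' r. branch_coeff t u (Suc K) f ?n b (case_nat r g) * hl_H t x (Suc K) S (case_nat r g)) = C r * B r" .
  qed
  also have "\<dots> = (\<Sum>r\<in>(if f 0 = 0 then {0} else {f 0, f 0 - 1}). C r * B r)"
  proof (rule sum.mono_neutral_left)
    show "\<forall>r\<in>(if f 0 = 0 then {0} else {f 0, f 0 - 1}) - A. C r * B r = 0"
    proof
      fix r assume "r \<in> (if f 0 = 0 then {0} else {f 0, f 0 - 1}) - A"
      hence "?n < r" by (auto simp: A_def split: if_splits)
      hence "card T \<noteq> r" if "T \<subseteq> S" for T using card_mono[OF Suc.prems(1) that] by simp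
      hence "{T. T \<subseteq> S \<and> card T = r} = {}" by blast
      thus "C r * B r = 0" unfolding B_def by (simp only: sum.empty mult_zero_right)
    qed
  qed (auto simp: A_def)
  also have "\<dots> = hl_branch t x u (Suc K) S f b"
  proof (cases "f 0")
    case 0 thus ?thesis by (simp add: C_def B_def)
  next
    case (Suc r)
    have "f 0 \<noteq> Suc (f 0)" by simp
    thus ?thesis using Suc by (simp add: C_def B_def)
  qed
  finally show ?case by (rule sym)
qed

text \<open>All factors compare two consecutive columns of \<open>g\<close>, except the first one,
  which involves \<open>n\<close>. With the flag \<open>True\<close> that factor is absent and
  Macdonald's \<psi> remains, so the result does not depend on the number of variables.\<close>

lemma branch_coeff_eq_prod:
  assumes "\<And>k. g k \<le> f k \<and> f k \<le> Suc (g k)"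
  shows "branch_coeff t u K f n b g = (if 0 < K \<and> \<not> b \<and> f 0 = Suc (g 0) then 1 - t ^ (n - g 0) else 1) *
    (\<Prod>k<K - 1. if f k = g k \<and> f (Suc k) = Suc (g (Suc k)) then 1 - t ^ (g k - g (Suc k)) else 1) *
    u ^ (\<Sum>k<K. f k - g k)"
  using assms
proof (induction K arbitrary: f n b g)
  case (Suc K)
  have fg: "f 0 \<noteq> Suc (g 0) \<longleftrightarrow> f 0 = g 0" using Suc.prems[of 0] by auto
  have IH: "branch_coeff t u K (\<lambda>k. f (Suc k)) (g 0) (f 0 = Suc (g 0)) (\<lambda>k. g (Suc k)) =
    (if 0 < K \<and> f 0 = g 0 \<and> f (Suc 0) = Suc (g (Suc 0)) then 1 - t ^ (g 0 - g (Suc 0)) else 1) *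
    (\<Prod>k<K - 1. if f (Suc k) = g (Suc k) \<and> f (Suc (Suc k)) = Suc (g (Suc (Suc k))) then 1 - t ^ (g (Suc k) - g (Suc (Suc k))) else 1) *
    u ^ (\<Sum>k<K. f (Suc k) - g (Suc k))"
    using Suc.IH[of "\<lambda>k. g (Suc k)" "\<lambda>k. f (Suc k)" "g 0" "f 0 = Suc (g 0)"] Suc.prems fg by simp
  have s: "(\<Sum>k<Suc K. f k - g k) = (f 0 - g 0) + (\<Sum>k<K. f (Suc k) - g (Suc k))"
    by (rule sum.lessThan_Suc_shift)
  have p: "(\<Prod>k<K. if f k = g k \<and> f (Suc k) = Suc (g (Suc k)) then 1 - t ^ (g k - g (Suc k)) else 1) =
    (if 0 < K \<and> f 0 = g 0 \<and> f (Suc 0) = Suc (g (Suc 0)) then 1 - t ^ (g 0 - g (Suc 0)) else 1) *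
    (\<Prod>k<K - 1. if f (Suc k) = g (Suc k) \<and> f (Suc (Suc k)) = Suc (g (Suc (Suc k))) then 1 - t ^ (g (Suc k) - g (Suc (Suc k))) else 1)"
  proof (cases K)
    case (Suc K')
    show ?thesis unfolding Suc by (subst prod.lessThan_Suc_shift) simp
  qed simp
  have q: "(if f 0 = Suc (g 0) then (if b then 1 else 1 - t ^ (n - g 0)) * u else 1) =
    (if \<not> b \<and> f 0 = Suc (g 0) then 1 - t ^ (n - g 0) else 1) * u ^ (f 0 - g 0)"
    using fg by auto
  show ?case unfolding branch_coeff.simps IH s q using p by (simp add: power_add mult_ac)
qed simp

lemma hl_psi_eq_prod_nat:
  assumes p: "\<And>a. a \<in> set p \<Longrightarrow> a \<le> K"
  shows "hl_psi t (map int p) (map int q) =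
    (\<Prod>k<K - 1. if nht p k = nht q k \<and> nht p (Suc k) = Suc (nht q (Suc k)) then 1 - t ^ (nht q k - nht q (Suc k)) else 1)"
proof -
  let ?J = "{k. k < K - 1 \<and> nht p k = nht q k \<and> nht p (Suc k) = Suc (nht q (Suc k))}"
  have nS: "nat (1 + int j) = Suc j" "nat (int j + 1) = Suc j" for j by auto
  have nD: "nat (int a - int b) = a - b" for a b by arith
  have *: "{k. 0 < k \<and> ht (map int p) (k - 1) = ht (map int q) (k - 1) \<and> ht (map int p) k = ht (map int q) k + 1} =
    (\<lambda>k. int (Suc k)) ` ?J"
  proof (intro set_eqI iffI)
    fix k assume k: "k \<in> {k. 0 < k \<and> ht (map int p) (k - 1) = ht (map int q) (k - 1) \<and> ht (map int p) k = ht (map int q) k + 1}"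
    define j where "j = nat (k - 1)"
    have j: "k = int (Suc j)" "k - 1 = int j" using k by (auto simp: j_def)
    have e: "nht p j = nht q j" "nht p (Suc j) = Suc (nht q (Suc j))" using k unfolding j ht_map_int by (auto simp: nS)
    have "Suc j < K" using nht_eq_0[of p "Suc j"] e(2) p by (metis Zero_not_Suc le_trans not_le)
    thus "k \<in> (\<lambda>k. int (Suc k)) ` ?J" using j e by (intro image_eqI[of _ _ j]) auto
  qed (auto simp: ht_map_int nS)
  have "hl_psi t (map int p) (map int q) = (\<Prod>k\<in>?J. 1 - t ^ (nht q k - nht q (Suc k)))"
    unfolding hl_psi_def * by (subst prod.reindex) (auto simp: inj_on_def ht_map_int nS nD intro!: prod.cong)
  also have "\<dots> = (\<Prod>k<K - 1. if nht p k = nht q k \<and> nht p (Suc k) = Suc (nht q (Suc k)) then 1 - t ^ (nht q k - nht q (Suc k)) else 1)"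
    by (rule prod.mono_neutral_cong_left) auto
  finally show ?thesis .
qed

lemma branch_coeff_below:
  assumes p: "\<And>a. a \<in> set p \<Longrightarrow> a \<le> K" and q: "q \<in> below p"
  shows "branch_coeff t u K (nht p) n True (nht q) = hl_psi t (map int p) (map int q) * u ^ (sum_list p - sum_list q)"
proof -
  have qK: "a \<le> K" if "a \<in> set q" for a
  proof (rule ccontr)
    assume "\<not> a \<le> K"
    hence "0 < nht q K" using that nht_pos[of a q K] by simp
    moreover have "nht q K \<le> nht p K" using q by (auto simp: below_def)
    ultimately show False using nht_eq_0[of p K] p by simp
  qed
  have le: "nht q k \<le> nht p k" for k using q by (auto simp: below_def)
  have "(\<Sum>k<K. nht p k - nht q k) = sum_list p - sum_list q"
    using p qK le by (simp add: sum_list_nht[of p K] sum_list_nht[of q K] sum_subtractf_nat)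
  thus ?thesis
    using branch_coeff_eq_prod[of "nht q" "nht p" t u K n True] q hl_psi_eq_prod_nat[of p K t q] p
    by (simp add: below_def)
qed

text \<open>The Hall-Littlewood polynomial by repeated branching; no genericity of the variables is needed.\<close>

fun hl_poly :: "real \<Rightarrow> nat list \<Rightarrow> real list \<Rightarrow> real" where
  "hl_poly t p [] = of_bool (p = [])"
| "hl_poly t p (x # xs) = (\<Sum>q\<in>below p. hl_psi t (map int p) (map int q) * x ^ (sum_list p - sum_list q) * hl_poly t q xs)"

lemma hl_poly_eq_0: "is_partition p \<Longrightarrow> length xs < length p \<Longrightarrow> hl_poly t p xs = 0"
proof (induction xs arbitrary: p)
  case (Cons x xs)
  have "hl_poly t q xs = 0" if q: "q \<in> below p" for q
  proof (rule Cons.IH)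
    have "nht p 0 \<le> Suc (nht q 0)" "is_partition q" using q by (auto simp: below_def)
    thus "length xs < length q" "is_partition q" using Cons.prems by (auto simp: partition_ht_0)
  qed
  thus ?case by simp
qed simp

lemma hl_H_empty: "(\<And>k. f k = 0) \<Longrightarrow> hl_H t x K {} f = 1"
proof (induction K arbitrary: f)
  case (Suc K)
  have "{T :: 'a set. T \<subseteq> {} \<and> card T = f 0} = {{}}" using Suc.prems by auto
  thus ?case using Suc by (simp add: hl_W_def)
qed simp

lemma hl_H_eq_hl_poly:
  assumes "distinct xs" "is_partition p" "length p \<le> length xs" "\<And>a. a \<in> set p \<Longrightarrow> a \<le> K"
  shows "hl_H t ((!) xs) K {..<length xs} (nht p) = hl_poly t p xs"
  using assms
proof (induction xs arbitrary: p)
  case Nil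
  thus ?case by (simp add: hl_H_empty nht_def)
next
  case (Cons x xs)
  let ?n = "length xs" and ?S = "Suc ` {..<length xs}" and ?x = "(!) (x # xs)"
  have S: "{..<length (x # xs)} = insert 0 ?S" by (auto simp: lessThan_Suc_eq_insert_0)
  have cardS: "card ?S = ?n" by (simp add: card_image)
  have inj: "inj_on ?x (insert 0 ?S)" unfolding S[symmetric] using Cons.prems(1) by (simp add: inj_on_nth)
  have f0: "nht p 0 \<le> card ?S + 1" using Cons.prems by (simp add: partition_ht_0 cardS)
  have fK: "nht p k = 0" if "K \<le> k" for k using Cons.prems(4) that by (intro nht_eq_0) force
  have below_le: "a \<le> K" if "q \<in> below p" "a \<in> set q" for q a
  proof (rule ccontr)
    assume "\<not> a \<le> K"
    hence "0 < nht q K" using that nht_pos[of a q K] by simp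
    moreover have "nht q K \<le> nht p K" using that by (auto simp: below_def)
    ultimately show False using fK[of K] by simp
  qed
  have "hl_H t ?x K {..<length (x # xs)} (nht p) = hl_branch t ?x (?x 0) K ?S (nht p) True"
    unfolding S by (rule hl_H_branch(1)) (use inj f0 in \<open>auto intro: nht_antimono\<close>)
  also have "\<dots> = (\<Sum>g\<in>strips K (nht p) ?n. branch_coeff t x K (nht p) ?n True g * hl_H t ?x K ?S g)"
    using fK by (subst hl_branch_eq_sum) (auto simp: cardS)
  also have "\<dots> = (\<Sum>q\<in>{q \<in> below p. length q \<le> ?n}. branch_coeff t x K (nht p) ?n True (nht q) * hl_H t ?x K ?S (nht q))"
  proof (rule sum.reindex_cong[of nht])
    show "inj_on nht {q \<in> below p. length q \<le> ?n}"
      by (rule inj_onI) (auto simp: below_def intro!: partition_eqI dest: fun_cong)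
    show "strips K (nht p) ?n = nht ` {q \<in> below p. length q \<le> ?n}"
    proof (intro set_eqI iffI)
      fix g assume g: "g \<in> strips K (nht p) ?n"
      then obtain q where q: "is_partition q" "\<And>k. nht q k = g k"
        using partition_exists[of g K] by (auto simp: strips_def)
      hence "q \<in> below p" "length q \<le> ?n" using g partition_ht_0[OF q(1)] by (auto simp: strips_def below_def)
      moreover have "g = nht q" using q(2) by auto
      ultimately show "g \<in> nht ` {q \<in> below p. length q \<le> ?n}" by blast
    next
      fix g assume "g \<in> nht ` {q \<in> below p. length q \<le> ?n}"
      then obtain q where q: "q \<in> below p" "length q \<le> ?n" "g = nht q" by blast
      have "nht q k = 0" if "K \<le> k" for k using q(1) fK[OF that] by (metis (mono_tags, lifting) below_def le_zero_eq mem_Collect_eq)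
      thus "g \<in> strips K (nht p) ?n"
        using q partition_ht_0[of q] nht_antimono[of _ _ q] by (auto simp: strips_def below_def)
    qed
  qed simp
  also have "\<dots> = (\<Sum>q\<in>{q \<in> below p. length q \<le> ?n}. hl_psi t (map int p) (map int q) * x ^ (sum_list p - sum_list q) * hl_poly t q xs)"
  proof (intro sum.cong refl arg_cong2[where f = times])
    fix q assume q: "q \<in> {q \<in> below p. length q \<le> ?n}"
    show "branch_coeff t x K (nht p) ?n True (nht q) = hl_psi t (map int p) (map int q) * x ^ (sum_list p - sum_list q)"
      by (rule branch_coeff_below) (use q Cons.prems in auto)
    have "hl_H t ?x K ?S (nht q) = hl_H t (?x \<circ> Suc) K {..<?n} (nht q)" by (rule hl_H_image) simp
    also have "?x \<circ> Suc = (!) xs" by (simp add: fun_eq_iff)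
    also have "hl_H t ((!) xs) K {..<?n} (nht q) = hl_poly t q xs"
      by (rule Cons.IH) (use q Cons.prems below_le in \<open>auto simp: below_def\<close>)
    finally show "hl_H t ?x K ?S (nht q) = hl_poly t q xs" .
  qed
  also have "\<dots> = hl_poly t p (x # xs)"
    unfolding hl_poly.simps
  proof (rule sum.mono_neutral_left)
    show "finite (below p)" by (rule finite_below)
  qed (auto simp: below_def not_le intro!: hl_poly_eq_0)
  finally show ?case .
qed

subsection \<open>Values at arbitrary variables\<close>

lemma tendsto_hl_poly:
  assumes "\<And>f. f \<in> set fs \<Longrightarrow> (f \<longlongrightarrow> l f) F"
  shows "((\<lambda>\<epsilon>. hl_poly t p (map (\<lambda>f. f \<epsilon>) fs)) \<longlongrightarrow> hl_poly t p (map l fs)) F"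
  using assms
proof (induction fs arbitrary: p)
  case (Cons f fs)
  show ?case unfolding list.map hl_poly.simps
    by (intro tendsto_intros Cons.IH) (use Cons.prems in auto)
qed simp

text \<open>Two given coordinates coincide for a single \<epsilon> only, so there are finitely many
  non-zero exceptions.\<close>

lemma eventually_distinct_perturb:
  fixes xs :: "real list"
  shows "\<forall>\<^sub>F \<epsilon> in at 0. distinct (map (\<lambda>i. xs ! i + real i * \<epsilon>) [0..<length xs])"
proof -
  let ?B = "(\<lambda>(i, j). (xs ! i - xs ! j) / (real j - real i)) ` ({..<length xs} \<times> {..<length xs})"
  define B where "B = ?B - {0}"
  have "finite B" by (simp add: B_def)
  hence "open (- B)" by (simp add: finite_imp_closed open_Compl)
  moreover have "0 \<in> - B" by (simp add: B_def)
  ultimately have "\<forall>\<^sub>F \<epsilon> in at 0. \<epsilon> \<in> - B" unfolding eventually_at_topological by blast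
  hence "\<forall>\<^sub>F \<epsilon> in at 0. \<epsilon> \<notin> ?B - {0}" by (simp only: B_def Compl_iff)
  hence "\<forall>\<^sub>F \<epsilon> in at 0. \<epsilon> \<notin> ?B - {0} \<and> \<epsilon> \<noteq> 0"
    by (rule eventually_conj) (simp add: eventually_at_filter)
  thus ?thesis
  proof (rule eventually_mono)
    fix \<epsilon> :: real assume \<epsilon>: "\<epsilon> \<notin> ?B - {0} \<and> \<epsilon> \<noteq> 0"
    show "distinct (map (\<lambda>i. xs ! i + real i * \<epsilon>) [0..<length xs])"
      unfolding distinct_map
    proof (intro conjI inj_onI)
      fix i j assume ij: "i \<in> set [0..<length xs]" "j \<in> set [0..<length xs]"
        "xs ! i + real i * \<epsilon> = xs ! j + real j * \<epsilon>"
      show "i = j"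
      proof (rule ccontr)
        assume "i \<noteq> j"
        hence "\<epsilon> = (xs ! i - xs ! j) / (real j - real i)" using ij(3) by (simp add: field_simps)
        hence "\<epsilon> \<in> ?B" using ij by force
        thus False using \<epsilon> by blast
      qed
    qed simp
  qed
qed

lemma tendsto_hl_poly_perturb:
  "((\<lambda>\<epsilon>. hl_poly t p (map (\<lambda>i. xs ! \<pi> i + real (\<pi> i) * \<epsilon>) [0..<n])) \<longlongrightarrow> hl_poly t p (map (\<lambda>i. xs ! \<pi> i) [0..<n])) (at 0)"
proof -
  define fs where "fs = map (\<lambda>i \<epsilon>. xs ! \<pi> i + real (\<pi> i) * \<epsilon>) [0..<n]"
  have "((\<lambda>\<epsilon>. hl_poly t p (map (\<lambda>f. f \<epsilon>) fs)) \<longlongrightarrow> hl_poly t p (map (\<lambda>f. f 0) fs)) (at 0)"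
  proof (rule tendsto_hl_poly)
    fix f assume "f \<in> set fs"
    then obtain i where f: "f = (\<lambda>\<epsilon>. xs ! \<pi> i + real (\<pi> i) * \<epsilon>)" by (auto simp: fs_def)
    show "(f \<longlongrightarrow> f 0) (at 0)" unfolding f by (intro tendsto_intros)
  qed
  thus ?thesis by (simp add: fs_def comp_def)
qed

text \<open>The symmetrization agrees with \<open>hl_poly\<close> at the perturbed, distinct
  variables, and \<open>hl_poly\<close> is continuous; so the limit in the definition is its value
  at \<open>xs\<close>.\<close>

lemma hl_P_eq_hl_poly:
  assumes p: "is_partition p"
  shows "hl_P t p xs = hl_poly t p xs"
proof (cases "length p \<le> length xs")
  case True
  let ?p = "p @ replicate (length xs - length p) 0" and ?y = "\<lambda>\<epsilon>. map (\<lambda>i. xs ! i + real i * \<epsilon>) [0..<length xs]"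
  define K where "K = sum_list p"
  have K: "a \<le> K" if "a \<in> set p" for a using that member_le_sum_list[of a p] by (simp add: K_def)
  have nht: "nht ?p = nht p" by (auto simp: nht_def fun_eq_iff)
  have K': "a \<le> K" if "a \<in> set ?p" for a using that K by (auto simp: set_replicate_conv_if split: if_splits)
  have eq: "hl_sym t ?p (?y \<epsilon>) = hl_poly t p (?y \<epsilon>)" if "distinct (?y \<epsilon>)" for \<epsilon>
    using hl_sym_eq_hl_H[of ?p "?y \<epsilon>" K t] hl_H_eq_hl_poly[OF that p, of K t] True K
    K' unfolding nht by simp
  have lim: "((\<lambda>\<epsilon>. hl_poly t p (?y \<epsilon>)) \<longlongrightarrow> hl_poly t p xs) (at 0)"
    using tendsto_hl_poly_perturb[of t p xs id "length xs"] by (simp add: map_nth)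
  have "((\<lambda>\<epsilon>. hl_sym t ?p (?y \<epsilon>)) \<longlongrightarrow> hl_poly t p xs) (at 0)"
    by (rule Lim_transform_eventually[OF lim], rule eventually_mono[OF eventually_distinct_perturb[of xs]])
      (use eq in auto)
  hence "Lim (at 0) (\<lambda>\<epsilon>. hl_sym t ?p (?y \<epsilon>)) = hl_poly t p xs" by (intro tendsto_Lim) auto
  thus ?thesis using True by (simp add: hl_P_def)
next
  case False
  thus ?thesis using hl_poly_eq_0[OF p, of xs t] by (simp add: hl_P_def)
qed

lemma hl_poly_permute_distinct:
  assumes p: "is_partition p" and xs: "distinct xs" and \<pi>: "\<pi> permutes {..<length xs}"
  shows "hl_poly t p (permute_list \<pi> xs) = hl_poly t p xs"
proof (cases "length p \<le> length xs")
  case True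
  define K where "K = sum_list p"
  have K: "a \<le> K" if "a \<in> set p" for a using that member_le_sum_list[of a p] by (simp add: K_def)
  have "hl_poly t p (permute_list \<pi> xs) = hl_H t ((!) (permute_list \<pi> xs)) K {..<length xs} (nht p)"
    using hl_H_eq_hl_poly[of "permute_list \<pi> xs" p K t] xs \<pi> p True K by simp
  also have "\<dots> = hl_H t ((!) xs \<circ> \<pi>) K {..<length xs} (nht p)"
    by (rule hl_H_cong) (use \<pi> in \<open>simp add: permute_list_nth\<close>)
  also have "\<dots> = hl_H t ((!) xs) K (\<pi> ` {..<length xs}) (nht p)"
    by (rule hl_H_image[symmetric]) (use \<pi> permutes_inj_on in auto)
  also have "\<pi> ` {..<length xs} = {..<length xs}" using \<pi> by (rule permutes_image)
  also have "hl_H t ((!) xs) K {..<length xs} (nht p) = hl_poly t p xs"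
    by (rule hl_H_eq_hl_poly) (use xs p True K in auto)
  finally show ?thesis .
qed (use hl_poly_eq_0[OF p] in simp)

text \<open>Symmetry is evident for the symmetrization but not for repeated branching. At distinct
  variables it is inherited from the former, and a limit transfers it. The permuted list is
  perturbed by multiples of \<open>\<pi> i\<close> rather than \<open>i\<close>, so that it remains
  a rearrangement of the perturbed list.\<close>

lemma hl_poly_mset:
  assumes p: "is_partition p" and xy: "mset xs = mset ys"
  shows "hl_poly t p xs = hl_poly t p ys"
proof -
  obtain \<pi> where \<pi>: "\<pi> permutes {..<length ys}" "permute_list \<pi> ys = xs"
    using mset_eq_permutation[OF xy] by blast
  let ?y = "\<lambda>\<epsilon>. map (\<lambda>i. ys ! i + real i * \<epsilon>) [0..<length ys]"
  have perm: "permute_list \<pi> (?y \<epsilon>) = map (\<lambda>i. ys ! \<pi> i + real (\<pi> i) * \<epsilon>) [0..<length ys]" for \<epsilon>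
    using permutes_in_image[OF \<pi>(1)] by (auto simp: permute_list_def)
  have lim1: "((\<lambda>\<epsilon>. hl_poly t p (?y \<epsilon>)) \<longlongrightarrow> hl_poly t p ys) (at 0)"
    using tendsto_hl_poly_perturb[of t p ys id "length ys"] by (simp add: map_nth)
  have lim2: "((\<lambda>\<epsilon>. hl_poly t p (?y \<epsilon>)) \<longlongrightarrow> hl_poly t p xs) (at 0)"
  proof (rule Lim_transform_eventually)
    have "map (\<lambda>i. ys ! \<pi> i) [0..<length ys] = xs" using \<pi>(2) by (simp add: permute_list_def)
    thus "((\<lambda>\<epsilon>. hl_poly t p (map (\<lambda>i. ys ! \<pi> i + real (\<pi> i) * \<epsilon>) [0..<length ys])) \<longlongrightarrow> hl_poly t p xs) (at 0)"
      using tendsto_hl_poly_perturb[of t p ys \<pi> "length ys"] by simp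
    show "\<forall>\<^sub>F \<epsilon> in at 0. hl_poly t p (map (\<lambda>i. ys ! \<pi> i + real (\<pi> i) * \<epsilon>) [0..<length ys]) = hl_poly t p (?y \<epsilon>)"
    proof (rule eventually_mono[OF eventually_distinct_perturb[of ys]])
      fix \<epsilon> assume "distinct (?y \<epsilon>)"
      from hl_poly_permute_distinct[OF p this, of \<pi> t] \<pi>(1)
      show "hl_poly t p (map (\<lambda>i. ys ! \<pi> i + real (\<pi> i) * \<epsilon>) [0..<length ys]) = hl_poly t p (?y \<epsilon>)"
        unfolding perm by simp
    qed
  qed
  show ?thesis by (rule tendsto_unique[OF at_neq_bot lim2 lim1])
qed

subsection \<open>Linear independence\<close>

definition first :: "nat list \<Rightarrow> nat" where
  "first s = (case s of [] \<Rightarrow> 0 | a # _ \<Rightarrow> a)"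

lemma first_ge: "is_partition s \<Longrightarrow> a \<in> set s \<Longrightarrow> a \<le> first s"
  by (cases s) (auto simp: first_def is_partition_def)

lemma nht_tl:
  assumes "is_partition s"
  shows "nht (tl s) k = nht s k - 1"
proof (cases s)
  case (Cons a s')
  show ?thesis
  proof (cases "k < a")
    case False
    hence "nht s' k = 0" using assms Cons by (intro nht_eq_0) (force simp: is_partition_def)
    thus ?thesis using Cons False by (simp add: nht_def)
  qed (simp add: Cons nht_def)
qed (simp add: nht_def)

lemma is_partition_tl: "is_partition s \<Longrightarrow> is_partition (tl s)"
  by (cases s) (auto simp: is_partition_def)

text \<open>A strip has at most one box in each of the \<open>first s\<close> non-empty columns.
  Equality shortens each of them by one, which is the effect of deleting the first row.\<close>

lemma below_size:
  assumes s: "is_partition s" and q: "q \<in> below s"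
  shows "sum_list s - sum_list q \<le> first s"
    and "sum_list s - sum_list q = first s \<longleftrightarrow> q = tl s"
proof -
  have qs: "nht q k \<le> nht s k" "nht s k \<le> Suc (nht q k)" "is_partition q" for k using q by (auto simp: below_def)
  have s0: "nht s k = 0" if "first s \<le> k" for k
    by (rule nht_eq_0) (use first_ge[OF s] that order.trans in blast)
  have q0: "nht q k = 0" if "first s \<le> k" for k using qs(1)[of k] s0[OF that] by simp
  have qle: "a \<le> first s" if "a \<in> set q" for a
  proof (rule ccontr)
    assume "\<not> a \<le> first s"
    hence "0 < nht q (first s)" using nht_pos[OF that, of "first s"] by simp
    thus False using q0[of "first s"] by simp
  qed
  have diff: "sum_list s - sum_list q = (\<Sum>k<first s. nht s k - nht q k)"
    using qs(1) first_ge[OF s] qle by (simp add: sum_list_nht[of s "first s"] sum_list_nht[of q "first s"] sum_subtractf_nat)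
  have le1: "nht s k - nht q k \<le> 1" for k using qs(2)[of k] by simp
  show "sum_list s - sum_list q \<le> first s"
    unfolding diff using sum_mono[of "{..<first s}" "\<lambda>k. nht s k - nht q k" "\<lambda>_. 1"] le1 by simp
  show "sum_list s - sum_list q = first s \<longleftrightarrow> q = tl s"
  proof
    assume "q = tl s"
    hence "nht s k - nht q k = 1" if "k < first s" for k
    proof (cases s)
      case (Cons a s')
      have "0 < nht s k" using that Cons by (intro nht_pos[of a]) (auto simp: first_def)
      thus ?thesis using nht_tl[OF s, of k] \<open>q = tl s\<close> by simp
    qed (use that in \<open>simp add: first_def\<close>)
    thus "sum_list s - sum_list q = first s" unfolding diff by simp
  next
    assume eq: "sum_list s - sum_list q = first s"
    have all: "nht s k - nht q k = 1" if "k < first s" for k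
    proof (rule ccontr)
      assume "nht s k - nht q k \<noteq> 1"
      hence "nht s k - nht q k < 1" using le1[of k] by simp
      hence "(\<Sum>k<first s. nht s k - nht q k) < (\<Sum>k<first s. 1)"
        using that le1 by (intro sum_strict_mono_ex1) auto
      thus False using eq diff by simp
    qed
    show "q = tl s"
    proof (rule partition_eqI[OF qs(3) is_partition_tl[OF s]])
      fix k show "nht q k = nht (tl s) k"
        using nht_tl[OF s, of k] all[of k] s0[of k] q0[of k] by (cases "k < first s") auto
    qed
  qed
qed

lemma tl_below:
  assumes "is_partition s"
  shows "tl s \<in> below s" "hl_psi t (map int s) (map int (tl s)) = 1"
proof -
  show "tl s \<in> below s"
    using assms nht_tl[OF assms] is_partition_tl[OF assms] by (auto simp: below_def)
  have "nht s k = 0" if "nht s k = nht (tl s) k" for k using that nht_tl[OF assms, of k] by simp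
  moreover have "nht s (Suc k) \<le> nht s k" for k by (rule nht_antimono) simp
  ultimately have "\<not> (nht s k = nht (tl s) k \<and> nht s (Suc k) = Suc (nht (tl s) (Suc k)))" for k
    by (metis le_zero_eq nat.distinct(1))
  thus "hl_psi t (map int s) (map int (tl s)) = 1"
    using first_ge[OF assms] by (subst hl_psi_eq_prod_nat[of s "first s"]) (auto intro!: prod.neutral)
qed

lemma tendsto_pow_div:
  assumes "e \<le> M"
  shows "((\<lambda>x :: real. x ^ e / x ^ M) \<longlongrightarrow> of_bool (e = M)) at_top"
proof (cases "e = M")
  case True
  have "\<forall>\<^sub>F x :: real in at_top. 1 = x ^ e / x ^ M"
    using eventually_gt_at_top[of 0] by eventually_elim (simp add: True)
  thus ?thesis using True by (auto intro: Lim_transform_eventually[OF tendsto_const])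
next
  case False
  have "((\<lambda>x :: real. inverse (x ^ (M - e))) \<longlongrightarrow> 0) at_top"
    using False assms by (intro tendsto_inverse_0_at_top filterlim_pow_at_top filterlim_ident) auto
  moreover have "\<forall>\<^sub>F x :: real in at_top. inverse (x ^ (M - e)) = x ^ e / x ^ M"
    using eventually_gt_at_top[of 0] by eventually_elim (use assms in \<open>simp add: power_diff field_simps\<close>)
  ultimately show ?thesis using False by (auto intro: Lim_transform_eventually)
qed

text \<open>The leading coefficient in the first variable singles out the partitions with the longest
  first row.\<close>

lemma hl_poly_independent_aux:
  assumes "finite A" "\<And>s. s \<in> A \<Longrightarrow> is_partition s \<and> length s \<le> n"
    "\<And>y. length y = n \<Longrightarrow> (\<Sum>s\<in>A. d s * hl_poly t s y) = 0"
  shows "\<forall>s\<in>A. d s = 0"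
  using assms
proof (induction n arbitrary: A d)
  case 0
  hence "A \<subseteq> {[]}" by auto
  hence "A = {} \<or> A = {[]}" by blast
  thus ?case using 0(3)[of "[]"] by auto
next
  case (Suc n)
  show ?case
  proof (rule ccontr)
    assume "\<not> ?case"
    define A' where "A' = {s \<in> A. d s \<noteq> 0}"
    have A': "finite A'" "A' \<noteq> {}" using Suc.prems(1) \<open>\<not> ?case\<close> by (auto simp: A'_def)
    define M where "M = Max (first ` A')"
    have M: "first s \<le> M" if "s \<in> A'" for s using that A' by (simp add: M_def)
    have part: "is_partition s" "length s \<le> Suc n" if "s \<in> A'" for s using that Suc.prems(2) by (auto simp: A'_def)
    define B where "B = {s \<in> A'. first s = M}"
    have "M \<in> first ` A'" unfolding M_def using A' by (intro Max_in) auto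
    hence Bne: "B \<noteq> {}" by (auto simp: B_def)
    have "(\<Sum>s\<in>B. d s * hl_poly t (tl s) y) = 0" if y: "length y = n" for y
    proof -
      \<comment> \<open>Divide the relation by \<open>x ^ M\<close> and let \<open>x\<close> tend to
        infinity: only strips of size \<open>M\<close> survive, and by \<open>below_size\<close>
        these delete a first row of length \<open>M\<close>.\<close>
      have lim: "((\<lambda>x. \<Sum>s\<in>A'. d s * (\<Sum>q\<in>below s. hl_psi t (map int s) (map int q) *
          (x ^ (sum_list s - sum_list q) / x ^ M) * hl_poly t q y)) \<longlongrightarrow>
        (\<Sum>s\<in>A'. d s * (\<Sum>q\<in>below s. hl_psi t (map int s) (map int q) *
          of_bool (sum_list s - sum_list q = M) * hl_poly t q y))) at_top"
      proof (intro tendsto_intros tendsto_pow_div)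
        fix s q assume "s \<in> A'" "q \<in> below s"
        thus "sum_list s - sum_list q \<le> M" using below_size(1)[OF part(1)] M le_trans by blast
      qed
      have eq0: "(\<Sum>s\<in>A'. d s * (\<Sum>q\<in>below s. hl_psi t (map int s) (map int q) *
          (x ^ (sum_list s - sum_list q) / x ^ M) * hl_poly t q y)) = 0" for x :: real
      proof -
        have "(\<Sum>s\<in>A'. d s * hl_poly t s (x # y)) = (\<Sum>s\<in>A. d s * hl_poly t s (x # y))"
          using Suc.prems(1) by (intro sum.mono_neutral_left) (auto simp: A'_def)
        also have "\<dots> = 0" using Suc.prems(3)[of "x # y"] y by simp
        finally have "(\<Sum>s\<in>A'. d s * hl_poly t s (x # y)) / x ^ M = 0" by simp
        moreover have "(\<Sum>s\<in>A'. d s * hl_poly t s (x # y)) / x ^ M =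
            (\<Sum>s\<in>A'. d s * (\<Sum>q\<in>below s. hl_psi t (map int s) (map int q) *
              (x ^ (sum_list s - sum_list q) / x ^ M) * hl_poly t q y))"
          unfolding sum_divide_distrib
        proof (rule sum.cong[OF refl])
          fix s
          have "hl_poly t s (x # y) / x ^ M = (\<Sum>q\<in>below s. hl_psi t (map int s) (map int q) *
              (x ^ (sum_list s - sum_list q) / x ^ M) * hl_poly t q y)"
            unfolding hl_poly.simps sum_divide_distrib by (rule sum.cong[OF refl]) simp
          thus "d s * hl_poly t s (x # y) / x ^ M = d s * (\<Sum>q\<in>below s. hl_psi t (map int s) (map int q) *
              (x ^ (sum_list s - sum_list q) / x ^ M) * hl_poly t q y)"
            by (metis times_divide_eq_right)
        qed
        ultimately show ?thesis by (rule trans[OF sym, rotated])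
      qed
      have lim0: "((\<lambda>_ :: real. 0) \<longlongrightarrow> (\<Sum>s\<in>A'. d s * (\<Sum>q\<in>below s. hl_psi t (map int s) (map int q) *
          of_bool (sum_list s - sum_list q = M) * hl_poly t q y))) at_top"
        using lim unfolding eq0 .
      have "(\<Sum>s\<in>A'. d s * (\<Sum>q\<in>below s. hl_psi t (map int s) (map int q) *
          of_bool (sum_list s - sum_list q = M) * hl_poly t q y)) = 0"
        by (rule tendsto_unique[OF trivial_limit_at_top_linorder lim0 tendsto_const])
      moreover have "(\<Sum>q\<in>below s. hl_psi t (map int s) (map int q) *
          of_bool (sum_list s - sum_list q = M) * hl_poly t q y) = of_bool (first s = M) * hl_poly t (tl s) y"
        if s: "s \<in> A'" for s
      proof -
        have iff: "sum_list s - sum_list q = M \<longleftrightarrow> first s = M \<and> q = tl s" if "q \<in> below s" for q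
          using below_size[OF part(1)[OF s] that] M[OF s] by auto
        have "(\<Sum>q\<in>below s. hl_psi t (map int s) (map int q) *
          of_bool (sum_list s - sum_list q = M) * hl_poly t q y) =
          (\<Sum>q\<in>{tl s}. hl_psi t (map int s) (map int q) * of_bool (first s = M) * hl_poly t q y)"
          using tl_below(1)[OF part(1)[OF s]] iff
          by (intro sum.mono_neutral_cong_right) (auto simp: finite_below)
        thus ?thesis using tl_below(2)[OF part(1)[OF s]] by simp
      qed
      ultimately have "(\<Sum>s\<in>A'. d s * (of_bool (first s = M) * hl_poly t (tl s) y)) = 0" by simp
      moreover have "(\<Sum>s\<in>B. d s * hl_poly t (tl s) y) = (\<Sum>s\<in>A'. d s * (of_bool (first s = M) * hl_poly t (tl s) y))"
        using A' by (intro sum.mono_neutral_cong_left) (auto simp: B_def)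
      ultimately show ?thesis by simp
    qed
    \<comment> \<open>With its first row fixed to \<open>M\<close>, a partition is recovered from
      its tail; for \<open>M = 0\<close> it is empty.\<close>
    moreover define r where "r q = (if M = 0 then [] else M # q)" for q
    have rB: "r (tl s) = s" if "s \<in> B" for s
    proof (cases s)
      case Nil thus ?thesis using that by (simp add: r_def B_def first_def)
    next
      case (Cons a s')
      have "a = M" "a \<noteq> 0" using that Cons part[of s] by (auto simp: B_def first_def is_partition_def)
      thus ?thesis using Cons by (simp add: r_def)
    qed
    have inj: "inj_on tl B" using rB by (metis inj_onI)
    ultimately have "(\<Sum>q\<in>tl ` B. d (r q) * hl_poly t q y) = 0" if "length y = n" for y
      using rB that by (simp add: sum.reindex)
    moreover have "finite (tl ` B)" using A' by (simp add: B_def)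
    moreover have "is_partition q \<and> length q \<le> n" if q: "q \<in> tl ` B" for q
    proof -
      obtain s where s: "s \<in> A'" "q = tl s" using q unfolding B_def by blast
      show ?thesis using part[OF s(1)] is_partition_tl[of s] s(2) by simp
    qed
    ultimately have "\<forall>q\<in>tl ` B. d (r q) = 0" using Suc.IH[of "tl ` B" "\<lambda>q. d (r q)"] by blast
    hence "\<forall>s\<in>B. d s = 0" using rB by auto
    thus False using Bne by (auto simp: B_def A'_def)
  qed
qed

lemma hl_poly_independent:
  assumes "finite A" "\<And>s. s \<in> A \<Longrightarrow> is_partition s" "\<And>y. (\<Sum>s\<in>A. d s * hl_poly t s y) = 0" "s \<in> A"
  shows "d s = 0"
proof -
  have "\<forall>s\<in>A. d s = 0"
    by (rule hl_poly_independent_aux[of A "Max (length ` A)" d t]) (use assms in \<open>auto intro!: Max_ge\<close>)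
  thus ?thesis using assms(4) by blast
qed

subsection \<open>Skew functions as sums over chains of horizontal strips\<close>

lemma hl_phi_eq_prod_nat:
  assumes p: "\<And>a. a \<in> set p \<Longrightarrow> a \<le> K" and q: "\<And>k. nht q k \<le> nht p k"
  shows "hl_phi t (map int p) (map int q) =
    (\<Prod>k<K. if nht p k = Suc (nht q k) \<and> nht p (Suc k) = nht q (Suc k) then 1 - t ^ (nht p k - nht p (Suc k)) else 1)"
proof -
  let ?J = "{k. k < K \<and> nht p k = Suc (nht q k) \<and> nht p (Suc k) = nht q (Suc k)}"
  have nS: "nat (1 + int j) = Suc j" "nat (int j + 1) = Suc j" for j by auto
  have nD: "nat (int a - int b) = a - b" "nat (1 + int a - int b) = Suc a - b" for a b by arith+
  have *: "{k. 0 < k \<and> ht (map int p) (k - 1) = ht (map int q) (k - 1) + 1 \<and> ht (map int p) k = ht (map int q) k} =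
    (\<lambda>k. int (Suc k)) ` ?J"
  proof (intro set_eqI iffI)
    fix k assume k: "k \<in> {k. 0 < k \<and> ht (map int p) (k - 1) = ht (map int q) (k - 1) + 1 \<and> ht (map int p) k = ht (map int q) k}"
    define j where "j = nat (k - 1)"
    have j: "k = int (Suc j)" "k - 1 = int j" using k by (auto simp: j_def)
    have e: "nht p j = Suc (nht q j)" "nht p (Suc j) = nht q (Suc j)" using k unfolding j ht_map_int by (auto simp: nS)
    have "j < K" using nht_eq_0[of p j] e(1) p by (metis Zero_not_Suc le_trans not_le)
    thus "k \<in> (\<lambda>k. int (Suc k)) ` ?J" using j e by (intro image_eqI[of _ _ j]) auto
  qed (auto simp: ht_map_int nS)
  have "hl_phi t (map int p) (map int q) = (\<Prod>k\<in>?J. 1 - t ^ (nht p k - nht p (Suc k)))"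
    unfolding hl_phi_def * by (subst prod.reindex) (auto simp: inj_on_def ht_map_int nS nD intro!: prod.cong)
  also have "\<dots> = (\<Prod>k<K. if nht p k = Suc (nht q k) \<and> nht p (Suc k) = nht q (Suc k) then 1 - t ^ (nht p k - nht p (Suc k)) else 1)"
    by (rule prod.mono_neutral_cong_left) auto
  finally show ?thesis .
qed

lemma count_list_nht: "count_list p (Suc k) = nht p k - nht p (Suc k)"
proof -
  have "count_list p (Suc k) + nht p (Suc k) = nht p k"
    by (induction p) (auto simp: nht_def not_less_eq less_Suc_eq)
  thus ?thesis by simp
qed

lemma hl_b_eq_prod:
  assumes p: "is_partition p" "\<And>a. a \<in> set p \<Longrightarrow> a \<le> K"
  shows "hl_b t p = (\<Prod>k<K. \<Prod>j = 1..nht p k - nht p (Suc k). 1 - t ^ j)"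
proof -
  have sub: "set p \<subseteq> Suc ` {..<K}"
  proof
    fix a assume "a \<in> set p"
    moreover from this have "a \<noteq> 0" using p(1) by (metis is_partition_def)
    ultimately show "a \<in> Suc ` {..<K}" using p(2)[of a] by (intro image_eqI[of _ _ "a - 1"]) auto
  qed
  have "hl_b t p = (\<Prod>i\<in>Suc ` {..<K}. \<Prod>j = 1..count_list p i. 1 - t ^ j)"
    unfolding hl_b_def using sub by (intro prod.mono_neutral_left) auto
  also have "\<dots> = (\<Prod>k<K. \<Prod>j = 1..count_list p (Suc k). 1 - t ^ j)" by (subst prod.reindex) auto
  finally show ?thesis by (simp add: count_list_nht)
qed

lemma hl_b_nonzero:
  assumes "0 \<le> t" "t < 1"
  shows "hl_b t p \<noteq> 0"
proof -
  have "1 - t ^ j \<noteq> 0" if "1 \<le> j" for j :: nat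
  proof -
    have "t ^ j \<le> t ^ 1" using assms that by (intro power_decreasing) auto
    thus ?thesis using assms by simp
  qed
  thus ?thesis by (auto simp: hl_b_def)
qed

text \<open>In each column the multiplicities in \<open>p\<close> and \<open>q\<close> agree or
  differ by one. In the latter case the quotient of their products in \<open>hl_b\<close> is a
  single factor, which is that of \<phi> or of \<psi>.\<close>

lemma hl_b_psi_phi:
  assumes p: "is_partition p" and q: "q \<in> below p"
  shows "hl_b t p * hl_psi t (map int p) (map int q) = hl_phi t (map int p) (map int q) * hl_b t q"
proof -
  define K where "K = sum_list p"
  have pK: "a \<le> K" if "a \<in> set p" for a using that member_le_sum_list[of a p] by (simp add: K_def)
  have qp: "is_partition q" "nht q k \<le> nht p k" "nht p k \<le> Suc (nht q k)" for k using q by (auto simp: below_def)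
  have qK: "a \<le> K" if a: "a \<in> set q" for a
  proof (rule ccontr)
    assume "\<not> a \<le> K"
    hence "0 < nht q K" using nht_pos[OF a, of K] by simp
    thus False using qp(2)[of K] nht_eq_0[of p K] pK by simp
  qed
  define B where "B n = (\<Prod>j = 1..n. 1 - t ^ j)" for n :: nat
  have B: "B (Suc n) = B n * (1 - t ^ Suc n)" for n by (simp add: B_def)
  have step: "B (nht p k - nht p (Suc k)) *
      (if nht p k = nht q k \<and> nht p (Suc k) = Suc (nht q (Suc k)) then 1 - t ^ (nht q k - nht q (Suc k)) else 1) =
    (if nht p k = Suc (nht q k) \<and> nht p (Suc k) = nht q (Suc k) then 1 - t ^ (nht p k - nht p (Suc k)) else 1) *
      B (nht q k - nht q (Suc k))" for k
  proof -
    have mono: "nht p (Suc k) \<le> nht p k" "nht q (Suc k) \<le> nht q k" by (rule nht_antimono; simp)+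
    consider "nht p k = nht q k" "nht p (Suc k) = nht q (Suc k)" | "nht p k = Suc (nht q k)" "nht p (Suc k) = Suc (nht q (Suc k))"
      | "nht p k = nht q k" "nht p (Suc k) = Suc (nht q (Suc k))" | "nht p k = Suc (nht q k)" "nht p (Suc k) = nht q (Suc k)"
      using qp(2,3)[of k] qp(2,3)[of "Suc k"] by linarith
    thus ?thesis
    proof cases
      case 3
      hence "nht q k - nht q (Suc k) = Suc (nht p k - nht p (Suc k))" using mono by simp
      thus ?thesis using 3 B by simp
    next
      case 4
      hence "nht p k - nht p (Suc k) = Suc (nht q k - nht q (Suc k))" using mono by simp
      thus ?thesis using 4 B by simp
    qed simp_all
  qed
  have psi: "hl_psi t (map int p) (map int q) =
      (\<Prod>k<K. if nht p k = nht q k \<and> nht p (Suc k) = Suc (nht q (Suc k)) then 1 - t ^ (nht q k - nht q (Suc k)) else 1)"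
    using hl_psi_eq_prod_nat[of p "Suc K" t q] pK le_SucI by simp
  have phi: "hl_phi t (map int p) (map int q) =
      (\<Prod>k<K. if nht p k = Suc (nht q k) \<and> nht p (Suc k) = nht q (Suc k) then 1 - t ^ (nht p k - nht p (Suc k)) else 1)"
    by (rule hl_phi_eq_prod_nat) (use pK qp(2) in auto)
  have b: "hl_b t p = (\<Prod>k<K. B (nht p k - nht p (Suc k)))" "hl_b t q = (\<Prod>k<K. B (nht q k - nht q (Suc k)))"
    unfolding B_def by (rule hl_b_eq_prod; use p pK qp(1) qK in blast)+
  show ?thesis unfolding psi phi b prod.distrib[symmetric] by (rule prod.cong[OF refl step])
qed

text \<open>With \<open>hl_psi\<close> or \<open>hl_phi\<close> for \<open>w\<close> these will be
  the skew functions P and Q, as sums over chains of horizontal strips. The first variable belongs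
  to the strip next to \<open>p\<close>, so the order of the list matters in this form.\<close>

fun strip_sum :: "(int list \<Rightarrow> int list \<Rightarrow> real) \<Rightarrow> nat list \<Rightarrow> nat list \<Rightarrow> real list \<Rightarrow> real" where
  "strip_sum w p q [] = of_bool (p = q)"
| "strip_sum w p q (x # xs) =
    (\<Sum>r\<in>below p. w (map int p) (map int r) * x ^ (sum_list p - sum_list r) * strip_sum w r q xs)"

lemma hl_poly_eq_strip_sum: "hl_poly t p xs = strip_sum (hl_psi t) p [] xs"
  by (induction xs arbitrary: p) auto

lemma below'_trans: "q \<in> below' p \<Longrightarrow> r \<in> below' q \<Longrightarrow> r \<in> below' p"
  by (auto simp: below'_def intro: order.trans)

lemma strip_sum_support: "is_partition p \<Longrightarrow> strip_sum w p q xs \<noteq> 0 \<Longrightarrow> q \<in> below' p"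
proof (induction xs arbitrary: p)
  case Nil
  thus ?case by (auto simp: below'_def split: if_splits)
next
  case (Cons x xs)
  obtain r where r: "r \<in> below p" "strip_sum w r q xs \<noteq> 0"
    using Cons.prems(2) by (metis (no_types, lifting) strip_sum.simps(2) mult_eq_0_iff sum.neutral)
  moreover have "is_partition r" using r(1) by (simp add: below_def)
  ultimately show ?case using Cons.IH below'_trans below_subset by blast
qed

lemma strip_sum_append:
  "is_partition p \<Longrightarrow> strip_sum w p q (xs @ ys) = (\<Sum>r\<in>below' p. strip_sum w p r xs * strip_sum w r q ys)"
proof (induction xs arbitrary: p)
  case Nil
  have "p \<in> below' p" using Nil by (simp add: below'_def)
  have "(\<Sum>r\<in>below' p. strip_sum w p r [] * strip_sum w r q ys) = (\<Sum>r\<in>{p}. strip_sum w p r [] * strip_sum w r q ys)"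
    using \<open>p \<in> below' p\<close> by (intro sum.mono_neutral_right finite_below') auto
  thus ?case by simp
next
  case (Cons x xs)
  let ?c = "\<lambda>u. w (map int p) (map int u) * x ^ (sum_list p - sum_list u)"
  have "strip_sum w u q (xs @ ys) = (\<Sum>r\<in>below' p. strip_sum w u r xs * strip_sum w r q ys)" if u: "u \<in> below p" for u
  proof -
    have pu: "is_partition u" using u by (simp add: below_def)
    have "below' u \<subseteq> below' p" using u below_subset below'_trans by blast
    moreover have "strip_sum w u r xs = 0" if "r \<notin> below' u" for r using strip_sum_support[OF pu, of w r xs] that by blast
    ultimately show ?thesis unfolding Cons.IH[OF pu] by (intro sum.mono_neutral_left finite_below') auto
  qed
  hence "strip_sum w p q ((x # xs) @ ys) = (\<Sum>u\<in>below p. ?c u * (\<Sum>r\<in>below' p. strip_sum w u r xs * strip_sum w r q ys))"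
    by simp
  also have "\<dots> = (\<Sum>r\<in>below' p. strip_sum w p r (x # xs) * strip_sum w r q ys)"
    unfolding strip_sum.simps sum_distrib_left sum_distrib_right by (subst sum.swap) (simp add: mult_ac)
  finally show ?case .
qed

text \<open>The definition selects the coefficients by \<open>THE\<close>, so uniqueness is needed:
  two families of coefficients differ by a linear relation among the \<open>hl_poly t s\<close>. The
  scaling \<open>g\<close> covers both normalizations, 1 for P and \<open>hl_b\<close> for
  Q.\<close>

lemma skew_eqI:
  assumes p: "is_partition p"
    and F: "\<And>s y. is_partition s \<Longrightarrow> F s y = g s * hl_poly t s y" and g: "\<And>s. g s \<noteq> 0"
    and c: "\<And>s. c s \<noteq> 0 \<Longrightarrow> s \<in> below' p" "\<And>y. F p (x @ y) = (\<Sum>s\<in>below' p. c s * F s y)"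
  shows "skew F p q x = c q"
  unfolding skew_def
proof (rule arg_cong[of _ c "\<lambda>c. c q"], rule the_equality)
  have part: "is_partition s" if "s \<in> below' p" for s using that by (simp add: below'_def)
  have fin: "finite {s. c s \<noteq> 0}" by (rule finite_subset[OF _ finite_below'[of p]]) (use c(1) in auto)
  have "F p (x @ y) = (\<Sum>s | c s \<noteq> 0. c s * F s y)" for y
    unfolding c(2) using c(1) by (intro sum.mono_neutral_right finite_below') auto
  thus "finite {s. c s \<noteq> 0} \<and> (\<forall>s. c s \<noteq> 0 \<longrightarrow> is_partition s) \<and>
      (\<forall>y. F p (x @ y) = (\<Sum>s | c s \<noteq> 0. c s * F s y))"
    using fin c(1) part by blast
  fix c' assume c': "finite {s. c' s \<noteq> 0} \<and> (\<forall>s. c' s \<noteq> 0 \<longrightarrow> is_partition s) \<and>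
      (\<forall>y. F p (x @ y) = (\<Sum>s | c' s \<noteq> 0. c' s * F s y))"
  define A where "A = below' p \<union> {s. c' s \<noteq> 0}"
  have A: "finite A" "\<And>s. s \<in> A \<Longrightarrow> is_partition s" using c' finite_below'[of p] part by (auto simp: A_def)
  have zero: "(\<Sum>s\<in>A. ((c' s - c s) * g s) * hl_poly t s y) = 0" for y
  proof -
    have "F p (x @ y) = (\<Sum>s | c' s \<noteq> 0. c' s * F s y)" using c' by blast
    also have "\<dots> = (\<Sum>s\<in>A. c' s * F s y)" using A(1) by (intro sum.mono_neutral_left) (auto simp: A_def)
    finally have 1: "F p (x @ y) = (\<Sum>s\<in>A. c' s * F s y)" .
    have 2: "F p (x @ y) = (\<Sum>s\<in>A. c s * F s y)"
      unfolding c(2) using A(1) c(1) by (intro sum.mono_neutral_left) (auto simp: A_def)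
    have "(\<Sum>s\<in>A. ((c' s - c s) * g s) * hl_poly t s y) = (\<Sum>s\<in>A. c' s * F s y - c s * F s y)"
      by (intro sum.cong[OF refl]) (simp add: F[OF A(2)] algebra_simps)
    also have "\<dots> = 0" unfolding sum_subtractf 1[symmetric] 2[symmetric] by simp
    finally show ?thesis .
  qed
  show "c' = c"
  proof
    fix s show "c' s = c s"
    proof (cases "s \<in> A")
      case True
      have "(c' s - c s) * g s = 0" by (rule hl_poly_independent[OF A zero True])
      thus ?thesis using g[of s] by simp
    next
      case False
      thus ?thesis using c(1)[of s] by (auto simp: A_def)
    qed
  qed
qed

lemma skew_hl_P: "is_partition p \<Longrightarrow> skew (hl_P t) p q xs = strip_sum (hl_psi t) p q xs"
proof (rule skew_eqI[where g = "\<lambda>_. 1" and t = t])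
  fix y assume p: "is_partition p"
  have "hl_P t p (xs @ y) = (\<Sum>s\<in>below' p. strip_sum (hl_psi t) p s xs * hl_poly t s y)"
    unfolding hl_P_eq_hl_poly[OF p] hl_poly_eq_strip_sum by (rule strip_sum_append[OF p])
  thus "hl_P t p (xs @ y) = (\<Sum>s\<in>below' p. strip_sum (hl_psi t) p s xs * hl_P t s y)"
    by (simp add: hl_P_eq_hl_poly below'_def)
qed (use hl_P_eq_hl_poly strip_sum_support in auto)

text \<open>Along a chain of strips, the factors \<open>hl_b\<close> from
  \<open>hl_b_psi_phi\<close> telescope.\<close>

lemma strip_sum_psi_phi:
  "is_partition p \<Longrightarrow> hl_b t p * strip_sum (hl_psi t) p q xs = hl_b t q * strip_sum (hl_phi t) p q xs"
proof (induction xs arbitrary: p)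
  case (Cons x xs)
  have "hl_b t p * (hl_psi t (map int p) (map int r) * x ^ (sum_list p - sum_list r) * strip_sum (hl_psi t) r q xs) =
      hl_b t q * (hl_phi t (map int p) (map int r) * x ^ (sum_list p - sum_list r) * strip_sum (hl_phi t) r q xs)"
    if r: "r \<in> below p" for r
  proof -
    have "hl_b t p * (hl_psi t (map int p) (map int r) * x ^ (sum_list p - sum_list r) * strip_sum (hl_psi t) r q xs) =
        (hl_b t p * hl_psi t (map int p) (map int r)) * x ^ (sum_list p - sum_list r) * strip_sum (hl_psi t) r q xs" by simp
    also have "\<dots> = hl_phi t (map int p) (map int r) * x ^ (sum_list p - sum_list r) * (hl_b t r * strip_sum (hl_psi t) r q xs)"
      unfolding hl_b_psi_phi[OF Cons.prems r] by simp
    also have "hl_b t r * strip_sum (hl_psi t) r q xs = hl_b t q * strip_sum (hl_phi t) r q xs"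
      by (rule Cons.IH) (use r in \<open>simp add: below_def\<close>)
    finally show ?thesis by (simp only: mult_ac)
  qed
  thus ?case by (simp only: strip_sum.simps sum_distrib_left cong: sum.cong)
qed auto

lemma skew_hl_Q:
  assumes t: "0 \<le> t" "t < 1" and p: "is_partition p"
  shows "skew (hl_Q t) p q xs = strip_sum (hl_phi t) p q xs"
proof -
  note nz = hl_b_nonzero[OF t]
  have "skew (hl_Q t) p q xs = hl_b t p / hl_b t q * strip_sum (hl_psi t) p q xs"
  proof (rule skew_eqI[OF p, where g = "hl_b t" and t = t and c = "\<lambda>q. hl_b t p / hl_b t q * strip_sum (hl_psi t) p q xs"])
    fix y
    have "hl_Q t p (xs @ y) = hl_b t p * (\<Sum>s\<in>below' p. strip_sum (hl_psi t) p s xs * hl_poly t s y)"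
      unfolding hl_Q_def hl_P_eq_hl_poly[OF p] hl_poly_eq_strip_sum strip_sum_append[OF p] ..
    also have "\<dots> = (\<Sum>s\<in>below' p. hl_b t p / hl_b t s * strip_sum (hl_psi t) p s xs * hl_Q t s y)"
      unfolding sum_distrib_left
      by (rule sum.cong[OF refl]) (use nz in \<open>simp add: hl_Q_def hl_P_eq_hl_poly below'_def\<close>)
    finally show "hl_Q t p (xs @ y) = (\<Sum>s\<in>below' p. hl_b t p / hl_b t s * strip_sum (hl_psi t) p s xs * hl_Q t s y)" .
  qed (use nz strip_sum_support[OF p] in \<open>auto simp: hl_Q_def hl_P_eq_hl_poly\<close>)
  thus ?thesis using strip_sum_psi_phi[OF p, of t q xs] nz by (simp add: field_simps)
qed

text \<open>\<open>skew\<close> depends on the variables only through the symmetric values of P and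
  Q at longer lists. The rule is needed because the segments of a lattice path list their variables
  in decreasing order.\<close>

lemma strip_sum_mset:
  assumes p: "is_partition p" and xs: "mset xs = mset ys"
  shows "strip_sum (hl_psi t) p q xs = strip_sum (hl_psi t) p q ys"
    "0 \<le> t \<Longrightarrow> t < 1 \<Longrightarrow> strip_sum (hl_phi t) p q xs = strip_sum (hl_phi t) p q ys"
proof -
  have "hl_P t p (xs @ y) = hl_P t p (ys @ y)" for y
    unfolding hl_P_eq_hl_poly[OF p] by (rule hl_poly_mset[OF p]) (simp add: xs)
  hence "skew (hl_P t) p q xs = skew (hl_P t) p q ys" "skew (hl_Q t) p q xs = skew (hl_Q t) p q ys"
    unfolding skew_def hl_Q_def by simp_all
  thus "strip_sum (hl_psi t) p q xs = strip_sum (hl_psi t) p q ys"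
    "0 \<le> t \<Longrightarrow> t < 1 \<Longrightarrow> strip_sum (hl_phi t) p q xs = strip_sum (hl_phi t) p q ys"
    using skew_hl_P[OF p] skew_hl_Q[OF _ _ p] by simp_all
qed

section \<open>The joint law of the field\<close>

text \<open>A substitute for conditional probabilities: proportionality is checked for each value of
  an auxiliary variable and then summed, so events of probability 0 need no separate
  treatment.\<close>

lemma (in prob_space) prob_countable_slices:
  fixes f :: "'a \<Rightarrow> 'b :: countable"
  assumes [measurable]: "f \<in> measurable M (count_space UNIV)" "A \<in> events" "B \<in> events"
    and eq: "\<And>x. prob {\<omega> \<in> A. f \<omega> = x} = c * prob {\<omega> \<in> B. f \<omega> = x}"
  shows "prob A = c * prob B"
proof -
  have slices: "(\<lambda>n. prob {\<omega> \<in> C. to_nat (f \<omega>) = n}) sums prob C" if [measurable]: "C \<in> events" for C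
  proof -
    have ev: "{\<omega> \<in> C. to_nat (f \<omega>) = n} \<in> events" for n
    proof -
      have "C \<inter> {\<omega> \<in> space M. to_nat (f \<omega>) = n} \<in> events" by measurable
      also have "C \<inter> {\<omega> \<in> space M. to_nat (f \<omega>) = n} = {\<omega> \<in> C. to_nat (f \<omega>) = n}"
        using sets.sets_into_space[OF that] by auto
      finally show ?thesis .
    qed
    have "(\<lambda>n. prob {\<omega> \<in> C. to_nat (f \<omega>) = n}) sums prob (\<Union>n. {\<omega> \<in> C. to_nat (f \<omega>) = n})"
      by (rule finite_measure_UNION) (use ev in \<open>auto simp: disjoint_family_on_def\<close>)
    also have "(\<Union>n. {\<omega> \<in> C. to_nat (f \<omega>) = n}) = C" by auto
    finally show ?thesis .
  qed
  have "prob {\<omega> \<in> A. to_nat (f \<omega>) = n} = c * prob {\<omega> \<in> B. to_nat (f \<omega>) = n}" for n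
  proof (cases "n \<in> range (to_nat :: 'b \<Rightarrow> nat)")
    case True
    then obtain x :: 'b where "n = to_nat x" by blast
    hence "(to_nat (f \<omega>) = n) = (f \<omega> = x)" for \<omega> by simp
    thus ?thesis using eq[of x] by simp
  next
    case False
    hence "to_nat (f \<omega>) \<noteq> n" for \<omega> by blast
    thus ?thesis by simp
  qed
  hence "(\<lambda>n. c * prob {\<omega> \<in> B. to_nat (f \<omega>) = n}) sums prob A" using slices[OF assms(2)] by simp
  thus ?thesis using sums_mult[OF slices[OF assms(3)], of c] sums_unique2 by blast
qed

text \<open>The values outside \<open>T\<close> have probability 0 each, and there are only
  countably many of them.\<close>

lemma (in prob_space) prob_finite_slices:
  fixes f :: "'a \<Rightarrow> 'b :: countable"
  assumes f [measurable]: "f \<in> measurable M (count_space UNIV)" and A [measurable]: "A \<in> events"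
    and T: "finite T" and zero: "\<And>x. x \<notin> T \<Longrightarrow> prob {\<omega> \<in> A. f \<omega> = x} = 0"
  shows "prob A = (\<Sum>x\<in>T. prob {\<omega> \<in> A. f \<omega> = x})"
proof -
  have sl: "{\<omega> \<in> A. P (f \<omega>)} \<in> events" for P
  proof -
    have "A \<inter> {\<omega> \<in> space M. P (f \<omega>)} \<in> events" by measurable
    also have "A \<inter> {\<omega> \<in> space M. P (f \<omega>)} = {\<omega> \<in> A. P (f \<omega>)}"
      using sets.sets_into_space[OF A] by auto
    finally show ?thesis .
  qed
  have sl': "{\<omega> \<in> A. f \<omega> \<notin> T} \<in> events" "{\<omega> \<in> A. f \<omega> \<in> T} \<in> events" "\<And>x. {\<omega> \<in> A. f \<omega> = x} \<in> events"
    using sl[of "\<lambda>x. x \<notin> T"] sl[of "\<lambda>x. x \<in> T"] sl by auto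
  have "prob {\<omega> \<in> A. f \<omega> \<notin> T} = 0 * prob {\<omega> \<in> A. f \<omega> \<notin> T}"
  proof (rule prob_countable_slices[OF f sl'(1) sl'(1)])
    fix x
    have "{\<omega> \<in> {\<omega> \<in> A. f \<omega> \<notin> T}. f \<omega> = x} = (if x \<in> T then {} else {\<omega> \<in> A. f \<omega> = x})"
      by auto
    thus "prob {\<omega> \<in> {\<omega> \<in> A. f \<omega> \<notin> T}. f \<omega> = x} = 0 * prob {\<omega> \<in> {\<omega> \<in> A. f \<omega> \<notin> T}. f \<omega> = x}"
      using zero[of x] by (cases "x \<in> T") (simp_all only: if_True if_False measure_empty mult_zero_left simp_thms)
  qed
  hence "prob {\<omega> \<in> A. f \<omega> \<notin> T} = 0" by simp
  moreover have "prob A = prob ({\<omega> \<in> A. f \<omega> \<in> T} \<union> {\<omega> \<in> A. f \<omega> \<notin> T})" by (rule arg_cong[of _ _ prob]) auto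
  moreover have "prob ({\<omega> \<in> A. f \<omega> \<in> T} \<union> {\<omega> \<in> A. f \<omega> \<notin> T}) = prob {\<omega> \<in> A. f \<omega> \<in> T} + prob {\<omega> \<in> A. f \<omega> \<notin> T}"
    by (rule finite_measure_Union) (use sl' in auto)
  moreover have "prob {\<omega> \<in> A. f \<omega> \<in> T} = (\<Sum>x\<in>T. prob {\<omega> \<in> A. f \<omega> = x})"
  proof -
    have "{\<omega> \<in> A. f \<omega> \<in> T} = (\<Union>x\<in>T. {\<omega> \<in> A. f \<omega> = x})" by auto
    moreover have "prob (\<Union>x\<in>T. {\<omega> \<in> A. f \<omega> = x}) = (\<Sum>x\<in>T. prob {\<omega> \<in> A. f \<omega> = x})"
      by (rule finite_measure_finite_Union[OF T]) (use sl'(3) in \<open>auto simp: disjoint_family_on_def\<close>)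
    ultimately show ?thesis by simp
  qed
  ultimately show ?thesis by simp
qed

lemma (in prob_space) prob_family_slices:
  fixes f :: "'i \<Rightarrow> 'a \<Rightarrow> 'b :: countable"
  assumes "finite X" "\<And>x. x \<in> X \<Longrightarrow> f x \<in> measurable M (count_space UNIV)" "A \<in> events" "B \<in> events"
    and "\<And>g. prob {\<omega> \<in> A. \<forall>x\<in>X. f x \<omega> = g x} = c * prob {\<omega> \<in> B. \<forall>x\<in>X. f x \<omega> = g x}"
  shows "prob A = c * prob B"
  using assms
proof (induction X arbitrary: A B)
  case (insert x X)
  have sl: "{\<omega> \<in> C. f x \<omega> = y} \<in> events" if "C \<in> events" for C y
  proof -
    have [measurable]: "f x \<in> measurable M (count_space UNIV)" "C \<in> events" using insert.prems(1)[of x] that by auto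
    have "C \<inter> {\<omega> \<in> space M. f x \<omega> = y} \<in> events" by measurable
    also have "C \<inter> {\<omega> \<in> space M. f x \<omega> = y} = {\<omega> \<in> C. f x \<omega> = y}"
      using sets.sets_into_space[OF that] by auto
    finally show ?thesis .
  qed
  show ?case
  proof (rule prob_countable_slices[of "f x"])
    fix y
    show "prob {\<omega> \<in> A. f x \<omega> = y} = c * prob {\<omega> \<in> B. f x \<omega> = y}"
    proof (rule insert.IH)
      fix g
      have "{\<omega> \<in> {\<omega> \<in> C. f x \<omega> = y}. \<forall>x\<in>X. f x \<omega> = g x} = {\<omega> \<in> C. \<forall>z\<in>insert x X. f z \<omega> = (g(x := y)) z}" for C
        using insert.hyps by auto
      thus "prob {\<omega> \<in> {\<omega> \<in> A. f x \<omega> = y}. \<forall>x\<in>X. f x \<omega> = g x} = c * prob {\<omega> \<in> {\<omega> \<in> B. f x \<omega> = y}. \<forall>x\<in>X. f x \<omega> = g x}"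
        using insert.prems(4)[of "g(x := y)"] by simp
    qed (use insert.prems sl in auto)
  qed (use insert.prems in auto)
qed simp

definition input_prob :: "real \<Rightarrow> real \<Rightarrow> nat \<Rightarrow> real" where
  "input_prob t x d = (1 - (if d \<ge> 1 then t else 0)) * x ^ d * ((1 - x) / (1 - t * x))"

text \<open>The input is determined by the four signatures around a box, so that averaging over it leaves
  a single term.\<close>

definition hl_kernel :: "real \<Rightarrow> real \<Rightarrow> int list \<Rightarrow> int list \<Rightarrow> int list \<Rightarrow> int list \<Rightarrow> real" where
  "hl_kernel t x \<mu> \<rho> la \<nu> = (let d = sum_list \<rho> + sum_list la - sum_list \<mu> - sum_list \<nu> in
     if d < 0 then 0 else input_prob t x (nat d) * hl_U_input t (nat d) \<mu> \<rho> la \<nu>)"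

definition triangle :: "nat \<Rightarrow> (nat \<times> nat) set" where
  "triangle n = {(i, j). 1 \<le> i \<and> 1 \<le> j \<and> i + j \<le> n}"

lemma finite_triangle: "finite (triangle n)"
  by (rule finite_subset[of _ "{..n} \<times> {..n}"]) (auto simp: triangle_def)

definition box_trans :: "real \<Rightarrow> (nat \<Rightarrow> nat \<Rightarrow> nat) \<Rightarrow> (nat \<Rightarrow> nat \<Rightarrow> int list) \<Rightarrow> nat \<times> nat \<Rightarrow> real" where
  "box_trans t d s = (\<lambda>(i, j). hl_U_input t (d i j) (s (i - 1) j) (s i j) (s (i - 1) (j - 1)) (s i (j - 1)))"

definition boundary_ok :: "(nat \<Rightarrow> nat \<Rightarrow> int list) \<Rightarrow> bool" where
  "boundary_ok s \<longleftrightarrow> (\<forall>i. s i 0 = []) \<and> (\<forall>j. s 0 j = replicate j 0)"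

definition down_closed :: "(nat \<times> nat) set \<Rightarrow> bool" where
  "down_closed D \<longleftrightarrow> (\<forall>i j i' j'. (i, j) \<in> D \<longrightarrow> 1 \<le> i' \<longrightarrow> i' \<le> i \<longrightarrow> 1 \<le> j' \<longrightarrow> j' \<le> j \<longrightarrow> (i', j') \<in> D)"

lemma box_trans_cong:
  assumes "down_closed D" "x \<in> D" "D \<subseteq> {1..} \<times> {1..}" "boundary_ok s" "boundary_ok s'"
    "\<And>i j. (i, j) \<in> D \<Longrightarrow> s i j = s' i j" "d (fst x) (snd x) = d' (fst x) (snd x)"
  shows "box_trans t d s x = box_trans t d' s' x"
proof -
  obtain i j where x: "x = (i, j)" by (cases x)
  have ij: "1 \<le> i" "1 \<le> j" using assms(2,3) x by auto
  have "s i' j' = s' i' j'" if "i' \<le> i" "j' \<le> j" for i' j'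
  proof (cases "1 \<le> i' \<and> 1 \<le> j'")
    case True
    hence "(i', j') \<in> D" using assms(1,2) x that unfolding down_closed_def by blast
    thus ?thesis by (rule assms(6))
  next
    case False
    hence "i' = 0 \<or> j' = 0" by auto
    thus ?thesis using assms(4,5) by (auto simp: boundary_ok_def)
  qed
  thus ?thesis using assms(7) by (simp add: box_trans_def x)
qed

lemma interlace_nonneg:
  assumes "interlace \<mu> \<rho>" "length \<mu> = length \<rho>" "\<forall>a\<in>set \<mu>. 0 \<le> a"
  shows "\<forall>a\<in>set \<rho>. 0 \<le> a"
proof
  fix a assume "a \<in> set \<rho>"
  then obtain i where i: "i < length \<rho>" "a = \<rho> ! i" by (auto simp: in_set_conv_nth)
  have "\<mu> ! i \<le> \<rho> ! i" using assms i by (auto simp: interlace_def)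
  moreover have "0 \<le> \<mu> ! i" using assms i by auto
  ultimately show "0 \<le> a" using i by simp
qed

text \<open>Non-zero weights propagate lengths, signs and interlacing from the boundary through
  \<open>D\<close>. The conclusions are the hypotheses of \<open>hl_U_input_stochastic\<close> for
  the next box \<open>(i, j)\<close>.\<close>

lemma box_trans_support:
  assumes D: "down_closed D" "D \<subseteq> {1..} \<times> {1..}" and s: "boundary_ok s"
    and nz: "\<And>x. x \<in> D \<Longrightarrow> box_trans t d s x \<noteq> 0"
    and ij: "1 \<le> i" "1 \<le> j" "\<And>i' j'. 1 \<le> i' \<Longrightarrow> i' \<le> i \<Longrightarrow> 1 \<le> j' \<Longrightarrow> j' \<le> j \<Longrightarrow> (i', j') \<noteq> (i, j) \<Longrightarrow> (i', j') \<in> D"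
  shows "s (i - 1) (j - 1) \<in> Sig (j - 1)" "s i (j - 1) \<in> Sig (j - 1)" "s (i - 1) j \<in> Sig j"
    "\<forall>a\<in>set (s (i - 1) (j - 1)). 0 \<le> a" "\<forall>a\<in>set (s i (j - 1)). 0 \<le> a" "\<forall>a\<in>set (s (i - 1) j). 0 \<le> a"
    "interlace (s (i - 1) (j - 1)) (s (i - 1) j)" "interlace (s (i - 1) (j - 1)) (s i (j - 1))"
proof -
  have bd: "s p 0 = []" "s 0 q = replicate q 0" for p q using s by (auto simp: boundary_ok_def)
  have rep: "replicate q (0 :: int) \<in> Sig q" for q by (auto simp: Sig_def sorted_wrt_iff_nth_less)
  have nzD: "hl_U_input t (d p q) (s (p - 1) q) (s p q) (s (p - 1) (q - 1)) (s p (q - 1)) \<noteq> 0" if "(p, q) \<in> D" for p q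
    using nz[OF that] by (simp add: box_trans_def)
  have sig: "s p q \<in> Sig q" if "(p, q) \<in> D \<or> p = 0 \<or> q = 0" for p q
    using that
  proof (induction q arbitrary: p)
    case 0
    thus ?case by (simp add: bd Sig_def)
  next
    case (Suc q)
    show ?case
    proof (cases "p = 0")
      case True thus ?thesis using rep by (simp add: bd del: replicate_Suc)
    next
      case False
      hence pD: "(p, Suc q) \<in> D" using Suc.prems by auto
      have below: "(p', q') \<in> D \<or> p' = 0 \<or> q' = 0" if "p' \<le> p" "q' \<le> Suc q" for p' q'
        using D(1) pD that unfolding down_closed_def by (metis One_nat_def Suc_leI neq0_conv)
      have "s (p - 1) q \<in> Sig q" "s p q \<in> Sig q" by (rule Suc.IH, rule below, simp, simp)+
      hence len: "length (s (p - 1) q) = q" "length (s p q) = q" by (simp_all add: Sig_def)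
      have "hl_U_input t (d p (Suc q)) (s (p - 1) (Suc q)) (s p (Suc q)) (s (p - 1) q) (s p q) \<noteq> 0"
        using nzD[OF pD] unfolding diff_Suc_1 .
      from hl_U_input_nonzeroD[OF this len] show ?thesis by blast
    qed
  qed
  have rel: "interlace (s (p - 1) (q - 1)) (s (p - 1) q) \<and> interlace (s (p - 1) (q - 1)) (s p (q - 1)) \<and>
     interlace (s (p - 1) q) (s p q) \<and> interlace (s p (q - 1)) (s p q) \<and> length (s (p - 1) q) = length (s p q)" if pD: "(p, q) \<in> D" for p q
  proof -
    have p: "1 \<le> p" "1 \<le> q" using pD D(2) by auto
    have below: "(p', q') \<in> D \<or> p' = 0 \<or> q' = 0" if "p' \<le> p" "q' \<le> q" for p' q'
      using D(1) pD that unfolding down_closed_def by (metis One_nat_def Suc_leI neq0_conv)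
    have l: "length (s p' q') = q'" if "p' \<le> p" "q' \<le> q" for p' q' using sig[OF below[OF that]] by (simp add: Sig_def)
    show ?thesis
    proof -
      have "length (s (p - 1) (q - 1)) = q - 1" "length (s p (q - 1)) = q - 1"
        "length (s (p - 1) q) = q" "length (s p q) = q" by (rule l, simp, simp)+
      thus ?thesis using hl_U_input_nonzeroD(1-4)[OF nzD[OF pD]] by metis
    qed
  qed
  have nn: "\<forall>a\<in>set (s p q). 0 \<le> a" if "(p, q) \<in> D \<or> p = 0 \<or> q = 0" for p q
    using that
  proof (induction p)
    case 0 thus ?case by (simp add: bd)
  next
    case (Suc p)
    show ?case
    proof (cases "q = 0")
      case True thus ?thesis by (simp add: bd)
    next
      case False
      hence pD: "(Suc p, q) \<in> D" using Suc.prems by auto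
      have "(p, q) \<in> D \<or> p = 0 \<or> q = 0"
        using D(1) pD False unfolding down_closed_def by (metis One_nat_def Suc_leI neq0_conv le_SucI order_refl)
      hence "\<forall>a\<in>set (s p q). 0 \<le> a" by (rule Suc.IH)
      thus ?thesis using rel[OF pD] interlace_nonneg[of "s p q" "s (Suc p) q"] by simp
    qed
  qed
  have c: "(i - 1, j - 1) \<in> D \<or> i - 1 = 0 \<or> j - 1 = 0" "(i, j - 1) \<in> D \<or> i = 0 \<or> j - 1 = 0" "(i - 1, j) \<in> D \<or> i - 1 = 0 \<or> j = 0"
  proof -
    have "(i - 1, j - 1) \<in> D" if "1 \<le> i - 1" "1 \<le> j - 1" by (rule ij(3)) (use that in auto)
    moreover have "(i, j - 1) \<in> D" if "1 \<le> j - 1" by (rule ij(3)) (use that ij(1) in auto)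
    moreover have "(i - 1, j) \<in> D" if "1 \<le> i - 1" by (rule ij(3)) (use that ij(2) in auto)
    ultimately show "(i - 1, j - 1) \<in> D \<or> i - 1 = 0 \<or> j - 1 = 0" "(i, j - 1) \<in> D \<or> i = 0 \<or> j - 1 = 0"
      "(i - 1, j) \<in> D \<or> i - 1 = 0 \<or> j = 0" by linarith+
  qed
  show "s (i - 1) (j - 1) \<in> Sig (j - 1)" "s i (j - 1) \<in> Sig (j - 1)" "s (i - 1) j \<in> Sig j"
    using sig c by blast+
  show "\<forall>a\<in>set (s (i - 1) (j - 1)). 0 \<le> a" "\<forall>a\<in>set (s i (j - 1)). 0 \<le> a" "\<forall>a\<in>set (s (i - 1) j). 0 \<le> a"
    using nn c by blast+
  show "interlace (s (i - 1) (j - 1)) (s (i - 1) j)"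
  proof (cases "i = 1")
    case True thus ?thesis using ij(2) by (auto simp: bd interlace_def)
  next
    case False
    hence "(i - 1, j) \<in> D" using c(3) ij by auto
    thus ?thesis using rel by blast
  qed
  show "interlace (s (i - 1) (j - 1)) (s i (j - 1))"
  proof (cases "j = 1")
    case True thus ?thesis by (simp add: bd interlace_def)
  next
    case False
    hence "(i, j - 1) \<in> D" using c(2) ij by auto
    thus ?thesis using rel by blast
  qed
qed

section \<open>Product formula for the field and Markov property\<close>

context hl_rsk_field
begin

definition cyl :: "(nat \<times> nat) set \<Rightarrow> (nat \<times> nat) set \<Rightarrow> (nat \<Rightarrow> nat \<Rightarrow> nat) \<Rightarrow> (nat \<Rightarrow> nat \<Rightarrow> int list) \<Rightarrow> 'w set" where
  "cyl S E d s = {\<omega> \<in> space M. (\<forall>(i, j)\<in>S. R i j \<omega> = d i j) \<and> (\<forall>(i, j)\<in>E. \<Lambda> i j \<omega> = s i j)}"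

lemma R_measurable: "1 \<le> i \<Longrightarrow> 1 \<le> j \<Longrightarrow> R i j \<in> measurable M (count_space UNIV)"
  using R_indep unfolding indep_vars_def by force

lemma cyl_events:
  assumes "finite S" "S \<subseteq> {1..} \<times> {1..}" "finite E"
  shows "cyl S E d s \<in> events"
proof -
  have "{\<omega> \<in> space M. \<forall>x\<in>S. R (fst x) (snd x) \<omega> = d (fst x) (snd x)} \<in> events"
  proof (intro sets.sets_Collect_finite_All assms(1))
    fix x assume "x \<in> S"
    hence [measurable]: "R (fst x) (snd x) \<in> measurable M (count_space UNIV)" using assms(2) by (intro R_measurable) auto
    show "{\<omega> \<in> space M. R (fst x) (snd x) \<omega> = d (fst x) (snd x)} \<in> events" by measurable
  qed
  moreover have "{\<omega> \<in> space M. \<forall>x\<in>E. \<Lambda> (fst x) (snd x) \<omega> = s (fst x) (snd x)} \<in> events"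
  proof (intro sets.sets_Collect_finite_All assms(3))
    fix x
    have [measurable]: "\<Lambda> (fst x) (snd x) \<in> measurable M (count_space UNIV)" by (rule field_measurable)
    show "{\<omega> \<in> space M. \<Lambda> (fst x) (snd x) \<omega> = s (fst x) (snd x)} \<in> events" by measurable
  qed
  ultimately have "{\<omega> \<in> space M. \<forall>x\<in>S. R (fst x) (snd x) \<omega> = d (fst x) (snd x)} \<inter>
     {\<omega> \<in> space M. \<forall>x\<in>E. \<Lambda> (fst x) (snd x) \<omega> = s (fst x) (snd x)} \<in> events" by (rule sets.Int)
  moreover have "cyl S E d s = {\<omega> \<in> space M. \<forall>x\<in>S. R (fst x) (snd x) \<omega> = d (fst x) (snd x)} \<inter>
     {\<omega> \<in> space M. \<forall>x\<in>E. \<Lambda> (fst x) (snd x) \<omega> = s (fst x) (snd x)}"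
    by (auto simp: cyl_def case_prod_beta')
  ultimately show ?thesis by simp
qed

lemma prob_inputs:
  assumes "finite S" "S \<subseteq> {1..} \<times> {1..}"
  shows "prob (cyl S {} d s) = (\<Prod>(i, j)\<in>S. input_prob t (a i * b j) (d i j))"
proof (cases "S = {}")
  case True thus ?thesis by (simp add: cyl_def prob_space)
next
  case False
  have "prob (\<Inter>x\<in>S. (case x of (i, j) \<Rightarrow> R i j) -` {d (fst x) (snd x)} \<inter> space M) =
      (\<Prod>x\<in>S. prob ((case x of (i, j) \<Rightarrow> R i j) -` {d (fst x) (snd x)} \<inter> space M))"
    by (rule indep_varsD[OF R_indep False assms]) auto
  also have "(\<Inter>x\<in>S. (case x of (i, j) \<Rightarrow> R i j) -` {d (fst x) (snd x)} \<inter> space M) = cyl S {} d s"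
    using False by (auto simp: cyl_def split: prod.splits)
  also have "(\<Prod>x\<in>S. prob ((case x of (i, j) \<Rightarrow> R i j) -` {d (fst x) (snd x)} \<inter> space M)) =
      (\<Prod>(i, j)\<in>S. input_prob t (a i * b j) (d i j))"
  proof (rule prod.cong[OF refl])
    fix x assume "x \<in> S"
    moreover obtain i j where x: "x = (i, j)" by (cases x)
    ultimately have "1 \<le> i" "1 \<le> j" using assms(2) by auto
    moreover have "(case x of (i, j) \<Rightarrow> R i j) -` {d (fst x) (snd x)} \<inter> space M = {\<omega> \<in> space M. R i j \<omega> = d i j}"
      using x by auto
    ultimately show "prob ((case x of (i, j) \<Rightarrow> R i j) -` {d (fst x) (snd x)} \<inter> space M) =
        (case x of (i, j) \<Rightarrow> input_prob t (a i * b j) (d i j))" using R_law x by (simp add: input_prob_def)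
  qed
  finally show ?thesis .
qed

text \<open>\<open>field_step\<close> iterated over the antidiagonals, starting from the independent
  inputs; all inputs up to \<open>K\<close> stay prescribed throughout.\<close>

lemma prob_triangle:
  assumes s: "boundary_ok s" and n: "1 \<le> n" "n \<le> K"
  shows "prob (cyl (triangle K) (triangle n) d s) =
    (\<Prod>(i, j)\<in>triangle K. input_prob t (a i * b j) (d i j)) * (\<Prod>x\<in>triangle n. box_trans t d s x)"
  using n
proof (induction n rule: dec_induct)
  case base
  have "triangle 1 = {}" by (auto simp: triangle_def)
  moreover have "triangle K \<subseteq> {1..} \<times> {1..}" by (auto simp: triangle_def)
  ultimately show ?case using prob_inputs[OF finite_triangle] by simp
next
  case (step n)
  let ?J = "{(i, j). 1 \<le> i \<and> 1 \<le> j \<and> i + j = Suc n}"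
  have tri: "triangle (Suc n) = triangle n \<union> ?J" "triangle n \<inter> ?J = {}" by (auto simp: triangle_def)
  have finJ: "finite ?J" using finite_triangle[of "Suc n"] unfolding tri(1) by simp
  have bd: "(\<forall>i j. i + j < Suc n \<longrightarrow> \<Lambda> i j \<omega> = s i j) \<longleftrightarrow> (\<forall>(i, j)\<in>triangle n. \<Lambda> i j \<omega> = s i j)" if \<omega>: "\<omega> \<in> space M" for \<omega>
  proof
    assume R: "\<forall>(i, j)\<in>triangle n. \<Lambda> i j \<omega> = s i j"
    show "\<forall>i j. i + j < Suc n \<longrightarrow> \<Lambda> i j \<omega> = s i j"
    proof (intro allI impI)
      fix i j assume ij: "i + j < Suc n"
      show "\<Lambda> i j \<omega> = s i j"
      proof (cases "i = 0 \<or> j = 0")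
        case True
        thus ?thesis using s field_bottom[OF \<omega>] field_left[OF \<omega>] by (auto simp: boundary_ok_def)
      next
        case False
        thus ?thesis using R ij by (auto simp: triangle_def)
      qed
    qed
  qed (auto simp: triangle_def)
  have Rk: "(\<forall>i\<ge>1. \<forall>j\<ge>1. i + j \<le> K \<longrightarrow> R i j \<omega> = d i j) \<longleftrightarrow> (\<forall>(i, j)\<in>triangle K. R i j \<omega> = d i j)" for \<omega>
    by (auto simp: triangle_def)
  have A: "{\<omega> \<in> space M. (\<forall>i\<ge>1. \<forall>j\<ge>1. i + j \<le> K \<longrightarrow> R i j \<omega> = d i j) \<and>
      (\<forall>i j. i + j < Suc n \<longrightarrow> \<Lambda> i j \<omega> = s i j)} = cyl (triangle K) (triangle n) d s"
    unfolding cyl_def Rk using bd by blast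
  have B: "{\<omega> \<in> space M. (\<forall>i\<ge>1. \<forall>j\<ge>1. i + j \<le> K \<longrightarrow> R i j \<omega> = d i j) \<and>
      (\<forall>i j. i + j < Suc n \<longrightarrow> \<Lambda> i j \<omega> = s i j) \<and> (\<forall>i\<ge>1. \<forall>j\<ge>1. i + j = Suc n \<longrightarrow> \<Lambda> i j \<omega> = s i j)} =
      cyl (triangle K) (triangle (Suc n)) d s"
    unfolding cyl_def Rk tri(1) ball_Un using bd by auto
  have "prob (cyl (triangle K) (triangle (Suc n)) d s) = prob (cyl (triangle K) (triangle n) d s) * (\<Prod>x\<in>?J. box_trans t d s x)"
    using field_step[of "Suc n" K d s] step.hyps step.prems unfolding A B box_trans_def by simp
  moreover have "prod (box_trans t d s) (triangle (Suc n)) = prod (box_trans t d s) (triangle n) * prod (box_trans t d s) ?J"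
    unfolding tri(1) using finite_triangle finJ tri(2) by (rule prod.union_disjoint)
  ultimately show ?case using step by simp
qed

text \<open>Antidiagonals are too rigid for general lattice paths. Starting from the full triangle,
  the signatures outside \<open>D\<close> are summed out one at a time, and each of these sums is 1
  by stochasticity.\<close>

lemma prob_down_closed:
  assumes t: "0 \<le> t" "t < 1" and s: "boundary_ok s" and K: "1 \<le> K" and D: "down_closed D" "D \<subseteq> triangle K"
  shows "prob (cyl (triangle K) D d s) =
    (\<Prod>(i, j)\<in>triangle K. input_prob t (a i * b j) (d i j)) * (\<Prod>x\<in>D. box_trans t d s x)"
  using s D
proof (induction "card (triangle K - D)" arbitrary: D s rule: less_induct)
  case less
  note [simp] = finite_triangle
  have finD: "finite D" by (rule finite_subset[OF less.prems(3) finite_triangle])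
  show ?case
  proof (cases "D = triangle K")
    case True thus ?thesis using prob_triangle[OF less.prems(1) K] by simp
  next
    case False
    hence ne: "triangle K - D \<noteq> {}" using less.prems(3) by blast
    \<comment> \<open>For a missing point with least \<open>i + j\<close>, all points weakly below
      and to the left of it are already in \<open>D\<close>, so \<open>D\<close> stays closed when
      it is added.\<close>
    obtain x where x: "x \<in> triangle K - D" "\<And>y. y \<in> triangle K - D \<Longrightarrow> fst x + snd x \<le> fst y + snd y"
      using ne ex_has_least_nat[of "\<lambda>x. x \<in> triangle K - D" _ "\<lambda>x. fst x + snd x"] by blast
    obtain i j where ij: "x = (i, j)" by (cases x)
    have ij1: "1 \<le> i" "1 \<le> j" "i + j \<le> K" "(i, j) \<notin> D" using x(1) ij by (auto simp: triangle_def)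
    have lower: "(i', j') \<in> D" if "1 \<le> i'" "i' \<le> i" "1 \<le> j'" "j' \<le> j" "(i', j') \<noteq> (i, j)" for i' j'
    proof (rule ccontr)
      assume "(i', j') \<notin> D"
      hence "(i', j') \<in> triangle K - D" using that ij1 by (auto simp: triangle_def)
      from x(2)[OF this] show False using that ij by auto
    qed
    let ?D = "insert (i, j) D"
    have D': "down_closed ?D" using less.prems(2) lower unfolding down_closed_def by blast
    have "D \<subseteq> {1..} \<times> {1..}" using less.prems(3) by (auto simp: triangle_def)
    note Dpos = this
    let ?P = "\<Prod>(i, j)\<in>triangle K. input_prob t (a i * b j) (d i j)" and ?s = "\<lambda>\<rho>. s(i := (s i)(j := \<rho>))"
    have s': "boundary_ok (?s \<rho>)" for \<rho> using less.prems(1) ij1 by (auto simp: boundary_ok_def)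
    have slice: "{\<omega> \<in> cyl (triangle K) D d s. \<Lambda> i j \<omega> = \<rho>} = cyl (triangle K) ?D d (?s \<rho>)" for \<rho>
      using ij1(4) by (auto simp: cyl_def)
    let ?U = "\<lambda>\<rho>. hl_U_input t (d i j) (s (i - 1) j) \<rho> (s (i - 1) (j - 1)) (s i (j - 1))"
    have IH: "prob {\<omega> \<in> cyl (triangle K) D d s. \<Lambda> i j \<omega> = \<rho>} = ?P * (\<Prod>x\<in>D. box_trans t d s x) * ?U \<rho>" for \<rho>
    proof -
      have "card (triangle K - ?D) < card (triangle K - D)" by (rule psubset_card_mono) (use x(1) ij in auto)
      hence "prob (cyl (triangle K) ?D d (?s \<rho>)) = ?P * (\<Prod>x\<in>?D. box_trans t d (?s \<rho>) x)"
        by (rule less.hyps[OF _ s' D']) (use less.prems(3) x(1) ij in auto)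
      also have "(\<Prod>x\<in>?D. box_trans t d (?s \<rho>) x) = box_trans t d (?s \<rho>) (i, j) * (\<Prod>x\<in>D. box_trans t d (?s \<rho>) x)"
        using ij1(4) finD by simp
      also have "box_trans t d (?s \<rho>) (i, j) = ?U \<rho>"
      proof -
        have "i - 1 \<noteq> i" "j - 1 \<noteq> j" using ij1 by auto
        thus ?thesis by (simp add: box_trans_def)
      qed
      also have "(\<Prod>x\<in>D. box_trans t d (?s \<rho>) x) = (\<Prod>x\<in>D. box_trans t d s x)"
        by (intro prod.cong[OF refl] box_trans_cong[OF less.prems(2) _ Dpos s' less.prems(1)]) (use ij1(4) in auto)
      finally show ?thesis unfolding slice by (simp only: mult_ac)
    qed
    have cyl_ev: "cyl (triangle K) D d s \<in> events" by (rule cyl_events[OF finite_triangle _ finD]) (auto simp: triangle_def)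
    show ?thesis
    proof (cases "(\<Prod>x\<in>D. box_trans t d s x) = 0")
      case True
      hence "prob (cyl (triangle K) D d s) = (\<Sum>\<rho>\<in>{}. prob {\<omega> \<in> cyl (triangle K) D d s. \<Lambda> i j \<omega> = \<rho>})"
        by (intro prob_finite_slices[OF field_measurable cyl_ev]) (auto simp: IH)
      thus ?thesis using True by simp
    next
      case False
      hence nz: "\<And>x. x \<in> D \<Longrightarrow> box_trans t d s x \<noteq> 0" using finD by auto
      note sup = box_trans_support[OF less.prems(2) Dpos less.prems(1) nz ij1(1,2) lower]
      have nonneg: "0 \<le> c" if "c \<in> set (s (i - 1) (j - 1)) \<union> set (s i (j - 1)) \<union> set (s (i - 1) j)" for c
        using sup(4-6) that by blast
      have sucj: "s (i - 1) j \<in> Sig (Suc (j - 1))" using sup(3) ij1(2) by simp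
      have "\<exists>T. finite T \<and> (\<forall>\<rho>. ?U \<rho> \<noteq> 0 \<longrightarrow> \<rho> \<in> T) \<and> (\<Sum>\<rho>\<in>T. ?U \<rho>) = 1"
        by (rule hl_U_input_stochastic[OF t sup(1,2) sucj nonneg sup(7,8), where r = "d i j"]) blast+
      then obtain T where T: "finite T" "\<forall>\<rho>. ?U \<rho> \<noteq> 0 \<longrightarrow> \<rho> \<in> T" "(\<Sum>\<rho>\<in>T. ?U \<rho>) = 1" by blast
      have "prob (cyl (triangle K) D d s) = (\<Sum>\<rho>\<in>T. prob {\<omega> \<in> cyl (triangle K) D d s. \<Lambda> i j \<omega> = \<rho>})"
      proof (rule prob_finite_slices[OF field_measurable cyl_ev T(1)])
        fix \<rho> assume "\<rho> \<notin> T"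
        hence "?U \<rho> = 0" using T(2) by blast
        thus "prob {\<omega> \<in> cyl (triangle K) D d s. \<Lambda> i j \<omega> = \<rho>} = 0" unfolding IH by simp
      qed
      also have "\<dots> = ?P * (\<Prod>x\<in>D. box_trans t d s x) * (\<Sum>\<rho>\<in>T. ?U \<rho>)" by (simp add: IH sum_distrib_left)
      finally show ?thesis using T(3) by simp
    qed
  qed
qed

text \<open>The points outside the quadrant with corner \<open>(i, j)\<close> form the largest
  down-closed set without this point. On it, with all inputs prescribed,
  \<open>prob_down_closed\<close> gives both identities; then the signatures outside
  \<open>E\<close> and the inputs at other boxes are summed out.\<close>

lemma markov_input:
  assumes t: "0 \<le> t" "t < 1" and s: "boundary_ok s" and ij: "(i, j) \<in> triangle K"
    and E: "E \<subseteq> triangle K" "\<And>p q. (p, q) \<in> E \<Longrightarrow> \<not> (i \<le> p \<and> j \<le> q)"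
      "\<And>p q. (p, q) \<in> {(i - 1, j), (i - 1, j - 1), (i, j - 1)} \<Longrightarrow> 1 \<le> p \<Longrightarrow> 1 \<le> q \<Longrightarrow> (p, q) \<in> E"
  shows "prob {\<omega> \<in> cyl {(i, j)} E d s. \<Lambda> i j \<omega> = \<rho>} =
      hl_U_input t (d i j) (s (i - 1) j) \<rho> (s (i - 1) (j - 1)) (s i (j - 1)) * prob (cyl {(i, j)} E d s)" (is ?A)
    and "prob (cyl {(i, j)} E d s) = input_prob t (a i * b j) (d i j) * prob (cyl {} E d s)" (is ?B)
proof -
  define D where "D = {(p, q) \<in> triangle K. \<not> (i \<le> p \<and> j \<le> q)}"
  have ij1: "1 \<le> i" "1 \<le> j" "i + j \<le> K" "(i, j) \<notin> D" using ij by (auto simp: triangle_def D_def)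
  have ED: "E \<subseteq> D" using E(1,2) by (auto simp: D_def)
  have DT: "D \<subseteq> triangle K" by (auto simp: D_def)
  have finD: "finite D" "finite E" using finite_subset[OF DT finite_triangle] finite_subset[OF E(1) finite_triangle] by auto
  have Tpos: "triangle K \<subseteq> {1..} \<times> {1..}" by (auto simp: triangle_def)
  have D1: "down_closed D" unfolding down_closed_def D_def triangle_def by (auto intro: order.trans)
  have D2: "down_closed (insert (i, j) D)"
    unfolding down_closed_def D_def using ij1 by (auto simp: triangle_def)
  define U where "U = hl_U_input t (d i j) (s (i - 1) j) \<rho> (s (i - 1) (j - 1)) (s i (j - 1))"
  define d' where "d' g = (\<lambda>p q. if (p, q) = (i, j) then d i j else g (p, q))" for g :: "nat \<times> nat \<Rightarrow> nat"
  define s' where "s' h = (\<lambda>p q. if (p, q) \<in> D - E then h (p, q) else s p q)" for h :: "nat \<times> nat \<Rightarrow> int list"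
  have bd: "boundary_ok (s' h)" for h
    using s DT by (auto simp: boundary_ok_def s'_def triangle_def)
  have same: "s' h p q = s p q" if pq: "(p, q) \<in> {(i - 1, j), (i - 1, j - 1), (i, j - 1)}" for h p q
  proof -
    have "(p, q) \<notin> D - E"
    proof
      assume *: "(p, q) \<in> D - E"
      hence "1 \<le> p" "1 \<le> q" using DT Tpos by auto
      from E(3)[OF pq this] * show False by blast
    qed
    thus ?thesis unfolding s'_def by (simp only: if_False)
  qed
  have s'3: "s' h (i - 1) j = s (i - 1) j" "s' h (i - 1) (j - 1) = s (i - 1) (j - 1)" "s' h i (j - 1) = s i (j - 1)" for h
    by (rule same, simp)+
  have K: "1 \<le> K" using ij1 by simp
  let ?P = "\<lambda>S d. \<Prod>(i, j)\<in>S. input_prob t (a i * b j) (d i j)"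
  note law = prob_down_closed[OF t bd K]
  have Rm: "(\<lambda>(p, q). R p q) x \<in> measurable M (count_space UNIV)" if "x \<in> triangle K - {(i, j)}" for x
    using that R_measurable by (auto simp: triangle_def)
  have Lm: "(\<lambda>(p, q). \<Lambda> p q) x \<in> measurable M (count_space UNIV)" for x
    using field_measurable by (cases x) auto
  have ev: "{\<omega> \<in> cyl S E d s. \<Lambda> i j \<omega> = \<rho>} \<in> events" "cyl S E d s \<in> events" if "S \<subseteq> {(i, j)}" for S
  proof -
    have fS: "finite S" "S \<subseteq> {1..} \<times> {1..}" using that ij1 finite_subset by auto
    show "cyl S E d s \<in> events" using fS finD by (intro cyl_events)
    have upd: "(s(i := (s i)(j := \<rho>))) p q = (if (p, q) = (i, j) then \<rho> else s p q)" for p q by simp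
    have "(\<forall>x\<in>E. case x of (p, q) \<Rightarrow> \<Lambda> p q \<omega> = (s(i := (s i)(j := \<rho>))) p q) =
        (\<forall>x\<in>E. case x of (p, q) \<Rightarrow> \<Lambda> p q \<omega> = s p q)" for \<omega>
      by (rule ball_cong[OF refl]) (use ED ij1(4) in \<open>auto simp: upd\<close>)
    hence "{\<omega> \<in> cyl S E d s. \<Lambda> i j \<omega> = \<rho>} = cyl S (insert (i, j) E) d (s(i := (s i)(j := \<rho>)))"
      unfolding cyl_def ball_insert by auto
    thus "{\<omega> \<in> cyl S E d s. \<Lambda> i j \<omega> = \<rho>} \<in> events" using fS finD by (simp add: cyl_events)
  qed
  have ext: "{\<omega> \<in> A. \<forall>x\<in>X. (\<lambda>(p, q). R p q) x \<omega> = g x} \<in> events"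
    if "A \<in> events" "X \<subseteq> triangle K" for A X and g :: "nat \<times> nat \<Rightarrow> nat"
  proof -
    have "A \<inter> cyl X {} (\<lambda>p q. g (p, q)) s \<in> events"
      using that Tpos by (intro sets.Int cyl_events finite_subset[OF _ finite_triangle]) auto
    also have "A \<inter> cyl X {} (\<lambda>p q. g (p, q)) s = {\<omega> \<in> A. \<forall>x\<in>X. (\<lambda>(p, q). R p q) x \<omega> = g x}"
      using sets.sets_into_space[OF that(1)] by (auto simp: cyl_def)
    finally show ?thesis .
  qed
  have RR': "(\<forall>(p, q)\<in>triangle K - {(i, j)}. R p q \<omega> = d' g p q) \<longleftrightarrow>
      (\<forall>x\<in>triangle K - {(i, j)}. (\<lambda>(p, q). R p q) x \<omega> = g x)" for g \<omega>
    by (rule ball_cong[OF refl]) (auto simp: d'_def)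
  have RR: "(\<forall>(p, q)\<in>triangle K. R p q \<omega> = d' g p q) \<longleftrightarrow>
      R i j \<omega> = d i j \<and> (\<forall>x\<in>triangle K - {(i, j)}. (\<lambda>(p, q). R p q) x \<omega> = g x)" for g \<omega>
  proof -
    have "(\<forall>x\<in>triangle K. P x) \<longleftrightarrow> P (i, j) \<and> (\<forall>x\<in>triangle K - {(i, j)}. P x)" for P using ij by blast
    from this[of "\<lambda>(p, q). R p q \<omega> = d' g p q"] show ?thesis unfolding RR' by (simp add: d'_def)
  qed
  have LL: "(\<forall>(p, q)\<in>D. \<Lambda> p q \<omega> = s' h p q) \<longleftrightarrow>
      (\<forall>(p, q)\<in>E. \<Lambda> p q \<omega> = s p q) \<and> (\<forall>x\<in>D - E. (\<lambda>(p, q). \<Lambda> p q) x \<omega> = h x)" for h \<omega>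
  proof -
    have "(\<forall>x\<in>D. P x) \<longleftrightarrow> (\<forall>x\<in>E. P x) \<and> (\<forall>x\<in>D - E. P x)" for P using ED by blast
    hence "(\<forall>(p, q)\<in>D. \<Lambda> p q \<omega> = s' h p q) \<longleftrightarrow>
        (\<forall>(p, q)\<in>E. \<Lambda> p q \<omega> = s' h p q) \<and> (\<forall>(p, q)\<in>D - E. \<Lambda> p q \<omega> = s' h p q)" .
    moreover have "(\<forall>(p, q)\<in>E. \<Lambda> p q \<omega> = s' h p q) \<longleftrightarrow> (\<forall>(p, q)\<in>E. \<Lambda> p q \<omega> = s p q)"
      by (rule ball_cong[OF refl]) (auto simp: s'_def)
    moreover have "(\<forall>(p, q)\<in>D - E. \<Lambda> p q \<omega> = s' h p q) \<longleftrightarrow> (\<forall>x\<in>D - E. (\<lambda>(p, q). \<Lambda> p q) x \<omega> = h x)"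
      by (rule ball_cong[OF refl]) (auto simp: s'_def)
    ultimately show ?thesis by simp
  qed
  have set1: "{\<omega> \<in> {\<omega> \<in> cyl {(i, j)} E d s. \<forall>x\<in>triangle K - {(i, j)}. (\<lambda>(p, q). R p q) x \<omega> = g x}.
      \<forall>x\<in>D - E. (\<lambda>(p, q). \<Lambda> p q) x \<omega> = h x} = cyl (triangle K) D (d' g) (s' h)" for g h
    unfolding cyl_def RR LL by auto
  have set2: "{\<omega> \<in> {\<omega> \<in> cyl {} E d s. \<forall>x\<in>triangle K - {(i, j)}. (\<lambda>(p, q). R p q) x \<omega> = g x}.
      \<forall>x\<in>D - E. (\<lambda>(p, q). \<Lambda> p q) x \<omega> = h x} = cyl (triangle K - {(i, j)}) D (d' g) (s' h)" for g h
    unfolding cyl_def RR' LL by auto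
  have upd: "{\<omega> \<in> cyl (triangle K) D d s. \<Lambda> i j \<omega> = \<rho>} =
      cyl (triangle K) (insert (i, j) D) d (s(i := (s i)(j := \<rho>)))" for d s
    using ij1(4) by (auto simp: cyl_def)
  have keyA: "prob {\<omega> \<in> cyl (triangle K) D (d' g) (s' h). \<Lambda> i j \<omega> = \<rho>} = U * prob (cyl (triangle K) D (d' g) (s' h))" for g h
  proof -
    let ?s = "(s' h)(i := (s' h i)(j := \<rho>))"
    have bd': "boundary_ok ?s" using bd[of h] ij1 by (auto simp: boundary_ok_def)
    have "prob {\<omega> \<in> cyl (triangle K) D (d' g) (s' h). \<Lambda> i j \<omega> = \<rho>} =
        ?P (triangle K) (d' g) * (\<Prod>x\<in>insert (i, j) D. box_trans t (d' g) ?s x)"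
      unfolding upd by (rule prob_down_closed[OF t bd' K D2]) (use ij DT in auto)
    also have "(\<Prod>x\<in>insert (i, j) D. box_trans t (d' g) ?s x) = box_trans t (d' g) ?s (i, j) * (\<Prod>x\<in>D. box_trans t (d' g) ?s x)"
      using ij1(4) finD by simp
    also have "(\<Prod>x\<in>D. box_trans t (d' g) ?s x) = (\<Prod>x\<in>D. box_trans t (d' g) (s' h) x)"
      by (intro prod.cong[OF refl] box_trans_cong[OF D1 _ order.trans[OF DT Tpos] bd' bd]) (use ij1(4) in auto)
    also have "box_trans t (d' g) ?s (i, j) = U"
    proof -
      have "i - 1 \<noteq> i" "j - 1 \<noteq> j" using ij1 by auto
      thus ?thesis using s'3[of h] by (simp add: box_trans_def U_def d'_def)
    qed
    finally show ?thesis using law[OF D1 DT, of "d' g" h] by simp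
  qed
  \<comment> \<open>No weight in \<open>D\<close> involves the input at \<open>(i, j)\<close>, so
    this input is independent of everything seen on \<open>D\<close>.\<close>
  have keyB: "prob (cyl (triangle K) D (d' g) (s' h)) =
      input_prob t (a i * b j) (d i j) * prob (cyl (triangle K - {(i, j)}) D (d' g) (s' h))" for g h
  proof -
    let ?c = "?P (triangle K - {(i, j)}) (d' g) * (\<Prod>x\<in>D. box_trans t (d' g) (s' h) x)"
    have updR: "((d' g)(i := (d' g i)(j := r))) p q = (if (p, q) = (i, j) then r else d' g p q)" for r p q by simp
    have full: "prob (cyl (triangle K) D ((d' g)(i := (d' g i)(j := r))) (s' h)) = input_prob t (a i * b j) r * ?c" for r
    proof -
      let ?d = "(d' g)(i := (d' g i)(j := r))"
      have "?P (triangle K) ?d = input_prob t (a i * b j) r * ?P (triangle K - {(i, j)}) ?d"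
        using ij finite_triangle by (subst prod.remove[of _ "(i, j)"]) auto
      also have "?P (triangle K - {(i, j)}) ?d = ?P (triangle K - {(i, j)}) (d' g)"
        by (rule prod.cong[OF refl]) (auto simp: updR simp del: fun_upd_apply split: if_split_asm)
      finally have "?P (triangle K) ?d = input_prob t (a i * b j) r * ?P (triangle K - {(i, j)}) (d' g)" .
      moreover have "(\<Prod>x\<in>D. box_trans t ?d (s' h) x) = (\<Prod>x\<in>D. box_trans t (d' g) (s' h) x)"
        by (intro prod.cong[OF refl] box_trans_cong[OF D1 _ order.trans[OF DT Tpos] bd bd]) (use ij1(4) in auto)
      ultimately show ?thesis using law[OF D1 DT, of ?d h] by simp
    qed
    have "prob (cyl (triangle K - {(i, j)}) D (d' g) (s' h)) = ?c * prob (space M)"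
    proof (rule prob_countable_slices[OF R_measurable[OF ij1(1,2)]])
      show "cyl (triangle K - {(i, j)}) D (d' g) (s' h) \<in> events"
        using Tpos finD finite_triangle by (intro cyl_events) auto
      fix r
      have "{\<omega> \<in> cyl (triangle K - {(i, j)}) D (d' g) (s' h). R i j \<omega> = r} =
          cyl (triangle K) D ((d' g)(i := (d' g i)(j := r))) (s' h)"
      proof -
        have "(\<forall>x\<in>triangle K. P x) \<longleftrightarrow> P (i, j) \<and> (\<forall>x\<in>triangle K - {(i, j)}. P x)" for P using ij by blast
        from this[of "\<lambda>(p, q). R p q \<omega> = ((d' g)(i := (d' g i)(j := r))) p q" for \<omega>]
        have "(\<forall>(p, q)\<in>triangle K. R p q \<omega> = ((d' g)(i := (d' g i)(j := r))) p q) \<longleftrightarrow>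
            R i j \<omega> = r \<and> (\<forall>(p, q)\<in>triangle K - {(i, j)}. R p q \<omega> = ((d' g)(i := (d' g i)(j := r))) p q)" for \<omega>
          by simp
        moreover have "(\<forall>(p, q)\<in>triangle K - {(i, j)}. R p q \<omega> = ((d' g)(i := (d' g i)(j := r))) p q) \<longleftrightarrow>
            (\<forall>(p, q)\<in>triangle K - {(i, j)}. R p q \<omega> = d' g p q)" for \<omega>
          by (rule ball_cong[OF refl]) (auto simp: updR simp del: fun_upd_apply)
        ultimately show ?thesis unfolding cyl_def by auto
      qed
      thus "prob {\<omega> \<in> cyl (triangle K - {(i, j)}) D (d' g) (s' h). R i j \<omega> = r} = ?c * prob {\<omega> \<in> space M. R i j \<omega> = r}"
        using full[of r] R_law[OF ij1(1,2), of r] by (simp add: input_prob_def)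
    qed simp
    moreover have "prob (cyl (triangle K) D (d' g) (s' h)) = input_prob t (a i * b j) (d i j) * ?c"
    proof -
      have "(d' g)(i := (d' g i)(j := d i j)) = d' g" by (auto simp: d'_def fun_eq_iff)
      thus ?thesis using full[of "d i j"] by simp
    qed
    ultimately show ?thesis by (simp add: prob_space)
  qed
  show ?A unfolding U_def[symmetric]
  proof (rule prob_family_slices[where X = "triangle K - {(i, j)}" and f = "\<lambda>(p, q). R p q"])
    fix g
    show "prob {\<omega> \<in> {\<omega> \<in> cyl {(i, j)} E d s. \<Lambda> i j \<omega> = \<rho>}. \<forall>x\<in>triangle K - {(i, j)}. (\<lambda>(p, q). R p q) x \<omega> = g x} =
        U * prob {\<omega> \<in> cyl {(i, j)} E d s. \<forall>x\<in>triangle K - {(i, j)}. (\<lambda>(p, q). R p q) x \<omega> = g x}"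
    proof (rule prob_family_slices[where X = "D - E" and f = "\<lambda>(p, q). \<Lambda> p q"])
      fix h
      have "{\<omega> \<in> {\<omega> \<in> {\<omega> \<in> cyl {(i, j)} E d s. \<Lambda> i j \<omega> = \<rho>}.
            \<forall>x\<in>triangle K - {(i, j)}. (\<lambda>(p, q). R p q) x \<omega> = g x}. \<forall>x\<in>D - E. (\<lambda>(p, q). \<Lambda> p q) x \<omega> = h x} =
          {\<omega> \<in> cyl (triangle K) D (d' g) (s' h). \<Lambda> i j \<omega> = \<rho>}"
        unfolding set1[symmetric] by blast
      thus "prob {\<omega> \<in> {\<omega> \<in> {\<omega> \<in> cyl {(i, j)} E d s. \<Lambda> i j \<omega> = \<rho>}.
            \<forall>x\<in>triangle K - {(i, j)}. (\<lambda>(p, q). R p q) x \<omega> = g x}. \<forall>x\<in>D - E. (\<lambda>(p, q). \<Lambda> p q) x \<omega> = h x} =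
          U * prob {\<omega> \<in> {\<omega> \<in> cyl {(i, j)} E d s. \<forall>x\<in>triangle K - {(i, j)}. (\<lambda>(p, q). R p q) x \<omega> = g x}.
            \<forall>x\<in>D - E. (\<lambda>(p, q). \<Lambda> p q) x \<omega> = h x}"
        unfolding set1 by (simp only: keyA)
    qed (use finD Lm ext ev in auto)
  qed (use finite_triangle Rm ev in auto)
  show ?B
  proof (rule prob_family_slices[where X = "triangle K - {(i, j)}" and f = "\<lambda>(p, q). R p q"])
    fix g
    show "prob {\<omega> \<in> cyl {(i, j)} E d s. \<forall>x\<in>triangle K - {(i, j)}. (\<lambda>(p, q). R p q) x \<omega> = g x} =
        input_prob t (a i * b j) (d i j) * prob {\<omega> \<in> cyl {} E d s. \<forall>x\<in>triangle K - {(i, j)}. (\<lambda>(p, q). R p q) x \<omega> = g x}"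
    proof (rule prob_family_slices[where X = "D - E" and f = "\<lambda>(p, q). \<Lambda> p q"])
      fix h
      show "prob {\<omega> \<in> {\<omega> \<in> cyl {(i, j)} E d s. \<forall>x\<in>triangle K - {(i, j)}. (\<lambda>(p, q). R p q) x \<omega> = g x}.
            \<forall>x\<in>D - E. (\<lambda>(p, q). \<Lambda> p q) x \<omega> = h x} =
          input_prob t (a i * b j) (d i j) * prob {\<omega> \<in> {\<omega> \<in> cyl {} E d s. \<forall>x\<in>triangle K - {(i, j)}. (\<lambda>(p, q). R p q) x \<omega> = g x}.
            \<forall>x\<in>D - E. (\<lambda>(p, q). \<Lambda> p q) x \<omega> = h x}"
        unfolding set1 set2 by (rule keyB)
    qed (use finD Lm ext ev in auto)
  qed (use finite_triangle Rm ev in auto)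
qed

text \<open>The signatures around a box are compatible with one input only, so the sum over inputs
  has at most one term. Points of \<open>E\<close> on the axes are not random and are removed
  beforehand (\<open>E0\<close>).\<close>

lemma markov:
  assumes t: "0 \<le> t" "t < 1" and ij: "1 \<le> i" "1 \<le> j" and E: "finite E"
    "\<And>p q. (p, q) \<in> E \<Longrightarrow> \<not> (i \<le> p \<and> j \<le> q)"
    "{(i - 1, j), (i - 1, j - 1), (i, j - 1)} \<subseteq> E"
  shows "prob {\<omega> \<in> space M. (\<forall>(p, q)\<in>E. \<Lambda> p q \<omega> = s p q) \<and> \<Lambda> i j \<omega> = \<rho>} =
    prob {\<omega> \<in> space M. \<forall>(p, q)\<in>E. \<Lambda> p q \<omega> = s p q} *
    hl_kernel t (a i * b j) (s (i - 1) j) \<rho> (s (i - 1) (j - 1)) (s i (j - 1))"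
proof (cases "prob {\<omega> \<in> space M. \<forall>(p, q)\<in>E. \<Lambda> p q \<omega> = s p q} = 0")
  case True
  have "{\<omega> \<in> space M. \<forall>(p, q)\<in>E. \<Lambda> p q \<omega> = s p q} \<in> events"
    using cyl_events[of "{}" E] E(1) by (simp add: cyl_def)
  hence "prob {\<omega> \<in> space M. (\<forall>(p, q)\<in>E. \<Lambda> p q \<omega> = s p q) \<and> \<Lambda> i j \<omega> = \<rho>} \<le>
      prob {\<omega> \<in> space M. \<forall>(p, q)\<in>E. \<Lambda> p q \<omega> = s p q}"
    by (intro finite_measure_mono) auto
  hence "prob {\<omega> \<in> space M. (\<forall>(p, q)\<in>E. \<Lambda> p q \<omega> = s p q) \<and> \<Lambda> i j \<omega> = \<rho>} = 0"
    unfolding True by (rule order_antisym[OF _ measure_nonneg])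
  thus ?thesis using True by simp
next
  case False
  hence "{\<omega> \<in> space M. \<forall>(p, q)\<in>E. \<Lambda> p q \<omega> = s p q} \<noteq> {}"
    by (rule contrapos_nn) (simp only: measure_empty)
  \<comment> \<open>An outcome in the event shows that \<open>s\<close> has the correct boundary
    values on \<open>E\<close>; off \<open>E\<close> it can be changed to satisfy
    \<open>boundary_ok\<close>.\<close>
  then obtain \<omega> where \<omega>: "\<omega> \<in> space M" "\<forall>(p, q)\<in>E. \<Lambda> p q \<omega> = s p q" by blast
  have sE: "s p q = \<Lambda> p q \<omega>" if "(p, q) \<in> E" for p q using \<omega>(2) that by auto
  define s0 where "s0 p q = (if p = 0 then replicate q 0 else if q = 0 then [] else s p q)" for p q
  have s0: "boundary_ok s0" by (auto simp: boundary_ok_def s0_def)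
  have s0E: "s0 p q = s p q" if "(p, q) \<in> E" for p q
    using sE[OF that] field_bottom[OF \<omega>(1)] field_left[OF \<omega>(1)] by (auto simp: s0_def)
  define E0 where "E0 = E \<inter> {1..} \<times> {1..}"
  have setE: "{\<omega> \<in> space M. (\<forall>(p, q)\<in>E. \<Lambda> p q \<omega> = s p q)} = cyl {} E0 (\<lambda>_ _. r) s0" for r
  proof -
    have "(\<forall>(p, q)\<in>E. \<Lambda> p q \<omega>' = s p q) \<longleftrightarrow> (\<forall>(p, q)\<in>E0. \<Lambda> p q \<omega>' = s0 p q)" if w: "\<omega>' \<in> space M" for \<omega>'
    proof
      assume R: "\<forall>(p, q)\<in>E0. \<Lambda> p q \<omega>' = s0 p q"
      show "\<forall>(p, q)\<in>E. \<Lambda> p q \<omega>' = s p q"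
      proof clarify
        fix p q assume pq: "(p, q) \<in> E"
        show "\<Lambda> p q \<omega>' = s p q"
        proof (cases "p = 0 \<or> q = 0")
          case True
          thus ?thesis using sE[OF pq] field_bottom[OF w] field_left[OF w] field_bottom[OF \<omega>(1)] field_left[OF \<omega>(1)] by auto
        next
          case False
          hence "(p, q) \<in> E0" using pq by (auto simp: E0_def)
          thus ?thesis using R s0E[OF pq] by auto
        qed
      qed
    qed (use s0E in \<open>auto simp: E0_def\<close>)
    thus ?thesis by (auto simp: cyl_def)
  qed
  define K where "K = i + j + (\<Sum>x\<in>E. fst x + snd x)"
  have EK: "E0 \<subseteq> triangle K"
  proof
    fix x assume x: "x \<in> E0"
    hence "fst x + snd x \<le> (\<Sum>x\<in>E. fst x + snd x)" using E(1) by (intro member_le_sum) (auto simp: E0_def)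
    thus "x \<in> triangle K" using x by (auto simp: K_def triangle_def E0_def)
  qed
  have ijK: "(i, j) \<in> triangle K" using ij by (simp add: triangle_def K_def)
  have E0: "\<And>p q. (p, q) \<in> E0 \<Longrightarrow> \<not> (i \<le> p \<and> j \<le> q)"
    "\<And>p q. (p, q) \<in> {(i - 1, j), (i - 1, j - 1), (i, j - 1)} \<Longrightarrow> 1 \<le> p \<Longrightarrow> 1 \<le> q \<Longrightarrow> (p, q) \<in> E0"
    using E(2,3) by (auto simp: E0_def)
  let ?U = "\<lambda>r. hl_U_input t r (s (i - 1) j) \<rho> (s (i - 1) (j - 1)) (s i (j - 1))"
  let ?A = "{\<omega> \<in> space M. (\<forall>(p, q)\<in>E. \<Lambda> p q \<omega> = s p q) \<and> \<Lambda> i j \<omega> = \<rho>}"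
  let ?B = "{\<omega> \<in> space M. \<forall>(p, q)\<in>E. \<Lambda> p q \<omega> = s p q}"
  have three: "s0 (i - 1) j = s (i - 1) j" "s0 (i - 1) (j - 1) = s (i - 1) (j - 1)" "s0 i (j - 1) = s i (j - 1)"
    using E(3) by (auto intro!: s0E)
  have slice: "prob {\<omega> \<in> ?A. R i j \<omega> = r} = ?U r * (input_prob t (a i * b j) r * prob ?B)" for r
  proof -
    have "{\<omega> \<in> ?A. R i j \<omega> = r} = {\<omega> \<in> ?B. R i j \<omega> = r \<and> \<Lambda> i j \<omega> = \<rho>}" by blast
    also have "\<dots> = {\<omega> \<in> cyl {(i, j)} E0 (\<lambda>_ _. r) s0. \<Lambda> i j \<omega> = \<rho>}"
      unfolding setE[of r] by (auto simp: cyl_def)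
    finally show ?thesis
      using markov_input[OF t s0 ijK EK E0, of "\<lambda>_ _. r"] unfolding three setE[of r] by simp
  qed
  have len: "length (s (i - 1) (j - 1)) = j - 1" "length (s i (j - 1)) = j - 1"
    using sE[of "i - 1" "j - 1"] sE[of i "j - 1"] E(3) field_Sig[OF \<omega>(1)] by (auto simp: Sig_def)
  define dd where "dd = sum_list \<rho> + sum_list (s (i - 1) (j - 1)) - sum_list (s (i - 1) j) - sum_list (s i (j - 1))"
  have det: "int r = dd" if "?U r \<noteq> 0" for r
    using hl_U_input_nonzeroD[OF that len] by (simp add: dd_def)
  have Aev: "?A \<in> events"
  proof -
    have "cyl {} E (\<lambda>_ _. 0) s \<inter> cyl {} {(i, j)} (\<lambda>_ _. 0) (\<lambda>_ _. \<rho>) \<in> events" using E(1) by (intro sets.Int cyl_events) auto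
    also have "cyl {} E (\<lambda>_ _. 0) s \<inter> cyl {} {(i, j)} (\<lambda>_ _. 0) (\<lambda>_ _. \<rho>) = ?A" by (auto simp: cyl_def)
    finally show ?thesis .
  qed
  have "prob ?A = (\<Sum>r\<in>(if dd < 0 then {} else {nat dd}). prob {\<omega> \<in> ?A. R i j \<omega> = r})"
  proof (rule prob_finite_slices[OF R_measurable[OF ij] Aev])
    fix r assume r: "r \<notin> (if dd < 0 then {} else {nat dd})"
    have "?U r = 0"
    proof (rule ccontr)
      assume "?U r \<noteq> 0"
      hence "int r = dd" by (rule det)
      thus False using r by (auto split: if_splits)
    qed
    thus "prob {\<omega> \<in> ?A. R i j \<omega> = r} = 0" unfolding slice by (simp only: mult_zero_left)
  qed auto
  also have "\<dots> = prob ?B * hl_kernel t (a i * b j) (s (i - 1) j) \<rho> (s (i - 1) (j - 1)) (s i (j - 1))"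
    unfolding slice hl_kernel_def Let_def dd_def[symmetric] by simp
  finally show ?thesis .
qed

end

section \<open>The law along lattice paths\<close>

definition nonneg_Sig :: "nat \<Rightarrow> int list set" where
  "nonneg_Sig N = {l \<in> Sig N. \<forall>a\<in>set l. 0 \<le> a}"

lemma ht_young:
  assumes "\<forall>a\<in>set l. 0 \<le> a" "0 \<le> k"
  shows "ht (map int (young l)) k = ht l k"
  using assms by (induction l) (auto simp: young_def ht_Cons)

lemma sum_list_young: "\<forall>a\<in>set l. 0 \<le> a \<Longrightarrow> int (sum_list (young l)) = sum_list l"
  by (induction l) (auto simp: young_def)

lemma young_partition:
  assumes "l \<in> nonneg_Sig N"
  shows "is_partition (young l)"
proof -
  have "sorted_wrt (\<ge>) l" "\<forall>a\<in>set l. 0 \<le> a" using assms by (auto simp: nonneg_Sig_def Sig_def)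
  hence "sorted_wrt (\<ge>) (young l)"
    by (induction l) (auto simp: young_def)
  moreover have "0 \<notin> set (young l)" using assms by (auto simp: young_def nonneg_Sig_def)
  ultimately show ?thesis by (simp add: is_partition_def)
qed

lemma length_young: "length (young l) \<le> length l"
  by (simp add: young_def)

lemma nht_young: "l \<in> nonneg_Sig N \<Longrightarrow> int (nht (young l) k) = ht l (int k)"
  using ht_young[of l "int k"] by (simp add: nonneg_Sig_def ht_map_int)

lemma inj_on_young: "inj_on young (nonneg_Sig N)"
proof (rule inj_onI)
  fix l l' assume l: "l \<in> nonneg_Sig N" "l' \<in> nonneg_Sig N" "young l = young l'"
  show "l = l'"
  proof (rule Sig_eqI[of _ N])
    fix k show "ht l k = ht l' k"
    proof (cases "0 \<le> k")
      case True
      thus ?thesis using nht_young[OF l(1), of "nat k"] nht_young[OF l(2), of "nat k"] l(3) by simp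
    next
      case False
      hence "ht l k = int (length l)" "ht l' k = int (length l')"
        using l by (auto simp: nonneg_Sig_def ht_eq_length_iff)
      thus ?thesis using l by (simp add: nonneg_Sig_def Sig_def)
    qed
  qed (use l in \<open>auto simp: nonneg_Sig_def\<close>)
qed

lemma young_pad:
  assumes "is_partition p" "length p \<le> N"
  shows "map int p @ replicate (N - length p) 0 \<in> nonneg_Sig N" "young (map int p @ replicate (N - length p) 0) = p"
proof -
  have "sorted_wrt (\<ge>) (map int p)" "0 \<notin> set p" using assms by (auto simp: is_partition_def sorted_wrt_map)
  moreover have "sorted_wrt (\<ge>) (replicate n (0 :: int))" for n by (induction n) auto
  ultimately show "map int p @ replicate (N - length p) 0 \<in> nonneg_Sig N"
    using assms(2) by (auto simp: nonneg_Sig_def Sig_def sorted_wrt_append)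
  have "filter (\<lambda>a. a \<noteq> 0) (map int p) = map int p" using \<open>0 \<notin> set p\<close> by (intro filter_True) (auto intro!: gr0I)
  thus "young (map int p @ replicate (N - length p) 0) = p" by (simp add: young_def comp_def)
qed

lemma replicate_nonneg_Sig: "replicate N 0 \<in> nonneg_Sig N" and young_replicate: "young (replicate N 0) = []"
  using young_pad[of "[]" N] by (simp_all add: is_partition_def)

lemma young_Nil_iff: "l \<in> nonneg_Sig N \<Longrightarrow> young l = [] \<longleftrightarrow> l = replicate N 0"
  using inj_on_young[of N] young_replicate[of N] replicate_nonneg_Sig[of N] by (metis inj_onD)

definition over :: "nat \<Rightarrow> nat list set \<Rightarrow> int list set" where
  "over N X = {l \<in> nonneg_Sig N. young l \<in> X}"

lemma finite_over: "finite X \<Longrightarrow> finite (over N X)"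
  unfolding over_def using inj_on_young[of N]
  by (intro inj_on_finite[of young _ X]) (auto intro: inj_on_subset)

text \<open>Padding by zeros matches partitions with at most \<open>N\<close> rows and signatures of
  length \<open>N\<close>. Partitions with more rows have no counterpart, so their terms have to
  vanish.\<close>

lemma sum_over:
  assumes "finite X" "\<And>p. p \<in> X \<Longrightarrow> is_partition p" "\<And>p. p \<in> X \<Longrightarrow> N < length p \<Longrightarrow> f p = 0"
  shows "(\<Sum>p\<in>X. f p) = (\<Sum>l\<in>over N X. f (young l))"
proof -
  have "(\<Sum>l\<in>over N X. f (young l)) = (\<Sum>p\<in>young ` over N X. f p)"
    by (rule sum.reindex[symmetric, unfolded comp_def]) (use inj_on_young[of N] in \<open>auto simp: over_def intro: inj_on_subset\<close>)
  also have "\<dots> = (\<Sum>p\<in>X. f p)"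
  proof (rule sum.mono_neutral_left[OF assms(1)])
    show "\<forall>p\<in>X - young ` over N X. f p = 0"
    proof
      fix p assume p: "p \<in> X - young ` over N X"
      have "N < length p"
      proof (rule ccontr)
        assume "\<not> N < length p"
        hence "map int p @ replicate (N - length p) 0 \<in> over N X" "young (map int p @ replicate (N - length p) 0) = p"
          using young_pad[of p N] p assms(2) by (auto simp: over_def)
        thus False using p by (metis DiffD2 imageI)
      qed
      thus "f p = 0" using p assms(3) by blast
    qed
  qed (auto simp: over_def)
  finally show ?thesis by simp
qed

lemma below_iff_interlace:
  assumes l: "l \<in> nonneg_Sig N" "l' \<in> nonneg_Sig N'" "N' = N \<or> N' = Suc N"
  shows "young l \<in> below (young l') \<longleftrightarrow> interlace l l'"
proof -
  have S: "l \<in> Sig N" "l' \<in> Sig N'" using l by (auto simp: nonneg_Sig_def)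
  have neg: "ht l k = int N" "ht l' k = int N'" if "k < 0" for k
  proof -
    have "ht l k = int (length l)" "ht l' k = int (length l')"
      using l(1,2) that by (auto simp: nonneg_Sig_def ht_eq_length_iff)
    thus "ht l k = int N" "ht l' k = int N'" using S by (simp_all add: Sig_def)
  qed
  have "young l \<in> below (young l') \<longleftrightarrow> (\<forall>k. ht l (int k) \<le> ht l' (int k) \<and> ht l' (int k) \<le> ht l (int k) + 1)"
  proof -
    have "(nht (young l) k \<le> nht (young l') k \<and> nht (young l') k \<le> Suc (nht (young l) k)) \<longleftrightarrow>
        ht l (int k) \<le> ht l' (int k) \<and> ht l' (int k) \<le> ht l (int k) + 1" for k
      unfolding nht_young[OF l(1), symmetric] nht_young[OF l(2), symmetric] by linarith
    thus ?thesis using young_partition[OF l(1)] by (simp add: below_def)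
  qed
  also have "\<dots> \<longleftrightarrow> (\<forall>k. ht l k \<le> ht l' k \<and> ht l' k \<le> ht l k + 1)"
  proof
    assume R: "\<forall>k. ht l (int k) \<le> ht l' (int k) \<and> ht l' (int k) \<le> ht l (int k) + 1"
    show "\<forall>k. ht l k \<le> ht l' k \<and> ht l' k \<le> ht l k + 1"
    proof
      fix k show "ht l k \<le> ht l' k \<and> ht l' k \<le> ht l k + 1"
      proof (cases "0 \<le> k")
        case True thus ?thesis using R[rule_format, of "nat k"] by simp
      next
        case False thus ?thesis using neg[of k] l(3) by auto
      qed
    qed
  qed blast
  also have "\<dots> \<longleftrightarrow> interlace l l'" using interlace_iff_ht[OF S l(3)] by blast
  finally show ?thesis .
qed

lemma hl_psi_young:
  assumes "l \<in> nonneg_Sig N" "l' \<in> nonneg_Sig N'"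
  shows "hl_psi t (map int (young l')) (map int (young l)) = hl_psi t l' l"
    "hl_phi t (map int (young l')) (map int (young l)) = hl_phi t l' l"
proof -
  have h: "ht (map int (young l)) k = ht l k" "ht (map int (young l')) k = ht l' k" if "0 \<le> k" for k
    using assms that by (auto simp: nonneg_Sig_def ht_young)
  have sets: "{k. 0 < k \<and> ht (map int (young l')) (k - 1) = ht (map int (young l)) (k - 1) \<and> ht (map int (young l')) k = ht (map int (young l)) k + 1} =
      {k. 0 < k \<and> ht l' (k - 1) = ht l (k - 1) \<and> ht l' k = ht l k + 1}"
    "{k. 0 < k \<and> ht (map int (young l')) (k - 1) = ht (map int (young l)) (k - 1) + 1 \<and> ht (map int (young l')) k = ht (map int (young l)) k} =
      {k. 0 < k \<and> ht l' (k - 1) = ht l (k - 1) + 1 \<and> ht l' k = ht l k}"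
    by (intro Collect_cong conj_cong refl; simp add: h)+
  show "hl_psi t (map int (young l')) (map int (young l)) = hl_psi t l' l"
    unfolding hl_psi_def sets by (rule prod.cong[OF refl]) (auto simp: h)
  show "hl_phi t (map int (young l')) (map int (young l)) = hl_phi t l' l"
    unfolding hl_phi_def sets by (rule prod.cong[OF refl]) (auto simp: h)
qed

section \<open>Weights of straight segments of a path\<close>

lemma strip_sum_single:
  "strip_sum w p q [x] = (if q \<in> below p then w (map int p) (map int q) * x ^ (sum_list p - sum_list q) else 0)"
proof -
  have "strip_sum w p q [x] = (\<Sum>r\<in>below p. if r = q then w (map int p) (map int q) * x ^ (sum_list p - sum_list q) else 0)"
    unfolding strip_sum.simps by (rule sum.cong) auto
  thus ?thesis by (simp add: finite_below)
qed

text \<open>The variables are reversed because \<open>strip_sum\<close> begins at the larger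
  partition, which an upward segment reaches at its end. A leftward segment begins there and uses
  \<open>a i\<close> first, hence the same reversal in \<open>left_wt\<close>. A segment of length 0
  only says that one signature is observed twice, whatever it is.\<close>

definition up_wt :: "real \<Rightarrow> (nat \<Rightarrow> real) \<Rightarrow> nat \<Rightarrow> nat \<Rightarrow> int list \<Rightarrow> int list \<Rightarrow> real" where
  "up_wt t b j n \<sigma> \<tau> = (if n = 0 then of_bool (\<sigma> = \<tau>)
     else of_bool (\<sigma> \<in> nonneg_Sig j \<and> \<tau> \<in> nonneg_Sig (j + n)) *
       strip_sum (hl_psi t) (young \<tau>) (young \<sigma>) (map b (rev [j + 1..<j + n + 1])))"

definition left_wt :: "real \<Rightarrow> (nat \<Rightarrow> real) \<Rightarrow> nat \<Rightarrow> nat \<Rightarrow> nat \<Rightarrow> int list \<Rightarrow> int list \<Rightarrow> real" where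
  "left_wt t a i j n \<sigma> \<tau> = (if n = 0 then of_bool (\<sigma> = \<tau>)
     else of_bool (\<sigma> \<in> nonneg_Sig j \<and> \<tau> \<in> nonneg_Sig j) *
       strip_sum (hl_phi t) (young \<sigma>) (young \<tau>) (map a (rev [i - n + 1..<i + 1])))"

lemma nat_diff_young: 
  assumes "l \<in> nonneg_Sig N" "l' \<in> nonneg_Sig N'"
  shows "sum_list (young l') - sum_list (young l) = nat (sum_list l' - sum_list l)"
  using sum_list_young[of l] sum_list_young[of l'] assms by (simp add: nonneg_Sig_def)

lemma up_wt_one:
  "up_wt t b j 1 \<sigma> \<tau> = (if \<sigma> \<in> nonneg_Sig j \<and> \<tau> \<in> nonneg_Sig (Suc j) \<and> interlace \<sigma> \<tau>
     then hl_psi t \<tau> \<sigma> * b (Suc j) ^ nat (sum_list \<tau> - sum_list \<sigma>) else 0)"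
  using below_iff_interlace[of \<sigma> j \<tau> "Suc j"] hl_psi_young[of \<sigma> j \<tau> "Suc j"] nat_diff_young[of \<sigma> j \<tau> "Suc j"]
  by (auto simp: up_wt_def strip_sum_single simp del: strip_sum.simps)

lemma left_wt_one:
  assumes "1 \<le> i"
  shows "left_wt t a i j 1 \<sigma> \<tau> = (if \<sigma> \<in> nonneg_Sig j \<and> \<tau> \<in> nonneg_Sig j \<and> interlace \<tau> \<sigma>
     then hl_phi t \<sigma> \<tau> * a i ^ nat (sum_list \<sigma> - sum_list \<tau>) else 0)"
proof -
  have "[i - 1 + 1..<i + 1] = [i]" using assms by (simp add: upt_rec)
  thus ?thesis using below_iff_interlace[of \<tau> j \<sigma> j] hl_psi_young[of \<tau> j \<sigma> j] nat_diff_young[of \<tau> j \<sigma> j]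
    by (auto simp: left_wt_def strip_sum_single simp del: strip_sum.simps)
qed

text \<open>Branching at the first step of the segment. The finite set carries all non-zero terms,
  as summation by \<open>prob_finite_slices\<close> demands.\<close>

lemma up_wt_split:
  obtains X where "finite X" "\<And>\<eta>. \<eta> \<notin> X \<Longrightarrow> up_wt t b j 1 \<sigma> \<eta> * up_wt t b (Suc j) n \<eta> \<tau> = 0"
    "up_wt t b j (Suc n) \<sigma> \<tau> = (\<Sum>\<eta>\<in>X. up_wt t b j 1 \<sigma> \<eta> * up_wt t b (Suc j) n \<eta> \<tau>)"
proof (cases "n = 0")
  case True
  show ?thesis by (rule that[of "{\<tau>}"]) (auto simp: True up_wt_def simp del: strip_sum.simps)
next
  case False
  show ?thesis
  proof (cases "\<sigma> \<in> nonneg_Sig j \<and> \<tau> \<in> nonneg_Sig (j + Suc n)")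
    case True
    note p = young_partition[OF conjunct2[OF True]]
    let ?X = "over (Suc j) (below' (young \<tau>))"
    have val: "up_wt t b j 1 \<sigma> \<eta> * up_wt t b (Suc j) n \<eta> \<tau> =
        of_bool (\<eta> \<in> nonneg_Sig (Suc j)) * (strip_sum (hl_psi t) (young \<tau>) (young \<eta>) (map b (rev [Suc j + 1..<Suc j + n + 1])) *
          strip_sum (hl_psi t) (young \<eta>) (young \<sigma>) [b (Suc j)])" for \<eta>
      using True False by (auto simp: up_wt_def simp del: strip_sum.simps)
    show ?thesis
    proof (rule that[of ?X])
      show "finite ?X" by (rule finite_over[OF finite_below'])
      fix \<eta> assume "\<eta> \<notin> ?X"
      thus "up_wt t b j 1 \<sigma> \<eta> * up_wt t b (Suc j) n \<eta> \<tau> = 0"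
        unfolding val using strip_sum_support[OF p, of "hl_psi t" "young \<eta>"] by (auto simp: over_def simp del: strip_sum.simps)
    next
      have list: "map b (rev [j + 1..<j + Suc n + 1]) = map b (rev [Suc j + 1..<Suc j + n + 1]) @ [b (Suc j)]"
        by (subst upt_conv_Cons) auto
      have "up_wt t b j (Suc n) \<sigma> \<tau> = (\<Sum>r\<in>below' (young \<tau>).
          strip_sum (hl_psi t) (young \<tau>) r (map b (rev [Suc j + 1..<Suc j + n + 1])) * strip_sum (hl_psi t) r (young \<sigma>) [b (Suc j)])"
        unfolding strip_sum_append[OF p, symmetric] list[symmetric] using True by (simp add: up_wt_def)
      also have "\<dots> = (\<Sum>\<eta>\<in>?X. strip_sum (hl_psi t) (young \<tau>) (young \<eta>) (map b (rev [Suc j + 1..<Suc j + n + 1])) *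
          strip_sum (hl_psi t) (young \<eta>) (young \<sigma>) [b (Suc j)])"
      proof (rule sum_over[OF finite_below'])
        \<comment> \<open>A horizontal strip over \<open>young \<sigma>\<close> adds at most one
          row, so the intermediate partitions fit into signatures of length
          \<open>Suc j\<close>.\<close>
        fix r assume r: "r \<in> below' (young \<tau>)" "Suc j < length r"
        have "young \<sigma> \<notin> below r"
        proof
          assume "young \<sigma> \<in> below r"
          hence "nht r 0 \<le> Suc (nht (young \<sigma>) 0)" by (simp add: below_def)
          hence "length r \<le> Suc (length (young \<sigma>))"
            using partition_ht_0[of r] partition_ht_0[OF young_partition[OF conjunct1[OF True]]] r(1) by (simp add: below'_def)
          also have "length (young \<sigma>) \<le> j" using length_young[of \<sigma>] True by (simp add: nonneg_Sig_def Sig_def)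
          finally show False using r(2) by simp
        qed
        thus "strip_sum (hl_psi t) (young \<tau>) r (map b (rev [Suc j + 1..<Suc j + n + 1])) * strip_sum (hl_psi t) r (young \<sigma>) [b (Suc j)] = 0"
          by (simp only: strip_sum_single if_False mult_zero_right)
      qed (auto simp: below'_def)
      also have "\<dots> = (\<Sum>\<eta>\<in>?X. up_wt t b j 1 \<sigma> \<eta> * up_wt t b (Suc j) n \<eta> \<tau>)"
        by (rule sum.cong[OF refl], subst val) (auto simp: over_def)
      finally show "up_wt t b j (Suc n) \<sigma> \<tau> = (\<Sum>\<eta>\<in>?X. up_wt t b j 1 \<sigma> \<eta> * up_wt t b (Suc j) n \<eta> \<tau>)" .
    qed
  next
    case F: False
    show ?thesis by (rule that[of "{}"]) (use F False in \<open>auto simp: up_wt_def simp del: strip_sum.simps\<close>)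
  qed
qed

lemma left_wt_split:
  assumes i: "Suc n \<le> i"
  obtains X where "finite X" "\<And>\<eta>. \<eta> \<notin> X \<Longrightarrow> left_wt t a i j 1 \<sigma> \<eta> * left_wt t a (i - 1) j n \<eta> \<tau> = 0"
    "left_wt t a i j (Suc n) \<sigma> \<tau> = (\<Sum>\<eta>\<in>X. left_wt t a i j 1 \<sigma> \<eta> * left_wt t a (i - 1) j n \<eta> \<tau>)"
proof (cases "n = 0")
  case True
  show ?thesis by (rule that[of "{\<tau>}"]) (auto simp: True left_wt_def simp del: strip_sum.simps)
next
  case False
  show ?thesis
  proof (cases "\<sigma> \<in> nonneg_Sig j \<and> \<tau> \<in> nonneg_Sig j")
    case True
    note p = young_partition[OF conjunct1[OF True]]
    let ?X = "over j (below' (young \<sigma>))" and ?xs = "map a (rev [i - 1 - n + 1..<i - 1 + 1])"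
    have one: "[i - 1 + 1..<i + 1] = [i]" using i by (simp add: upt_rec)
    have val: "left_wt t a i j 1 \<sigma> \<eta> * left_wt t a (i - 1) j n \<eta> \<tau> =
        of_bool (\<eta> \<in> nonneg_Sig j) * (strip_sum (hl_phi t) (young \<sigma>) (young \<eta>) [a i] * strip_sum (hl_phi t) (young \<eta>) (young \<tau>) ?xs)" for \<eta>
      unfolding left_wt_def one using True False by (simp del: strip_sum.simps)
    show ?thesis
    proof (rule that[of ?X])
      show "finite ?X" by (rule finite_over[OF finite_below'])
      fix \<eta> assume "\<eta> \<notin> ?X"
      thus "left_wt t a i j 1 \<sigma> \<eta> * left_wt t a (i - 1) j n \<eta> \<tau> = 0"
        unfolding val using strip_sum_support[OF p, of "hl_phi t" "young \<eta>"] by (auto simp: over_def simp del: strip_sum.simps)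
    next
      have "[i - Suc n + 1..<i + 1] = [i - 1 - n + 1..<i - 1 + 1] @ [i]" using i by simp
      hence list: "map a (rev [i - Suc n + 1..<i + 1]) = [a i] @ ?xs" by simp
      have "left_wt t a i j (Suc n) \<sigma> \<tau> = (\<Sum>r\<in>below' (young \<sigma>).
          strip_sum (hl_phi t) (young \<sigma>) r [a i] * strip_sum (hl_phi t) r (young \<tau>) ?xs)"
        unfolding strip_sum_append[OF p, symmetric] list[symmetric] using True by (simp add: left_wt_def)
      also have "\<dots> = (\<Sum>\<eta>\<in>?X. strip_sum (hl_phi t) (young \<sigma>) (young \<eta>) [a i] * strip_sum (hl_phi t) (young \<eta>) (young \<tau>) ?xs)"
      proof (rule sum_over[OF finite_below'])
        fix r assume r: "r \<in> below' (young \<sigma>)" "j < length r"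
        have "nht r 0 \<le> nht (young \<sigma>) 0" using r by (simp add: below'_def)
        hence "length r \<le> length (young \<sigma>)"
          using partition_ht_0[of r] partition_ht_0[OF p] r(1) by (simp add: below'_def)
        also have "length (young \<sigma>) \<le> j" using length_young[of \<sigma>] True by (simp add: nonneg_Sig_def Sig_def)
        finally show "strip_sum (hl_phi t) (young \<sigma>) r [a i] * strip_sum (hl_phi t) r (young \<tau>) ?xs = 0" using r(2) by simp
      qed (auto simp: below'_def)
      also have "\<dots> = (\<Sum>\<eta>\<in>?X. left_wt t a i j 1 \<sigma> \<eta> * left_wt t a (i - 1) j n \<eta> \<tau>)"
        by (rule sum.cong[OF refl], subst val) (auto simp: over_def simp del: strip_sum.simps)
      finally show "left_wt t a i j (Suc n) \<sigma> \<tau> = (\<Sum>\<eta>\<in>?X. left_wt t a i j 1 \<sigma> \<eta> * left_wt t a (i - 1) j n \<eta> \<tau>)" .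
    qed
  next
    case F: False
    show ?thesis by (rule that[of "{}"]) (use F False in \<open>auto simp: left_wt_def simp del: strip_sum.simps\<close>)
  qed
qed

lemma interlace_le:
  assumes "interlace l k" "c \<in> set l" "\<forall>a\<in>set k. a < K"
  shows "c < (K :: int)"
proof -
  obtain i where i: "i < length l" "c = l ! i" using assms(2) by (auto simp: in_set_conv_nth)
  hence "l ! i \<le> k ! i" "i < length k" using assms(1) by (auto simp: interlace_def)
  thus ?thesis using i assms(3) nth_mem by fastforce
qed

text \<open>The powers of \<open>a\<^sub>i\<close> and \<open>b\<^sub>j\<close> produced by the input cancel the difference between the two ways
  around the box.\<close>

lemma corner_swap:
  assumes t: "0 \<le> t" "t < 1" and ij: "1 \<le> i" and ab: "0 < a i" "0 < b (Suc j)" "a i * b (Suc j) < 1"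
  obtains X where "finite X"
    "\<And>la. la \<notin> X \<Longrightarrow> left_wt t a i j 1 \<nu> la * up_wt t b j 1 la \<mu> = 0"
    "(\<Sum>la\<in>X. left_wt t a i j 1 \<nu> la * up_wt t b j 1 la \<mu> * hl_kernel t (a i * b (Suc j)) \<mu> \<rho> la \<nu>) =
      (1 - a i * b (Suc j)) / (1 - t * (a i * b (Suc j))) * (up_wt t b j 1 \<nu> \<rho> * left_wt t a i (Suc j) 1 \<rho> \<mu>)"
proof -
  let ?x = "a i * b (Suc j)"
  define K where "K = Max (insert 0 (set \<nu> \<union> set \<mu> \<union> set \<rho>)) + 1"
  have K: "c < K" if "c \<in> set \<nu> \<union> set \<mu> \<union> set \<rho>" for c
  proof -
    have "c \<le> Max (insert 0 (set \<nu> \<union> set \<mu> \<union> set \<rho>))" using that by (intro Max_ge) auto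
    thus ?thesis by (simp add: K_def)
  qed
  have "0 \<le> Max (insert 0 (set \<nu> \<union> set \<mu> \<union> set \<rho>))" by (rule Max_ge) auto
  hence K0: "0 < K" by (simp add: K_def)
  let ?X = "Sig_below j K"
  have finX: "finite ?X"
  proof (rule finite_subset)
    show "?X \<subseteq> {l. set l \<subseteq> {0..<K} \<and> length l = j}" by (auto simp: Sig_below_def Sig_def)
    show "finite {l. set l \<subseteq> {0..<K} \<and> length l = j}" by (rule finite_lists_length_eq) simp
  qed
  have below: "l \<in> Sig_below N K" if "l \<in> nonneg_Sig N" "set l \<subseteq> set \<nu> \<union> set \<mu> \<union> set \<rho>" for l N
    using that K by (auto simp: Sig_below_def nonneg_Sig_def)
  show ?thesis
  proof (rule that[OF finX])
    fix la assume la: "la \<notin> ?X"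
    show "left_wt t a i j 1 \<nu> la * up_wt t b j 1 la \<mu> = 0"
    proof (rule ccontr)
      assume "left_wt t a i j 1 \<nu> la * up_wt t b j 1 la \<mu> \<noteq> 0"
      hence *: "la \<in> nonneg_Sig j" "interlace la \<nu>" unfolding left_wt_one[OF ij] by (auto split: if_splits)
      have "c < K" if "c \<in> set la" for c by (rule interlace_le[OF *(2) that]) (use K in auto)
      thus False using la *(1) by (auto simp: Sig_below_def nonneg_Sig_def)
    qed
  next
    show "(\<Sum>la\<in>?X. left_wt t a i j 1 \<nu> la * up_wt t b j 1 la \<mu> * hl_kernel t ?x \<mu> \<rho> la \<nu>) =
      (1 - ?x) / (1 - t * ?x) * (up_wt t b j 1 \<nu> \<rho> * left_wt t a i (Suc j) 1 \<rho> \<mu>)"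
    proof (cases "\<nu> \<in> nonneg_Sig j \<and> \<mu> \<in> nonneg_Sig (Suc j) \<and> \<rho> \<in> nonneg_Sig (Suc j) \<and> interlace \<mu> \<rho> \<and> interlace \<nu> \<rho>")
      case True
      let ?m = "sum_list \<mu>" and ?n = "sum_list \<nu>" and ?r = "sum_list \<rho>"
      let ?c = "(1 - ?x) / (1 - t * ?x) * a i ^ nat (?r - ?m) * b (Suc j) ^ nat (?r - ?n)"
      have mono: "sum_list l \<le> sum_list l'" if "interlace l l'" "\<forall>a\<in>set l'. 0 \<le> a" for l l'
      proof -
        have "sum_list l = (\<Sum>q<length l. l ! q)" by (simp add: sum_list_sum_nth atLeast0LessThan)
        also have "\<dots> \<le> (\<Sum>q<length l. l' ! q)" using that by (intro sum_mono) (auto simp: interlace_def)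
        also have "\<dots> \<le> (\<Sum>q<length l'. l' ! q)"
          using that by (intro sum_mono2) (auto simp: interlace_def)
        finally show ?thesis by (simp add: sum_list_sum_nth atLeast0LessThan)
      qed
      have nn: "\<forall>a\<in>set \<nu>. 0 \<le> a" "\<forall>a\<in>set \<mu>. 0 \<le> a" "\<forall>a\<in>set \<rho>. 0 \<le> a" using True by (auto simp: nonneg_Sig_def)
      have mr: "?m \<le> ?r" "?n \<le> ?r" using mono[of \<mu> \<rho>] mono[of \<nu> \<rho>] True nn by auto
      have summand: "left_wt t a i j 1 \<nu> la * up_wt t b j 1 la \<mu> * hl_kernel t ?x \<mu> \<rho> la \<nu> =
        ?c * (of_bool (interlace la \<mu> \<and> interlace la \<nu>) * hl_psi t \<mu> la * hl_phi t \<nu> la *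
         (let d = ?r + sum_list la - ?m - ?n in if d < 0 then 0 else (1 - (if 1 \<le> d then t else 0)) * hl_U_input t (nat d) \<mu> \<rho> la \<nu>))"
        if la: "la \<in> ?X" for la
      proof (cases "interlace la \<mu> \<and> interlace la \<nu> \<and> 0 \<le> ?r + sum_list la - ?m - ?n")
        case T: True
        have laN: "la \<in> nonneg_Sig j" using la by (auto simp: Sig_below_def nonneg_Sig_def)
        have lm: "sum_list la \<le> ?m" "sum_list la \<le> ?n" using mono T nn by auto
        let ?d = "nat (?r + sum_list la - ?m - ?n)"
        have e: "nat (?r - ?m) = nat (?n - sum_list la) + ?d" "nat (?r - ?n) = nat (?m - sum_list la) + ?d" using lm T mr by linarith+
        have d1: "(1 \<le> ?d) = (1 \<le> ?r + sum_list la - ?m - ?n)" using T by linarith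
        show ?thesis unfolding left_wt_one[OF ij] up_wt_one hl_kernel_def input_prob_def e power_add power_mult_distrib Let_def d1
          using T laN True by (simp add: mult_ac)
      next
        case F: False
        thus ?thesis unfolding left_wt_one[OF ij] up_wt_one hl_kernel_def Let_def by auto
      qed
      have "(\<Sum>la\<in>?X. left_wt t a i j 1 \<nu> la * up_wt t b j 1 la \<mu> * hl_kernel t ?x \<mu> \<rho> la \<nu>) = (\<Sum>la\<in>?X. ?c * (of_bool (interlace la \<mu> \<and> interlace la \<nu>) * hl_psi t \<mu> la * hl_phi t \<nu> la *
         (let d = ?r + sum_list la - ?m - ?n in if d < 0 then 0 else (1 - (if 1 \<le> d then t else 0)) * hl_U_input t (nat d) \<mu> \<rho> la \<nu>)))"
        by (rule sum.cong[OF refl summand])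
      also have "\<dots> = ?c * (\<Sum>la\<in>?X. (of_bool (interlace la \<mu> \<and> interlace la \<nu>) * hl_psi t \<mu> la * hl_phi t \<nu> la *
         (let d = ?r + sum_list la - ?m - ?n in if d < 0 then 0 else (1 - (if 1 \<le> d then t else 0)) * hl_U_input t (nat d) \<mu> \<rho> la \<nu>)))"
        by (rule sum_distrib_left[symmetric])
      also have "\<dots> = ?c * (hl_psi t \<rho> \<nu> * hl_phi t \<rho> \<mu>)"
        by (rule arg_cong[OF local_identity[OF t]]) (use True below K0 in auto)
      finally have "(\<Sum>la\<in>?X. left_wt t a i j 1 \<nu> la * up_wt t b j 1 la \<mu> * hl_kernel t ?x \<mu> \<rho> la \<nu>) = ?c * (hl_psi t \<rho> \<nu> * hl_phi t \<rho> \<mu>)" .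
      thus ?thesis unfolding left_wt_one[OF ij] up_wt_one using True by simp
    next
      case False
      have "left_wt t a i j 1 \<nu> la * up_wt t b j 1 la \<mu> * hl_kernel t ?x \<mu> \<rho> la \<nu> = 0" for la
      proof (rule ccontr)
        assume nz: "left_wt t a i j 1 \<nu> la * up_wt t b j 1 la \<mu> * hl_kernel t ?x \<mu> \<rho> la \<nu> \<noteq> 0"
        hence *: "la \<in> nonneg_Sig j" "\<nu> \<in> nonneg_Sig j" "\<mu> \<in> nonneg_Sig (Suc j)"
          unfolding left_wt_one[OF ij] up_wt_one by (auto split: if_splits)
        obtain r where "hl_U_input t r \<mu> \<rho> la \<nu> \<noteq> 0" using nz by (auto simp: hl_kernel_def Let_def split: if_splits)
        note U = hl_U_input_nonzeroD[OF this, of j]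
        have len: "length la = j" "length \<nu> = j" using * by (auto simp: nonneg_Sig_def Sig_def)
        have "\<rho> \<in> nonneg_Sig (Suc j)"
          using U(6)[OF len] U(3)[OF len] interlace_nonneg[of \<mu> \<rho>] *(3) by (auto simp: nonneg_Sig_def Sig_def)
        thus False using False * U(3,4)[OF len] by blast
      qed
      hence 0: "(\<Sum>la\<in>?X. left_wt t a i j 1 \<nu> la * up_wt t b j 1 la \<mu> * hl_kernel t ?x \<mu> \<rho> la \<nu>) = 0"
        by (intro sum.neutral ballI)
      have "up_wt t b j 1 \<nu> \<rho> * left_wt t a i (Suc j) 1 \<rho> \<mu> = 0"
        unfolding left_wt_one[OF ij] up_wt_one using False by auto
      thus ?thesis unfolding 0 by simp
    qed
  qed
qed

text \<open>A block \<open>(d, n, \<tau>)\<close> moves from \<open>(i, j)\<close> up (if \<open>d\<close>) or left by \<open>n\<close> steps, to a point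
  where the signature \<open>\<tau>\<close> is observed.\<close>

fun adv :: "nat \<times> nat \<times> int list \<Rightarrow> bool \<times> nat \<times> int list \<Rightarrow> nat \<times> nat \<times> int list" where
  "adv (i, j, \<sigma>) (d, n, \<tau>) = (if d then (i, j + n, \<tau>) else (i - n, j, \<tau>))"

fun pts :: "nat \<times> nat \<times> int list \<Rightarrow> (bool \<times> nat \<times> int list) list \<Rightarrow> (nat \<times> nat \<times> int list) list" where
  "pts s [] = [s]"
| "pts s (x # bs) = s # pts (adv s x) bs"

fun okp :: "nat \<times> nat \<times> int list \<Rightarrow> (bool \<times> nat \<times> int list) list \<Rightarrow> bool" where
  "okp s [] = True"
| "okp s (x # bs) = ((fst x \<or> fst (snd x) \<le> fst s) \<and> okp (adv s x) bs)"

text \<open>A unit step up at abscissa \<open>i\<close> has \<open>i\<close> boxes between itself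
  and the vertical axis. These are the boxes across which the path still has to be moved to reach
  the axes.\<close>

fun area :: "nat \<times> nat \<times> int list \<Rightarrow> (bool \<times> nat \<times> int list) list \<Rightarrow> nat" where
  "area s [] = 0"
| "area s (x # bs) = (if fst x then fst s * fst (snd x) else 0) + area (adv s x) bs"

text \<open>The factors of Z, one for each box counted by \<open>area\<close>, are attached to the
  upward steps. Moving a corner across a box then changes the normalization by the factor of that
  box only.\<close>

definition block_wt :: "real \<Rightarrow> (nat \<Rightarrow> real) \<Rightarrow> (nat \<Rightarrow> real) \<Rightarrow> nat \<times> nat \<times> int list \<Rightarrow> bool \<times> nat \<times> int list \<Rightarrow> real" where
  "block_wt t a b = (\<lambda>(i, j, \<sigma>) (d, n, \<tau>). if d
     then up_wt t b j n \<sigma> \<tau> / (\<Prod>l = j + 1..j + n. \<Prod>p = 1..i. (1 - t * a p * b l) / (1 - a p * b l))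
     else left_wt t a i j n \<sigma> \<tau>)"

fun path_wt :: "real \<Rightarrow> (nat \<Rightarrow> real) \<Rightarrow> (nat \<Rightarrow> real) \<Rightarrow> nat \<times> nat \<times> int list \<Rightarrow> (bool \<times> nat \<times> int list) list \<Rightarrow> real" where
  "path_wt t a b s [] = 1"
| "path_wt t a b s (x # bs) = block_wt t a b s x * path_wt t a b (adv s x) bs"

section \<open>Combinatorics of lattice paths\<close>

lemma set_pts_append: "set (pts s (xs @ ys)) = set (pts s xs) \<union> set (pts (foldl adv s xs) ys)"
proof (induction xs arbitrary: s)
  case Nil thus ?case by (cases ys) auto
qed auto

lemma last_in_pts: "foldl adv s bs \<in> set (pts s bs)"
  by (induction bs arbitrary: s) auto

lemma first_in_pts: "s \<in> set (pts s bs)"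
  by (cases bs) auto

lemma okp_append: "okp s (xs @ ys) \<longleftrightarrow> okp s xs \<and> okp (foldl adv s xs) ys"
  by (induction xs arbitrary: s) auto

lemma area_append: "area s (xs @ ys) = area s xs + area (foldl adv s xs) ys"
  by (induction xs arbitrary: s) auto

lemma path_wt_append: "path_wt t a b s (xs @ ys) = path_wt t a b s xs * path_wt t a b (foldl adv s xs) ys"
  by (induction xs arbitrary: s) auto

lemma adv_mono: "fst (adv s x) \<le> fst s" "fst (snd s) \<le> fst (snd (adv s x))"
  by (cases s; cases x; simp)+

lemma foldl_adv_mono: "fst (foldl adv s bs) \<le> fst s \<and> fst (snd s) \<le> fst (snd (foldl adv s bs))"
proof (induction bs arbitrary: s)
  case (Cons x bs)
  have "fst (foldl adv (adv s x) bs) \<le> fst s" "fst (snd s) \<le> fst (snd (foldl adv (adv s x) bs))"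
    using Cons.IH[of "adv s x"] adv_mono[of s x] by linarith+
  thus ?case by simp
qed simp

lemma pts_bounds:
  "x \<in> set (pts s bs) \<Longrightarrow> fst x \<le> fst s \<and> fst (snd x) \<le> fst (snd (foldl adv s bs))"
proof (induction bs arbitrary: s)
  case (Cons y bs)
  show ?case
  proof (cases "x = s")
    case True
    thus ?thesis using foldl_adv_mono[of s "y # bs"] by simp
  next
    case False
    hence "x \<in> set (pts (adv s y) bs)" using Cons.prems by simp
    thus ?thesis using Cons.IH[of "adv s y"] adv_mono(1)[of s y] by auto
  qed
qed simp

text \<open>The last step up at positive abscissa is followed by a step to the left, because the
  path still has to reach abscissa 0.\<close>

lemma corner_exists:
  assumes "okp s bs" "\<forall>x\<in>set bs. fst (snd x) = 1" "fst (foldl adv s bs) = 0" "0 < area s bs"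
  shows "\<exists>pre \<rho> \<mu> post. bs = pre @ [(True, 1, \<rho>), (False, 1, \<mu>)] @ post \<and> 0 < fst (foldl adv s pre)"
  using assms
proof (induction bs arbitrary: s)
  case (Cons x bs)
  obtain d \<rho> where x: "x = (d, 1, \<rho>)" using Cons.prems(2) by (cases x) auto
  obtain i j \<sigma> where s: "s = (i, j, \<sigma>)" by (cases s)
  show ?case
  proof (cases "0 < area (adv s x) bs")
    case True
    have "\<exists>pre \<rho> \<mu> post. bs = pre @ [(True, 1, \<rho>), (False, 1, \<mu>)] @ post \<and> 0 < fst (foldl adv (adv s x) pre)"
      by (rule Cons.IH) (use Cons.prems True in auto)
    then obtain pre \<rho> \<mu> post where "bs = pre @ [(True, 1, \<rho>), (False, 1, \<mu>)] @ post" "0 < fst (foldl adv (adv s x) pre)" by blast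
    hence "x # bs = (x # pre) @ [(True, 1, \<rho>), (False, 1, \<mu>)] @ post" "0 < fst (foldl adv s (x # pre))" by auto
    thus ?thesis by blast
  next
    case False
    hence di: "d" "0 < i" using Cons.prems(4) by (auto simp: x s split: if_splits)
    obtain y post where y: "bs = y # post" using Cons.prems(3) di by (cases bs) (auto simp: x s)
    obtain d' \<mu> where y': "y = (d', 1, \<mu>)" using Cons.prems(2) y by (cases y) auto
    have "\<not> d'" using False di by (auto simp: x s y y')
    hence "x # bs = [] @ [(True, 1, \<rho>), (False, 1, \<mu>)] @ post" using di by (simp add: x y y')
    thus ?thesis using di s by (metis foldl_Nil fst_conv)
  qed
qed simp

lemma nonneg_Sig_0: "\<tau> \<in> nonneg_Sig 0 \<longleftrightarrow> \<tau> = []"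
  by (auto simp: nonneg_Sig_def Sig_def)

lemma Nil_below_Nil: "q \<in> below [] \<longleftrightarrow> q = []"
proof
  assume "q \<in> below []"
  hence "nht q 0 \<le> nht [] 0" "is_partition q" by (auto simp: below_def)
  thus "q = []" using partition_ht_0[of q] by (simp add: nht_def)
qed (simp add: below_def is_partition_def nht_def)

lemma psi_phi_Nil: "hl_psi t [] [] = 1" "hl_phi t [] [] = 1"
  using hl_psi_eq_prod_nat[of "[]" 0 t "[]"] hl_phi_eq_prod_nat[of "[]" 0 "[]" t] by simp_all

lemma up_wt_zero: "up_wt t b j 1 (replicate j 0) (replicate (Suc j) 0) = 1"
  using replicate_nonneg_Sig[of j] replicate_nonneg_Sig[of "Suc j"]
  by (simp add: up_wt_def young_replicate strip_sum_single Nil_below_Nil psi_phi_Nil del: strip_sum.simps replicate_Suc)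

lemma left_wt_zero: "1 \<le> i \<Longrightarrow> left_wt t a i 0 1 [] \<tau> = of_bool (\<tau> = [])"
proof -
  assume "1 \<le> i"
  hence "[i - 1 + 1..<i + 1] = [i]" by (simp add: upt_rec)
  thus ?thesis by (auto simp: left_wt_def nonneg_Sig_0 young_def strip_sum_single Nil_below_Nil psi_phi_Nil simp del: strip_sum.simps)
qed

text \<open>Strips only add boxes and the path ends in the zero signature, so any box seen earlier
  on the vertical axis makes the weight 0.\<close>

lemma path_wt_up_zero:
  assumes "okp (0, j, \<tau>) bs" "\<forall>x\<in>set bs. fst (snd x) = 1" "foldl adv (0, j, \<tau>) bs = (0, B, replicate B 0)"
    "path_wt t a b (0, j, \<tau>) bs \<noteq> 0"
  shows "\<tau> = replicate j 0"
  using assms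
proof (induction bs arbitrary: j \<tau>)
  case (Cons x bs)
  obtain d \<tau>' where x: "x = (d, 1, \<tau>')" using Cons.prems(2) by (cases x) auto
  have d: "d" using Cons.prems(1) by (simp add: x)
  have "\<tau>' = replicate (Suc j) 0" by (rule Cons.IH) (use Cons.prems x d in auto)
  moreover have "up_wt t b j 1 \<tau> \<tau>' \<noteq> 0" using Cons.prems(4) d by (auto simp: x block_wt_def)
  ultimately have "\<tau> \<in> nonneg_Sig j" "young \<tau> \<in> below []"
    unfolding up_wt_def by (auto simp: young_replicate strip_sum_single simp del: strip_sum.simps replicate_Suc split: if_splits)
  thus ?case using young_Nil_iff[of \<tau> j] Nil_below_Nil by blast
qed simp

text \<open>A path of area 0 runs along the two axes, where the field is deterministic. This starts
  the induction over the area.\<close>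

lemma axis_path_wt:
  assumes "okp s bs" "\<forall>x\<in>set bs. fst (snd x) = 1" "area s bs = 0" "fst s = 0 \<or> fst (snd s) = 0"
    "snd (snd s) = replicate (fst (snd s)) 0" "foldl adv s bs = (0, B, replicate B 0)"
  shows "path_wt t a b s bs = of_bool (\<forall>(p, q, \<sigma>)\<in>set (pts s bs). \<sigma> = replicate q 0)"
  using assms
proof (induction bs arbitrary: s)
  case Nil
  thus ?case by (cases s) auto
next
  case (Cons x bs)
  obtain d \<tau> where x: "x = (d, 1, \<tau>)" using Cons.prems(2) by (cases x) auto
  obtain i j \<sigma> where s: "s = (i, j, \<sigma>)" by (cases s)
  have \<sigma>: "\<sigma> = replicate j 0" using Cons.prems(5) by (simp add: s)
  show ?case
  proof (cases d)
    case True
    have i: "i = 0" using Cons.prems(3) True by (simp add: x s)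
    have adv: "adv s x = (0, Suc j, \<tau>)" using True by (simp add: x s i)
    have bw: "block_wt t a b s x = up_wt t b j 1 \<sigma> \<tau>" using True by (simp add: block_wt_def x s i)
    show ?thesis
    proof (cases "\<tau> = replicate (Suc j) 0")
      case T: True
      have "path_wt t a b (adv s x) bs = of_bool (\<forall>(p, q, \<sigma>)\<in>set (pts (adv s x) bs). \<sigma> = replicate q 0)"
        by (rule Cons.IH) (use Cons.prems adv T in auto)
      thus ?thesis using bw T \<sigma> up_wt_zero[of t b j] by (simp add: s del: replicate_Suc)
    next
      case F: False
      have "path_wt t a b (0, Suc j, \<tau>) bs = 0"
        using path_wt_up_zero[of "Suc j" \<tau> bs B t a b] Cons.prems adv F by auto
      moreover have "(0, Suc j, \<tau>) \<in> set (pts (adv s x) bs)" using first_in_pts[of "adv s x" bs] adv by simp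
      hence mem: "(0, Suc j, \<tau>) \<in> set (pts s (x # bs))" by simp
      have "\<not> (\<forall>(p, q, \<sigma>)\<in>set (pts s (x # bs)). \<sigma> = replicate q 0)"
      proof
        assume "\<forall>(p, q, \<sigma>)\<in>set (pts s (x # bs)). \<sigma> = replicate q 0"
        from bspec[OF this mem] show False using F by simp
      qed
      ultimately show ?thesis by (simp only: path_wt.simps adv mult_zero_right of_bool_eq if_False)
    qed
  next
    case False
    have i: "1 \<le> i" using Cons.prems(1) False by (simp add: x s)
    hence j: "j = 0" using Cons.prems(4) by (simp add: s)
    have adv: "adv s x = (i - 1, 0, \<tau>)" using False by (simp add: x s j)
    have bw: "block_wt t a b s x = of_bool (\<tau> = [])" using False left_wt_zero[OF i] \<sigma> by (simp add: block_wt_def x s j)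
    show ?thesis
    proof (cases "\<tau> = []")
      case T: True
      have "path_wt t a b (adv s x) bs = of_bool (\<forall>(p, q, \<sigma>)\<in>set (pts (adv s x) bs). \<sigma> = replicate q 0)"
        by (rule Cons.IH) (use Cons.prems adv T False in \<open>auto simp: x\<close>)
      thus ?thesis using bw T \<sigma> by (simp add: s)
    next
      case F: False
      have "(i - 1, 0, \<tau>) \<in> set (pts (adv s x) bs)" using first_in_pts[of "adv s x" bs] adv by simp
      hence mem: "(i - 1, 0, \<tau>) \<in> set (pts s (x # bs))" by simp
      have "\<not> (\<forall>(p, q, \<sigma>)\<in>set (pts s (x # bs)). \<sigma> = replicate q 0)"
      proof
        assume "\<forall>(p, q, \<sigma>)\<in>set (pts s (x # bs)). \<sigma> = replicate q 0"
        from bspec[OF this mem] show False using F by simp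
      qed
      thus ?thesis using bw F by (simp only: path_wt.simps mult_zero_left of_bool_eq if_False)
    qed
  qed
qed

lemma axis_pts:
  assumes "okp s bs" "\<forall>x\<in>set bs. fst (snd x) = 1" "area s bs = 0" "fst s = 0 \<or> fst (snd s) = 0" "x \<in> set (pts s bs)"
  shows "fst x = 0 \<or> fst (snd x) = 0"
  using assms
proof (induction bs arbitrary: s)
  case (Cons y bs)
  obtain d \<tau> where y: "y = (d, 1, \<tau>)" using Cons.prems(2) by (cases y) auto
  obtain i j \<sigma> where s: "s = (i, j, \<sigma>)" by (cases s)
  have "fst (adv s y) = 0 \<or> fst (snd (adv s y)) = 0" using Cons.prems by (auto simp: y s)
  thus ?case using Cons.IH[of "adv s y"] Cons.prems by auto
qed auto

lemma block_wt_split: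
  assumes "d \<or> Suc n \<le> i"
  obtains X where "finite X"
    "\<And>\<eta>. \<eta> \<notin> X \<Longrightarrow> block_wt t a b (i, j, \<sigma>) (d, 1, \<eta>) * block_wt t a b (adv (i, j, \<sigma>) (d, 1, \<eta>)) (d, n, \<tau>) = 0"
    "block_wt t a b (i, j, \<sigma>) (d, Suc n, \<tau>) =
      (\<Sum>\<eta>\<in>X. block_wt t a b (i, j, \<sigma>) (d, 1, \<eta>) * block_wt t a b (adv (i, j, \<sigma>) (d, 1, \<eta>)) (d, n, \<tau>))"
proof (cases d)
  case True
  let ?g = "\<lambda>l. \<Prod>p = 1..i. (1 - t * a p * b l) / (1 - a p * b l)"
  obtain X where X: "finite X" "\<And>\<eta>. \<eta> \<notin> X \<Longrightarrow> up_wt t b j 1 \<sigma> \<eta> * up_wt t b (Suc j) n \<eta> \<tau> = 0"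
    "up_wt t b j (Suc n) \<sigma> \<tau> = (\<Sum>\<eta>\<in>X. up_wt t b j 1 \<sigma> \<eta> * up_wt t b (Suc j) n \<eta> \<tau>)"
    using up_wt_split[of t b j \<sigma> n \<tau>] by blast
  have g: "(\<Prod>l = j + 1..j + Suc n. ?g l) = (\<Prod>l = j + 1..j + 1. ?g l) * (\<Prod>l = Suc j + 1..Suc j + n. ?g l)"
    by (subst prod.atLeast_Suc_atMost) auto
  have val: "block_wt t a b (i, j, \<sigma>) (d, 1, \<eta>) * block_wt t a b (adv (i, j, \<sigma>) (d, 1, \<eta>)) (d, n, \<tau>) =
      up_wt t b j 1 \<sigma> \<eta> * up_wt t b (Suc j) n \<eta> \<tau> / (\<Prod>l = j + 1..j + Suc n. ?g l)" for \<eta>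
    unfolding g using True by (simp add: block_wt_def)
  show ?thesis
  proof (rule that[OF X(1)])
    fix \<eta> assume "\<eta> \<notin> X"
    thus "block_wt t a b (i, j, \<sigma>) (d, 1, \<eta>) * block_wt t a b (adv (i, j, \<sigma>) (d, 1, \<eta>)) (d, n, \<tau>) = 0"
      unfolding val using X(2) by simp
  next
    show "block_wt t a b (i, j, \<sigma>) (d, Suc n, \<tau>) =
      (\<Sum>\<eta>\<in>X. block_wt t a b (i, j, \<sigma>) (d, 1, \<eta>) * block_wt t a b (adv (i, j, \<sigma>) (d, 1, \<eta>)) (d, n, \<tau>))"
      unfolding val sum_divide_distrib[symmetric] X(3)[symmetric] using True by (simp only: block_wt_def prod.case if_True)
  qed
next
  case False
  obtain X where X: "finite X" "\<And>\<eta>. \<eta> \<notin> X \<Longrightarrow> left_wt t a i j 1 \<sigma> \<eta> * left_wt t a (i - 1) j n \<eta> \<tau> = 0"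
    "left_wt t a i j (Suc n) \<sigma> \<tau> = (\<Sum>\<eta>\<in>X. left_wt t a i j 1 \<sigma> \<eta> * left_wt t a (i - 1) j n \<eta> \<tau>)"
    using left_wt_split[of n i t a j \<sigma> \<tau>] assms False by blast
  have val: "block_wt t a b (i, j, \<sigma>) (d, 1, \<eta>) * block_wt t a b (adv (i, j, \<sigma>) (d, 1, \<eta>)) (d, n, \<tau>) =
      left_wt t a i j 1 \<sigma> \<eta> * left_wt t a (i - 1) j n \<eta> \<tau>" for \<eta>
    using False by (simp only: block_wt_def adv.simps prod.case if_False)
  show ?thesis
    by (rule that[OF X(1)]) (unfold val, use X(2) in blast, use X(3) False in \<open>simp only: block_wt_def prod.case if_False\<close>)
qed

section \<open>The law of the observations along a path\<close>

context hl_rsk_field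
begin

definition marks :: "(nat \<times> nat \<times> int list) set \<Rightarrow> 'w set" where
  "marks E = {\<omega> \<in> space M. \<forall>(p, q, \<sigma>)\<in>E. \<Lambda> p q \<omega> = \<sigma>}"

lemma marks_insert: "marks (insert (p, q, \<sigma>) E) = {\<omega> \<in> marks E. \<Lambda> p q \<omega> = \<sigma>}"
  by (auto simp: marks_def)

lemma marksD: "\<omega> \<in> marks E \<Longrightarrow> (p, q, \<sigma>) \<in> E \<Longrightarrow> \<Lambda> p q \<omega> = \<sigma>"
  by (auto simp: marks_def)

lemma marks_events:
  assumes "finite E"
  shows "marks E \<in> events"
proof -
  have "{\<omega> \<in> space M. \<forall>x\<in>E. \<Lambda> (fst x) (fst (snd x)) \<omega> = snd (snd x)} \<in> events"
  proof (intro sets.sets_Collect_finite_All assms)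
    fix x :: "nat \<times> nat \<times> int list"
    have [measurable]: "\<Lambda> (fst x) (fst (snd x)) \<in> measurable M (count_space UNIV)" by (rule field_measurable)
    show "{\<omega> \<in> space M. \<Lambda> (fst x) (fst (snd x)) \<omega> = snd (snd x)} \<in> events" by measurable
  qed
  thus ?thesis by (simp add: marks_def case_prod_beta')
qed

text \<open>A set of triples may prescribe two values at one point; then the event is empty.
  Otherwise any outcome in the event turns the triples into a function, as \<open>markov\<close>
  requires.\<close>

lemma markov_marks:
  assumes t: "0 \<le> t" "t < 1" and i: "1 \<le> i" and E: "finite E"
    "\<And>x. x \<in> E \<Longrightarrow> \<not> (i \<le> fst x \<and> Suc j \<le> fst (snd x))"
    "(i - 1, Suc j, \<mu>) \<in> E" "(i - 1, j, la) \<in> E" "(i, j, \<nu>) \<in> E"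
  shows "prob (marks (insert (i, Suc j, \<rho>) E)) = prob (marks E) * hl_kernel t (a i * b (Suc j)) \<mu> \<rho> la \<nu>"
proof (cases "marks E = {}")
  case True
  thus ?thesis by (simp add: marks_insert)
next
  case False
  then obtain \<omega> where \<omega>: "\<omega> \<in> marks E" by blast
  have s: "\<Lambda> p q \<omega> = \<sigma>" if "(p, q, \<sigma>) \<in> E" for p q \<sigma> using \<omega> that by (auto simp: marks_def)
  let ?E = "(\<lambda>x. (fst x, fst (snd x))) ` E"
  have m: "marks E = {\<omega>' \<in> space M. \<forall>(p, q)\<in>?E. \<Lambda> p q \<omega>' = \<Lambda> p q \<omega>}"
    using s by (fastforce simp: marks_def)
  have "prob {\<omega>' \<in> space M. (\<forall>(p, q)\<in>?E. \<Lambda> p q \<omega>' = \<Lambda> p q \<omega>) \<and> \<Lambda> i (Suc j) \<omega>' = \<rho>} =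
    prob {\<omega>' \<in> space M. \<forall>(p, q)\<in>?E. \<Lambda> p q \<omega>' = \<Lambda> p q \<omega>} *
    hl_kernel t (a i * b (Suc j)) (\<Lambda> (i - 1) (Suc j) \<omega>) \<rho> (\<Lambda> (i - 1) (Suc j - 1) \<omega>) (\<Lambda> i (Suc j - 1) \<omega>)"
  proof (rule markov[OF t i])
    show "finite ?E" using E(1) by simp
    show "\<not> (i \<le> p \<and> Suc j \<le> q)" if "(p, q) \<in> ?E" for p q using that E(2) by auto
    show "{(i - 1, Suc j), (i - 1, Suc j - 1), (i, Suc j - 1)} \<subseteq> ?E" using E(3-5) by force
  qed simp
  moreover have "marks (insert (i, Suc j, \<rho>) E) =
      {\<omega>' \<in> space M. (\<forall>(p, q)\<in>?E. \<Lambda> p q \<omega>' = \<Lambda> p q \<omega>) \<and> \<Lambda> i (Suc j) \<omega>' = \<rho>}"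
    unfolding marks_insert m by blast
  ultimately show ?thesis using s[OF E(3)] s[OF E(4)] s[OF E(5)] m by simp
qed

context
  assumes t: "0 \<le> t" "t < 1" and a: "\<And>i. 1 \<le> i \<Longrightarrow> 0 < a i" and b: "\<And>j. 1 \<le> j \<Longrightarrow> 0 < b j"
    and ab: "\<And>i j. 1 \<le> i \<Longrightarrow> 1 \<le> j \<Longrightarrow> a i * b j < 1"
begin

text \<open>Induction over the area. A corner that goes up and then left is replaced by one that
  goes left and then up. The law along the new path, with \<lambda> at its corner, is known by
  induction; the Markov property adds \<rho>, and \<open>corner_swap\<close> carries out the sum
  over \<lambda>.\<close>

lemma unit_path_law:
  assumes "okp (A, 0, []) bs" "\<forall>x\<in>set bs. fst (snd x) = 1" "foldl adv (A, 0, []) bs = (0, B, replicate B 0)"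
  shows "prob (marks (set (pts (A, 0, []) bs))) = path_wt t a b (A, 0, []) bs"
  using assms
proof (induction "area (A, 0, []) bs" arbitrary: bs rule: less_induct)
  case less
  let ?s = "(A, 0, [] :: int list)"
  show ?case
  proof (cases "area ?s bs = 0")
    case True
    have det: "\<Lambda> p q \<omega> = replicate q 0" if "(p, q, \<sigma>) \<in> set (pts ?s bs)" "\<omega> \<in> space M" for p q \<sigma> \<omega>
      using axis_pts[OF less.prems(1,2) True _ that(1)] field_bottom[OF that(2)] field_left[OF that(2)] by auto
    have "prob (marks (set (pts ?s bs))) = of_bool (\<forall>(p, q, \<sigma>)\<in>set (pts ?s bs). \<sigma> = replicate q 0)"
    proof (cases "\<forall>(p, q, \<sigma>)\<in>set (pts ?s bs). \<sigma> = replicate q 0")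
      case T: True
      hence "marks (set (pts ?s bs)) = space M" using det by (fastforce simp: marks_def)
      thus ?thesis using T by (simp add: prob_space)
    next
      case F: False
      hence "marks (set (pts ?s bs)) = {}" using det by (fastforce simp: marks_def)
      thus ?thesis using F by (simp only: measure_empty of_bool_eq)
    qed
    also have "\<dots> = path_wt t a b ?s bs"
      by (rule axis_path_wt[symmetric]) (use less.prems True in auto)
    finally show ?thesis .
  next
    case False
    then obtain pre \<rho> \<mu> post where bs: "bs = pre @ [(True, 1, \<rho>), (False, 1, \<mu>)] @ post" and pos: "0 < fst (foldl adv ?s pre)"
      using corner_exists[OF less.prems(1,2)] less.prems(3) by auto
    obtain i j \<nu> where s1: "foldl adv ?s pre = (i, j, \<nu>)" by (cases "foldl adv ?s pre")
    have i: "1 \<le> i" using pos s1 by simp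
    define bs' where "bs' la = pre @ [(False, 1, la), (True, 1, \<mu>)] @ post" for la
    define E0 where "E0 = set (pts ?s pre) \<union> set (pts (i - 1, Suc j, \<mu>) post)"
    have finE0: "finite E0" by (simp add: E0_def)
    have E: "set (pts ?s bs) = insert (i, Suc j, \<rho>) E0"
      using last_in_pts[of ?s pre] by (auto simp: bs set_pts_append s1 E0_def)
    have E': "set (pts ?s (bs' la)) = insert (i - 1, j, la) E0" for la
      using last_in_pts[of ?s pre] by (auto simp: bs'_def set_pts_append s1 E0_def)
    have IH: "prob (marks (insert (i - 1, j, la) E0)) = path_wt t a b ?s (bs' la)" for la
      unfolding E'[symmetric]
    proof (rule less.hyps)
      show "area ?s (bs' la) < area ?s bs" using i by (simp add: bs bs'_def area_append s1)
      show "okp ?s (bs' la)" using less.prems(1) i by (simp add: bs bs'_def okp_append s1)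
      show "\<forall>x\<in>set (bs' la). fst (snd x) = 1" using less.prems(2) by (auto simp: bs bs'_def)
      show "foldl adv ?s (bs' la) = (0, B, replicate B 0)" using less.prems(3) by (simp add: bs bs'_def s1)
    qed
    have in0: "(i, j, \<nu>) \<in> E0" "(i - 1, Suc j, \<mu>) \<in> E0"
      using last_in_pts[of ?s pre] first_in_pts[of "(i - 1, Suc j, \<mu>)" post] by (auto simp: E0_def s1)
    \<comment> \<open>The observations lie outside the quadrant of \<open>(i, Suc j)\<close>: before
      the corner the path stays at levels up to \<open>j\<close>, after it at abscissas up to
      \<open>i - 1\<close>.\<close>
    have out: "\<not> (i \<le> fst x \<and> Suc j \<le> fst (snd x))" if "x \<in> insert (i - 1, j, la) E0" for x la
    proof -
      have "fst (snd x) \<le> j" if "x \<in> set (pts ?s pre)" using pts_bounds[OF that] by (simp add: s1)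
      moreover have "fst x \<le> i - 1" if "x \<in> set (pts (i - 1, Suc j, \<mu>) post)" using pts_bounds[OF that] by simp
      ultimately show ?thesis using that i by (auto simp: E0_def)
    qed
    let ?W1 = "path_wt t a b ?s pre" and ?W2 = "path_wt t a b (i - 1, Suc j, \<mu>) post"
    let ?F = "\<lambda>p. (1 - t * a p * b (Suc j)) / (1 - a p * b (Suc j))"
    let ?G = "\<Prod>p = 1..i - 1. ?F p" and ?x = "a i * b (Suc j)"
    have wt': "path_wt t a b ?s (bs' la) = ?W1 * (left_wt t a i j 1 \<nu> la * up_wt t b j 1 la \<mu>) * ?W2 / ?G" for la
      by (simp add: bs'_def path_wt_append s1 block_wt_def)
    have Gi: "(\<Prod>p = 1..i. ?F p) = ?G * ?F i" using i by (cases i) (simp_all add: mult.commute)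
    have wt: "path_wt t a b ?s bs = ?W1 * (up_wt t b j 1 \<nu> \<rho> * left_wt t a i (Suc j) 1 \<rho> \<mu>) * ?W2 / (?G * ?F i)"
      unfolding Gi[symmetric] by (simp add: bs path_wt_append s1 block_wt_def)
    obtain X where X: "finite X" "\<And>la. la \<notin> X \<Longrightarrow> left_wt t a i j 1 \<nu> la * up_wt t b j 1 la \<mu> = 0"
      "(\<Sum>la\<in>X. left_wt t a i j 1 \<nu> la * up_wt t b j 1 la \<mu> * hl_kernel t ?x \<mu> \<rho> la \<nu>) =
        (1 - ?x) / (1 - t * ?x) * (up_wt t b j 1 \<nu> \<rho> * left_wt t a i (Suc j) 1 \<rho> \<mu>)"
      using corner_swap[where t = t and a = a and b = b and i = i and j = j and \<nu> = \<nu> and \<mu> = \<mu> and \<rho> = \<rho>, OF t i a[OF i] b[of "Suc j"] ab[OF i, of "Suc j"]] by auto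
    have slice: "prob {\<omega> \<in> marks (insert (i, Suc j, \<rho>) E0). \<Lambda> (i - 1) j \<omega> = la} =
        path_wt t a b ?s (bs' la) * hl_kernel t ?x \<mu> \<rho> la \<nu>" for la
    proof -
      have "{\<omega> \<in> marks (insert (i, Suc j, \<rho>) E0). \<Lambda> (i - 1) j \<omega> = la} = marks (insert (i, Suc j, \<rho>) (insert (i - 1, j, la) E0))"
        unfolding marks_insert by blast
      moreover have "prob (marks (insert (i, Suc j, \<rho>) (insert (i - 1, j, la) E0))) =
          prob (marks (insert (i - 1, j, la) E0)) * hl_kernel t ?x \<mu> \<rho> la \<nu>"
        by (rule markov_marks[OF t i _ out]) (use finE0 in0 in auto)
      ultimately show ?thesis unfolding IH by simp
    qed
    have "prob (marks (insert (i, Suc j, \<rho>) E0)) = (\<Sum>la\<in>X. prob {\<omega> \<in> marks (insert (i, Suc j, \<rho>) E0). \<Lambda> (i - 1) j \<omega> = la})"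
    proof (rule prob_finite_slices[OF field_measurable marks_events X(1)])
      fix la assume "la \<notin> X"
      thus "prob {\<omega> \<in> marks (insert (i, Suc j, \<rho>) E0). \<Lambda> (i - 1) j \<omega> = la} = 0" unfolding slice wt' using X(2) by simp
    qed (use finE0 in simp)
    also have "\<dots> = ?W1 * ?W2 / ?G * (\<Sum>la\<in>X. left_wt t a i j 1 \<nu> la * up_wt t b j 1 la \<mu> * hl_kernel t ?x \<mu> \<rho> la \<nu>)"
      unfolding slice wt' sum_distrib_left by (rule sum.cong) auto
    also have "\<dots> = path_wt t a b ?s bs" unfolding X(3) wt by (simp add: mult_ac)
    finally show ?thesis unfolding E .
  qed
qed

text \<open>Blocks are dissolved into unit steps from the front of the list, \<open>pre\<close>
  being the part already done. Each splitting introduces an unobserved point; summing over its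
  signature is matched by the branching rule for the weights.\<close>

lemma path_law:
  assumes "okp (A, 0, []) (pre @ bs)" "\<forall>x\<in>set pre. fst (snd x) = 1" "foldl adv (A, 0, []) (pre @ bs) = (0, B, replicate B 0)"
  shows "prob (marks (set (pts (A, 0, []) (pre @ bs)))) = path_wt t a b (A, 0, []) (pre @ bs)"
  using assms
proof (induction "\<Sum>x\<leftarrow>bs. Suc (fst (snd x))" arbitrary: pre bs rule: less_induct)
  case less
  let ?s = "(A, 0, [] :: int list)"
  show ?case
  proof (cases bs)
    case Nil
    thus ?thesis using unit_path_law[of A pre] less.prems by simp
  next
    case (Cons x rest)
    obtain d n \<tau> where x: "x = (d, n, \<tau>)" by (cases x)
    obtain i j \<sigma> where s1: "foldl adv ?s pre = (i, j, \<sigma>)" by (cases "foldl adv ?s pre")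
    have in1: "(i, j, \<sigma>) \<in> set (pts ?s pre)" using last_in_pts[of ?s pre] s1 by simp
    show ?thesis
    proof (cases n)
      case 0
      \<comment> \<open>An empty block observes the same point twice: unless the two signatures
        agree, the event is empty and the weight is 0.\<close>
      have adv0: "adv (i, j, \<sigma>) x = (i, j, \<tau>)" by (simp add: x 0)
      have pts0: "set (pts ?s (pre @ bs)) = set (pts ?s pre) \<union> insert (i, j, \<sigma>) (set (pts (i, j, \<tau>) rest))"
        by (simp add: Cons set_pts_append s1 adv0)
      have bw: "block_wt t a b (i, j, \<sigma>) x = of_bool (\<sigma> = \<tau>)"
        by (simp add: x 0 block_wt_def up_wt_def left_wt_def)
      show ?thesis
      proof (cases "\<sigma> = \<tau>")
        case True
        have "prob (marks (set (pts ?s (pre @ rest)))) = path_wt t a b ?s (pre @ rest)"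
          by (rule less.hyps) (use less.prems adv0 True in \<open>auto simp: Cons okp_append s1\<close>)
        moreover have "set (pts ?s (pre @ bs)) = set (pts ?s (pre @ rest))"
        proof -
          have "set (pts ?s (pre @ rest)) = set (pts ?s pre) \<union> set (pts (i, j, \<sigma>) rest)"
            by (simp add: set_pts_append s1)
          thus ?thesis unfolding pts0 using in1 True by blast
        qed
        moreover have "path_wt t a b ?s (pre @ bs) = path_wt t a b ?s (pre @ rest)"
          unfolding path_wt_append s1 Cons path_wt.simps adv0 bw using True by simp
        ultimately show ?thesis by simp
      next
        case False
        have mem: "(i, j, \<tau>) \<in> set (pts ?s (pre @ bs))" "(i, j, \<sigma>) \<in> set (pts ?s (pre @ bs))"
          unfolding pts0 using in1 first_in_pts[of "(i, j, \<tau>)" rest] by auto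
        have "marks (set (pts ?s (pre @ bs))) = {}"
        proof (rule equals0I)
          fix \<omega> assume "\<omega> \<in> marks (set (pts ?s (pre @ bs)))"
          from marksD[OF this mem(1)] marksD[OF this mem(2)] show False using False by simp
        qed
        moreover have "path_wt t a b ?s (pre @ bs) = 0" using bw False by (simp add: path_wt_append s1 Cons)
        ultimately show ?thesis by simp
      qed
    next
      case (Suc n')
      have din: "d \<or> Suc n' \<le> i" using less.prems(1) by (auto simp: Cons x Suc okp_append s1)
      define pq where "pq = (if d then (i, Suc j) else (i - 1, j))"
      define mid where "mid \<eta> = (fst pq, snd pq, \<eta>)" for \<eta> :: "int list"
      have mid: "adv (i, j, \<sigma>) (d, 1, \<eta>) = mid \<eta>" for \<eta> by (simp add: mid_def pq_def)
      have adv2: "adv (mid \<eta>) (d, n', \<tau>) = adv (i, j, \<sigma>) x" for \<eta> by (simp add: mid_def pq_def x Suc)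
      define bs' where "bs' \<eta> = pre @ [(d, 1, \<eta>)] @ (d, n', \<tau>) # rest" for \<eta>
      obtain X where X: "finite X"
        "\<And>\<eta>. \<eta> \<notin> X \<Longrightarrow> block_wt t a b (i, j, \<sigma>) (d, 1, \<eta>) * block_wt t a b (mid \<eta>) (d, n', \<tau>) = 0"
        "block_wt t a b (i, j, \<sigma>) x = (\<Sum>\<eta>\<in>X. block_wt t a b (i, j, \<sigma>) (d, 1, \<eta>) * block_wt t a b (mid \<eta>) (d, n', \<tau>))"
        using block_wt_split[OF din, of t a b j \<sigma> \<tau>] unfolding mid x Suc by blast
      let ?W1 = "path_wt t a b ?s pre" and ?W2 = "path_wt t a b (adv (i, j, \<sigma>) x) rest"
      have wt': "path_wt t a b ?s (bs' \<eta>) =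
          ?W1 * (block_wt t a b (i, j, \<sigma>) (d, 1, \<eta>) * block_wt t a b (mid \<eta>) (d, n', \<tau>)) * ?W2" for \<eta>
      proof -
        have "bs' \<eta> = pre @ (d, 1, \<eta>) # (d, n', \<tau>) # rest" by (simp add: bs'_def)
        thus ?thesis by (simp only: path_wt_append s1 path_wt.simps mid adv2 mult_ac)
      qed
      have pts': "set (pts ?s (bs' \<eta>)) = insert (mid \<eta>) (set (pts ?s (pre @ bs)))" for \<eta>
        unfolding bs'_def set_pts_append s1 Cons append_Cons append_Nil pts.simps mid adv2 by auto
      have IH: "prob (marks (set (pts ?s (bs' \<eta>)))) = path_wt t a b ?s (bs' \<eta>)" for \<eta>
      proof -
        have "prob (marks (set (pts ?s ((pre @ [(d, 1, \<eta>)]) @ (d, n', \<tau>) # rest)))) =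
            path_wt t a b ?s ((pre @ [(d, 1, \<eta>)]) @ (d, n', \<tau>) # rest)"
        proof (rule less.hyps)
          show "(\<Sum>x\<leftarrow>(d, n', \<tau>) # rest. Suc (fst (snd x))) < (\<Sum>x\<leftarrow>bs. Suc (fst (snd x)))" by (simp add: Cons x Suc)
          have "okp (adv (i, j, \<sigma>) x) rest" "okp ?s pre" using less.prems(1) by (auto simp: Cons okp_append s1)
          moreover have "d \<or> n' \<le> fst (mid \<eta>)" using din by (auto simp: mid_def pq_def)
          moreover have "d \<or> 1 \<le> i" using din by auto
          ultimately show "okp ?s ((pre @ [(d, 1, \<eta>)]) @ (d, n', \<tau>) # rest)"
            by (simp add: okp_append s1 mid[unfolded One_nat_def] adv2 del: adv.simps)
          show "\<forall>x\<in>set (pre @ [(d, 1, \<eta>)]). fst (snd x) = 1" using less.prems(2) by auto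
          show "foldl adv ?s ((pre @ [(d, 1, \<eta>)]) @ (d, n', \<tau>) # rest) = (0, B, replicate B 0)"
            using less.prems(3) by (simp add: Cons s1 mid[unfolded One_nat_def] adv2 del: adv.simps)
        qed
        thus ?thesis by (simp add: bs'_def)
      qed
      have slice: "prob {\<omega> \<in> marks (set (pts ?s (pre @ bs))). \<Lambda> (fst pq) (snd pq) \<omega> = \<eta>} = path_wt t a b ?s (bs' \<eta>)" for \<eta>
        using IH[of \<eta>] unfolding pts' mid_def marks_insert .
      have "prob (marks (set (pts ?s (pre @ bs)))) =
          (\<Sum>\<eta>\<in>X. prob {\<omega> \<in> marks (set (pts ?s (pre @ bs))). \<Lambda> (fst pq) (snd pq) \<omega> = \<eta>})"
      proof (rule prob_finite_slices[OF field_measurable marks_events X(1)])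
        fix \<eta> assume "\<eta> \<notin> X"
        thus "prob {\<omega> \<in> marks (set (pts ?s (pre @ bs))). \<Lambda> (fst pq) (snd pq) \<omega> = \<eta>} = 0"
          unfolding slice wt' using X(2) by simp
      qed simp
      also have "\<dots> = ?W1 * block_wt t a b (i, j, \<sigma>) x * ?W2"
        unfolding slice wt' X(3) sum_distrib_left sum_distrib_right ..
      also have "\<dots> = path_wt t a b ?s (pre @ bs)" by (simp add: path_wt_append s1 Cons)
      finally show ?thesis .
    qed
  qed
qed

end

end

section \<open>Comparison with the skew Hall-Littlewood functions\<close>

lemma up_wt_eq_skew_P:
  assumes "\<sigma> \<in> nonneg_Sig j" "\<tau> \<in> nonneg_Sig (j + n)"
  shows "up_wt t b j n \<sigma> \<tau> = skew_P t \<tau> \<sigma> (map b [j + 1..<j + n + 1])"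
proof (cases "n = 0")
  case True
  hence "young \<tau> = young \<sigma> \<longleftrightarrow> \<sigma> = \<tau>" using inj_onD[OF inj_on_young[of j], of \<tau> \<sigma>] assms by auto
  thus ?thesis using True by (simp add: up_wt_def skew_P_def skew_hl_P[OF young_partition[OF assms(2)]])
next
  case False
  have "strip_sum (hl_psi t) (young \<tau>) (young \<sigma>) (map b (rev [j + 1..<j + n + 1])) =
      strip_sum (hl_psi t) (young \<tau>) (young \<sigma>) (map b [j + 1..<j + n + 1])"
    by (rule strip_sum_mset(1)[OF young_partition[OF assms(2)]]) (simp del: upt_Suc)
  thus ?thesis using False assms unfolding up_wt_def skew_P_def skew_hl_P[OF young_partition[OF assms(2)]] by simp
qed

lemma left_wt_eq_skew_Q:
  assumes "0 \<le> t" "t < 1" "\<sigma> \<in> nonneg_Sig j" "\<tau> \<in> nonneg_Sig j"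
  shows "left_wt t a i j n \<sigma> \<tau> = skew_Q t \<sigma> \<tau> (map a (if n = 0 then [] else [i - n + 1..<i + 1]))"
proof (cases "n = 0")
  case True
  hence "young \<sigma> = young \<tau> \<longleftrightarrow> \<sigma> = \<tau>" using inj_onD[OF inj_on_young[of j], of \<tau> \<sigma>] assms by auto
  thus ?thesis using True by (simp add: left_wt_def skew_Q_def skew_hl_Q[OF assms(1,2) young_partition[OF assms(3)]])
next
  case False
  have "strip_sum (hl_phi t) (young \<sigma>) (young \<tau>) (map a (rev [i - n + 1..<i + 1])) =
      strip_sum (hl_phi t) (young \<sigma>) (young \<tau>) (map a [i - n + 1..<i + 1])"
    by (rule strip_sum_mset(2)[OF young_partition[OF assms(3)] _ assms(1,2)]) (simp del: upt_Suc)
  thus ?thesis using False assms unfolding left_wt_def skew_Q_def skew_hl_Q[OF assms(1,2) young_partition[OF assms(3)]] by simp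
qed

lemma prod_telescoping_blocks:
  fixes g :: "nat \<Rightarrow> real" and m :: "nat \<Rightarrow> nat"
  assumes "i \<le> k" "m (k + 1) = 0" "\<And>j. i \<le> j \<Longrightarrow> j < k \<Longrightarrow> m (j + 1) \<le> m j"
  shows "(\<Prod>j = i..k. \<Prod>p = m (j + 1) + 1..m j. g p) = (\<Prod>p = 1..m i. g p)"
  using assms
proof (induction i rule: inc_induct)
  case base
  thus ?case by simp
next
  case (step i)
  have le: "m (i + 1) \<le> m i" using step by simp
  have "(\<Prod>j = i..k. \<Prod>p = m (j + 1) + 1..m j. g p) =
      (\<Prod>p = m (i + 1) + 1..m i. g p) * (\<Prod>j = Suc i..k. \<Prod>p = m (j + 1) + 1..m j. g p)"
    using step.hyps by (intro prod.atLeast_Suc_atMost) simp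
  also have "(\<Prod>j = Suc i..k. \<Prod>p = m (j + 1) + 1..m j. g p) = (\<Prod>p = 1..m (Suc i). g p)"
    by (rule step.IH) (use step.prems in auto)
  also have "(\<Prod>p = m (i + 1) + 1..m i. g p) * (\<Prod>p = 1..m (Suc i). g p) =
      (\<Prod>p\<in>{m (i + 1) + 1..m i} \<union> {1..m (Suc i)}. g p)"
    by (rule prod.union_disjoint[symmetric]) auto
  also have "{m (i + 1) + 1..m i} \<union> {1..m (Suc i)} = {1..m i}" using le by auto
  finally show ?case .
qed

theorem proposition3p10:
  fixes t :: real and a b :: "nat \<Rightarrow> real"
    and M :: "'w measure"
    and R :: "nat \<Rightarrow> nat \<Rightarrow> 'w \<Rightarrow> nat"
    and \<Lambda> :: "nat \<Rightarrow> nat \<Rightarrow> 'w \<Rightarrow> int list"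
    and k :: nat and m n :: "nat \<Rightarrow> nat"
    and \<kappa> \<eta> :: "nat \<Rightarrow> int list"
  assumes "0 \<le> t" and "t < 1"
    and "\<And>i. 1 \<le> i \<Longrightarrow> 0 < a i"
    and "\<And>j. 1 \<le> j \<Longrightarrow> 0 < b j"
    and "\<And>i j. 1 \<le> i \<Longrightarrow> 1 \<le> j \<Longrightarrow> a i * b j < 1"
    and "hl_rsk_field M t a b R \<Lambda>"
    and "1 \<le> k"
    and "\<And>i. 1 \<le> i \<Longrightarrow> i \<le> k \<Longrightarrow> 0 < m i"
    and "\<And>i. 1 \<le> i \<Longrightarrow> i \<le> k \<Longrightarrow> 0 < n i"
    and "\<And>i. 1 \<le> i \<Longrightarrow> i < k \<Longrightarrow> m i \<ge> m (i + 1)"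
    and "\<And>i. 1 \<le> i \<Longrightarrow> i < k \<Longrightarrow> n i \<le> n (i + 1)"
    and "n 0 = 0" and "m (k + 1) = 0"
    and "\<And>i. 1 \<le> i \<Longrightarrow> i \<le> k \<Longrightarrow> \<kappa> i \<in> Sig (n i) \<and> (\<forall>x\<in>set (\<kappa> i). 0 \<le> x)"
    and "\<And>i. i \<le> k \<Longrightarrow> \<eta> i \<in> Sig (n i) \<and> (\<forall>x\<in>set (\<eta> i). 0 \<le> x)"
    and "\<eta> 0 = []" and "\<eta> k = replicate (n k) 0"
  shows "measure M {\<omega> \<in> space M. (\<forall>i\<in>{1..k}. \<Lambda> (m i) (n i) \<omega> = \<kappa> i) \<and>
                                   (\<forall>i\<in>{1..<k}. \<Lambda> (m (i + 1)) (n i) \<omega> = \<eta> i)} =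
    1 / (\<Prod>i = 1..k. \<Prod>j = i..k. \<Prod>l = n (i - 1) + 1..n i. \<Prod>p = m (j + 1) + 1..m j.
           (1 - t * a p * b l) / (1 - a p * b l)) *
    (\<Prod>i = 1..k. skew_P t (\<kappa> i) (\<eta> (i - 1)) (map b [n (i - 1) + 1..<n i + 1]) *
                  skew_Q t (\<kappa> i) (\<eta> i) (map a [m (i + 1) + 1..<m i + 1]))"
proof -
  interpret hl_rsk_field M t a b R \<Lambda> by fact
  define s0 where "s0 = (m 1, 0 :: nat, [] :: int list)"
  \<comment> \<open>The two segments of block \<open>i\<close> account for the factors P and Q with
    index \<open>i\<close>. The last block ends on the vertical axis because
    \<open>m (k + 1) = 0\<close>.\<close>
  define blk where "blk i = [(True, n i - n (i - 1), \<kappa> i), (False, m i - m (i + 1), \<eta> i)]" for i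
  define path where "path r = concat (map blk [1..<Suc r])" for r
  let ?W = "\<lambda>i. block_wt t a b (m i, n (i - 1), \<eta> (i - 1)) (True, n i - n (i - 1), \<kappa> i) *
      block_wt t a b (m i, n i, \<kappa> i) (False, m i - m (i + 1), \<eta> i)"
  have m: "m (i + 1) \<le> m i" if "1 \<le> i" "i \<le> k" for i using assms(10)[of i] assms(13) that by (cases "i = k") auto
  have n: "n (i - 1) \<le> n i" if "1 \<le> i" "i \<le> k" for i
    using assms(11)[of "i - 1"] assms(12) that by (cases "i = 1") auto
  have path_Suc: "path (Suc r) = path r @ blk (Suc r)" for r by (simp add: path_def)
  have path: "foldl adv s0 (path r) = (m (r + 1), n r, \<eta> r) \<and> okp s0 (path r) \<and> path_wt t a b s0 (path r) = (\<Prod>i = 1..r. ?W i) \<and>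
      set (pts s0 (path r)) = insert s0 (\<Union>i\<in>{1..r}. {(m i, n i, \<kappa> i), (m (i + 1), n i, \<eta> i)})" if "r \<le> k" for r
    using that
  proof (induction r)
    case 0
    show ?case using assms(12,16) by (simp add: path_def s0_def)
  next
    case (Suc r)
    have IH: "foldl adv s0 (path r) = (m (Suc r), n r, \<eta> r)" "okp s0 (path r)" "path_wt t a b s0 (path r) = (\<Prod>i = 1..r. ?W i)"
      "set (pts s0 (path r)) = insert s0 (\<Union>i\<in>{1..r}. {(m i, n i, \<kappa> i), (m (i + 1), n i, \<eta> i)})"
      using Suc by simp_all
    have le: "m (Suc (Suc r)) \<le> m (Suc r)" "n r \<le> n (Suc r)" using m[of "Suc r"] n[of "Suc r"] Suc.prems by simp_all
    have adv: "adv (m (Suc r), n r, \<eta> r) (True, n (Suc r) - n r, \<kappa> (Suc r)) = (m (Suc r), n (Suc r), \<kappa> (Suc r))"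
      "adv (m (Suc r), n (Suc r), \<kappa> (Suc r)) (False, m (Suc r) - m (Suc (Suc r)), \<eta> (Suc r)) = (m (Suc (Suc r)), n (Suc r), \<eta> (Suc r))"
      using le by simp_all
    have blk: "blk (Suc r) = [(True, n (Suc r) - n r, \<kappa> (Suc r)), (False, m (Suc r) - m (Suc (Suc r)), \<eta> (Suc r))]"
      by (simp add: blk_def)
    have 1: "foldl adv s0 (path (Suc r)) = (m (Suc r + 1), n (Suc r), \<eta> (Suc r))"
      unfolding path_Suc foldl_append IH(1) blk by (simp add: adv del: adv.simps)
    have 2: "okp s0 (path (Suc r))"
      unfolding path_Suc okp_append IH(1) blk using IH(2) by simp
    have 3: "path_wt t a b s0 (path (Suc r)) = (\<Prod>i = 1..Suc r. ?W i)"
      unfolding path_Suc path_wt_append IH(1,3) blk path_wt.simps adv by simp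
    have 4: "set (pts s0 (path (Suc r))) = insert s0 (\<Union>i\<in>{1..Suc r}. {(m i, n i, \<kappa> i), (m (i + 1), n i, \<eta> i)})"
    proof -
      have "(m (Suc r), n r, \<eta> r) \<in> set (pts s0 (path r))" using last_in_pts[of s0 "path r"] IH(1) by simp
      moreover have "{1..Suc r} = insert (Suc r) {1..r}" by auto
      ultimately show ?thesis
        unfolding path_Suc set_pts_append IH(1) blk pts.simps adv using IH(4) by auto
    qed
    show ?case using 1 2 3 4 by blast
  qed
  have "{\<omega> \<in> space M. (\<forall>i\<in>{1..k}. \<Lambda> (m i) (n i) \<omega> = \<kappa> i) \<and> (\<forall>i\<in>{1..<k}. \<Lambda> (m (i + 1)) (n i) \<omega> = \<eta> i)} =
      marks (set (pts s0 (path k)))"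
  proof -
    \<comment> \<open>The path also observes its end point, which lies on the vertical axis; there
      the condition holds automatically.\<close>
    have "(\<forall>i\<in>{1..<k}. \<Lambda> (m (i + 1)) (n i) \<omega> = \<eta> i) \<longleftrightarrow> (\<forall>i\<in>{1..k}. \<Lambda> (m (i + 1)) (n i) \<omega> = \<eta> i)" if "\<omega> \<in> space M" for \<omega>
    proof -
      have "{1..k} = insert k {1..<k}" using assms(7) by auto
      moreover have "\<Lambda> (m (k + 1)) (n k) \<omega> = \<eta> k" using field_left[OF that] assms(13,17) by simp
      ultimately show ?thesis by auto
    qed
    thus ?thesis using path[of k] field_bottom unfolding marks_def s0_def by auto
  qed
  also have "prob (marks (set (pts s0 (path k)))) = path_wt t a b s0 (path k)"
  proof -
    have "prob (marks (set (pts (m 1, 0, []) ([] @ path k)))) = path_wt t a b (m 1, 0, []) ([] @ path k)"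
      by (rule path_law[OF assms(1-5), where B = "n k"]) (use path[of k] assms(13,17) in \<open>simp_all add: s0_def\<close>)
    thus ?thesis by (simp add: s0_def)
  qed
  also have "\<dots> = (\<Prod>i = 1..k. ?W i)" using path[of k] by blast
  also have "\<dots> = (\<Prod>i = 1..k. (skew_P t (\<kappa> i) (\<eta> (i - 1)) (map b [n (i - 1) + 1..<n i + 1]) *
      skew_Q t (\<kappa> i) (\<eta> i) (map a [m (i + 1) + 1..<m i + 1])) /
      (\<Prod>j = i..k. \<Prod>l = n (i - 1) + 1..n i. \<Prod>p = m (j + 1) + 1..m j. (1 - t * a p * b l) / (1 - a p * b l)))"
  proof (rule prod.cong[OF refl])
    fix i assume "i \<in> {1..k}"
    hence i: "1 \<le> i" "i \<le> k" by auto
    have N: "\<kappa> i \<in> nonneg_Sig (n i)" "\<eta> i \<in> nonneg_Sig (n i)" "\<eta> (i - 1) \<in> nonneg_Sig (n (i - 1))"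
      using assms(14)[OF i] assms(15)[of i] assms(15)[of "i - 1"] i by (auto simp: nonneg_Sig_def)
    have ni: "n (i - 1) + (n i - n (i - 1)) = n i" and mi: "m i - (m i - m (i + 1)) = m (i + 1)" using n[OF i] m[OF i] by auto
    have P: "up_wt t b (n (i - 1)) (n i - n (i - 1)) (\<eta> (i - 1)) (\<kappa> i) =
        skew_P t (\<kappa> i) (\<eta> (i - 1)) (map b [n (i - 1) + 1..<n i + 1])"
      using up_wt_eq_skew_P[OF N(3), of "\<kappa> i" "n i - n (i - 1)"] N(1) unfolding ni by blast
    have Q: "left_wt t a (m i) (n i) (m i - m (i + 1)) (\<kappa> i) (\<eta> i) =
        skew_Q t (\<kappa> i) (\<eta> i) (map a [m (i + 1) + 1..<m i + 1])"
    proof -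
      have "(if m i - m (i + 1) = 0 then [] else [m i - (m i - m (i + 1)) + 1..<m i + 1]) = [m (i + 1) + 1..<m i + 1]"
        unfolding mi using m[OF i] by auto
      thus ?thesis using left_wt_eq_skew_Q[OF assms(1,2) N(1,2), of a "m i" "m i - m (i + 1)"] by simp
    qed
    \<comment> \<open>For fixed \<open>i\<close>, the blocks of \<open>a\<close> variables with
      index \<open>j \<ge> i\<close> together make up all \<open>p\<close> from 1 to
      \<open>m i\<close>: these are the boxes left of the upward segment, as in
      \<open>block_wt\<close>.\<close>
    have Z: "(\<Prod>j = i..k. \<Prod>l = n (i - 1) + 1..n i. \<Prod>p = m (j + 1) + 1..m j. (1 - t * a p * b l) / (1 - a p * b l)) =
        (\<Prod>l = n (i - 1) + 1..n i. \<Prod>p = 1..m i. (1 - t * a p * b l) / (1 - a p * b l))"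
    proof (subst prod.swap, rule prod.cong[OF refl])
      fix l
      show "(\<Prod>j = i..k. \<Prod>p = m (j + 1) + 1..m j. (1 - t * a p * b l) / (1 - a p * b l)) =
          (\<Prod>p = 1..m i. (1 - t * a p * b l) / (1 - a p * b l))"
        by (rule prod_telescoping_blocks) (use i assms(10,13) in auto)
    qed
    show "?W i = (skew_P t (\<kappa> i) (\<eta> (i - 1)) (map b [n (i - 1) + 1..<n i + 1]) *
      skew_Q t (\<kappa> i) (\<eta> i) (map a [m (i + 1) + 1..<m i + 1])) /
      (\<Prod>j = i..k. \<Prod>l = n (i - 1) + 1..n i. \<Prod>p = m (j + 1) + 1..m j. (1 - t * a p * b l) / (1 - a p * b l))"
      unfolding Z block_wt_def prod.case if_True if_False P Q ni by simp
  qed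
  also have "\<dots> = 1 / (\<Prod>i = 1..k. \<Prod>j = i..k. \<Prod>l = n (i - 1) + 1..n i. \<Prod>p = m (j + 1) + 1..m j.
           (1 - t * a p * b l) / (1 - a p * b l)) *
    (\<Prod>i = 1..k. skew_P t (\<kappa> i) (\<eta> (i - 1)) (map b [n (i - 1) + 1..<n i + 1]) *
                  skew_Q t (\<kappa> i) (\<eta> i) (map a [m (i + 1) + 1..<m i + 1]))"
    unfolding prod_dividef by simp
  finally show ?thesis .
qed

end
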